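(* Let $t_0>0$ and $f\in\mathcal M([t_0,\infty[)$. Then there is $\phi_f\in C^2([t_0,\infty[,\mathbb R)$, with $\phi_f(t)\to0$ as $t\to\infty$ whenever $f''(t)/f(t)\to0$, such that the following holds for any given $s>0$. (1) For the equation on $\mathbb R$ $$\frac1{\mathrm i}\partial_tu=\frac12\big(D^2+(1+\phi_f(t))X^2\big)u$$ with $u(t_0)\in\mathcal H^s\setminus\{0\}$, there exists a constant $c_0>1$ such that the solution satisfies $c_0^{-1}f(t)^{s/2}\le\|u(t)\|_s\le c_0f(t)^{s/2}$ for all $t\ge t_0$. (2) If moreover $f(t)=o(t^2)$ as $t\to\infty$ and there exists $0<\kappa<2$ such that $t\frac{f'(t)}{f(t)}\le\kappa$ for $t\ge t_0$ and $t\mapsto t\frac{f'(t)}{f(t)}$ is decreasing on $[t_0,\infty[$, then for the equation $$\frac1{\mathrm i}\partial_tu=\frac12\big(D^2+(1+\phi_f(t))X^2\big)u+a\sin(t)Xu,\qquad a\in\mathbb R\setminus\{0\},$$ with $u(t_0)\in\mathcal H^s\setminus\{0\}$, there exists a constant $c_1>1$ such that $c_1^{-1}t^s\le\|u(t)\|_s\le c_1t^s$ for all $t\ge t_0$.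
   Context: $\mathcal M([t_0,\infty[)$ is the class of $C^2$ non-decreasing functions $f$ on $[t_0,\infty[$ with $\inf_{t\ge t_0}f(t)>0$, $f(t)\to\infty$ as $t\to\infty$, and $\frac{f'}{f}(t)\to0$ monotonously as $t\to\infty$. On $\mathbb R$: $D=-\mathrm i\frac{d}{dx}$, $X$ is multiplication by $x$, $\mathcal T=\frac12(D^2+X^2)$, $\mathcal H^s=\{u\in L^2(\mathbb R):\mathcal T^{s/2}u\in L^2\}$ with norm $\|u\|_s=(\|\mathcal T^{s/2}u\|_{L^2}^2+\|u\|_{L^2}^2)^{1/2}$. *)

theory Defs
  imports "HOL-Analysis.Analysis" "HOL-Library.Landau_Symbols"
begin

definition C2_on :: "real set \<Rightarrow> (real \<Rightarrow> real) \<Rightarrow> bool" where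
  "C2_on S f \<longleftrightarrow> (\<exists>f1 f2.
      (\<forall>t\<in>S. (f has_real_derivative f1 t) (at t within S)) \<and>
      (\<forall>t\<in>S. (f1 has_real_derivative f2 t) (at t within S)) \<and>
      continuous_on S f2)"

definition dR :: "real \<Rightarrow> (real \<Rightarrow> real) \<Rightarrow> real \<Rightarrow> real" where
  "dR t0 f t = vector_derivative f (at t within {t0..})"

definition classM :: "real \<Rightarrow> (real \<Rightarrow> real) \<Rightarrow> bool" where
  "classM t0 f \<longleftrightarrow>
     C2_on {t0..} f \<and> mono_on {t0..} f \<and>
     (\<exists>m>0. \<forall>t\<ge>t0. m \<le> f t) \<and>
     filterlim f at_top at_top \<and>
     ((\<lambda>t. dR t0 f t / f t) \<longlongrightarrow> 0) at_top \<and>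
     monotone_on {t0..} (\<le>) (\<ge>) (\<lambda>t. dR t0 f t / f t)"

definition L2 :: "(real \<Rightarrow> complex) \<Rightarrow> bool" where
  "L2 u \<longleftrightarrow> u \<in> borel_measurable lborel \<and> integrable lborel (\<lambda>x. (cmod (u x))\<^sup>2)"

definition L2norm :: "(real \<Rightarrow> complex) \<Rightarrow> real" where
  "L2norm u = sqrt (LINT x|lborel. (cmod (u x))\<^sup>2)"

fun hermite_poly :: "nat \<Rightarrow> real \<Rightarrow> real" where
  "hermite_poly 0 x = 1"
| "hermite_poly (Suc 0) x = 2 * x"
| "hermite_poly (Suc (Suc n)) x =
     2 * x * hermite_poly (Suc n) x - 2 * real (Suc n) * hermite_poly n x"

text \<open>Normalized Hermite functions: orthonormal eigenbasis of T, T h_n = (n + 1/2) h_n.\<close>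
definition hermite_fun :: "nat \<Rightarrow> real \<Rightarrow> real" where
  "hermite_fun n x = hermite_poly n x * exp (- (x\<^sup>2) / 2) / sqrt (2 ^ n * fact n * sqrt pi)"

definition herm_coeff :: "(real \<Rightarrow> complex) \<Rightarrow> nat \<Rightarrow> complex" where
  "herm_coeff u n = (LINT x|lborel. u x * complex_of_real (hermite_fun n x))"

text \<open>u in H^s iff T^(s/2) u in L^2; computed via the spectral decomposition of T.\<close>
definition in_Hs :: "real \<Rightarrow> (real \<Rightarrow> complex) \<Rightarrow> bool" where
  "in_Hs s u \<longleftrightarrow> L2 u \<and>
     summable (\<lambda>n. (real n + 1/2) powr s * (cmod (herm_coeff u n))\<^sup>2)"

text \<open>||u||_s = (||T^(s/2) u||^2 + ||u||^2)^(1/2).\<close>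
definition Hs_norm :: "real \<Rightarrow> (real \<Rightarrow> complex) \<Rightarrow> real" where
  "Hs_norm s u = sqrt ((\<Sum>n. (real n + 1/2) powr s * (cmod (herm_coeff u n))\<^sup>2)
                       + (L2norm u)\<^sup>2)"

definition cderiv :: "nat \<Rightarrow> (real \<Rightarrow> complex) \<Rightarrow> real \<Rightarrow> complex" where
  "cderiv k \<psi> = ((\<lambda>g x. vector_derivative g (at x)) ^^ k) \<psi>"

definition schwartz :: "(real \<Rightarrow> complex) \<Rightarrow> bool" where
  "schwartz \<psi> \<longleftrightarrow> (\<forall>k x. cderiv k \<psi> differentiable (at x)) \<and>
     (\<forall>a k. \<exists>C. \<forall>x. \<bar>x\<bar> ^ a * cmod (cderiv k \<psi> x) \<le> C)"

text \<open>The Hamiltonian (1/2) D^2 + V(t,x), with D = -i d/dx, acting on smooth functions.\<close>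
definition ham :: "(real \<Rightarrow> real \<Rightarrow> real) \<Rightarrow> real \<Rightarrow> (real \<Rightarrow> complex) \<Rightarrow> real \<Rightarrow> complex" where
  "ham V t \<psi> x = - (1/2) * cderiv 2 \<psi> x + complex_of_real (V t x) * \<psi> x"

definition pair :: "(real \<Rightarrow> complex) \<Rightarrow> (real \<Rightarrow> complex) \<Rightarrow> complex" where
  "pair u \<psi> = (LINT x|lborel. u x * cnj (\<psi> x))"

text \<open>u is a (weak, L^2-valued, locally bounded) solution on [t0, infinity[ of
  (1/i) d/dt u = H(t) u, H(t) = (1/2) D^2 + V(t, .), tested against Schwartz functions:
  d/dt <u(t), psi> = i <u(t), H(t) psi>.\<close>
definition schrod_sol :: "real \<Rightarrow> (real \<Rightarrow> real \<Rightarrow> real) \<Rightarrow> (real \<Rightarrow> real \<Rightarrow> complex) \<Rightarrow> bool" where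
  "schrod_sol t0 V u \<longleftrightarrow>
     (\<forall>t\<ge>t0. L2 (u t)) \<and>
     (\<forall>T. \<exists>M. \<forall>t\<in>{t0..T}. L2norm (u t) \<le> M) \<and>
     (\<forall>\<psi>. schwartz \<psi> \<longrightarrow> (\<forall>t\<ge>t0.
        ((\<lambda>\<tau>. pair (u \<tau>) \<psi>) has_vector_derivative (\<i> * pair (u t) (ham V t \<psi>)))
          (at t within {t0..})))"

end

theory Submission
  imports Defs "HOL-Probability.Probability" "HOL-Computational_Algebra.Polynomial"
begin

text \<open>The potential is chosen so that \<open>y = exp g cos t\<close>, with \<open>g' = h cos\<^sup>2 t\<close> and \<open>h\<close> a smoothing of
  \<open>f' / f\<close>, solves \<open>y'' + (1 + \<phi>) y = 0\<close> exactly: this is parametric resonance, and \<open>exp (2 g)\<close> is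
  comparable to \<open>f\<close> because \<open>cos\<^sup>2\<close> has mean \<open>1 / 2\<close>. A complex solution \<open>\<zeta>\<close> of the same equation and
  a forced classical trajectory \<open>(q, p)\<close> carry the Hermite basis to an orthonormal basis of squeezed,
  translated Hermite functions that solve the Schroedinger equation. Pairing a weak solution \<open>u\<close> with
  this moving basis shows that its coefficients there are constant. Everything is then read off the
  matrix \<open>M\<close> between the fixed and the moving basis, which intertwines the two annihilation operators.
  Upper bound: the intertwining relation bounds \<open>M\<close> on integer weights, and a dyadic decomposition
  interpolates to \<open>s\<close>. Lower bound: an observable \<open>\<epsilon> X + \<delta> D\<close> with small \<open>\<epsilon>\<close> and \<open>\<delta>\<close> has matrix elements
  of order one on \<open>u\<close>, which forbids concentration of \<open>u\<close> on Hermite modes below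
  \<open>1 / (\<epsilon>\<^sup>2 + \<delta>\<^sup>2)\<close>, a multiple of \<open>f\<close> in the first case and of \<open>t\<^sup>2\<close> in the second.\<close>



subsection \<open>Matrices intertwining ladder operators\<close>

text \<open>The potential is found backwards: a growing solution of Hill's equation is prescribed
  and the potential is read off, so no asymptotic integration of an ODE is needed. The price is
  regularity: the potential contains \<open>h'\<close> and has to be C2, while \<open>f' / f\<close>
  is only C1. So \<open>h\<close> must gain two derivatives and still keep the sign, the
  monotonicity and, up to a constant, the integral of \<open>f' / f\<close>. A second solution that
  decays is as important as the growing one: through the Wronskian it bounds the growing one from
  below, and it supplies the small observable of the first lower bound. In the forced case the
  packet has width at most of order \<open>sqrt f\<close> around a centre at distance of order
  \<open>t\<close>, and \<open>f = o(t^2)\<close> makes the width negligible. Solutions are only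
  weak, so a Sobolev norm cannot be differentiated along the flow. Pairing with explicit Schwartz
  functions replaces energy estimates, and completeness of the moving basis returns norms from
  coefficients. All constants must be uniform in time, so the tested mode \<open>m\<close> may
  depend on the initial datum but not on \<open>t\<close>.\<close>

definition ladder :: "complex \<Rightarrow> complex \<Rightarrow> complex \<Rightarrow> (nat \<Rightarrow> complex) \<Rightarrow> nat \<Rightarrow> complex" where
  "ladder \<alpha> \<beta> \<gamma> b n =
     \<alpha> * sqrt (Suc n) * b (Suc n) + \<beta> * sqrt n * b (n - 1) + \<gamma> * b n"

lemma ladder_eq_0: "(\<And>m. N \<le> m \<Longrightarrow> b m = 0) \<Longrightarrow> Suc N \<le> m \<Longrightarrow> ladder \<alpha> \<beta> \<gamma> b m = 0"
  by (auto simp: ladder_def)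

text \<open>The hypothesis says that the creation operator on rows, applied after \<open>M\<close>,
  equals \<open>M\<close> after the first-order operator \<open>ladder\<close> on columns. Moving
  the index shifts from \<open>M\<close> to \<open>b\<close> gives this for vectors. The range grows
  to \<open>Suc N\<close> because \<open>ladder\<close> enlarges the support by one; the values at
  \<open>m - 1\<close> and \<open>n - 1\<close> for index 0 are multiplied by
  \<open>sqrt 0\<close>.\<close>

lemma sum_mult_ladder:
  fixes M :: "nat \<Rightarrow> nat \<Rightarrow> complex" and \<alpha> \<beta> \<gamma> :: complex
  assumes M: "\<And>n m. sqrt n * M (n - 1) m =
      \<alpha> * sqrt m * M n (m - 1) + \<beta> * sqrt (Suc m) * M n (Suc m) + \<gamma> * M n m"
    and b: "\<And>m. N \<le> m \<Longrightarrow> b m = 0"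
  shows "(\<Sum>m<Suc N. M n m * ladder \<alpha> \<beta> \<gamma> b m) = sqrt n * (\<Sum>m<N. M (n - 1) m * b m)"
proof -
  have 1: "(\<Sum>m<Suc N. M n m * (\<alpha> * sqrt (Suc m) * b (Suc m)))
         = (\<Sum>m<N. \<alpha> * sqrt m * M n (m - 1) * b m)"
  proof -
    have "(\<Sum>m<Suc (Suc N). \<alpha> * sqrt m * M n (m - 1) * b m)
        = (\<Sum>m<Suc N. M n m * (\<alpha> * sqrt (Suc m) * b (Suc m)))"
      by (subst sum.lessThan_Suc_shift) (simp add: mult_ac)
    moreover have "(\<Sum>m<Suc (Suc N). \<alpha> * sqrt m * M n (m - 1) * b m)
        = (\<Sum>m<N. \<alpha> * sqrt m * M n (m - 1) * b m)"
      using b by simp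
    ultimately show ?thesis by metis
  qed
  have 2: "(\<Sum>m<Suc N. M n m * (\<beta> * sqrt m * b (m - 1)))
         = (\<Sum>m<N. \<beta> * sqrt (Suc m) * M n (Suc m) * b m)"
    by (subst sum.lessThan_Suc_shift) (simp add: mult_ac)
  have 3: "(\<Sum>m<Suc N. M n m * (\<gamma> * b m)) = (\<Sum>m<N. \<gamma> * M n m * b m)"
    using b by (simp add: mult_ac)
  have "(\<Sum>m<Suc N. M n m * ladder \<alpha> \<beta> \<gamma> b m) =
     (\<Sum>m<Suc N. M n m * (\<alpha> * sqrt (Suc m) * b (Suc m)))
   + (\<Sum>m<Suc N. M n m * (\<beta> * sqrt m * b (m - 1)))
   + (\<Sum>m<Suc N. M n m * (\<gamma> * b m))"
    unfolding ladder_def sum.distrib[symmetric] by (rule sum.cong) (simp_all only: distrib_left)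
  also have "\<dots> = (\<Sum>m<N. (\<alpha> * sqrt m * M n (m - 1) + \<beta> * sqrt (Suc m) * M n (Suc m) + \<gamma> * M n m) * b m)"
    unfolding 1 2 3 sum.distrib[symmetric] by (rule sum.cong) (simp_all only: distrib_right)
  also have "\<dots> = (\<Sum>m<N. (sqrt n * M (n - 1) m) * b m)"
    by (simp only: M)
  finally show ?thesis by (simp add: sum_distrib_left mult_ac)
qed

lemma norm_add3_sq: "(cmod (a + b + c))\<^sup>2 \<le> 3 * ((cmod a)\<^sup>2 + (cmod b)\<^sup>2 + (cmod c)\<^sup>2)"
proof -
  have "(cmod (a + b + c))\<^sup>2 \<le> (cmod a + cmod b + cmod c)\<^sup>2"
    by (intro power_mono order_trans[OF norm_triangle_ineq] add_mono) (auto intro: norm_triangle_ineq)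
  also have "\<dots> \<le> 3 * ((cmod a)\<^sup>2 + (cmod b)\<^sup>2 + (cmod c)\<^sup>2)"
    using sum_squares_bound[of "cmod a" "cmod b"] sum_squares_bound[of "cmod b" "cmod c"]
      sum_squares_bound[of "cmod a" "cmod c"] by (simp add: power2_eq_square algebra_simps)
  finally show ?thesis .
qed

lemma norm_add_sq: "(cmod (a + b))\<^sup>2 \<le> 2 * ((cmod a)\<^sup>2 + (cmod b)\<^sup>2)"
proof -
  have "(cmod (a + b))\<^sup>2 \<le> (cmod a + cmod b)\<^sup>2"
    by (intro power_mono norm_triangle_ineq) auto
  also have "\<dots> \<le> 2 * ((cmod a)\<^sup>2 + (cmod b)\<^sup>2)"
    using sum_squares_bound[of "cmod a" "cmod b"] by (simp add: power2_eq_square algebra_simps)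
  finally show ?thesis .
qed

text \<open>One ladder step costs one power of the weight. The factor 3 comes from squaring a sum of
  three terms. In \<open>2 + 2 ^ k\<close> the lowering and the diagonal part contribute 1 each, and
  the raising part contributes \<open>2 ^ k\<close> because
  \<open>m + 2 <= 2 (m + 1)\<close>.\<close>

lemma ladder_weighted_bound:
  fixes K :: real
  assumes K: "(cmod \<alpha>)\<^sup>2 \<le> K" "(cmod \<beta>)\<^sup>2 \<le> K" "(cmod \<gamma>)\<^sup>2 \<le> K"
    and b: "\<And>m. N \<le> m \<Longrightarrow> b m = 0"
  shows "(\<Sum>m<Suc N. real (Suc m) ^ k * (cmod (ladder \<alpha> \<beta> \<gamma> b m))\<^sup>2)
       \<le> 3 * (2 + 2 ^ k) * K * (\<Sum>m<N. real (Suc m) ^ Suc k * (cmod (b m))\<^sup>2)"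
proof -
  define S where "S = (\<Sum>m<N. real (Suc m) ^ Suc k * (cmod (b m))\<^sup>2)"
  have K0: "K \<ge> 0" using K(1) by (meson order_trans zero_le_power2)
  have pt: "real (Suc m) ^ k * (cmod (ladder \<alpha> \<beta> \<gamma> b m))\<^sup>2 \<le>
     3 * K * (real (Suc (Suc m)) ^ Suc k * (cmod (b (Suc m)))\<^sup>2
        + real (Suc m) ^ k * real m * (cmod (b (m - 1)))\<^sup>2
        + real (Suc m) ^ Suc k * (cmod (b m))\<^sup>2)" for m
  proof -
    have "(cmod (ladder \<alpha> \<beta> \<gamma> b m))\<^sup>2 \<le> 3 * ((cmod (\<alpha> * sqrt (Suc m) * b (Suc m)))\<^sup>2
       + (cmod (\<beta> * sqrt m * b (m - 1)))\<^sup>2 + (cmod (\<gamma> * b m))\<^sup>2)"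
      unfolding ladder_def by (rule norm_add3_sq)
    also have "\<dots> = 3 * ((cmod \<alpha>)\<^sup>2 * (real (Suc m) * (cmod (b (Suc m)))\<^sup>2)
       + (cmod \<beta>)\<^sup>2 * (real m * (cmod (b (m - 1)))\<^sup>2) + (cmod \<gamma>)\<^sup>2 * (cmod (b m))\<^sup>2)"
      by (simp add: norm_mult power_mult_distrib del: of_nat_Suc)
    also have "\<dots> \<le> 3 * (K * (real (Suc m) * (cmod (b (Suc m)))\<^sup>2)
       + K * (real m * (cmod (b (m - 1)))\<^sup>2) + K * (cmod (b m))\<^sup>2)"
      by (intro mult_left_mono add_mono mult_right_mono K) auto
    finally have "real (Suc m) ^ k * (cmod (ladder \<alpha> \<beta> \<gamma> b m))\<^sup>2 \<le> real (Suc m) ^ k * (3 * (K * (real (Suc m) * (cmod (b (Suc m)))\<^sup>2)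
       + K * (real m * (cmod (b (m - 1)))\<^sup>2) + K * (cmod (b m))\<^sup>2))"
      by (intro mult_left_mono) auto
    also have "\<dots> = 3 * K * (real (Suc m) ^ Suc k * (cmod (b (Suc m)))\<^sup>2
        + real (Suc m) ^ k * real m * (cmod (b (m - 1)))\<^sup>2
        + real (Suc m) ^ k * (cmod (b m))\<^sup>2)"
      by (simp add: algebra_simps)
    also have "\<dots> \<le> 3 * K * (real (Suc (Suc m)) ^ Suc k * (cmod (b (Suc m)))\<^sup>2
        + real (Suc m) ^ k * real m * (cmod (b (m - 1)))\<^sup>2
        + real (Suc m) ^ Suc k * (cmod (b m))\<^sup>2)"
      using K0 by (intro mult_left_mono add_mono mult_right_mono power_mono order_refl power_increasing) auto
    finally show ?thesis .
  qed
  have 1: "(\<Sum>m<Suc N. real (Suc (Suc m)) ^ Suc k * (cmod (b (Suc m)))\<^sup>2) \<le> S"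
  proof -
    have "(\<Sum>m<Suc (Suc N). real (Suc m) ^ Suc k * (cmod (b m))\<^sup>2) = S"
      using b by (simp add: S_def)
    moreover have "(\<Sum>m<Suc (Suc N). real (Suc m) ^ Suc k * (cmod (b m))\<^sup>2)
      = real (Suc 0) ^ Suc k * (cmod (b 0))\<^sup>2 + (\<Sum>m<Suc N. real (Suc (Suc m)) ^ Suc k * (cmod (b (Suc m)))\<^sup>2)"
      by (rule sum.lessThan_Suc_shift)
    ultimately show ?thesis by simp
  qed
  have 2: "(\<Sum>m<Suc N. real (Suc m) ^ k * real m * (cmod (b (m - 1)))\<^sup>2) \<le> 2 ^ k * S"
  proof -
    have "(\<Sum>m<Suc N. real (Suc m) ^ k * real m * (cmod (b (m - 1)))\<^sup>2)
        = (\<Sum>m<N. real (Suc (Suc m)) ^ k * real (Suc m) * (cmod (b m))\<^sup>2)"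
      by (subst sum.lessThan_Suc_shift) simp
    also have "\<dots> \<le> (\<Sum>m<N. (2 * real (Suc m)) ^ k * real (Suc m) * (cmod (b m))\<^sup>2)"
      by (intro sum_mono mult_right_mono power_mono) auto
    also have "\<dots> = 2 ^ k * S"
      unfolding S_def sum_distrib_left by (rule sum.cong) (simp_all add: power_mult_distrib mult_ac del: of_nat_Suc)
    finally show ?thesis .
  qed
  have 3: "(\<Sum>m<Suc N. real (Suc m) ^ Suc k * (cmod (b m))\<^sup>2) = S"
    using b by (simp add: S_def)
  have "(\<Sum>m<Suc N. real (Suc m) ^ k * (cmod (ladder \<alpha> \<beta> \<gamma> b m))\<^sup>2) \<le>
    (\<Sum>m<Suc N. 3 * K * (real (Suc (Suc m)) ^ Suc k * (cmod (b (Suc m)))\<^sup>2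
        + real (Suc m) ^ k * real m * (cmod (b (m - 1)))\<^sup>2
        + real (Suc m) ^ Suc k * (cmod (b m))\<^sup>2))"
    by (rule sum_mono[OF pt])
  also have "\<dots> = 3 * K * ((\<Sum>m<Suc N. real (Suc (Suc m)) ^ Suc k * (cmod (b (Suc m)))\<^sup>2)
     + (\<Sum>m<Suc N. real (Suc m) ^ k * real m * (cmod (b (m - 1)))\<^sup>2)
     + (\<Sum>m<Suc N. real (Suc m) ^ Suc k * (cmod (b m))\<^sup>2))"
    by (simp only: sum.distrib[symmetric] sum_distrib_left)
  also have "\<dots> \<le> 3 * K * (S + 2 ^ k * S + S)"
    using K0 1 2 3 by (intro mult_left_mono add_mono) auto
  finally show ?thesis by (simp add: S_def algebra_simps)
qed

text \<open>The weight \<open>n + 1\<close> on row \<open>n\<close> of \<open>M b\<close> is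
  absorbed by applying \<open>M\<close> to the ladder image and reading row \<open>Suc n\<close>. So
  each induction step trades one power of the weight for one ladder operator and one factor
  \<open>K\<close>, down to the contraction at \<open>k = 0\<close>. Only finitely supported vectors
  and finite row ranges occur, so no convergence has to be discussed.\<close>

lemma intertwiner_integer_bound:
  fixes M :: "nat \<Rightarrow> nat \<Rightarrow> complex" and K :: real and \<alpha> \<beta> \<gamma> :: complex
  assumes K: "(cmod \<alpha>)\<^sup>2 \<le> K" "(cmod \<beta>)\<^sup>2 \<le> K" "(cmod \<gamma>)\<^sup>2 \<le> K"
    and M: "\<And>n m. sqrt n * M (n - 1) m =
      \<alpha> * sqrt m * M n (m - 1) + \<beta> * sqrt (Suc m) * M n (Suc m) + \<gamma> * M n m"
    and contr: "\<And>b N R. (\<Sum>n<R. (cmod (\<Sum>m<N. M n m * b m))\<^sup>2) \<le> (\<Sum>m<N. (cmod (b m))\<^sup>2)"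
    and b: "\<And>m. N \<le> m \<Longrightarrow> b m = 0"
  shows "(\<Sum>n<R. real (Suc n) ^ k * (cmod (\<Sum>m<N. M n m * b m))\<^sup>2)
       \<le> (\<Prod>j<k. 3 * (2 + 2 ^ j)) * K ^ k * (\<Sum>m<N. real (Suc m) ^ k * (cmod (b m))\<^sup>2)"
  using b
proof (induction k arbitrary: b N R)
  case 0
  then show ?case using contr by simp
next
  case (Suc k)
  have K0: "K \<ge> 0" using K(1) by (meson order_trans zero_le_power2)
  let ?L = "ladder \<alpha> \<beta> \<gamma> b"
  have "(\<Sum>n<R. real (Suc n) ^ Suc k * (cmod (\<Sum>m<N. M n m * b m))\<^sup>2)
     = (\<Sum>n<R. real (Suc n) ^ k * (cmod (\<Sum>m<Suc N. M (Suc n) m * ?L m))\<^sup>2)"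
  proof (rule sum.cong)
    fix n
    have "(\<Sum>m<Suc N. M (Suc n) m * ?L m) = sqrt (Suc n) * (\<Sum>m<N. M (Suc n - 1) m * b m)"
      by (rule sum_mult_ladder[OF M]) (use Suc.prems in auto)
    then have "(cmod (\<Sum>m<Suc N. M (Suc n) m * ?L m))\<^sup>2 = real (Suc n) * (cmod (\<Sum>m<N. M n m * b m))\<^sup>2"
      by (simp add: norm_mult power_mult_distrib del: of_nat_Suc sum.lessThan_Suc)
    then show "real (Suc n) ^ Suc k * (cmod (\<Sum>m<N. M n m * b m))\<^sup>2
       = real (Suc n) ^ k * (cmod (\<Sum>m<Suc N. M (Suc n) m * ?L m))\<^sup>2"
      by (simp only: power_Suc mult_ac)
  qed simp
  also have "\<dots> \<le> (\<Sum>n<R. real (Suc (Suc n)) ^ k * (cmod (\<Sum>m<Suc N. M (Suc n) m * ?L m))\<^sup>2)"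
    by (intro sum_mono mult_right_mono power_mono) auto
  also have "\<dots> \<le> (\<Sum>n<Suc R. real (Suc n) ^ k * (cmod (\<Sum>m<Suc N. M n m * ?L m))\<^sup>2)"
    by (subst sum.lessThan_Suc_shift) simp
  also have "\<dots> \<le> (\<Prod>j<k. 3 * (2 + 2 ^ j)) * K ^ k * (\<Sum>m<Suc N. real (Suc m) ^ k * (cmod (?L m))\<^sup>2)"
    by (rule Suc.IH) (use Suc.prems in \<open>auto intro: ladder_eq_0\<close>)
  also have "\<dots> \<le> (\<Prod>j<k. 3 * (2 + 2 ^ j)) * K ^ k *
      (3 * (2 + 2 ^ k) * K * (\<Sum>m<N. real (Suc m) ^ Suc k * (cmod (b m))\<^sup>2))"
    using K0 by (intro mult_left_mono ladder_weighted_bound K Suc.prems mult_nonneg_nonneg prod_nonneg) auto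
  finally show ?case by (simp add: mult_ac)
qed

section \<open>Dyadic sums and interpolation to fractional weights\<close>

lemma dyadic_geometric_low:
  fixes s x :: real assumes "s > 0" "x > 0"
  shows "(\<Sum>J<J0. if 2 ^ J \<le> x then (2 ^ J) powr s else 0) * (1 - 2 powr - s) \<le> (min (2 ^ J0 / 2) x) powr s"
proof (induction J0)
  case (Suc J0)
  show ?case
  proof (cases "2 ^ J0 \<le> x")
    case True
    have "min (2 ^ J0 / 2) x = 2 ^ J0 / 2" using True assms by (simp add: min_def field_simps)
    moreover have "min (2 ^ Suc J0 / 2) x = 2 ^ J0" using True by (simp add: min_def)
    moreover have "(2 ^ J0 / 2) powr s = (2 ^ J0) powr s * 2 powr - s"
      by (simp add: powr_divide powr_minus field_simps)
    ultimately show ?thesis using Suc True by (simp add: algebra_simps)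
  next
    case False
    have "(min (2 ^ J0 / 2) x) powr s \<le> (min (2 ^ Suc J0 / 2) x) powr s"
      using assms by (intro powr_mono2 min.mono) auto
    then show ?thesis using Suc False by simp
  qed
qed simp

text \<open>Multiplying by \<open>1 - 2 powr - r\<close> makes the geometric sum telescope. The
  \<open>max\<close> keeps the induction valid while \<open>2 ^ J0\<close> is still below
  \<open>x\<close>; the \<open>min\<close> in the companion for the low scales does the same once
  \<open>2 ^ J0\<close> has passed \<open>x\<close>.\<close>

lemma dyadic_geometric_high:
  fixes r x :: real assumes "r > 0" "x \<ge> 1"
  shows "(\<Sum>J<J0. if 2 ^ J < x then 0 else (2 ^ J) powr - r) * (1 - 2 powr - r)
    \<le> x powr - r - (max (2 ^ J0) x) powr - r"
proof (induction J0)
  case (Suc J0)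
  show ?case
  proof (cases "2 ^ J0 < x")
    case False
    have "max (2 ^ J0) x = 2 ^ J0" "max (2 ^ Suc J0) x = 2 * 2 ^ J0" using False assms by (auto simp: max_def)
    moreover have "(2 * 2 ^ J0) powr - r = (2 ^ J0) powr - r * 2 powr - r"
      by (simp add: powr_mult)
    ultimately show ?thesis using Suc False by (simp add: algebra_simps)
  next
    case True
    have "(max (2 ^ Suc J0) x) powr - r \<le> (max (2 ^ J0) x) powr - r"
      using assms by (intro powr_mono2') (auto simp: max_def)
    then show ?thesis using Suc True by simp
  qed
qed (use assms in \<open>simp add: max_def\<close>)


text \<open>Scales up to \<open>m\<close> form an increasing geometric sum because
  \<open>s > 0\<close>, scales above \<open>m\<close> a decreasing one because \<open>s < k\<close>;
  both have the size of their term at scale \<open>m + 1\<close>. Summing the capped weight over all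
  scales therefore rebuilds the fractional weight.\<close>

lemma dyadic_weight_sum:
  fixes s :: real
  assumes s: "0 < s" "s < real k"
  shows "(\<Sum>J<J0. (2 ^ J) powr s * (if 2 ^ J \<le> m then 1 else real (Suc m) ^ k / (2 ^ J) ^ k))
    \<le> (1 / (1 - 2 powr - s) + 1 / (1 - 2 powr (s - real k))) * real (Suc m) powr s"
proof -
  define x where "x = real (Suc m)"
  have x: "x \<ge> 1" by (simp add: x_def)
  have a: "1 - 2 powr - s > 0" "1 - 2 powr - (real k - s) > 0"
    using s by (auto simp: powr_less_one)
  have "(2 ^ J) powr s * (if 2 ^ J \<le> m then 1 else real (Suc m) ^ k / (2 ^ J) ^ k)
     \<le> (if 2 ^ J \<le> x then (2 ^ J) powr s else 0)
       + x ^ k * (if 2 ^ J < x then 0 else (2 ^ J) powr - (real k - s))" for J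
  proof (cases "2 ^ J \<le> m")
    case True
    then have "(2::real) ^ J \<le> real m" by (metis of_nat_le_iff of_nat_numeral of_nat_power)
    also have "\<dots> \<le> x" by (simp add: x_def)
    finally have "2 ^ J \<le> x" .
    then show ?thesis using True x by simp
  next
    case False
    then have "Suc m \<le> 2 ^ J" by simp
    then have "\<not> 2 ^ J < x" unfolding x_def by (metis not_le of_nat_le_iff of_nat_numeral of_nat_power)
    moreover have "(2 ^ J) powr s / (2 ^ J) ^ k = ((2::real) ^ J) powr - (real k - s)"
      by (simp add: powr_diff powr_realpow)
    ultimately show ?thesis using False
      by (simp add: x_def[symmetric] field_simps del: of_nat_Suc)
  qed
  then have "(\<Sum>J<J0. (2 ^ J) powr s * (if 2 ^ J \<le> m then 1 else real (Suc m) ^ k / (2 ^ J) ^ k))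
    \<le> (\<Sum>J<J0. (if 2 ^ J \<le> x then (2 ^ J) powr s else 0)
       + x ^ k * (if 2 ^ J < x then 0 else (2 ^ J) powr - (real k - s)))"
    by (rule sum_mono)
  also have "\<dots> = (\<Sum>J<J0. if 2 ^ J \<le> x then (2 ^ J) powr s else 0)
      + x ^ k * (\<Sum>J<J0. if 2 ^ J < x then 0 else (2 ^ J) powr - (real k - s))"
    by (simp only: sum.distrib sum_distrib_left)
  also have "\<dots> \<le> x powr s / (1 - 2 powr - s) + x ^ k * (x powr - (real k - s) / (1 - 2 powr - (real k - s)))"
  proof (intro add_mono mult_left_mono)
    show "(\<Sum>J<J0. if 2 ^ J \<le> x then (2 ^ J) powr s else 0) \<le> x powr s / (1 - 2 powr - s)"
    proof -
      have "(\<Sum>J<J0. if 2 ^ J \<le> x then (2 ^ J) powr s else 0) * (1 - 2 powr - s) \<le> (min (2 ^ J0 / 2) x) powr s"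
        using s x by (intro dyadic_geometric_low) auto
      also have "\<dots> \<le> x powr s" using s x by (intro powr_mono2) auto
      finally show ?thesis using a by (simp add: pos_le_divide_eq)
    qed
    show "(\<Sum>J<J0. if 2 ^ J < x then 0 else (2 ^ J) powr - (real k - s)) \<le> x powr - (real k - s) / (1 - 2 powr - (real k - s))"
    proof -
      have "(\<Sum>J<J0. if 2 ^ J < x then 0 else (2 ^ J) powr - (real k - s)) * (1 - 2 powr - (real k - s))
         \<le> x powr - (real k - s) - (max (2 ^ J0) x) powr - (real k - s)"
        using s x by (intro dyadic_geometric_high) auto
      also have "\<dots> \<le> x powr - (real k - s)" by simp
      finally show ?thesis using a(2) by (simp only: pos_le_divide_eq)
    qed
  qed (use x in auto)
  also have "x ^ k * (x powr - (real k - s) / (1 - 2 powr - (real k - s))) = x powr s / (1 - 2 powr (s - real k))"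
    using x by (simp add: powr_diff powr_realpow)
  finally show ?thesis by (simp add: x_def algebra_simps)
qed

text \<open>Real interpolation by hand: at the scale \<open>n \<approx> K 2^J\<close> the part of \<open>c\<close> above \<open>2^J\<close> is
  controlled in \<open>l\<^sup>2\<close>, the part below through the integer weight \<open>k > s\<close>.\<close>
lemma intertwiner_fractional_bound:
  fixes s :: real
  assumes s: "s > 0"
  obtains C where "C > 0" "\<And>K M \<alpha> \<beta> \<gamma> c d.
    \<lbrakk>K \<ge> 1; (cmod \<alpha>)\<^sup>2 \<le> K; (cmod \<beta>)\<^sup>2 \<le> K; (cmod \<gamma>)\<^sup>2 \<le> K;
     \<And>n m. complex_of_real (sqrt (real n)) * M (n - 1) m =
        \<alpha> * complex_of_real (sqrt m) * M n (m - 1)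
        + \<beta> * complex_of_real (sqrt (Suc m)) * M n (Suc m) + \<gamma> * M n m;
     \<And>b N R. (\<Sum>n<R. (cmod (\<Sum>m<N. M n m * b m))\<^sup>2) \<le> (\<Sum>m<N. (cmod (b m))\<^sup>2);
     summable (\<lambda>m. (cmod (c m))\<^sup>2);
     \<And>N R. (\<Sum>n<R. (cmod (d n - (\<Sum>m<N. M n m * c m)))\<^sup>2)
         \<le> (\<Sum>m. (cmod (c m))\<^sup>2) - (\<Sum>m<N. (cmod (c m))\<^sup>2);
     summable (\<lambda>m. real (Suc m) powr s * (cmod (c m))\<^sup>2)\<rbrakk>
    \<Longrightarrow> summable (\<lambda>n. real (Suc n) powr s * (cmod (d n))\<^sup>2) \<and>
      (\<Sum>n. real (Suc n) powr s * (cmod (d n))\<^sup>2)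
        \<le> C * K powr s * (\<Sum>m. real (Suc m) powr s * (cmod (c m))\<^sup>2)"
proof -
  define k where "k = nat \<lceil>s\<rceil> + 1"
  have k: "s < real k" unfolding k_def using s by linarith
  define P where "P = (\<Prod>j<k. 3 * (2 + 2 ^ j) :: real)"
  have P: "P \<ge> 1" unfolding P_def by (intro prod_ge_1) auto
  define G where "G = 1 / (1 - 2 powr - s) + 1 / (1 - 2 powr (s - real k))"
  have G: "G \<ge> 0" unfolding G_def using s k by (auto intro!: add_nonneg_nonneg simp: powr_le_one_le powr_less_one less_imp_le)
  \<comment> \<open>The 1 pays for rows below \<open>K\<close>, \<open>2 powr s\<close> for rounding
    a row to a dyadic scale, \<open>2 * P\<close> for a single scale and \<open>G\<close> for the
    sum over scales.\<close>
  define C where "C = 1 + 2 powr s * (2 * P * G)"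
  have C: "C > 0" unfolding C_def using P G by (intro add_pos_nonneg mult_nonneg_nonneg) auto
  show thesis
  proof (rule that[OF C], goal_cases)
    case (1 K M \<alpha> \<beta> \<gamma> c d)
    note K1 = 1(1) and K = 1(2-4) and M = 1(5) and contr = 1(6) and sumc = 1(7) and rem = 1(8) and sumcs = 1(9)
    define w where "w = (\<lambda>m. (cmod (c m))\<^sup>2)"
    define A where "A = (\<Sum>m. real (Suc m) powr s * w m)"
    \<comment> \<open>The price of the coefficient \<open>c m\<close> at scale \<open>2 ^ J\<close>:
      its full \<open>l2\<close> mass if it lies in the tail, otherwise the Chebyshev quotient of
      its weight of order \<open>k\<close> by that of the scale.\<close>
    define \<kappa> where "\<kappa> = (\<lambda>J m. if 2 ^ J \<le> m then 1 else real (Suc m) ^ k / (2 ^ J) ^ k)"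
    have w0: "w m \<ge> 0" for m by (simp add: w_def)
    have sw: "summable w" using sumc by (simp add: w_def)
    have sws: "summable (\<lambda>m. real (Suc m) powr s * w m)" using sumcs by (simp add: w_def)
    have fin\<kappa>: "summable (\<lambda>m. if 2 ^ J \<le> m then w m else 0)" 
        "summable (\<lambda>m. if 2 ^ J \<le> m then 0 else w m)" 
        "summable (\<lambda>m. if 2 ^ J \<le> m then 0 else real (Suc m) ^ k / (2 ^ J) ^ k * w m)" for J :: nat
    proof -
      show "summable (\<lambda>m. if 2 ^ J \<le> m then w m else 0)"
        by (rule summable_comparison_test'[OF sw, of 0]) (auto simp: w0)
      show "summable (\<lambda>m. if 2 ^ J \<le> m then 0 else w m)"
        by (rule summable_finite[of "{..<2^J}"]) auto
      show "summable (\<lambda>m. if 2 ^ J \<le> m then 0 else real (Suc m) ^ k / (2 ^ J) ^ k * w m)"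
        by (rule summable_finite[of "{..<2^J}"]) auto
    qed
    have \<kappa>_split: "w m * \<kappa> J m = (if 2 ^ J \<le> m then w m else 0) + (if 2 ^ J \<le> m then 0 else real (Suc m) ^ k / (2 ^ J) ^ k * w m)" for J m
      by (simp add: \<kappa>_def mult.commute)
    have s\<kappa>: "summable (\<lambda>m. w m * \<kappa> J m)" for J
      unfolding \<kappa>_split by (intro summable_add fin\<kappa>)
    have tail: "(\<Sum>m. if 2 ^ J \<le> m then w m else 0) = (\<Sum>m. w m) - (\<Sum>m<2^J. w m)" for J :: nat
    proof -
      have "(\<Sum>m. w m) = (\<Sum>m. (if 2 ^ J \<le> m then w m else 0) + (if 2 ^ J \<le> m then 0 else w m))"
        by (rule suminf_cong) auto
      also have "\<dots> = (\<Sum>m. if 2 ^ J \<le> m then w m else 0) + (\<Sum>m. if 2 ^ J \<le> m then 0 else w m)"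
        by (rule suminf_add[symmetric]) (rule fin\<kappa>)+
      also have "(\<Sum>m. if 2 ^ J \<le> m then 0 else w m) = (\<Sum>m<2^J. if 2 ^ J \<le> m then 0 else w m)"
        by (rule suminf_finite) auto
      also have "\<dots> = (\<Sum>m<2^J. w m)" by (rule sum.cong) auto
      finally show ?thesis by simp
    qed
    have head: "(\<Sum>m. if 2 ^ J \<le> m then 0 else real (Suc m) ^ k / (2 ^ J) ^ k * w m)
        = (\<Sum>m<2^J. real (Suc m) ^ k * w m) / (2 ^ J) ^ k" for J :: nat
    proof -
      have "(\<Sum>m. if 2 ^ J \<le> m then 0 else real (Suc m) ^ k / (2 ^ J) ^ k * w m)
         = (\<Sum>m<2^J. if 2 ^ J \<le> m then 0 else real (Suc m) ^ k / (2 ^ J) ^ k * w m)"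
        by (rule suminf_finite) auto
      also have "\<dots> = (\<Sum>m<2^J. real (Suc m) ^ k * w m / (2 ^ J) ^ k)" by (rule sum.cong) auto
      finally show ?thesis by (simp only: sum_divide_distrib)
    qed
    \<comment> \<open>On these rows the weight of order \<open>k\<close> is at least
      \<open>(K * 2 ^ J) ^ k\<close>, whose factor \<open>K ^ k\<close> cancels the one lost in the
      integer bound. The resulting constant does not depend on \<open>K\<close>.\<close>
    have block: "(\<Sum>n<R. if K * 2 ^ J \<le> real (Suc n) then (cmod (d n))\<^sup>2 else 0) \<le> 2 * P * (\<Sum>m. w m * \<kappa> J m)" for R J
    proof -
      define N where "N = (2::nat) ^ J"
      define b where "b = (\<lambda>m. if m < N then c m else 0)"
      define r where "r = (\<lambda>n. d n - (\<Sum>m<N. M n m * c m))"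
      have bc: "(\<Sum>m<N. M n m * b m) = (\<Sum>m<N. M n m * c m)" for n by (rule sum.cong) (auto simp: b_def)
      have Kpos: "(K * 2 ^ J) ^ k > 0" using K1 by simp
      have pt: "(if K * 2 ^ J \<le> real (Suc n) then (cmod (d n))\<^sup>2 else 0) \<le>
          2 * (cmod (r n))\<^sup>2 + 2 / (K * 2 ^ J) ^ k * (real (Suc n) ^ k * (cmod (\<Sum>m<N. M n m * b m))\<^sup>2)" for n
      proof (cases "K * 2 ^ J \<le> real (Suc n)")
        case True
        have "1 \<le> real (Suc n) ^ k / (K * 2 ^ J) ^ k"
          using Kpos power_mono[OF True, of k] K1 by simp
        then have "(cmod (\<Sum>m<N. M n m * b m))\<^sup>2 \<le> real (Suc n) ^ k / (K * 2 ^ J) ^ k * (cmod (\<Sum>m<N. M n m * b m))\<^sup>2"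
          by (metis mult.left_neutral mult_right_mono zero_le_power2)
        moreover have "(cmod (d n))\<^sup>2 \<le> 2 * ((cmod (r n))\<^sup>2 + (cmod (\<Sum>m<N. M n m * b m))\<^sup>2)"
          using norm_add_sq[of "r n" "\<Sum>m<N. M n m * b m"] bc by (simp add: r_def)
        ultimately show ?thesis using True by (simp add: algebra_simps)
      next
        case False
        then show ?thesis using Kpos by (auto intro!: add_nonneg_nonneg mult_nonneg_nonneg)
      qed
      have "(\<Sum>n<R. if K * 2 ^ J \<le> real (Suc n) then (cmod (d n))\<^sup>2 else 0) \<le>
         (\<Sum>n<R. 2 * (cmod (r n))\<^sup>2 + 2 / (K * 2 ^ J) ^ k * (real (Suc n) ^ k * (cmod (\<Sum>m<N. M n m * b m))\<^sup>2))"
        by (rule sum_mono) (rule pt)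
      also have "\<dots> = 2 * (\<Sum>n<R. (cmod (r n))\<^sup>2) + 2 / (K * 2 ^ J) ^ k * (\<Sum>n<R. real (Suc n) ^ k * (cmod (\<Sum>m<N. M n m * b m))\<^sup>2)"
        by (simp only: sum.distrib sum_distrib_left)
      also have "\<dots> \<le> 2 * (\<Sum>m. if N \<le> m then w m else 0) + 2 / (K * 2 ^ J) ^ k * (P * K ^ k * (\<Sum>m<N. real (Suc m) ^ k * (cmod (b m))\<^sup>2))"
      proof (intro add_mono mult_left_mono)
        show "(\<Sum>n<R. (cmod (r n))\<^sup>2) \<le> (\<Sum>m. if N \<le> m then w m else 0)"
          using rem[of N R] tail[of J] by (simp add: N_def r_def w_def)
        show "(\<Sum>n<R. real (Suc n) ^ k * (cmod (\<Sum>m<N. M n m * b m))\<^sup>2) \<le> P * K ^ k * (\<Sum>m<N. real (Suc m) ^ k * (cmod (b m))\<^sup>2)"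
          unfolding P_def by (rule intertwiner_integer_bound[OF K M contr]) (simp add: b_def)
      qed (use Kpos in auto)
      also have "(\<Sum>m<N. real (Suc m) ^ k * (cmod (b m))\<^sup>2) = (\<Sum>m<N. real (Suc m) ^ k * w m)"
        by (rule sum.cong) (auto simp: b_def w_def)
      also have "2 / (K * 2 ^ J) ^ k * (P * K ^ k * (\<Sum>m<N. real (Suc m) ^ k * w m)) = 2 * P * ((\<Sum>m<N. real (Suc m) ^ k * w m) / (2 ^ J) ^ k)"
        using K1 by (simp add: power_mult_distrib field_simps)
      also have "\<dots> = 2 * P * (\<Sum>m. if 2 ^ J \<le> m then 0 else real (Suc m) ^ k / (2 ^ J) ^ k * w m)"
        by (simp add: head N_def)
      also have "2 * (\<Sum>m. if N \<le> m then w m else 0) \<le> 2 * P * (\<Sum>m. if 2 ^ J \<le> m then w m else 0)"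
      proof -
        have "(\<Sum>m. if 2 ^ J \<le> m then w m else 0) \<ge> 0" by (rule suminf_nonneg[OF fin\<kappa>(1)]) (simp add: w0)
        then show ?thesis using P by (simp add: N_def mult_le_cancel_right1)
      qed
      finally show ?thesis
        unfolding \<kappa>_split by (subst suminf_add[OF fin\<kappa>(1) fin\<kappa>(3), symmetric]) (simp add: distrib_left)
    qed
    have fin_bound: "(\<Sum>n<R. real (Suc n) powr s * (cmod (d n))\<^sup>2) \<le> C * K powr s * A" for R
    proof -
      obtain J0 where J0: "real (Suc R) < 2 ^ J0" using real_arch_pow[of 2 "real (Suc R)"] by auto
      \<comment> \<open>A row \<open>n\<close> is charged to the largest scale with
        \<open>K * 2 ^ J <= n + 1\<close>, which loses only \<open>2 powr s\<close>; the lower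
        scales in the sum are a harmless surplus. \<open>J0\<close> bounds all scales met by the
        rows below \<open>R\<close>.\<close>
      have pt: "real (Suc n) powr s \<le> K powr s + K powr s * 2 powr s * (\<Sum>J<J0. if K * 2 ^ J \<le> real (Suc n) then (2 ^ J) powr s else 0)"
        if n: "n < R" for n
      proof (cases "real (Suc n) < K")
        case True
        then have "real (Suc n) powr s \<le> K powr s" using s by (intro powr_mono2) auto
        moreover have "0 \<le> K powr s * 2 powr s * (\<Sum>J<J0. if K * 2 ^ J \<le> real (Suc n) then (2 ^ J) powr s else 0)"
          by (intro mult_nonneg_nonneg sum_nonneg) auto
        ultimately show ?thesis by linarith
      next
        case False
        define J where "J = (GREATEST J. K * 2 ^ J \<le> real (Suc n))"
        have bd: "\<forall>J. K * 2 ^ J \<le> real (Suc n) \<longrightarrow> J \<le> J0"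
        proof (intro allI impI)
          fix J assume "K * 2 ^ J \<le> real (Suc n)"
          moreover have "2 ^ J \<le> K * (2::real) ^ J" using K1 by simp
          moreover have "real (Suc n) \<le> real (Suc R)" using n by simp
          ultimately have "(2::real) ^ J \<le> 2 ^ J0" using J0 by linarith
          then show "J \<le> J0" by (simp add: power_increasing_iff)
        qed
        have J: "K * 2 ^ J \<le> real (Suc n)" unfolding J_def
          by (rule GreatestI_nat[of "\<lambda>J. K * 2 ^ J \<le> real (Suc n)" 0 J0]) (use False bd in auto)
        have J': "real (Suc n) < K * 2 ^ Suc J"
        proof (rule ccontr)
          assume "\<not> real (Suc n) < K * 2 ^ Suc J"
          then have "Suc J \<le> J" unfolding J_def 
            by (intro Greatest_le_nat[where b=J0]) (use bd in auto)
          then show False by simp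
        qed
        have JJ: "J < J0"
        proof -
          have "2 ^ J \<le> K * (2::real) ^ J" using K1 by simp
          moreover have "real (Suc n) \<le> real (Suc R)" using n by simp
          ultimately have "(2::real) ^ J < 2 ^ J0" using J0 J by linarith
          then show ?thesis by simp
        qed
        have "real (Suc n) powr s \<le> (K * 2 ^ Suc J) powr s" using J' s by (intro powr_mono2) auto
        also have "\<dots> = K powr s * 2 powr s * (2 ^ J) powr s" using K1 by (simp add: powr_mult)
        also have "\<dots> \<le> K powr s * 2 powr s * (\<Sum>J<J0. if K * 2 ^ J \<le> real (Suc n) then (2 ^ J) powr s else 0)"
        proof (rule mult_left_mono)
          have "(2 ^ J) powr s = (if K * 2 ^ J \<le> real (Suc n) then (2 ^ J) powr s else 0)" using J by simp
          also have "\<dots> \<le> (\<Sum>J<J0. if K * 2 ^ J \<le> real (Suc n) then (2 ^ J) powr s else 0)"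
            by (rule member_le_sum) (use JJ in auto)
          finally show "(2 ^ J) powr s \<le> (\<Sum>J<J0. if K * 2 ^ J \<le> real (Suc n) then (2 ^ J) powr s else 0)" .
        qed simp
        also have "\<dots> \<le> K powr s + \<dots>" by simp
        finally show ?thesis .
      qed
      have "(\<Sum>n<R. real (Suc n) powr s * (cmod (d n))\<^sup>2) \<le>
        (\<Sum>n<R. (K powr s + K powr s * 2 powr s * (\<Sum>J<J0. if K * 2 ^ J \<le> real (Suc n) then (2 ^ J) powr s else 0)) * (cmod (d n))\<^sup>2)"
        by (intro sum_mono mult_right_mono pt) auto
      also have "\<dots> = K powr s * (\<Sum>n<R. (cmod (d n))\<^sup>2) + K powr s * 2 powr s *
          (\<Sum>n<R. (\<Sum>J<J0. (2 ^ J) powr s * (if K * 2 ^ J \<le> real (Suc n) then (cmod (d n))\<^sup>2 else 0)))"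
      proof -
        have "(\<Sum>J<J0. if K * 2 ^ J \<le> real (Suc n) then (2 ^ J) powr s else 0) * (cmod (d n))\<^sup>2
           = (\<Sum>J<J0. (2 ^ J) powr s * (if K * 2 ^ J \<le> real (Suc n) then (cmod (d n))\<^sup>2 else 0))" for n
          unfolding sum_distrib_right by (rule sum.cong) auto
        then show ?thesis
          by (simp only: distrib_right sum.distrib sum_distrib_left[symmetric] mult.assoc)
      qed
      also have "(\<Sum>n<R. (\<Sum>J<J0. (2 ^ J) powr s * (if K * 2 ^ J \<le> real (Suc n) then (cmod (d n))\<^sup>2 else 0)))
         = (\<Sum>J<J0. (2 ^ J) powr s * (\<Sum>n<R. if K * 2 ^ J \<le> real (Suc n) then (cmod (d n))\<^sup>2 else 0))"
        by (subst sum.swap) (simp add: sum_distrib_left)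
      also have "K powr s * (\<Sum>n<R. (cmod (d n))\<^sup>2) + K powr s * 2 powr s * \<dots> \<le>
         K powr s * A + K powr s * 2 powr s * (2 * P * (G * A))"
      proof (intro add_mono mult_left_mono)
        \<comment> \<open>With \<open>N = 0\<close> the remainder hypothesis is Bessel's inequality
          for \<open>d\<close>.\<close>
        have "(\<Sum>n<R. (cmod (d n))\<^sup>2) \<le> (\<Sum>m. w m)" using rem[of 0 R] by (simp add: w_def)
        also have "\<dots> \<le> A" unfolding A_def
        proof (rule suminf_le[OF _ sw sws])
          fix m show "w m \<le> real (Suc m) powr s * w m"
            using ge_one_powr_ge_zero[of "real (Suc m)" s] s w0[of m] by (simp add: mult_le_cancel_right1)
        qed
        finally show "(\<Sum>n<R. (cmod (d n))\<^sup>2) \<le> A" .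
        have "(\<Sum>J<J0. (2 ^ J) powr s * (\<Sum>n<R. if K * 2 ^ J \<le> real (Suc n) then (cmod (d n))\<^sup>2 else 0))
           \<le> (\<Sum>J<J0. (2 ^ J) powr s * (2 * P * (\<Sum>m. w m * \<kappa> J m)))"
          by (intro sum_mono mult_left_mono block) auto
        also have "\<dots> = 2 * P * (\<Sum>J<J0. (\<Sum>m. (2 ^ J) powr s * (w m * \<kappa> J m)))"
          unfolding suminf_mult[OF s\<kappa>] by (simp only: sum_distrib_left mult_ac)
        also have "(\<Sum>J<J0. (\<Sum>m. (2 ^ J) powr s * (w m * \<kappa> J m))) = (\<Sum>m. (\<Sum>J<J0. (2 ^ J) powr s * (w m * \<kappa> J m)))"
          by (rule suminf_sum[symmetric]) (intro summable_mult s\<kappa>)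
        also have "\<dots> \<le> (\<Sum>m. G * (real (Suc m) powr s * w m))"
        proof (rule suminf_le)
          show "summable (\<lambda>m. \<Sum>J<J0. (2 ^ J) powr s * (w m * \<kappa> J m))" by (intro summable_sum summable_mult s\<kappa>)
          show "summable (\<lambda>m. G * (real (Suc m) powr s * w m))" by (intro summable_mult sws)
          fix m
          have "(\<Sum>J<J0. (2 ^ J) powr s * (w m * \<kappa> J m)) = (\<Sum>J<J0. (2 ^ J) powr s * \<kappa> J m) * w m"
            unfolding sum_distrib_right by (simp only: mult_ac)
          also have "\<dots> \<le> (G * real (Suc m) powr s) * w m"
            unfolding \<kappa>_def G_def by (intro mult_right_mono dyadic_weight_sum s k w0)
          finally show "(\<Sum>J<J0. (2 ^ J) powr s * (w m * \<kappa> J m)) \<le> G * (real (Suc m) powr s * w m)" by (simp add: mult_ac)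
        qed
        also have "\<dots> = G * A" unfolding A_def by (rule suminf_mult[OF sws])
        finally show "(\<Sum>J<J0. (2 ^ J) powr s * (\<Sum>n<R. if K * 2 ^ J \<le> real (Suc n) then (cmod (d n))\<^sup>2 else 0)) \<le> 2 * P * (G * A)"
          using P by simp
      qed (use P in auto)
      also have "\<dots> = C * K powr s * A" by (simp add: C_def algebra_simps)
      finally show ?thesis .
    qed
    have "summable (\<lambda>n. real (Suc n) powr s * (cmod (d n))\<^sup>2)"
      by (rule summableI_nonneg_bounded[OF _ fin_bound]) simp
    moreover have "(\<Sum>n. real (Suc n) powr s * (cmod (d n))\<^sup>2) \<le> C * K powr s * A"
      using calculation fin_bound by (rule suminf_le_const)
    ultimately show ?case by (simp add: A_def w_def)
  qed
qed

section \<open>From one large pairing to a lower bound for a weighted sum\<close>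

lemma sum_mult_norm_le_sqrt:
  "cmod (\<Sum>n\<in>A. a n * b n) \<le> sqrt (\<Sum>n\<in>A. (cmod (a n))\<^sup>2) * sqrt (\<Sum>n\<in>A. (cmod (b n))\<^sup>2)"
proof -
  have "cmod (\<Sum>n\<in>A. a n * b n) \<le> (\<Sum>n\<in>A. \<bar>cmod (a n)\<bar> * \<bar>cmod (b n)\<bar>)"
    by (rule order_trans[OF norm_sum]) (simp add: norm_mult)
  also have "\<dots> \<le> sqrt (\<Sum>n\<in>A. (cmod (a n))\<^sup>2) * sqrt (\<Sum>n\<in>A. (cmod (b n))\<^sup>2)"
    using L2_set_mult_ineq[of "\<lambda>n. cmod (a n)" "\<lambda>n. cmod (b n)" A] by (simp add: L2_set_def)
  finally show ?thesis .
qed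

text \<open>Hypothesis \<open>G\<close> splits a quantity of size \<open>G0\<close> into the modes
  below \<open>N\<close> and the rest. For \<open>N\<close> up to a small multiple of
  \<open>G0^2 / (\<kappa> B)^2\<close> the low modes cannot supply more than half of it. So the
  squared mass beyond \<open>N\<close> is at least \<open>(G0 / (2 Q))^2\<close>, and all of it
  carries at least the weight \<open>(N + 1/2) powr s\<close>.\<close>

lemma weighted_sum_lower_bound:
  fixes d :: "nat \<Rightarrow> complex" and s G0 \<kappa> B Q :: real
  assumes s: "s > 0" and pos: "G0 > 0" "\<kappa> > 0" "B > 0" "Q > 0"
    and sumd: "summable (\<lambda>n. (cmod (d n))\<^sup>2)" "(\<Sum>n. (cmod (d n))\<^sup>2) = B\<^sup>2"
    and sums: "summable (\<lambda>n. (real n + 1/2) powr s * (cmod (d n))\<^sup>2)"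
    and G: "\<And>N. G0 \<le> 2 * \<kappa> * sqrt (\<Sum>n<N. real (Suc n) * (cmod (d n))\<^sup>2)
        + sqrt ((\<Sum>n. (cmod (d n))\<^sup>2) - (\<Sum>n<N. (cmod (d n))\<^sup>2)) * Q"
  shows "(G0\<^sup>2 / (32 * \<kappa>\<^sup>2 * B\<^sup>2)) powr s * (G0 / (2 * Q))\<^sup>2
      \<le> (\<Sum>n. (real n + 1/2) powr s * (cmod (d n))\<^sup>2)"
proof -
  \<comment> \<open>The 16 makes the low-mode term at most \<open>G0 / 2\<close>. Rounding
    \<open>X\<close> down to \<open>N\<close> costs another factor 2, since
    \<open>N + 1/2 >= X / 2\<close> also when \<open>N = 0\<close>; hence the 32 in the
    statement.\<close>
  define X where "X = G0\<^sup>2 / (16 * \<kappa>\<^sup>2 * B\<^sup>2)"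
  have X: "X > 0" using pos by (simp add: X_def)
  define N where "N = nat \<lfloor>X\<rfloor>"
  have NX: "real N \<le> X" "X / 2 \<le> real N + 1/2" using X unfolding N_def by linarith+
  define T where "T = (\<Sum>n. (cmod (d n))\<^sup>2) - (\<Sum>n<N. (cmod (d n))\<^sup>2)"
  have Teq: "T = (\<Sum>n. (cmod (d (n + N)))\<^sup>2)"
    unfolding T_def using suminf_split_initial_segment[OF sumd(1), of N] by simp
  have T0: "T \<ge> 0" unfolding Teq by (rule suminf_nonneg) (use summable_ignore_initial_segment[OF sumd(1), of N] in auto)
  have "(\<Sum>n<N. real (Suc n) * (cmod (d n))\<^sup>2) \<le> (\<Sum>n<N. real N * (cmod (d n))\<^sup>2)"
    by (intro sum_mono mult_right_mono) auto
  also have "\<dots> = real N * (\<Sum>n<N. (cmod (d n))\<^sup>2)" by (simp add: sum_distrib_left)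
  also have "\<dots> \<le> X * B\<^sup>2"
    using NX X sum_le_suminf[OF sumd(1), of "{..<N}"] sumd(2) by (intro mult_mono) (auto intro!: sum_nonneg)
  also have "\<dots> = (G0 / (4 * \<kappa>))\<^sup>2" using pos by (simp add: X_def power2_eq_square)
  finally have "sqrt (\<Sum>n<N. real (Suc n) * (cmod (d n))\<^sup>2) \<le> G0 / (4 * \<kappa>)"
    using pos real_le_lsqrt by (simp add: real_le_lsqrt)
  then have "2 * \<kappa> * sqrt (\<Sum>n<N. real (Suc n) * (cmod (d n))\<^sup>2) \<le> G0 / 2"
    using pos by (simp add: field_simps)
  then have "G0 / 2 \<le> sqrt T * Q" using G[of N] unfolding T_def by linarith
  then have "G0 / (2 * Q) \<le> sqrt T" using pos by (simp add: field_simps)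
  then have T: "(G0 / (2 * Q))\<^sup>2 \<le> T" using pos T0
    by (metis divide_nonneg_nonneg less_imp_le mult_nonneg_nonneg power_mono real_sqrt_pow2 zero_le_numeral)
  have "(G0\<^sup>2 / (32 * \<kappa>\<^sup>2 * B\<^sup>2)) powr s * (G0 / (2 * Q))\<^sup>2 \<le> (real N + 1/2) powr s * T"
  proof (rule mult_mono[OF _ T])
    have "G0\<^sup>2 / (32 * \<kappa>\<^sup>2 * B\<^sup>2) = X / 2" by (simp add: X_def)
    then have eq: "G0\<^sup>2 / (32 * \<kappa>\<^sup>2 * B\<^sup>2) = X / 2" .
    show "(G0\<^sup>2 / (32 * \<kappa>\<^sup>2 * B\<^sup>2)) powr s \<le> (real N + 1/2) powr s"
      unfolding eq using NX X s by (intro powr_mono2) auto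
  qed auto
  also have "\<dots> = (\<Sum>n. (real N + 1/2) powr s * (cmod (d (n + N)))\<^sup>2)"
    unfolding Teq by (rule suminf_mult[symmetric]) (use summable_ignore_initial_segment[OF sumd(1), of N] in auto)
  also have "\<dots> \<le> (\<Sum>n. (real (n + N) + 1/2) powr s * (cmod (d (n + N)))\<^sup>2)"
    using s summable_ignore_initial_segment[OF sumd(1), of N] summable_ignore_initial_segment[OF sums, of N]
    by (intro suminf_le mult_right_mono powr_mono2 summable_mult) auto
  also have "\<dots> \<le> (\<Sum>n. (real n + 1/2) powr s * (cmod (d n))\<^sup>2)"
    using suminf_split_initial_segment[OF sums, of N] by (simp add: sum_nonneg)
  finally show ?thesis .
qed


subsection \<open>Polynomials times complex Gaussians\<close>

text \<open>A class of explicit functions closed under products, conjugation, differentiation and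
  multiplication by polynomials, which contains every Hermite function and its squeezed, chirped and
  translated images. For \<open>Re A < 0\<close> it supplies all test functions and all integrations
  by parts that are used.\<close>

definition poly_gauss :: "complex poly \<Rightarrow> complex \<Rightarrow> complex \<Rightarrow> real \<Rightarrow> complex" where
  "poly_gauss P A B x = poly P (complex_of_real x) * exp (A * (complex_of_real x)\<^sup>2 + B * complex_of_real x)"

definition gauss_deriv :: "complex \<Rightarrow> complex \<Rightarrow> complex poly \<Rightarrow> complex poly" where
  "gauss_deriv A B P = pderiv P + [:B, 2 * A:] * P"

lemma poly_gauss_mult: "poly_gauss P A B x * poly_gauss Q A' B' x = poly_gauss (P * Q) (A + A') (B + B') x"
  by (simp add: poly_gauss_def algebra_simps exp_add)

lemma cnj_poly_gauss: "cnj (poly_gauss P A B x) = poly_gauss (map_poly cnj P) (cnj A) (cnj B) x"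
proof -
  have "cnj (poly P (complex_of_real x)) = poly (map_poly cnj P) (complex_of_real x)"
    by (induction P) (simp_all add: map_poly_pCons)
  then show ?thesis by (simp add: poly_gauss_def exp_cnj)
qed

lemma poly_gauss_has_vector_derivative:
  "(poly_gauss P A B has_vector_derivative poly_gauss (gauss_deriv A B P) A B x) (at x within S)"
proof -
  have "((\<lambda>z. poly P z * exp (A * z\<^sup>2 + B * z)) has_field_derivative
      poly (gauss_deriv A B P) z * exp (A * z\<^sup>2 + B * z)) (at z)" for z
    by (auto intro!: derivative_eq_intros simp: gauss_deriv_def algebra_simps power2_eq_square)
  from has_vector_derivative_real_field[OF this]
  show ?thesis by (simp add: poly_gauss_def[abs_def])
qed

lemma poly_gauss_continuous: "continuous_on S (poly_gauss P A B)"
  unfolding poly_gauss_def by (intro continuous_intros)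

lemma poly_gauss_measurable [measurable]: "poly_gauss P A B \<in> borel_measurable borel"
  by (intro borel_measurable_continuous_onI poly_gauss_continuous)

lemma power_le_fact_exp:
  fixes x :: real assumes "x \<ge> 0" shows "x ^ n \<le> fact n * exp x"
proof -
  have "x ^ n / fact n \<le> exp x"
  proof -
    have "(\<Sum>i\<in>{n}. x ^ i / fact i) \<le> (\<Sum>i. x ^ i / fact i)"
      using assms summable_exp[of x] by (intro sum_le_suminf) (auto simp: field_simps)
    then show ?thesis by (simp add: exp_def field_simps scaleR_conv_of_real)
  qed
  then show ?thesis by (simp add: field_simps)
qed

lemma poly_gauss_bounded:
  assumes A: "Re A < 0"
  obtains C where "\<And>x. cmod (poly_gauss P A B x) \<le> C"
proof -
  define \<delta> where "\<delta> = - Re A"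
  have \<delta>: "\<delta> > 0" using A by (simp add: \<delta>_def)
  define S where "S = (\<Sum>i\<le>degree P. cmod (coeff P i) * fact i)"
  have S: "S \<ge> 0" unfolding S_def by (intro sum_nonneg) auto
  define b where "b = 1 + \<bar>Re B\<bar>"
  have "cmod (poly_gauss P A B x) \<le> S * exp (b\<^sup>2 / (4 * \<delta>))" for x
  proof -
    have "cmod (poly P (complex_of_real x)) \<le> (\<Sum>i\<le>degree P. cmod (coeff P i) * \<bar>x\<bar> ^ i)"
      unfolding poly_altdef by (rule order_trans[OF norm_sum]) (simp add: norm_mult norm_power)
    also have "\<dots> \<le> (\<Sum>i\<le>degree P. cmod (coeff P i) * (fact i * exp \<bar>x\<bar>))"
      by (intro sum_mono mult_left_mono power_le_fact_exp) auto
    also have "\<dots> = S * exp \<bar>x\<bar>" unfolding S_def sum_distrib_right by (simp only: mult_ac)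
    finally have 1: "cmod (poly P (complex_of_real x)) \<le> S * exp \<bar>x\<bar>" .
    have 2: "cmod (exp (A * (complex_of_real x)\<^sup>2 + B * complex_of_real x)) = exp (- \<delta> * x\<^sup>2 + Re B * x)"
      by (simp add: \<delta>_def power2_eq_square)
    \<comment> \<open>Completing the square in \<open>|x|\<close>; \<open>b\<close> collects the
      linear growth of both exponentials.\<close>
    have "\<bar>x\<bar> + (- \<delta> * x\<^sup>2 + Re B * x) \<le> b\<^sup>2 / (4 * \<delta>)"
    proof -
      have "0 \<le> (2 * \<delta> * \<bar>x\<bar> - b)\<^sup>2" by simp
      then have "4 * \<delta> * (b * \<bar>x\<bar> - \<delta> * x\<^sup>2) \<le> b\<^sup>2" by (simp add: power2_eq_square algebra_simps)
      then have "b * \<bar>x\<bar> - \<delta> * x\<^sup>2 \<le> b\<^sup>2 / (4 * \<delta>)" using \<delta> by (simp add: field_simps)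
      moreover have "Re B * x \<le> \<bar>Re B\<bar> * \<bar>x\<bar>" by (metis abs_ge_self abs_mult)
      ultimately show ?thesis by (simp add: b_def algebra_simps)
    qed
    then have "exp \<bar>x\<bar> * exp (- \<delta> * x\<^sup>2 + Re B * x) \<le> exp (b\<^sup>2 / (4 * \<delta>))"
      by (simp only: exp_add[symmetric] exp_le_cancel_iff)
    then have "S * (exp \<bar>x\<bar> * exp (- \<delta> * x\<^sup>2 + Re B * x)) \<le> S * exp (b\<^sup>2 / (4 * \<delta>))"
      using S by (rule mult_left_mono)
    then show ?thesis
      unfolding poly_gauss_def norm_mult 2
      using mult_right_mono[OF 1, of "exp (- \<delta> * x\<^sup>2 + Re B * x)"]
      by (smt (verit, best) exp_ge_zero mult.assoc)
  qed
  then show thesis by (rule that)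
qed

text \<open>The factor \<open>1 + x^2\<close> is absorbed into the polynomial. The rate
  \<open>C / (1 + x^2)\<close> is the common majorant for domination: it is integrable, and so is
  its square.\<close>

lemma poly_gauss_decay:
  assumes A: "Re A < 0"
  obtains C where "C > 0" "\<And>x. cmod (poly_gauss P A B x) \<le> C / (1 + x\<^sup>2)"
proof -
  obtain C where C: "\<And>x. cmod (poly_gauss ([:1, 0, 1:] * P) A B x) \<le> C"
    using poly_gauss_bounded[OF A] by blast
  have "cmod (poly_gauss P A B x) \<le> (\<bar>C\<bar> + 1) / (1 + x\<^sup>2)" for x
  proof -
    have "poly_gauss ([:1, 0, 1:] * P) A B x = complex_of_real (1 + x\<^sup>2) * poly_gauss P A B x"
      by (simp add: poly_gauss_def power2_eq_square algebra_simps)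
    then have "(1 + x\<^sup>2) * cmod (poly_gauss P A B x) \<le> C"
      using C[of x] by (simp add: norm_mult del: of_real_add of_real_power)
    moreover have p: "1 + x\<^sup>2 > 0" by (simp add: add_pos_nonneg)
    ultimately show ?thesis by (simp add: pos_le_divide_eq[OF p] mult.commute)
  qed
  then show thesis by (intro that[of "\<bar>C\<bar> + 1"]) auto
qed

lemma vector_derivative_poly_gauss:
  "(\<lambda>x. vector_derivative (poly_gauss P A B) (at x)) = poly_gauss (gauss_deriv A B P) A B"
  by (rule ext) (rule vector_derivative_at[OF poly_gauss_has_vector_derivative])

lemma cderiv_poly_gauss: "cderiv k (poly_gauss P A B) = poly_gauss ((gauss_deriv A B ^^ k) P) A B"
  unfolding cderiv_def by (induction k) (simp_all add: vector_derivative_poly_gauss)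

lemma schwartz_poly_gauss:
  assumes A: "Re A < 0"
  shows "schwartz (poly_gauss P A B)"
  unfolding schwartz_def cderiv_poly_gauss
proof (intro conjI allI)
  fix k x show "poly_gauss ((gauss_deriv A B ^^ k) P) A B differentiable at x"
    using poly_gauss_has_vector_derivative differentiableI_vector by blast
next
  fix a k
  obtain C where C: "\<And>x. cmod (poly_gauss ([:0, 1:] ^ a * (gauss_deriv A B ^^ k) P) A B x) \<le> C"
    using poly_gauss_bounded[OF A] by blast
  show "\<exists>C. \<forall>x. \<bar>x\<bar> ^ a * cmod (poly_gauss ((gauss_deriv A B ^^ k) P) A B x) \<le> C"
  proof (intro exI allI)
    fix x
    have "poly_gauss ([:0, 1:] ^ a * (gauss_deriv A B ^^ k) P) A B x
      = complex_of_real x ^ a * poly_gauss ((gauss_deriv A B ^^ k) P) A B x"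
      by (simp add: poly_gauss_def poly_power)
    then show "\<bar>x\<bar> ^ a * cmod (poly_gauss ((gauss_deriv A B ^^ k) P) A B x) \<le> C"
      using C[of x] by (simp add: norm_mult norm_power)
  qed
qed

lemma integrable_inverse_quadratic: "integrable lborel (\<lambda>x::real. 1 / (1 + x\<^sup>2))"
  using integrable_I0i_1_div_plus_square integrable_inverse_1_plus_square 
  by (simp add: set_integrable_def inverse_eq_divide)

lemma integrable_inverse_decay:
  fixes f :: "real \<Rightarrow> 'b::{banach, second_countable_topology}"
  assumes "f \<in> borel_measurable borel" "\<And>x. norm (f x) \<le> C / (1 + x\<^sup>2)"
  shows "integrable lborel f"
proof (rule Bochner_Integration.integrable_bound)
  show "integrable lborel (\<lambda>x::real. C * (1 / (1 + x\<^sup>2)))"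
    by (intro integrable_mult_right integrable_inverse_quadratic)
  show "AE x in lborel. norm (f x) \<le> norm (C * (1 / (1 + x\<^sup>2)))"
  proof (intro AE_I2)
    fix x show "norm (f x) \<le> norm (C * (1 / (1 + x\<^sup>2)))"
      using assms(2)[of x] abs_ge_self[of "C / (1 + x\<^sup>2)"] by simp
  qed
qed (use assms in simp)

lemma integrable_poly_gauss:
  assumes "Re A < 0" shows "integrable lborel (poly_gauss P A B)"
proof -
  obtain C where "\<And>x. cmod (poly_gauss P A B x) \<le> C / (1 + x\<^sup>2)" using poly_gauss_decay[OF assms] by blast
  then show ?thesis by (intro integrable_inverse_decay) auto
qed

lemma integral_gauss_deriv:
  assumes A: "Re A < 0"
  shows "(LINT x|lborel. poly_gauss (gauss_deriv A B P) A B x) = 0"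
proof -
  obtain C where C: "C > 0" "\<And>x. cmod (poly_gauss P A B x) \<le> C / (1 + x\<^sup>2)" using poly_gauss_decay[OF A] by blast
  have lim: "((\<lambda>x. C / (1 + x\<^sup>2)) \<longlongrightarrow> 0) at_top" "((\<lambda>x. C / (1 + x\<^sup>2)) \<longlongrightarrow> 0) at_bot"
    by real_asymp+
  have "(LBINT x=-\<infinity>..\<infinity>. poly_gauss (gauss_deriv A B P) A B x) = 0 - 0"
  proof (rule interval_integral_FTC_integrable)
    show "set_integrable lborel (einterval (-\<infinity>) \<infinity>) (poly_gauss (gauss_deriv A B P) A B)"
      using integrable_poly_gauss[OF A] by (simp add: set_integrable_def)
    show "((poly_gauss P A B \<circ> real_of_ereal) \<longlongrightarrow> 0) (at_right (-\<infinity>))"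
      "((poly_gauss P A B \<circ> real_of_ereal) \<longlongrightarrow> 0) (at_left \<infinity>)"
      unfolding ereal_tendsto_simps
      by (rule Lim_null_comparison[OF _ lim(2)], simp add: C)
         (rule Lim_null_comparison[OF _ lim(1)], simp add: C)
  qed (use poly_gauss_has_vector_derivative poly_gauss_continuous[of UNIV] in \<open>auto simp: continuous_on_eq_continuous_at\<close>)
  then show ?thesis by (simp add: interval_lebesgue_integral_def set_lebesgue_integral_def)
qed

lemma L2_bound_decay:
  assumes "u \<in> borel_measurable borel" "\<And>x. cmod (u x) \<le> C / (1 + x\<^sup>2)"
  shows "L2 u"
  unfolding L2_def
proof
  show "integrable lborel (\<lambda>x. (cmod (u x))\<^sup>2)"
  proof (rule integrable_inverse_decay)
    fix x
    have "(cmod (u x))\<^sup>2 \<le> (C / (1 + x\<^sup>2))\<^sup>2" using assms(2) by (intro power_mono) auto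
    also have "\<dots> \<le> C\<^sup>2 / (1 + x\<^sup>2)"
    proof -
      have "1 * (1 + x\<^sup>2) \<le> (1 + x\<^sup>2) * (1 + x\<^sup>2)" by (intro mult_right_mono) auto
      then have "1 + x\<^sup>2 \<le> (1 + x\<^sup>2)\<^sup>2" by (simp add: power2_eq_square)
      then show ?thesis unfolding power_divide
        by (intro divide_left_mono) (auto intro!: add_pos_nonneg mult_pos_pos zero_less_power)
    qed
    finally show "norm ((cmod (u x))\<^sup>2) \<le> C\<^sup>2 / (1 + x\<^sup>2)" by simp
  qed (use assms in measurable)
qed (use assms in simp)

lemma L2_poly_gauss:
  assumes "Re A < 0" shows "L2 (poly_gauss P A B)"
proof -
  obtain C where "\<And>x. cmod (poly_gauss P A B x) \<le> C / (1 + x\<^sup>2)" using poly_gauss_decay[OF assms] by blast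
  then show ?thesis by (intro L2_bound_decay) auto
qed

subsection \<open>Orthonormal families\<close>

lemma L2_integrable_mult:
  assumes "L2 u" "L2 v"
  shows "integrable lborel (\<lambda>x. u x * cnj (v x))"
proof (rule Bochner_Integration.integrable_bound)
  show "integrable lborel (\<lambda>x. (cmod (u x))\<^sup>2 + (cmod (v x))\<^sup>2)"
    using assms by (auto simp: L2_def)
  have [measurable]: "u \<in> borel_measurable borel" "v \<in> borel_measurable borel" using assms by (auto simp: L2_def)
  have "(\<lambda>x. cnj (v x)) \<in> borel_measurable borel"
    by (rule borel_measurable_continuous_on[OF continuous_on_cnj[OF continuous_on_id]]) measurable
  then show "(\<lambda>x. u x * cnj (v x)) \<in> borel_measurable lborel" by simp
  show "AE x in lborel. norm (u x * cnj (v x)) \<le> norm ((cmod (u x))\<^sup>2 + (cmod (v x))\<^sup>2)"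
  proof (intro AE_I2)
    fix x
    have "cmod (u x) * cmod (v x) * 2 \<le> (cmod (u x))\<^sup>2 + (cmod (v x))\<^sup>2"
      using sum_squares_bound[of "cmod (u x)" "cmod (v x)"] by (simp add: mult_ac)
    moreover have "0 \<le> cmod (u x) * cmod (v x)" by simp
    ultimately show "norm (u x * cnj (v x)) \<le> norm ((cmod (u x))\<^sup>2 + (cmod (v x))\<^sup>2)"
      unfolding norm_mult complex_mod_cnj real_norm_def by linarith
  qed
qed

lemma L2_cmult: "L2 u \<Longrightarrow> L2 (\<lambda>x. c * u x)"
  by (auto simp: L2_def norm_mult power_mult_distrib)

lemma L2_add:
  assumes "L2 u" "L2 v" shows "L2 (\<lambda>x. u x + v x)"
  unfolding L2_def
proof
  show "integrable lborel (\<lambda>x. (cmod (u x + v x))\<^sup>2)"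
  proof (rule Bochner_Integration.integrable_bound)
    show "integrable lborel (\<lambda>x. 2 * ((cmod (u x))\<^sup>2 + (cmod (v x))\<^sup>2))"
      using assms by (auto simp: L2_def)
    show "(\<lambda>x. (cmod (u x + v x))\<^sup>2) \<in> borel_measurable lborel" using assms by (auto simp: L2_def)
    show "AE x in lborel. norm ((cmod (u x + v x))\<^sup>2) \<le> norm (2 * ((cmod (u x))\<^sup>2 + (cmod (v x))\<^sup>2))"
      using norm_add_sq by (intro AE_I2) simp
  qed
qed (use assms in \<open>auto simp: L2_def\<close>)

lemma L2_zero [simp]: "L2 (\<lambda>x. 0)"
  by (simp add: L2_def)

lemma L2_sum: "(\<And>i. i \<in> I \<Longrightarrow> L2 (f i)) \<Longrightarrow> L2 (\<lambda>x. \<Sum>i\<in>I. f i x)"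
  by (induction I rule: infinite_finite_induct) (auto intro: L2_add)

lemma L2_diff: "L2 u \<Longrightarrow> L2 v \<Longrightarrow> L2 (\<lambda>x. u x - v x)"
  using L2_add[of u "\<lambda>x. (-1) * v x"] L2_cmult[of v "-1"] by simp

lemma pair_add_left: "L2 u \<Longrightarrow> L2 v \<Longrightarrow> L2 w \<Longrightarrow> pair (\<lambda>x. u x + v x) w = pair u w + pair v w"
  unfolding pair_def distrib_right by (intro Bochner_Integration.integral_add L2_integrable_mult)

lemma pair_diff_left: "L2 u \<Longrightarrow> L2 v \<Longrightarrow> L2 w \<Longrightarrow> pair (\<lambda>x. u x - v x) w = pair u w - pair v w"
  unfolding pair_def left_diff_distrib by (intro Bochner_Integration.integral_diff L2_integrable_mult)

lemma pair_add_right: "L2 u \<Longrightarrow> L2 v \<Longrightarrow> L2 w \<Longrightarrow> pair u (\<lambda>x. v x + w x) = pair u v + pair u w"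
  unfolding pair_def distrib_left complex_cnj_add by (intro Bochner_Integration.integral_add L2_integrable_mult)

lemma pair_diff_right: "L2 u \<Longrightarrow> L2 v \<Longrightarrow> L2 w \<Longrightarrow> pair u (\<lambda>x. v x - w x) = pair u v - pair u w"
  unfolding pair_def right_diff_distrib complex_cnj_diff by (intro Bochner_Integration.integral_diff L2_integrable_mult)

lemma pair_cmult_left: "pair (\<lambda>x. c * u x) v = c * pair u v"
  unfolding pair_def by (simp add: mult.assoc)

lemma pair_cmult_right: "pair u (\<lambda>x. c * v x) = cnj c * pair u v"
  unfolding pair_def by (simp add: mult.left_commute)

lemma pair_cnj: "cnj (pair u v) = pair v u"
proof -
  have "cnj (pair u v) = (LINT x|lborel. cnj (u x * cnj (v x)))"
    unfolding pair_def by (rule Bochner_Integration.integral_cnj[symmetric])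
  then show ?thesis by (simp add: pair_def mult.commute)
qed

lemma pair_sum_left:
  assumes "\<And>i. i \<in> I \<Longrightarrow> L2 (f i)" "L2 w"
  shows "pair (\<lambda>x. \<Sum>i\<in>I. f i x) w = (\<Sum>i\<in>I. pair (f i) w)"
  unfolding pair_def sum_distrib_right
  by (intro Bochner_Integration.integral_sum L2_integrable_mult assms)

lemma pair_self: "pair u u = complex_of_real ((L2norm u)\<^sup>2)"
proof -
  have "pair u u = (LINT x|lborel. complex_of_real ((cmod (u x))\<^sup>2))"
    unfolding pair_def by (simp add: complex_norm_square[symmetric])
  also have "\<dots> = complex_of_real (LINT x|lborel. (cmod (u x))\<^sup>2)" by (rule integral_complex_of_real)
  also have "(LINT x|lborel. (cmod (u x))\<^sup>2) = (L2norm u)\<^sup>2"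
    unfolding L2norm_def by (simp add: integral_nonneg_AE)
  finally show ?thesis .
qed

lemma L2norm_nonneg [simp]: "L2norm u \<ge> 0"
  unfolding L2norm_def by (simp add: integral_nonneg_AE)

lemma L2norm_sq: "(L2norm u)\<^sup>2 = Re (pair u u)"
  by (simp add: pair_self)

text \<open>Pythagoras with free coefficients \<open>b\<close>. Taking for \<open>b\<close> the
  coefficients of \<open>u\<close> gives Bessel's inequality and the exact remainder, and
  \<open>u = 0\<close> gives the norm of a finite combination.\<close>

lemma orthonormal_expansion:
  fixes e :: "nat \<Rightarrow> real \<Rightarrow> complex"
  assumes e: "\<And>n. L2 (e n)" and on: "\<And>n m. pair (e n) (e m) = (if n = m then 1 else 0)"
    and u: "L2 u"
  shows "(L2norm (\<lambda>x. u x - (\<Sum>m<N. b m * e m x)))\<^sup>2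
      = (L2norm u)\<^sup>2 - (\<Sum>m<N. (cmod (pair u (e m)))\<^sup>2) + (\<Sum>m<N. (cmod (pair u (e m) - b m))\<^sup>2)"
proof -
  define S where "S = (\<lambda>x. \<Sum>m<N. b m * e m x)"
  have S: "L2 S" unfolding S_def by (intro L2_sum L2_cmult e)
  have Sw: "pair S w = (\<Sum>m<N. b m * pair (e m) w)" if "L2 w" for w
    unfolding S_def by (subst pair_sum_left) (auto intro: L2_cmult e that simp: pair_cmult_left)
  have Se: "pair S (e m) = (if m < N then b m else 0)" for m
    by (simp add: Sw e on if_distrib sum.If_cases cong: if_cong)
  have SS: "pair S S = (\<Sum>m<N. b m * cnj (b m))"
  proof -
    have "pair (e m) S = cnj (pair S (e m))" for m by (simp only: pair_cnj)
    then show ?thesis using S by (simp add: Sw Se)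
  qed
  have Su: "pair S u = (\<Sum>m<N. b m * cnj (pair u (e m)))"
    using u by (simp add: Sw pair_cnj)
  have uS: "pair u S = (\<Sum>m<N. cnj (b m) * pair u (e m))"
    using arg_cong[OF Su, of cnj] by (simp add: pair_cnj)
  have "pair (\<lambda>x. u x - S x) (\<lambda>x. u x - S x) = pair u u - pair u S - (pair S u - pair S S)"
    using u S by (simp add: pair_diff_left pair_diff_right L2_diff)
  also have "\<dots> = pair u u - (\<Sum>m<N. pair u (e m) * cnj (pair u (e m)))
      + (\<Sum>m<N. (pair u (e m) - b m) * cnj (pair u (e m) - b m))"
  proof -
    have "(\<Sum>m<N. (pair u (e m) - b m) * cnj (pair u (e m) - b m)) =
      (\<Sum>m<N. pair u (e m) * cnj (pair u (e m))) - (\<Sum>m<N. cnj (b m) * pair u (e m))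
       - (\<Sum>m<N. b m * cnj (pair u (e m))) + (\<Sum>m<N. b m * cnj (b m))"
      unfolding sum.distrib[symmetric] sum_subtractf[symmetric]
      by (rule sum.cong) (simp_all add: algebra_simps)
    then show ?thesis by (simp only: SS Su uS) (simp only: algebra_simps)
  qed
  finally have "complex_of_real ((L2norm (\<lambda>x. u x - S x))\<^sup>2) = complex_of_real ((L2norm u)\<^sup>2 - (\<Sum>m<N. (cmod (pair u (e m)))\<^sup>2)
      + (\<Sum>m<N. (cmod (pair u (e m) - b m))\<^sup>2))"
    by (simp only: pair_self of_real_add of_real_diff of_real_sum complex_norm_square)
  then show ?thesis unfolding S_def using of_real_eq_iff by blast
qed

lemma bessel:
  fixes e :: "nat \<Rightarrow> real \<Rightarrow> complex"
  assumes "\<And>n. L2 (e n)" "\<And>n m. pair (e n) (e m) = (if n = m then 1 else 0)" "L2 u"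
  shows "(\<Sum>m<N. (cmod (pair u (e m)))\<^sup>2) \<le> (L2norm u)\<^sup>2"
  using orthonormal_expansion[OF assms, where b = "\<lambda>m. pair u (e m)" and N = N]
  zero_le_power2[of "L2norm (\<lambda>x. u x - (\<Sum>m<N. pair u (e m) * e m x))"] by simp

lemma L2norm_orthonormal_sum:
  fixes e :: "nat \<Rightarrow> real \<Rightarrow> complex"
  assumes "\<And>n. L2 (e n)" "\<And>n m. pair (e n) (e m) = (if n = m then 1 else 0)"
  shows "(L2norm (\<lambda>x. \<Sum>m<N. b m * e m x))\<^sup>2 = (\<Sum>m<N. (cmod (b m))\<^sup>2)"
proof -
  have z: "pair (\<lambda>x. 0) v = 0" for v by (simp add: pair_def)
  have "(L2norm (\<lambda>x. 0 - (\<Sum>m<N. b m * e m x)))\<^sup>2 = (\<Sum>m<N. (cmod (b m))\<^sup>2)"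
    by (subst orthonormal_expansion[OF assms]) (simp_all add: z L2norm_def)
  moreover have "L2norm (\<lambda>x. 0 - (\<Sum>m<N. b m * e m x)) = L2norm (\<lambda>x. \<Sum>m<N. b m * e m x)"
    by (simp add: L2norm_def)
  ultimately show ?thesis by simp
qed

text \<open>Positivity of the norm of \<open>\<epsilon> u - v\<close>, after turning
  \<open>u\<close> by a phase that makes the cross term real; the best \<open>\<epsilon>\<close> is
  the ratio of the norms. Functions are not identified almost everywhere, so a zero norm does not
  mean a zero function, and these degenerate cases need another choice of
  \<open>\<epsilon>\<close>.\<close>

lemma cauchy_schwarz_pair:
  assumes u: "L2 u" and v: "L2 v"
  shows "cmod (pair u v) \<le> L2norm u * L2norm v"
proof -
  have le: "2 * \<epsilon> * cmod (pair u v) \<le> \<epsilon>\<^sup>2 * (L2norm u)\<^sup>2 + (L2norm v)\<^sup>2" if "\<epsilon> > 0" for \<epsilon> :: real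
  proof (cases "pair u v = 0")
    case True then show ?thesis by simp
  next
    case False
    define z where "z = sgn (pair u v)"
    have z: "cnj z * pair u v = cmod (pair u v)" "z * cnj z = 1"
    proof -
      show "z * cnj z = 1" using False by (simp add: z_def norm_sgn flip: complex_norm_square)
      have "cnj z * pair u v = cnj z * (z * cmod (pair u v))" using False by (simp add: z_def sgn_eq)
      also have "\<dots> = cmod (pair u v)" using \<open>z * cnj z = 1\<close> by (simp add: mult.commute mult.left_commute)
      finally show "cnj z * pair u v = cmod (pair u v)" .
    qed
    have "pair (\<lambda>x. (\<epsilon> * cnj z) * u x - v x) (\<lambda>x. (\<epsilon> * cnj z) * u x - v x)
      = \<epsilon>\<^sup>2 * (z * cnj z) * pair u u - \<epsilon> * (cnj z * pair u v) - \<epsilon> * cnj (cnj z * pair u v) + pair v v"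
      using u v by (simp add: pair_diff_left pair_diff_right L2_diff L2_cmult pair_cmult_left pair_cmult_right pair_cnj algebra_simps power2_eq_square)
    also have "\<dots> = complex_of_real (\<epsilon>\<^sup>2 * (L2norm u)\<^sup>2 - 2 * \<epsilon> * cmod (pair u v) + (L2norm v)\<^sup>2)"
      unfolding z by (simp add: pair_self)
    finally have "complex_of_real ((L2norm (\<lambda>x. (\<epsilon> * cnj z) * u x - v x))\<^sup>2) = \<dots>"
      by (simp only: pair_self)
    then have "(L2norm (\<lambda>x. (\<epsilon> * cnj z) * u x - v x))\<^sup>2 = \<epsilon>\<^sup>2 * (L2norm u)\<^sup>2 - 2 * \<epsilon> * cmod (pair u v) + (L2norm v)\<^sup>2"
      using of_real_eq_iff by blast
    then show ?thesis using zero_le_power2[of "L2norm (\<lambda>x. (\<epsilon> * cnj z) * u x - v x)"] by linarith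
  qed
  show ?thesis
  proof (cases "L2norm u = 0")
    case True
    have "cmod (pair u v) \<le> 0"
    proof (rule ccontr)
      assume n: "\<not> cmod (pair u v) \<le> 0"
      have "((L2norm v)\<^sup>2 + 1) / (2 * cmod (pair u v)) > 0" using n by (simp add: add_nonneg_pos)
      from le[OF this] show False using True n by simp
    qed
    then show ?thesis using True by simp
  next
    case False
    then have pu: "L2norm u > 0" using L2norm_nonneg[of u] by linarith
    show ?thesis
    proof (cases "L2norm v = 0")
      case True
      have "cmod (pair u v) \<le> 0"
      proof (rule ccontr)
        assume n: "\<not> cmod (pair u v) \<le> 0"
        show False
          using le[of "cmod (pair u v) / (L2norm u)\<^sup>2"] True n pu by (simp add: power2_eq_square field_simps)
      qed
      then show ?thesis using True by simp
    next
      case False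
      then have pv: "L2norm v > 0" using L2norm_nonneg[of v] by linarith
      show ?thesis using le[of "L2norm v / L2norm u"] pu pv by (simp add: power2_eq_square field_simps)
    qed
  qed
qed

subsection \<open>Hermite functions\<close>

text \<open>The product of one function with the conjugate of the other lies in the same class, with
  exponent \<open>A + cnj A'\<close>, so its derivative integrates to zero. That derivative is
  identified by uniqueness of derivatives, which avoids computing with the polynomials.\<close>

lemma pair_by_parts:
  assumes A: "Re A < 0" "Re A' < 0"
  shows "pair (poly_gauss (gauss_deriv A B P) A B) (poly_gauss Q A' B')
    = - pair (poly_gauss P A B) (poly_gauss (gauss_deriv A' B' Q) A' B')"
proof -
  define R where "R = P * map_poly cnj Q"
  let ?f = "poly_gauss P A B" and ?g = "poly_gauss Q A' B'"
  let ?f' = "poly_gauss (gauss_deriv A B P) A B" and ?g' = "poly_gauss (gauss_deriv A' B' Q) A' B'"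
  have eq: "?f x * cnj (?g x) = poly_gauss R (A + cnj A') (B + cnj B') x" for x
    by (simp add: cnj_poly_gauss poly_gauss_mult R_def)
  have "?f' x * cnj (?g x) + ?f x * cnj (?g' x) = poly_gauss (gauss_deriv (A + cnj A') (B + cnj B') R) (A + cnj A') (B + cnj B') x" for x
  proof (rule vector_derivative_unique_at)
    have "((\<lambda>x. cnj (?g x)) has_vector_derivative cnj (?g' x)) (at x)"
      by (rule bounded_linear.has_vector_derivative[OF bounded_linear_cnj poly_gauss_has_vector_derivative])
    from has_vector_derivative_mult[OF poly_gauss_has_vector_derivative this]
    show "((\<lambda>x. ?f x * cnj (?g x)) has_vector_derivative ?f' x * cnj (?g x) + ?f x * cnj (?g' x)) (at x)"
      by (simp add: add.commute)
    show "((\<lambda>x. ?f x * cnj (?g x)) has_vector_derivative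
       poly_gauss (gauss_deriv (A + cnj A') (B + cnj B') R) (A + cnj A') (B + cnj B') x) (at x)"
      unfolding eq by (rule poly_gauss_has_vector_derivative)
  qed
  then have "(LINT x|lborel. ?f' x * cnj (?g x) + ?f x * cnj (?g' x)) = 0"
    using integral_gauss_deriv[of "A + cnj A'" "B + cnj B'" R] A by simp
  moreover have "(LINT x|lborel. ?f' x * cnj (?g x) + ?f x * cnj (?g' x)) = pair ?f' ?g + pair ?f ?g'"
    unfolding pair_def using A by (intro Bochner_Integration.integral_add L2_integrable_mult L2_poly_gauss)
  ultimately show ?thesis by (simp add: eq_neg_iff_add_eq_0)
qed

text \<open>At \<open>n = 0\<close> the term with index \<open>n - 1 = 0\<close> is killed by its
  factor \<open>n\<close>. The same convention lets the ladder relations below hold without a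
  separate case for the ground state.\<close>

lemma hermite_poly_Suc:
  "hermite_poly (Suc n) x = 2 * x * hermite_poly n x - 2 * real n * hermite_poly (n - 1) x"
  by (cases n) auto

lemma hermite_poly_has_derivative:
  "(hermite_poly n has_real_derivative 2 * real n * hermite_poly (n - 1) x) (at x within S)"
proof (induction n rule: less_induct)
  case (less n)
  show ?case
  proof (cases n)
    case 0
    have "hermite_poly 0 = (\<lambda>x. 1)" by auto
    then show ?thesis using 0 by simp
  next
    case (Suc k)
    have "hermite_poly n = (\<lambda>x. 2 * x * hermite_poly k x - 2 * real k * hermite_poly (k - 1) x)"
      unfolding Suc using hermite_poly_Suc[of k] by (intro ext)
    moreover have "((\<lambda>x. 2 * x * hermite_poly k x - 2 * real k * hermite_poly (k - 1) x) has_real_derivative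
      2 * hermite_poly k x + 2 * x * (2 * real k * hermite_poly (k - 1) x)
        - 2 * real k * (2 * real (k - 1) * hermite_poly (k - 1 - 1) x)) (at x within S)"
      by (rule derivative_eq_intros less.IH refl | simp add: Suc)+
    moreover have "2 * hermite_poly k x + 2 * x * (2 * real k * hermite_poly (k - 1) x)
        - 2 * real k * (2 * real (k - 1) * hermite_poly (k - 1 - 1) x) = 2 * real n * hermite_poly (n - 1) x"
    proof (cases k)
      case 0 then show ?thesis by (simp add: Suc)
    next
      case (Suc j)
      have "2 * hermite_poly k x + 2 * x * (2 * real k * hermite_poly (k - 1) x)
        - 2 * real k * (2 * real (k - 1) * hermite_poly (k - 1 - 1) x)
        = 2 * hermite_poly k x + 2 * real k * (2 * x * hermite_poly j x - 2 * real j * hermite_poly (j - 1) x)"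
        by (simp add: Suc algebra_simps)
      also have "\<dots> = 2 * hermite_poly k x + 2 * real k * hermite_poly k x"
        using hermite_poly_Suc[of j x] Suc by simp
      finally show ?thesis by (simp add: \<open>n = Suc k\<close> algebra_simps)
    qed
    ultimately show ?thesis by simp
  qed
qed

definition hermite_scale :: "nat \<Rightarrow> real" where
  "hermite_scale n = sqrt (2 ^ n * fact n * sqrt pi)"

lemma hermite_scale_pos: "hermite_scale n > 0"
  unfolding hermite_scale_def by simp

lemma hermite_scale_Suc: "hermite_scale (Suc n) = 2 * sqrt (Suc n / 2) * hermite_scale n"
proof -
  have "2 * sqrt (Suc n / 2) = sqrt (2 * real (Suc n))"
    by (rule real_sqrt_unique[symmetric]) (auto simp: power_mult_distrib)
  moreover have "hermite_scale (Suc n) = sqrt (2 * real (Suc n)) * hermite_scale n"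
    unfolding hermite_scale_def real_sqrt_mult[symmetric] by (simp add: mult_ac)
  ultimately show ?thesis by simp
qed

lemma hermite_fun_eq: "hermite_fun n x = hermite_poly n x * exp (- (x\<^sup>2) / 2) / hermite_scale n"
  by (simp add: hermite_fun_def hermite_scale_def)

lemma hermite_scale_pred: "real n * hermite_poly (n - 1) x / hermite_scale n
    = sqrt (n / 2) * (hermite_poly (n - 1) x / hermite_scale (n - 1))"
proof (cases n)
  case (Suc k)
  have "sqrt (Suc k / 2) * sqrt (Suc k / 2) = Suc k / 2" by simp
  then show ?thesis using hermite_scale_pos[of k] unfolding Suc diff_Suc_1 hermite_scale_Suc
    by (simp add: divide_simps) (simp add: algebra_simps)
qed simp

lemma mult_hermite_fun:
  "x * hermite_fun n x = sqrt (n / 2) * hermite_fun (n - 1) x + sqrt (Suc n / 2) * hermite_fun (Suc n) x"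
proof -
  have s: "sqrt (Suc n / 2) / hermite_scale (Suc n) = 1 / (2 * hermite_scale n)"
    using hermite_scale_pos[of n] by (simp add: hermite_scale_Suc)
  have "sqrt (Suc n / 2) * hermite_fun (Suc n) x = (sqrt (Suc n / 2) / hermite_scale (Suc n)) * hermite_poly (Suc n) x * exp (- (x\<^sup>2) / 2)"
    by (simp add: hermite_fun_eq)
  also have "\<dots> = (x * hermite_poly n x / hermite_scale n - real n * hermite_poly (n - 1) x / hermite_scale n) * exp (- (x\<^sup>2) / 2)"
    unfolding s hermite_poly_Suc by (simp add: diff_divide_distrib algebra_simps)
  finally show ?thesis
    unfolding hermite_scale_pred by (simp add: hermite_fun_eq algebra_simps)
qed

lemma hermite_fun_has_derivative:
  "(hermite_fun n has_real_derivative
     sqrt (n / 2) * hermite_fun (n - 1) x - sqrt (Suc n / 2) * hermite_fun (Suc n) x) (at x within S)"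
proof -
  have "((\<lambda>x. hermite_poly n x * exp (- (x\<^sup>2) / 2) / hermite_scale n) has_real_derivative
     (2 * real n * hermite_poly (n - 1) x * exp (- (x\<^sup>2) / 2) + exp (- (x\<^sup>2) / 2) * (- x) * hermite_poly n x) / hermite_scale n) (at x within S)"
  proof (rule DERIV_cdivide)
    have "((\<lambda>x. exp (- (x\<^sup>2) / 2)) has_real_derivative exp (- (x\<^sup>2) / 2) * (- x)) (at x within S)"
      by (auto intro!: derivative_eq_intros)
    from DERIV_mult[OF hermite_poly_has_derivative[of n x S] this]
    show "((\<lambda>x. hermite_poly n x * exp (- (x\<^sup>2) / 2)) has_real_derivative
     (2 * real n * hermite_poly (n - 1) x * exp (- (x\<^sup>2) / 2) + exp (- (x\<^sup>2) / 2) * (- x) * hermite_poly n x)) (at x within S)" .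
  qed
  moreover have "hermite_fun n = (\<lambda>x. hermite_poly n x * exp (- (x\<^sup>2) / 2) / hermite_scale n)"
    by (rule ext) (rule hermite_fun_eq)
  moreover have "(2 * real n * hermite_poly (n - 1) x * exp (- (x\<^sup>2) / 2) + exp (- (x\<^sup>2) / 2) * (- x) * hermite_poly n x) / hermite_scale n
     = 2 * (real n * hermite_poly (n - 1) x / hermite_scale n) * exp (- (x\<^sup>2) / 2) - x * hermite_fun n x"
    by (simp add: hermite_fun_eq add_divide_distrib diff_divide_distrib algebra_simps)
  moreover have "\<dots> = sqrt (n / 2) * hermite_fun (n - 1) x - sqrt (Suc n / 2) * hermite_fun (Suc n) x"
    unfolding hermite_scale_pred mult_hermite_fun by (simp add: hermite_fun_eq algebra_simps)
  ultimately show ?thesis by simp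
qed

definition hermite_c :: "nat \<Rightarrow> real \<Rightarrow> complex" where
  "hermite_c n x = complex_of_real (hermite_fun n x)"

fun hermite_cpoly :: "nat \<Rightarrow> complex poly" where
  "hermite_cpoly 0 = 1"
| "hermite_cpoly (Suc 0) = [:0, 2:]"
| "hermite_cpoly (Suc (Suc n)) = [:0, 2:] * hermite_cpoly (Suc n) - smult (2 * of_nat (Suc n)) (hermite_cpoly n)"

lemma poly_hermite_cpoly: "poly (hermite_cpoly n) (complex_of_real x) = complex_of_real (hermite_poly n x)"
  by (induction n rule: hermite_cpoly.induct) simp_all

lemma hermite_c_poly_gauss:
  "hermite_c n = poly_gauss (smult (1 / complex_of_real (hermite_scale n)) (hermite_cpoly n)) (- 1/2) 0"
  by (rule ext) (simp add: hermite_c_def hermite_fun_eq poly_gauss_def poly_hermite_cpoly exp_of_real[symmetric])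

lemma L2_hermite_c: "L2 (hermite_c n)"
  unfolding hermite_c_poly_gauss by (rule L2_poly_gauss) simp

lemma mult_hermite_c:
  "complex_of_real x * hermite_c n x = sqrt (n / 2) * hermite_c (n - 1) x + sqrt (Suc n / 2) * hermite_c (Suc n) x"
  using arg_cong[OF mult_hermite_fun[of x n], of complex_of_real] by (simp add: hermite_c_def)

lemma hermite_c_has_vector_derivative:
  "(hermite_c n has_vector_derivative (sqrt (n / 2) * hermite_c (n - 1) x - sqrt (Suc n / 2) * hermite_c (Suc n) x)) (at x within S)"
proof -
  have "hermite_c n = (\<lambda>x. complex_of_real (hermite_fun n x))" by (rule ext) (simp add: hermite_c_def)
  then show ?thesis
    using has_vector_derivative_of_real[OF hermite_fun_has_derivative[of n x S], where 'a = complex]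
    by (simp add: hermite_c_def)
qed

lemma gauss_deriv_hermite_c:
  "poly_gauss (gauss_deriv (- 1/2) 0 (smult (1 / complex_of_real (hermite_scale n)) (hermite_cpoly n))) (- 1/2) 0
   = (\<lambda>x. sqrt (n / 2) * hermite_c (n - 1) x - sqrt (Suc n / 2) * hermite_c (Suc n) x)"
proof
  fix x
  show "poly_gauss (gauss_deriv (- 1/2) 0 (smult (1 / complex_of_real (hermite_scale n)) (hermite_cpoly n))) (- 1/2) 0 x
   = sqrt (n / 2) * hermite_c (n - 1) x - sqrt (Suc n / 2) * hermite_c (Suc n) x"
    by (rule vector_derivative_unique_at[OF poly_gauss_has_vector_derivative])
       (use hermite_c_has_vector_derivative[of n x UNIV] in \<open>simp add: hermite_c_poly_gauss\<close>)
qed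

text \<open>The square of the ground state is the normal density of variance 1/2, so its
  normalisation is inherited.\<close>

lemma pair_hermite_c_0: "pair (hermite_c 0) (hermite_c 0) = 1"
proof -
  have "pair (hermite_c 0) (hermite_c 0) = (LINT x|lborel. complex_of_real (normal_density 0 (1 / sqrt 2) x))"
    unfolding pair_def
  proof (rule Bochner_Integration.integral_cong)
    fix x
    have "hermite_fun 0 x * hermite_fun 0 x = normal_density 0 (1 / sqrt 2) x"
      by (simp add: hermite_fun_def normal_density_def power_divide exp_add[symmetric] real_sqrt_mult[symmetric])
    then show "hermite_c 0 x * cnj (hermite_c 0 x) = complex_of_real (normal_density 0 (1 / sqrt 2) x)"
      by (simp add: hermite_c_def flip: of_real_mult)
  qed simp
  also have "\<dots> = complex_of_real (LINT x|lborel. normal_density 0 (1 / sqrt 2) x)" by (rule integral_complex_of_real)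
  also have "(LINT x|lborel. normal_density 0 (1 / sqrt 2) x) = 1" by (rule integral_normal_density) simp
  finally show ?thesis by simp
qed

lemma pair_mult_real:
  "pair (\<lambda>x. complex_of_real x * u x) v = pair u (\<lambda>x. complex_of_real x * v x)"
  unfolding pair_def by (simp add: mult_ac)

text \<open>Position is symmetric and differentiation antisymmetric for \<open>pair\<close>. The sum
  of the two relations keeps only the lowering operator on one side and the raising operator on the
  other.\<close>

lemma pair_hermite_c_ladder:
  "sqrt (n / 2) * pair (hermite_c (n - 1)) (hermite_c m) = sqrt (Suc m / 2) * pair (hermite_c n) (hermite_c (Suc m))"
proof -
  have x: "sqrt (n / 2) * pair (hermite_c (n - 1)) (hermite_c m) + sqrt (Suc n / 2) * pair (hermite_c (Suc n)) (hermite_c m)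
     = sqrt (m / 2) * pair (hermite_c n) (hermite_c (m - 1)) + sqrt (Suc m / 2) * pair (hermite_c n) (hermite_c (Suc m))"
    using pair_mult_real[of "hermite_c n" "hermite_c m"] unfolding mult_hermite_c
    by (simp add: pair_add_left pair_add_right L2_cmult L2_hermite_c pair_cmult_left pair_cmult_right)
  have d: "sqrt (n / 2) * pair (hermite_c (n - 1)) (hermite_c m) - sqrt (Suc n / 2) * pair (hermite_c (Suc n)) (hermite_c m)
     = - (sqrt (m / 2) * pair (hermite_c n) (hermite_c (m - 1)) - sqrt (Suc m / 2) * pair (hermite_c n) (hermite_c (Suc m)))"
    using pair_by_parts[of "-1/2" "-1/2" 0 "smult (1 / complex_of_real (hermite_scale n)) (hermite_cpoly n)"
      "smult (1 / complex_of_real (hermite_scale m)) (hermite_cpoly m)" 0]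
    unfolding gauss_deriv_hermite_c hermite_c_poly_gauss[symmetric]
    by (simp add: pair_diff_left pair_diff_right L2_cmult L2_hermite_c pair_cmult_left pair_cmult_right)
  show ?thesis using x d by (simp add: complex_eq_iff)
qed

text \<open>The ladder relation lowers both indices together, so every pairing reduces to one that
  involves the ground state.\<close>

lemma pair_hermite_c: "pair (hermite_c n) (hermite_c m) = (if n = m then 1 else 0)"
proof (induction m arbitrary: n)
  case 0
  show ?case
  proof (cases n)
    case (Suc k)
    have "sqrt (Suc k / 2) * pair (hermite_c 0) (hermite_c (Suc k)) = 0"
      using pair_hermite_c_ladder[of 0 k] by simp
    then have "pair (hermite_c 0) (hermite_c (Suc k)) = 0" by simp
    then have "cnj (pair (hermite_c (Suc k)) (hermite_c 0)) = 0" by (simp add: pair_cnj)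
    then show ?thesis using Suc by simp
  qed (simp add: pair_hermite_c_0)
next
  case (Suc m)
  show ?case
  proof (cases n)
    case 0
    then show ?thesis using pair_hermite_c_ladder[of 0 m] by simp
  next
    case (Suc k)
    have "complex_of_real (sqrt (Suc k / 2)) * pair (hermite_c k) (hermite_c m) = sqrt (Suc m / 2) * pair (hermite_c (Suc k)) (hermite_c (Suc m))"
      using pair_hermite_c_ladder[of "Suc k" m] by simp
    moreover have "complex_of_real (sqrt (Suc m / 2)) \<noteq> 0" by simp
    ultimately show ?thesis using Suc.IH[of k] Suc by (auto simp del: of_nat_Suc)
  qed
qed

subsection \<open>Completeness of the Hermite functions\<close>

text \<open>Characteristic functions determine probability measures. The positive and the negative
  part of \<open>F\<close> have the same mass, by the transform at 0, and after normalisation the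
  same characteristic function, hence the same density almost everywhere. Mass 0 is separate because
  it cannot be normalised.\<close>

lemma fourier_transform_eq_0_imp_AE_0:
  fixes F :: "real \<Rightarrow> real"
  assumes F: "integrable lborel F"
    and ft: "\<And>\<xi>. (LINT x|lborel. complex_of_real (F x) * iexp (\<xi> * x)) = 0"
  shows "AE x in lborel. F x = 0"
proof -
  define P where "P = (\<lambda>x. max (F x) 0)"
  define N where "N = (\<lambda>x. max (- F x) 0)"
  have FPN: "F x = P x - N x" for x by (auto simp: P_def N_def max_def)
  have PN0: "P x \<ge> 0" "N x \<ge> 0" for x by (auto simp: P_def N_def)
  have iP: "integrable lborel P" and iN: "integrable lborel N"
    unfolding P_def N_def using F by auto
  have [measurable]: "P \<in> borel_measurable borel" "N \<in> borel_measurable borel"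
    using iP iN by auto
  have ii: "integrable lborel (\<lambda>x. complex_of_real (G x) * iexp (\<xi> * x))" if "integrable lborel G" for G :: "real \<Rightarrow> real" and \<xi>
  proof (rule Bochner_Integration.integrable_bound[OF that])
    have [measurable]: "G \<in> borel_measurable borel" using that by auto
    show "(\<lambda>x. complex_of_real (G x) * iexp (\<xi> * x)) \<in> borel_measurable lborel"
      by (auto intro!: borel_measurable_times borel_measurable_continuous_onI continuous_intros)
  qed (auto simp: norm_mult)
  have eq: "(LINT x|lborel. complex_of_real (P x) * iexp (\<xi> * x)) = (LINT x|lborel. complex_of_real (N x) * iexp (\<xi> * x))" for \<xi>
  proof -
    have "(LINT x|lborel. complex_of_real (F x) * iexp (\<xi> * x))
      = (LINT x|lborel. complex_of_real (P x) * iexp (\<xi> * x) - complex_of_real (N x) * iexp (\<xi> * x))"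
      by (intro Bochner_Integration.integral_cong) (auto simp: FPN algebra_simps)
    also have "\<dots> = (LINT x|lborel. complex_of_real (P x) * iexp (\<xi> * x)) - (LINT x|lborel. complex_of_real (N x) * iexp (\<xi> * x))"
      by (intro Bochner_Integration.integral_diff ii iP iN)
    finally show ?thesis using ft by simp
  qed
  define c where "c = (LINT x|lborel. P x)"
  have cN: "c = (LINT x|lborel. N x)"
    using eq[of 0] unfolding c_def by (simp del: Bochner_Integration.integral_of_real add: integral_complex_of_real)
  have c0: "c \<ge> 0" unfolding c_def by (intro integral_nonneg_AE) (simp add: PN0)
  show ?thesis
  proof (cases "c = 0")
    case True
    have "AE x in lborel. P x = 0" using integral_nonneg_eq_0_iff_AE[OF iP] PN0 True c_def by auto
    moreover have "AE x in lborel. N x = 0" using integral_nonneg_eq_0_iff_AE[OF iN] PN0 True cN by auto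
    ultimately show ?thesis by eventually_elim (simp add: FPN)
  next
    case False
    then have cp: "c > 0" using c0 by simp
    define D where "D = (\<lambda>G. density (lborel :: real measure) (\<lambda>x. ennreal (G x / c)))"
    have rd: "real_distribution (D G)" if G: "integrable lborel G" "\<And>x. G x \<ge> 0" "(LINT x|lborel. G x) = c" for G
    proof -
      have [measurable]: "G \<in> borel_measurable borel" using G by auto
      have "emeasure (D G) (space (D G)) = (\<integral>\<^sup>+x. ennreal (G x / c) \<partial>lborel)"
        by (simp add: D_def emeasure_density)
      also have "\<dots> = ennreal (LINT x|lborel. G x / c)"
        by (rule nn_integral_eq_integral) (use G cp in auto)
      also have "\<dots> = 1" using G cp by simp
      finally have "prob_space (D G)" by (rule prob_spaceI)
      then show ?thesis by (simp add: real_distribution_def real_distribution_axioms_def D_def)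
    qed
    have ch: "char (D G) \<xi> = (LINT x|lborel. complex_of_real (G x) * iexp (\<xi> * x)) / c" if G: "integrable lborel G" "\<And>x. G x \<ge> 0" for G \<xi>
    proof -
      have [measurable]: "G \<in> borel_measurable borel" using G by auto
      have "char (D G) \<xi> = (LINT x|lborel. (G x / c) *\<^sub>R iexp (\<xi> * x))"
        unfolding char_def D_def
        by (rule integral_density) (use G cp in \<open>auto intro!: borel_measurable_continuous_onI continuous_intros\<close>)
      also have "\<dots> = (LINT x|lborel. (complex_of_real (G x) * iexp (\<xi> * x)) / c)"
        by (intro Bochner_Integration.integral_cong) (auto simp: scaleR_conv_of_real)
      also have "\<dots> = (LINT x|lborel. complex_of_real (G x) * iexp (\<xi> * x)) / c" by simp
      finally show ?thesis .
    qed
    have "D P = D N"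
    proof (rule Levy_uniqueness)
      show "char (D P) = char (D N)"
        using ch[OF iP PN0(1)] ch[OF iN PN0(2)] eq by (intro ext) simp
    qed (use rd[OF iP PN0(1)] rd[OF iN PN0(2)] c_def cN in auto)
    then have "AE x in lborel. ennreal (P x / c) = ennreal (N x / c)"
      unfolding D_def by (intro sigma_finite_measure.density_unique[OF sigma_finite_lborel]) auto
    then show ?thesis
    proof eventually_elim
      case (elim x)
      then have "P x = N x" using PN0[of x] cp by (simp add: ennreal_inj)
      then show ?case by (simp add: FPN)
    qed
  qed
qed

lemma L2_power_hermite_c: "L2 (\<lambda>x. complex_of_real x ^ n * hermite_c m x)"
proof -
  have "(\<lambda>x. complex_of_real x ^ n * hermite_c m x)
      = poly_gauss ([:0, 1:] ^ n * smult (1 / complex_of_real (hermite_scale m)) (hermite_cpoly m)) (- 1/2) 0"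
    by (rule ext) (simp add: hermite_c_poly_gauss poly_gauss_def poly_power)
  then show ?thesis by (simp add: L2_poly_gauss)
qed

text \<open>Orthogonality to all Hermite functions makes every moment of \<open>w\<close> times a
  Gaussian vanish, so the exponential series shows that the Fourier transform of this product is
  zero. The Gaussian is strictly positive, hence \<open>w\<close> itself is null.\<close>

lemma hermite_complete:
  assumes w: "L2 w" and orth: "\<And>n. pair w (hermite_c n) = 0"
  shows "AE x in lborel. w x = 0"
proof -
  define g where "g = (\<lambda>x::real. exp (- (x\<^sup>2) / 2))"
  have [measurable]: "w \<in> borel_measurable borel" "g \<in> borel_measurable borel"
    using w by (auto simp: L2_def g_def)
  have mom0: "pair w (\<lambda>x. complex_of_real x ^ n * hermite_c m x) = 0" for n m
  proof (induction n arbitrary: m)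
    case (Suc n)
    have "(\<lambda>x. complex_of_real x ^ Suc n * hermite_c m x) =
      (\<lambda>x. complex_of_real (sqrt (m / 2)) * (complex_of_real x ^ n * hermite_c (m - 1) x)
         + complex_of_real (sqrt (Suc m / 2)) * (complex_of_real x ^ n * hermite_c (Suc m) x))"
    proof
      fix x
      have "complex_of_real x ^ Suc n * hermite_c m x = complex_of_real x ^ n * (complex_of_real x * hermite_c m x)" by simp
      then show "complex_of_real x ^ Suc n * hermite_c m x = complex_of_real (sqrt (m / 2)) * (complex_of_real x ^ n * hermite_c (m - 1) x)
         + complex_of_real (sqrt (Suc m / 2)) * (complex_of_real x ^ n * hermite_c (Suc m) x)"
        unfolding mult_hermite_c by (simp only: algebra_simps)
    qed
    then show ?case
      by (simp only:) (simp add: pair_add_right w L2_cmult L2_power_hermite_c pair_cmult_right Suc.IH)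
  qed (use orth in simp)
  have gh: "hermite_c 0 x = complex_of_real (g x / hermite_scale 0)" for x
    by (simp add: hermite_c_def hermite_fun_eq g_def)
  have mom: "(LINT x|lborel. w x * (complex_of_real (g x) * complex_of_real x ^ n)) = 0" for n
  proof -
    have "pair w (\<lambda>x. complex_of_real x ^ n * hermite_c 0 x) =
      (LINT x|lborel. w x * (complex_of_real (g x) * complex_of_real x ^ n) / hermite_scale 0)"
      unfolding pair_def gh by (intro Bochner_Integration.integral_cong) auto
    also have "\<dots> = (LINT x|lborel. w x * (complex_of_real (g x) * complex_of_real x ^ n)) / hermite_scale 0"
      by simp
    finally show ?thesis using mom0[of n 0] hermite_scale_pos[of 0] by simp
  qed
  have imom: "integrable lborel (\<lambda>x. w x * (complex_of_real (g x) * complex_of_real x ^ n))" for n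
  proof -
    have "integrable lborel (\<lambda>x. hermite_scale 0 * (w x * cnj (complex_of_real x ^ n * hermite_c 0 x)))"
      by (intro integrable_mult_right L2_integrable_mult w L2_power_hermite_c)
    moreover have "hermite_scale 0 * (w x * cnj (complex_of_real x ^ n * hermite_c 0 x)) = w x * (complex_of_real (g x) * complex_of_real x ^ n)" for x
      using hermite_scale_pos[of 0] by (simp add: gh)
    ultimately show ?thesis by (simp only:)
  qed
  have ft: "(LINT x|lborel. (w x * complex_of_real (g x)) * iexp (\<xi> * x)) = 0" for \<xi>
  proof -
    \<comment> \<open>Partial sums of the exponential series are dominated by \<open>|w|\<close>
      times a Gaussian times \<open>exp |\<xi> x|\<close>. This is at most the sum of the moduli of
      two products of \<open>w\<close> with shifted Gaussians, integrable as products of square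
      integrable functions.\<close>
    define e1 where "e1 = poly_gauss 1 (- 1/2) (complex_of_real \<xi>)"
    define e2 where "e2 = poly_gauss 1 (- 1/2) (complex_of_real (- \<xi>))"
    define S where "S = (\<lambda>N x. \<Sum>n<N. (\<i> * \<xi>) ^ n / fact n * (w x * (complex_of_real (g x) * complex_of_real x ^ n)))"
    have "(\<lambda>N. LINT x|lborel. S N x) \<longlonglongrightarrow> (LINT x|lborel. (w x * complex_of_real (g x)) * iexp (\<xi> * x))"
    proof (rule integral_dominated_convergence)
      show "integrable lborel (\<lambda>x. norm (w x * cnj (e1 x)) + norm (w x * cnj (e2 x)))"
        unfolding e1_def e2_def by (intro Bochner_Integration.integrable_add integrable_norm L2_integrable_mult w L2_poly_gauss) auto
      show "(\<lambda>x. w x * complex_of_real (g x) * iexp (\<xi> * x)) \<in> borel_measurable lborel"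
        by (auto intro!: borel_measurable_times borel_measurable_continuous_onI continuous_intros)
      show "\<And>i. S i \<in> borel_measurable lborel" unfolding S_def by measurable
      show "AE x in lborel. (\<lambda>i. S i x) \<longlonglongrightarrow> w x * complex_of_real (g x) * iexp (\<xi> * x)"
      proof (intro AE_I2)
        fix x
        have "(\<lambda>n. w x * complex_of_real (g x) * ((\<i> * (\<xi> * x)) ^ n /\<^sub>R fact n)) sums (w x * complex_of_real (g x) * iexp (\<xi> * x))"
          by (intro sums_mult exp_converges)
        moreover have "(\<lambda>n. w x * complex_of_real (g x) * ((\<i> * (\<xi> * x)) ^ n /\<^sub>R fact n)) = (\<lambda>n. (\<i> * \<xi>) ^ n / fact n * (w x * (complex_of_real (g x) * complex_of_real x ^ n)))"
          by (rule ext) (simp add: scaleR_conv_of_real power_mult_distrib divide_inverse mult_ac)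
        ultimately show "(\<lambda>i. S i x) \<longlonglongrightarrow> w x * complex_of_real (g x) * iexp (\<xi> * x)"
          unfolding S_def sums_def by (simp only:)
      qed
      fix N
      show "AE x in lborel. norm (S N x) \<le> norm (w x * cnj (e1 x)) + norm (w x * cnj (e2 x))"
      proof (intro AE_I2)
        fix x
        have "norm (S N x) \<le> (\<Sum>n<N. norm ((\<i> * \<xi>) ^ n / fact n * (w x * (complex_of_real (g x) * complex_of_real x ^ n))))"
          unfolding S_def by (rule norm_sum)
        also have "\<dots> = (\<Sum>n<N. cmod (w x) * g x * (\<bar>\<xi> * x\<bar> ^ n / fact n))"
          by (rule sum.cong) (simp_all add: norm_mult norm_divide norm_power g_def power_mult_distrib abs_mult)
        also have "\<dots> = cmod (w x) * g x * (\<Sum>n<N. \<bar>\<xi> * x\<bar> ^ n / fact n)" by (simp only: sum_distrib_left)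
        also have "\<dots> \<le> cmod (w x) * g x * exp \<bar>\<xi> * x\<bar>"
        proof (intro mult_left_mono)
          have "(\<Sum>n<N. \<bar>\<xi> * x\<bar> ^ n / fact n) \<le> (\<Sum>n. \<bar>\<xi> * x\<bar> ^ n / fact n)"
            using summable_exp[of "\<bar>\<xi> * x\<bar>"] by (intro sum_le_suminf) (auto simp: field_simps)
          then show "(\<Sum>n<N. \<bar>\<xi> * x\<bar> ^ n / fact n) \<le> exp \<bar>\<xi> * x\<bar>"
            by (simp add: exp_def field_simps scaleR_conv_of_real)
        qed (simp add: g_def)
        also have "\<dots> \<le> cmod (w x) * g x * (exp (\<xi> * x) + exp (- (\<xi> * x)))"
          by (intro mult_left_mono) (auto simp: g_def abs_if)
        also have "\<dots> = norm (w x * cnj (e1 x)) + norm (w x * cnj (e2 x))"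
        proof -
          have "cmod (e1 x) = g x * exp (\<xi> * x)" "cmod (e2 x) = g x * exp (- (\<xi> * x))"
            by (simp_all add: e1_def e2_def poly_gauss_def g_def power2_eq_square exp_add[symmetric] exp_diff[symmetric] algebra_simps)
          then show ?thesis by (simp add: norm_mult algebra_simps)
        qed
        finally show "norm (S N x) \<le> norm (w x * cnj (e1 x)) + norm (w x * cnj (e2 x))" .
      qed
    qed
    moreover have "(LINT x|lborel. S N x) = 0" for N
      unfolding S_def by (subst Bochner_Integration.integral_sum) (auto intro!: integrable_mult_right imom simp: mom)
    ultimately show ?thesis by (simp add: LIMSEQ_const_iff)
  qed
  define G where "G = (\<lambda>x. w x * complex_of_real (g x))"
  have iG: "integrable lborel G" using imom[of 0] by (simp add: G_def)
  have iGe: "integrable lborel (\<lambda>x. G x * iexp (\<xi> * x))" for \<xi>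
  proof (rule Bochner_Integration.integrable_bound[OF iG])
    show "(\<lambda>x. G x * iexp (\<xi> * x)) \<in> borel_measurable lborel"
      unfolding G_def by (auto intro!: borel_measurable_times borel_measurable_continuous_onI continuous_intros)
  qed (auto simp: norm_mult)
  \<comment> \<open>The uniqueness lemma is for real functions; the transform of the conjugate is
    needed to separate real and imaginary part.\<close>
  have ft2: "(LINT x|lborel. cnj (G x) * iexp (\<xi> * x)) = 0" for \<xi>
  proof -
    have "(LINT x|lborel. cnj (G x) * iexp (\<xi> * x)) = (LINT x|lborel. cnj (G x * iexp (- \<xi> * x)))"
      by (intro Bochner_Integration.integral_cong) (auto simp: exp_cnj)
    also have "\<dots> = cnj (LINT x|lborel. G x * iexp (- \<xi> * x))" by (rule Bochner_Integration.integral_cnj)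
    finally show ?thesis using ft[of "- \<xi>"] by (simp add: G_def)
  qed
  have ft1: "(LINT x|lborel. G x * iexp (\<xi> * x)) = 0" for \<xi>
    unfolding G_def by (rule ft)
  have iGc: "integrable lborel (\<lambda>x. cnj (G x) * iexp (\<xi> * x))" for \<xi>
  proof -
    have "integrable lborel (\<lambda>x. cnj (G x * iexp (- \<xi> * x)))" by (intro integrable_cnj iGe)
    then show ?thesis by (simp add: exp_cnj)
  qed
  have re: "AE x in lborel. Re (G x) = 0"
  proof (rule fourier_transform_eq_0_imp_AE_0)
    fix \<xi>
    have "(LINT x|lborel. complex_of_real (Re (G x)) * iexp (\<xi> * x)) = (LINT x|lborel. (G x * iexp (\<xi> * x) + cnj (G x) * iexp (\<xi> * x)) / 2)"
      by (intro Bochner_Integration.integral_cong) (auto simp: complex_eq_iff algebra_simps)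
    also have "\<dots> = 0"
      using Bochner_Integration.integral_add[OF iGe[of \<xi>] iGc[of \<xi>]] unfolding ft1 ft2 integral_divide_zero by simp
    finally show "(LINT x|lborel. complex_of_real (Re (G x)) * iexp (\<xi> * x)) = 0" .
  qed (use iG in auto)
  have im: "AE x in lborel. Im (G x) = 0"
  proof (rule fourier_transform_eq_0_imp_AE_0)
    fix \<xi>
    have "(LINT x|lborel. complex_of_real (Im (G x)) * iexp (\<xi> * x)) = (LINT x|lborel. (G x * iexp (\<xi> * x) - cnj (G x) * iexp (\<xi> * x)) / (2 * \<i>))"
      by (intro Bochner_Integration.integral_cong) (auto simp: complex_eq_iff Re_divide Im_divide power2_eq_square algebra_simps)
    also have "\<dots> = 0"
      using Bochner_Integration.integral_diff[OF iGe[of \<xi>] iGc[of \<xi>]] unfolding ft1 ft2 integral_divide_zero by simp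
    finally show "(LINT x|lborel. complex_of_real (Im (G x)) * iexp (\<xi> * x)) = 0" .
  qed (use iG in auto)
  from re im show ?thesis
  proof eventually_elim
    case (elim x)
    then have "G x = 0" by (simp add: complex_eq_iff)
    then show ?case by (simp add: G_def g_def)
  qed
qed


text \<open>Completeness only says that a function with zero coefficients is null. Parseval for
  \<open>u\<close> therefore needs a function rebuilt from the coefficients of \<open>u\<close>,
  with known norm, to compare with. It is constructed as the pointwise limit of a sparse subsequence
  of partial sums.\<close>

lemma riesz_fischer:
  fixes e :: "nat \<Rightarrow> real \<Rightarrow> complex"
  assumes e: "\<And>n. L2 (e n)" and on: "\<And>n m. pair (e n) (e m) = (if n = m then 1 else 0)"
    and c: "summable (\<lambda>m. (cmod (c m))\<^sup>2)"
  obtains v where "L2 v" "\<And>m. pair v (e m) = c m" "(L2norm v)\<^sup>2 = (\<Sum>m. (cmod (c m))\<^sup>2)"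
proof -
  define T where "T = (\<lambda>N. (\<Sum>m. (cmod (c (m + N)))\<^sup>2))"
  have T0: "T \<longlonglongrightarrow> 0" unfolding T_def using suminf_exist_split2[OF c] by simp
  have Tnn: "T N \<ge> 0" for N
    unfolding T_def by (rule suminf_nonneg) (use summable_ignore_initial_segment[OF c] in auto)
  \<comment> \<open>The subsequence has tails at most \<open>4 ^ - k\<close>, so that its increments
    have norm at most \<open>2 ^ - k\<close>. The summand \<open>k\<close> forces \<open>N k\<close>
    to infinity even when the tails vanish early.\<close>
  define N where "N = (\<lambda>k. k + (LEAST n. \<forall>m\<ge>n. T m \<le> (1/4) ^ k))"
  have ex: "\<exists>n. \<forall>m\<ge>n. T m \<le> (1/4) ^ k" for k
  proof -
    have "eventually (\<lambda>m. T m < (1/4) ^ k) sequentially" using T0 by (rule order_tendstoD) simp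
    then show ?thesis unfolding eventually_sequentially by (meson less_imp_le)
  qed
  have TN: "T m \<le> (1/4) ^ k" if "m \<ge> N k" for m k
    using LeastI_ex[OF ex[of k]] that unfolding N_def by (meson add_leE)
  have Nk: "k \<le> N k" for k by (simp add: N_def)
  have Nmono: "mono N"
  proof (rule monoI)
    fix j k :: nat assume jk: "j \<le> k"
    have "(LEAST n. \<forall>m\<ge>n. T m \<le> (1/4) ^ j) \<le> (LEAST n. \<forall>m\<ge>n. T m \<le> (1/4) ^ k)"
    proof (rule Least_le)
      have "(1/4 :: real) ^ k \<le> (1/4) ^ j" using jk by (intro power_decreasing) auto
      then show "\<forall>m\<ge>(LEAST n. \<forall>m\<ge>n. T m \<le> (1/4) ^ k). T m \<le> (1/4) ^ j"
        using LeastI_ex[OF ex[of k]] by (meson order_trans)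
    qed
    then show "N j \<le> N k" using jk by (simp add: N_def)
  qed
  define S where "S = (\<lambda>k x. \<Sum>m<N k. c m * e m x)"
  have S: "L2 (S k)" for k unfolding S_def by (intro L2_sum L2_cmult e)
  have Smeas [measurable]: "S k \<in> borel_measurable borel" for k using S by (auto simp: L2_def)
  have Sdiff: "(L2norm (\<lambda>x. S k x - S j x))\<^sup>2 \<le> (1/4) ^ j" if "j \<le> k" for j k
  proof -
    have "N j \<le> N k" using Nmono that by (simp add: monoD)
    have "(\<lambda>x. S k x - S j x) = (\<lambda>x. \<Sum>m<N k. (if m < N j then 0 else c m) * e m x)"
    proof
      fix x
      have "S k x = (\<Sum>m<N k. (if m < N j then c m * e m x else 0) + (if m < N j then 0 else c m) * e m x)"
        unfolding S_def by (rule sum.cong) auto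
      also have "\<dots> = (\<Sum>m<N k. if m < N j then c m * e m x else 0) + (\<Sum>m<N k. (if m < N j then 0 else c m) * e m x)"
        by (rule sum.distrib)
      also have "(\<Sum>m<N k. if m < N j then c m * e m x else 0) = S j x"
        unfolding S_def using \<open>N j \<le> N k\<close> by (intro sum.mono_neutral_cong_right) auto
      finally show "S k x - S j x = (\<Sum>m<N k. (if m < N j then 0 else c m) * e m x)" by simp
    qed
    then have "(L2norm (\<lambda>x. S k x - S j x))\<^sup>2 = (\<Sum>m<N k. (cmod (if m < N j then 0 else c m))\<^sup>2)"
      using L2norm_orthonormal_sum[of e "\<lambda>m. if m < N j then 0 else c m" "N k", OF e on] by simp
    also have "\<dots> = (\<Sum>m\<in>{N j..<N k}. (cmod (c m))\<^sup>2)"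
      by (intro sum.mono_neutral_cong_right) auto
    also have "\<dots> = (\<Sum>m<N k - N j. (cmod (c (m + N j)))\<^sup>2)"
      using \<open>N j \<le> N k\<close> sum.shift_bounds_nat_ivl[of "\<lambda>m. (cmod (c m))\<^sup>2" 0 "N j" "N k - N j"]
      by (simp add: lessThan_atLeast0)
    also have "\<dots> \<le> T (N j)" unfolding T_def
      by (intro sum_le_suminf) (use summable_ignore_initial_segment[OF c] in auto)
    also have "\<dots> \<le> (1/4) ^ j" by (rule TN) simp
    finally show ?thesis .
  qed
  define f where "f = (\<lambda>k x. S (Suc k) x - S k x)"
  have f: "L2 (f k)" for k unfolding f_def by (intro L2_diff S)
  have fmeas [measurable]: "f k \<in> borel_measurable borel" for k using f by (auto simp: L2_def)
  have fn: "L2norm (f k) \<le> (1/2) ^ k" for k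
  proof -
    have "(L2norm (f k))\<^sup>2 \<le> (1/4) ^ k" unfolding f_def by (rule Sdiff) simp
    also have "\<dots> = ((1/2) ^ k)\<^sup>2" by (simp add: power2_eq_square power_mult_distrib[symmetric])
    finally show ?thesis by (rule power2_le_imp_le) simp
  qed
  \<comment> \<open>Lebesgue measure is infinite, so an \<open>L2\<close> bound does not control the
    plain \<open>L1\<close> norm. Pairing with the strictly positive unit vector \<open>g\<close>
    controls a weighted one, which is enough for summability almost everywhere.\<close>
  define g where "g = (\<lambda>x. cmod (hermite_c 0 x))"
  have gpos: "g x > 0" for x
    using hermite_scale_pos[of 0] by (simp add: g_def hermite_c_def hermite_fun_eq)
  have gmeas [measurable]: "g \<in> borel_measurable borel" using L2_hermite_c[of 0] by (auto simp: g_def L2_def)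
  have AEs: "AE x in lborel. summable (\<lambda>k. cmod (f k x))"
  proof -
    have "(\<integral>\<^sup>+x. (\<Sum>k. ennreal (cmod (f k x) * g x)) \<partial>lborel) = (\<Sum>k. \<integral>\<^sup>+x. ennreal (cmod (f k x) * g x) \<partial>lborel)"
      by (rule nn_integral_suminf) measurable
    also have "\<dots> \<le> (\<Sum>k. ennreal ((1/2) ^ k))"
    proof (intro suminf_le summableI)
      fix k
      have L: "L2 (\<lambda>x. complex_of_real (cmod (f k x)))" "L2 (\<lambda>x. complex_of_real (g x))"
        using f[of k] L2_hermite_c[of 0] by (auto simp: L2_def g_def)
      have eqn: "L2norm (\<lambda>x. complex_of_real (cmod (f k x))) = L2norm (f k)" "L2norm (\<lambda>x. complex_of_real (g x)) = 1"
      proof -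
        show "L2norm (\<lambda>x. complex_of_real (cmod (f k x))) = L2norm (f k)" by (simp add: L2norm_def)
        have "L2norm (\<lambda>x. complex_of_real (g x)) = L2norm (hermite_c 0)" by (simp add: L2norm_def g_def)
        also have "\<dots> = 1"
        proof -
          have "(L2norm (hermite_c 0))\<^sup>2 = 1" by (simp add: L2norm_sq pair_hermite_c)
          then show ?thesis using L2norm_nonneg[of "hermite_c 0"] by (simp add: power2_eq_1_iff)
        qed
        finally show "L2norm (\<lambda>x. complex_of_real (g x)) = 1" .
      qed
      have i: "integrable lborel (\<lambda>x. complex_of_real (cmod (f k x) * g x))"
        using L2_integrable_mult[OF L] by simp
      have i': "integrable lborel (\<lambda>x. cmod (f k x) * g x)"
      proof -
        have "norm (complex_of_real (cmod (f k x) * g x)) = cmod (f k x) * g x" for x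
          unfolding norm_of_real using gpos[of x] by simp
        then show ?thesis using integrable_norm[OF i] by (simp only:)
      qed
      have "pair (\<lambda>x. complex_of_real (cmod (f k x))) (\<lambda>x. complex_of_real (g x)) = (LINT x|lborel. complex_of_real (cmod (f k x) * g x))"
        unfolding pair_def by simp
      also have "\<dots> = complex_of_real (LINT x|lborel. cmod (f k x) * g x)" by (rule integral_complex_of_real)
      finally have "\<bar>LINT x|lborel. cmod (f k x) * g x\<bar> \<le> (1/2) ^ k"
        using cauchy_schwarz_pair[OF L] eqn fn[of k] by simp
      moreover have "(\<integral>\<^sup>+x. ennreal (cmod (f k x) * g x) \<partial>lborel) = ennreal (LINT x|lborel. cmod (f k x) * g x)"
        using i' gpos by (intro nn_integral_eq_integral) (auto simp: less_imp_le)
      ultimately show "(\<integral>\<^sup>+x. ennreal (cmod (f k x) * g x) \<partial>lborel) \<le> ennreal ((1/2) ^ k)"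
        by (simp add: ennreal_leI)
    qed
    also have "\<dots> < \<infinity>"
    proof -
      have "summable (\<lambda>k. (1/2 :: real) ^ k)" by (rule summable_geometric) simp
      then show ?thesis by (simp add: suminf_ennreal2 less_top[symmetric])
    qed
    finally have "AE x in lborel. (\<Sum>k. ennreal (cmod (f k x) * g x)) \<noteq> \<infinity>"
      by (intro nn_integral_PInf_AE) auto
    then show ?thesis
    proof eventually_elim
      case (elim x)
      have "summable (\<lambda>k. cmod (f k x) * g x)"
        using elim gpos[of x] by (intro summable_suminf_not_top) auto
      then have "summable (\<lambda>k. cmod (f k x) * g x * inverse (g x))" by (rule summable_mult2)
      then show ?case using gpos[of x] by (simp add: field_simps)
    qed
  qed
  define v where "v = (\<lambda>x. lim (\<lambda>k. S k x))"
  have vmeas [measurable]: "v \<in> borel_measurable borel"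
    unfolding v_def by (rule borel_measurable_lim_metric) measurable
  have vlim: "AE x in lborel. (\<lambda>k. S k x) \<longlonglongrightarrow> v x"
    using AEs
  proof eventually_elim
    case (elim x)
    have "summable (\<lambda>k. f k x)" using elim by (rule summable_norm_cancel)
    then have "(\<lambda>n. \<Sum>k<n. f k x) \<longlonglongrightarrow> (\<Sum>k. f k x)" by (rule summable_LIMSEQ)
    moreover have "(\<Sum>k<n. f k x) = S n x - S 0 x" for n
      unfolding f_def by (rule sum_lessThan_telescope)
    ultimately have "(\<lambda>n. (S n x - S 0 x) + S 0 x) \<longlonglongrightarrow> (\<Sum>k. f k x) + S 0 x"
      by (intro tendsto_add) auto
    then have "convergent (\<lambda>n. S n x)" by (auto simp: convergent_def)
    then show ?case unfolding v_def by (simp add: convergent_LIMSEQ_iff)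
  qed
  \<comment> \<open>Fatou's lemma along the subsequence turns convergence almost everywhere into
    convergence in norm, with the rate of the Cauchy estimate.\<close>
  have nn: "(\<integral>\<^sup>+x. ennreal ((cmod (v x - S j x))\<^sup>2) \<partial>lborel) \<le> ennreal ((1/4) ^ j)" for j
  proof -
    have "(\<integral>\<^sup>+x. ennreal ((cmod (v x - S j x))\<^sup>2) \<partial>lborel)
       = (\<integral>\<^sup>+x. liminf (\<lambda>k. ennreal ((cmod (S k x - S j x))\<^sup>2)) \<partial>lborel)"
    proof (rule nn_integral_cong_AE)
      show "AE x in lborel. ennreal ((cmod (v x - S j x))\<^sup>2) = liminf (\<lambda>k. ennreal ((cmod (S k x - S j x))\<^sup>2))"
        using vlim
      proof eventually_elim
        case (elim x)
        have "(\<lambda>k. ennreal ((cmod (S k x - S j x))\<^sup>2)) \<longlonglongrightarrow> ennreal ((cmod (v x - S j x))\<^sup>2)"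
          by (intro tendsto_intros elim tendsto_ennrealI)
        then show ?case by (intro lim_imp_Liminf[symmetric]) auto
      qed
    qed
    also have "\<dots> \<le> liminf (\<lambda>k. \<integral>\<^sup>+x. ennreal ((cmod (S k x - S j x))\<^sup>2) \<partial>lborel)"
      by (rule nn_integral_liminf) measurable
    also have "\<dots> \<le> limsup (\<lambda>k. \<integral>\<^sup>+x. ennreal ((cmod (S k x - S j x))\<^sup>2) \<partial>lborel)"
      by (rule Liminf_le_Limsup) simp
    also have "\<dots> \<le> ennreal ((1/4) ^ j)"
    proof (rule Limsup_bounded)
      show "\<forall>\<^sub>F k in sequentially. (\<integral>\<^sup>+x. ennreal ((cmod (S k x - S j x))\<^sup>2) \<partial>lborel) \<le> ennreal ((1/4) ^ j)"
        unfolding eventually_sequentially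
      proof (intro exI[of _ j] allI impI)
        fix k assume "j \<le> k"
        have "(\<integral>\<^sup>+x. ennreal ((cmod (S k x - S j x))\<^sup>2) \<partial>lborel) = ennreal (LINT x|lborel. (cmod (S k x - S j x))\<^sup>2)"
          using L2_diff[OF S S, of k j] by (intro nn_integral_eq_integral) (auto simp: L2_def)
        also have "(LINT x|lborel. (cmod (S k x - S j x))\<^sup>2) = (L2norm (\<lambda>x. S k x - S j x))\<^sup>2"
          unfolding L2norm_def by (simp add: integral_nonneg_AE)
        finally show "(\<integral>\<^sup>+x. ennreal ((cmod (S k x - S j x))\<^sup>2) \<partial>lborel) \<le> ennreal ((1/4) ^ j)"
          using Sdiff[OF \<open>j \<le> k\<close>] by (simp add: ennreal_leI)
      qed
    qed
    finally show ?thesis .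
  qed
  have vS: "L2 (\<lambda>x. v x - S j x)" "(L2norm (\<lambda>x. v x - S j x))\<^sup>2 \<le> (1/4) ^ j" for j
  proof -
    have i: "integrable lborel (\<lambda>x. (cmod (v x - S j x))\<^sup>2)"
    proof (rule integrableI_bounded)
      show "(\<integral>\<^sup>+x. ennreal (norm ((cmod (v x - S j x))\<^sup>2)) \<partial>lborel) < \<infinity>"
        using nn[of j] by (simp add: order_le_less_trans[OF _ ennreal_less_top])
    qed measurable
    then show "L2 (\<lambda>x. v x - S j x)" by (auto simp: L2_def)
    have "ennreal (LINT x|lborel. (cmod (v x - S j x))\<^sup>2) \<le> ennreal ((1/4) ^ j)"
      using nn[of j] nn_integral_eq_integral[OF i] by simp
    then show "(L2norm (\<lambda>x. v x - S j x))\<^sup>2 \<le> (1/4) ^ j"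
      unfolding L2norm_def by (simp add: integral_nonneg_AE)
  qed
  have v: "L2 v" using L2_add[OF vS(1)[of 0] S[of 0]] by simp
  have lim0: "(\<lambda>j. (1/4 :: real) ^ j) \<longlonglongrightarrow> 0" by (rule LIMSEQ_power_zero) simp
  have coeff: "pair v (e m) = c m" for m
  proof -
    have "(cmod (pair v (e m) - c m))\<^sup>2 \<le> (1/4) ^ j" if "j > m" for j
    proof -
      have "m < N j" using that Nk[of j] by simp
      have "pair (S j) (e m) = (\<Sum>i<N j. c i * pair (e i) (e m))"
        unfolding S_def by (subst pair_sum_left) (auto intro: L2_cmult e simp: pair_cmult_left)
      also have "\<dots> = c m" using \<open>m < N j\<close> by (simp add: on if_distrib sum.If_cases cong: if_cong)
      finally have "pair v (e m) - c m = pair (\<lambda>x. v x - S j x) (e m)"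
        by (simp add: pair_diff_left v S e)
      also have "cmod \<dots> \<le> L2norm (\<lambda>x. v x - S j x) * L2norm (e m)" by (rule cauchy_schwarz_pair[OF vS(1) e])
      also have "L2norm (e m) = 1"
      proof -
        have "(L2norm (e m))\<^sup>2 = 1" by (simp add: L2norm_sq on)
        then show ?thesis using L2norm_nonneg[of "e m"] by (simp add: power2_eq_1_iff)
      qed
      finally have "(cmod (pair v (e m) - c m))\<^sup>2 \<le> (L2norm (\<lambda>x. v x - S j x))\<^sup>2" by (intro power_mono) auto
      then show ?thesis using vS(2)[of j] by linarith
    qed
    then have "(cmod (pair v (e m) - c m))\<^sup>2 \<le> 0"
      by (intro tendsto_lowerbound[OF lim0]) (auto simp: eventually_sequentially intro!: exI[of _ "Suc m"])
    then show ?thesis by simp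
  qed
  have norm: "(L2norm v)\<^sup>2 = (\<Sum>m. (cmod (c m))\<^sup>2)"
  proof (rule LIMSEQ_unique)
    have eq: "(L2norm (\<lambda>x. v x - S j x))\<^sup>2 = (L2norm v)\<^sup>2 - (\<Sum>m<N j. (cmod (c m))\<^sup>2)" for j
      unfolding S_def by (subst orthonormal_expansion[OF e on v]) (simp add: coeff)
    have "(\<lambda>j. (L2norm (\<lambda>x. v x - S j x))\<^sup>2) \<longlonglongrightarrow> 0"
      by (rule tendsto_sandwich[OF _ _ tendsto_const lim0]) (use vS(2) in auto)
    then have "(\<lambda>j. (L2norm v)\<^sup>2 - (L2norm (\<lambda>x. v x - S j x))\<^sup>2) \<longlonglongrightarrow> (L2norm v)\<^sup>2 - 0"
      by (intro tendsto_diff tendsto_const)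
    then show "(\<lambda>j. \<Sum>m<N j. (cmod (c m))\<^sup>2) \<longlonglongrightarrow> (L2norm v)\<^sup>2" unfolding eq by simp
    have "filterlim N at_top sequentially"
      by (rule filterlim_at_top_mono[OF filterlim_ident]) (simp add: Nk)
    then show "(\<lambda>j. \<Sum>m<N j. (cmod (c m))\<^sup>2) \<longlonglongrightarrow> (\<Sum>m. (cmod (c m))\<^sup>2)"
      by (rule filterlim_compose[OF summable_LIMSEQ[OF c]])
  qed
  show thesis by (rule that[OF v coeff norm])
qed

lemma parseval_hermite:
  assumes u: "L2 u"
  shows "(\<lambda>m. (cmod (pair u (hermite_c m)))\<^sup>2) sums (L2norm u)\<^sup>2"
proof -
  have c: "summable (\<lambda>m. (cmod (pair u (hermite_c m)))\<^sup>2)"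
    by (rule summableI_nonneg_bounded[OF _ bessel[OF L2_hermite_c pair_hermite_c u]]) simp
  obtain v where v: "L2 v" "\<And>m. pair v (hermite_c m) = pair u (hermite_c m)"
      "(L2norm v)\<^sup>2 = (\<Sum>m. (cmod (pair u (hermite_c m)))\<^sup>2)"
    using riesz_fischer[OF L2_hermite_c pair_hermite_c c] by blast
  have "AE x in lborel. u x - v x = 0"
    by (rule hermite_complete) (use u v in \<open>auto intro: L2_diff simp: pair_diff_left L2_hermite_c\<close>)
  then have "(LINT x|lborel. (cmod (u x))\<^sup>2) = (LINT x|lborel. (cmod (v x))\<^sup>2)"
    using u v by (intro integral_cong_AE) (auto simp: L2_def)
  then have "L2norm u = L2norm v" by (simp add: L2norm_def)
  then show ?thesis using summable_sums[OF c] v(3) by simp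
qed

subsection \<open>Squeezed Hermite bases\<close>

lemma L2norm_triangle:
  assumes "L2 u" "L2 v" shows "L2norm (\<lambda>x. u x + v x) \<le> L2norm u + L2norm v"
proof (rule power2_le_imp_le)
  have "pair (\<lambda>x. u x + v x) (\<lambda>x. u x + v x) = pair u u + pair u v + (pair v u + pair v v)"
    using assms by (simp add: pair_add_left pair_add_right L2_add)
  then have "(L2norm (\<lambda>x. u x + v x))\<^sup>2 = (L2norm u)\<^sup>2 + (Re (pair u v) + Re (pair v u)) + (L2norm v)\<^sup>2"
    by (simp add: L2norm_sq)
  also have "Re (pair u v) + Re (pair v u) \<le> 2 * (L2norm u * L2norm v)"
    using complex_Re_le_cmod[of "pair u v"] complex_Re_le_cmod[of "pair v u"]
      cauchy_schwarz_pair[OF assms] cauchy_schwarz_pair[OF assms(2,1)] by (simp add: mult.commute)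
  finally show "(L2norm (\<lambda>x. u x + v x))\<^sup>2 \<le> (L2norm u + L2norm v)\<^sup>2"
    by (simp add: power2_eq_square algebra_simps)
qed simp

lemma L2norm_cmult: "L2norm (\<lambda>x. c * u x) = cmod c * L2norm u"
  by (simp add: L2norm_def norm_mult power_mult_distrib real_sqrt_mult)

definition dhermite_c :: "nat \<Rightarrow> real \<Rightarrow> complex" where
  "dhermite_c n x = sqrt (n / 2) * hermite_c (n - 1) x - sqrt (Suc n / 2) * hermite_c (Suc n) x"

text \<open>This is the eigenvalue equation of the harmonic oscillator, obtained from the two ladder
  relations.\<close>

lemma dhermite_c_has_vector_derivative:
  "(dhermite_c n has_vector_derivative (x\<^sup>2 - 2 * real n - 1) * hermite_c n x) (at x within S)"
proof -
  let ?r = "complex_of_real (sqrt (Suc n / 2))"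
  have rr: "?r * ?r = complex_of_real (Suc n / 2)" by (simp flip: of_real_mult)
  have d1: "dhermite_c n = (\<lambda>x. complex_of_real x * hermite_c n x - 2 * ?r * hermite_c (Suc n) x)"
    by (rule ext) (simp add: dhermite_c_def mult_hermite_c)
  have hd: "(hermite_c k has_vector_derivative dhermite_c k x) (at x within S)" for k
    unfolding dhermite_c_def by (rule hermite_c_has_vector_derivative)
  have "((\<lambda>x. complex_of_real x * hermite_c n x - 2 * ?r * hermite_c (Suc n) x) has_vector_derivative
     (complex_of_real x * dhermite_c n x + 1 * hermite_c n x - 2 * ?r * dhermite_c (Suc n) x)) (at x within S)"
    by (intro has_vector_derivative_diff has_vector_derivative_mult has_vector_derivative_mult_right hd)
       (rule has_vector_derivative_real_field[where f = "\<lambda>z. z", simplified], auto intro: derivative_eq_intros)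
  moreover have "complex_of_real x * dhermite_c n x + 1 * hermite_c n x - 2 * ?r * dhermite_c (Suc n) x
     = (x\<^sup>2 - 2 * real n - 1) * hermite_c n x"
  proof -
    have "dhermite_c (Suc n) x = 2 * ?r * hermite_c n x - complex_of_real x * hermite_c (Suc n) x"
      by (simp add: dhermite_c_def mult_hermite_c)
    then have "2 * ?r * dhermite_c (Suc n) x = 4 * (?r * ?r) * hermite_c n x - 2 * ?r * complex_of_real x * hermite_c (Suc n) x"
      by (simp only:) (simp only: algebra_simps, simp)
    also have "\<dots> = 2 * complex_of_real (Suc n) * hermite_c n x - complex_of_real x * (2 * ?r * hermite_c (Suc n) x)"
      unfolding rr by simp
    also have "2 * ?r * hermite_c (Suc n) x = complex_of_real x * hermite_c n x - dhermite_c n x"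
      using fun_cong[OF d1, of x] by simp
    finally show ?thesis by (simp add: algebra_simps power2_eq_square)
  qed
  ultimately show ?thesis unfolding d1 by simp
qed

text \<open>The metaplectic image of the Hermite basis, squeezed by \<open>\<rho>\<close>, chirped by \<open>\<sigma>\<close> and moved to the phase
  space point \<open>(q, p)\<close>. The numbers \<open>\<zeta>\<close> and \<open>\<zeta>\<^sub>1\<close> are the entries of the linear symplectic map.\<close>
locale squeezed_frame =
  fixes \<kappa> \<omega> :: complex and \<rho> \<sigma> q p :: real
  assumes norm_kappa: "cmod \<kappa> = 1" and norm_omega: "cmod \<omega> = 1" and rho_pos: "\<rho> > 0"
begin

definition phase :: "real \<Rightarrow> complex" where
  "phase x = exp (\<i> * complex_of_real (\<sigma> * (x - q)\<^sup>2 / 2 + p * (x - q)))"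

definition frame :: "nat \<Rightarrow> real \<Rightarrow> complex" where
  "frame m x = \<kappa> * \<omega> ^ m / sqrt \<rho> * hermite_c m ((x - q) / \<rho>) * phase x"

text \<open>With \<open>a\<close> the lowering operator of the frame, \<open>X\<close> acts as
  \<open>q + (\<zeta> a + adjoint) / sqrt 2\<close> and \<open>D\<close> as
  \<open>p - (\<zeta>\<^sub>1 a + adjoint) / sqrt 2\<close>. The minus sign matches
  \<open>q' = - p\<close>, which lets \<open>\<zeta>\<^sub>1\<close> become the time derivative of
  \<open>\<zeta>\<close>.\<close>

definition \<zeta> :: complex where "\<zeta> = \<rho> * \<omega>"
definition \<zeta>\<^sub>1 :: complex where "\<zeta>\<^sub>1 = - \<sigma> * \<zeta> + \<i> * \<omega> / \<rho>"

definition dframe :: "nat \<Rightarrow> real \<Rightarrow> complex" where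
  "dframe m x = \<kappa> * \<omega> ^ m / sqrt \<rho> *
     (dhermite_c m ((x - q) / \<rho>) / \<rho> + \<i> * (\<sigma> * (x - q) + p) * hermite_c m ((x - q) / \<rho>)) * phase x"

definition ddframe :: "nat \<Rightarrow> real \<Rightarrow> complex" where
  "ddframe m x = \<kappa> * \<omega> ^ m / sqrt \<rho> *
     ((((x - q) / \<rho>)\<^sup>2 - 2 * real m - 1) * hermite_c m ((x - q) / \<rho>) / \<rho>\<^sup>2
      + 2 * \<i> * (\<sigma> * (x - q) + p) * dhermite_c m ((x - q) / \<rho>) / \<rho>
      + (\<i> * \<sigma> - (\<sigma> * (x - q) + p)\<^sup>2) * hermite_c m ((x - q) / \<rho>)) * phase x"

lemma norm_phase [simp]: "cmod (phase x) = 1"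
  by (simp add: phase_def)

lemma omega_cnj: "\<omega> * cnj \<omega> = 1"
  using norm_omega complex_norm_square[of \<omega>] by simp

lemma kappa_cnj: "\<kappa> * cnj \<kappa> = 1"
  using norm_kappa complex_norm_square[of \<kappa>] by simp

lemma phase_has_vector_derivative:
  "(phase has_vector_derivative \<i> * (\<sigma> * (x - q) + p) * phase x) (at x)"
proof -
  have "((\<lambda>x. \<sigma> * (x - q)\<^sup>2 / 2 + p * (x - q)) has_real_derivative \<sigma> * (x - q) + p) (at x)"
    by (auto intro!: derivative_eq_intros)
  then have "((\<lambda>x. \<i> * complex_of_real (\<sigma> * (x - q)\<^sup>2 / 2 + p * (x - q))) has_vector_derivative
      \<i> * complex_of_real (\<sigma> * (x - q) + p)) (at x)"
    by (intro has_vector_derivative_mult_right has_vector_derivative_of_real)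
  from field_vector_diff_chain_at[OF this DERIV_exp]
  show ?thesis by (simp add: phase_def[abs_def] o_def)
qed

lemma has_vector_derivative_rescale:
  fixes h h' :: "real \<Rightarrow> complex"
  assumes "\<And>y. (h has_vector_derivative h' y) (at y)"
  shows "((\<lambda>x. h ((x - q) / \<rho>)) has_vector_derivative h' ((x - q) / \<rho>) / \<rho>) (at x)"
proof -
  have "((\<lambda>x. (x - q) / \<rho>) has_vector_derivative 1 / \<rho>) (at x)"
    unfolding has_real_derivative_iff_has_vector_derivative[symmetric]
    using rho_pos by (auto intro!: derivative_eq_intros)
  from vector_diff_chain_at[OF this assms[of "(x - q) / \<rho>"]]
  have "(h \<circ> (\<lambda>x. (x - q) / \<rho>) has_vector_derivative (1 / \<rho>) *\<^sub>R h' ((x - q) / \<rho>)) (at x)" .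
  then show ?thesis by (simp add: o_def scaleR_conv_of_real)
qed

lemma hermite_c_deriv: "(hermite_c n has_vector_derivative dhermite_c n x) (at x)"
  unfolding dhermite_c_def by (rule hermite_c_has_vector_derivative)

lemma frame_has_vector_derivative: "(frame m has_vector_derivative dframe m x) (at x)"
proof -
  have "((\<lambda>x. \<kappa> * \<omega> ^ m / sqrt \<rho> * hermite_c m ((x - q) / \<rho>) * phase x) has_vector_derivative
    \<kappa> * \<omega> ^ m / sqrt \<rho> * hermite_c m ((x - q) / \<rho>) * (\<i> * (\<sigma> * (x - q) + p) * phase x)
     + \<kappa> * \<omega> ^ m / sqrt \<rho> * (dhermite_c m ((x - q) / \<rho>) / \<rho>) * phase x) (at x)"
    by (intro has_vector_derivative_mult has_vector_derivative_mult_right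
        has_vector_derivative_rescale[of "hermite_c m" "dhermite_c m", OF hermite_c_deriv] phase_has_vector_derivative)
  then show ?thesis unfolding frame_def[abs_def] dframe_def by (simp add: algebra_simps)
qed

lemma dframe_has_vector_derivative: "(dframe m has_vector_derivative ddframe m x) (at x)"
proof -
  let ?w = "(x - q) / \<rho>" and ?S = "complex_of_real (\<sigma> * (x - q) + p)"
  have S: "((\<lambda>x. \<i> * complex_of_real (\<sigma> * (x - q) + p)) has_vector_derivative \<i> * \<sigma>) (at x)"
    by (intro has_vector_derivative_mult_right has_vector_derivative_of_real) (auto intro!: derivative_eq_intros)
  have "((\<lambda>x. \<kappa> * \<omega> ^ m / sqrt \<rho> *
     (dhermite_c m ((x - q) / \<rho>) / \<rho> + \<i> * complex_of_real (\<sigma> * (x - q) + p) * hermite_c m ((x - q) / \<rho>)) * phase x) has_vector_derivative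
    \<kappa> * \<omega> ^ m / sqrt \<rho> * (dhermite_c m ?w / \<rho> + \<i> * ?S * hermite_c m ?w) * (\<i> * (\<sigma> * (x - q) + p) * phase x)
     + \<kappa> * \<omega> ^ m / sqrt \<rho> * (((?w\<^sup>2 - 2 * real m - 1) * hermite_c m ?w / \<rho>) / \<rho> + (\<i> * ?S * (dhermite_c m ?w / \<rho>) + \<i> * \<sigma> * hermite_c m ?w)) * phase x) (at x)"
    by (intro has_vector_derivative_mult has_vector_derivative_mult_right has_vector_derivative_add
         has_vector_derivative_divide has_vector_derivative_rescale[of "hermite_c m" "dhermite_c m", OF hermite_c_deriv]
         has_vector_derivative_rescale[of "dhermite_c m" "\<lambda>y. complex_of_real (y\<^sup>2 - 2 * real m - 1) * hermite_c m y", OF dhermite_c_has_vector_derivative]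
         phase_has_vector_derivative S)
  moreover have "\<kappa> * \<omega> ^ m / sqrt \<rho> * (D / \<rho> + \<i> * S * H) * (\<i> * S * Q)
     + \<kappa> * \<omega> ^ m / sqrt \<rho> * ((W * H / \<rho>) / \<rho> + (\<i> * S * (D / \<rho>) + \<i> * \<sigma> * H)) * Q
    = \<kappa> * \<omega> ^ m / sqrt \<rho> * (W * H / \<rho>\<^sup>2 + 2 * \<i> * S * D / \<rho> + (\<i> * \<sigma> - S\<^sup>2) * H) * Q"
    for D H S Q W :: complex
    by (simp add: algebra_simps add_divide_distrib power2_eq_square)
  ultimately show ?thesis unfolding dframe_def[abs_def] ddframe_def by (simp only: of_real_power of_real_mult)
qed

text \<open>Chirp and translation only change the exponent and compose the Hermite polynomial with
  an affine map; \<open>Re A = - 1 / (2 * \<rho>^2)\<close> stays negative. This makes every frame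
  function admissible as a test function.\<close>

lemma frame_poly_gauss:
  obtains P A B where "frame m = poly_gauss P A B" "Re A < 0"
proof -
  define A where "A = - 1 / (2 * (complex_of_real \<rho>)\<^sup>2) + \<i> * \<sigma> / 2"
  define B where "B = - 2 * q * A + \<i> * p"
  define C where "C = \<kappa> * \<omega> ^ m / sqrt \<rho> * (1 / complex_of_real (hermite_scale m)) * exp (A * q\<^sup>2 - \<i> * p * q)"
  define P where "P = smult C (pcompose (hermite_cpoly m) [:- q / \<rho>, 1 / \<rho>:])"
  have "frame m x = poly_gauss P A B x" for x
  proof -
    let ?w = "(x - q) / \<rho>"
    have h: "hermite_c m ?w = poly (hermite_cpoly m) (complex_of_real ?w) / hermite_scale m * exp (- (complex_of_real ?w)\<^sup>2 / 2)"
      unfolding poly_hermite_cpoly hermite_c_def hermite_fun_eq by (simp flip: exp_of_real)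
    have w: "complex_of_real ?w = - q / \<rho> + 1 / \<rho> * complex_of_real x" using rho_pos by (simp add: field_simps)
    have pc: "poly (pcompose (hermite_cpoly m) [:- q / \<rho>, 1 / \<rho>:]) (complex_of_real x)
       = poly (hermite_cpoly m) (complex_of_real ?w)"
      unfolding w by (simp add: poly_pcompose mult.commute)
    have e: "- (complex_of_real ?w)\<^sup>2 / 2 + \<i> * complex_of_real (\<sigma> * (x - q)\<^sup>2 / 2 + p * (x - q))
       = (A * q\<^sup>2 - \<i> * p * q) + (A * (complex_of_real x)\<^sup>2 + B * complex_of_real x)"
      using rho_pos by (simp add: A_def B_def field_simps power2_eq_square)
    have "frame m x = \<kappa> * \<omega> ^ m / sqrt \<rho> * (1 / complex_of_real (hermite_scale m)) * poly (hermite_cpoly m) (complex_of_real ?w)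
       * exp (- (complex_of_real ?w)\<^sup>2 / 2 + \<i> * complex_of_real (\<sigma> * (x - q)\<^sup>2 / 2 + p * (x - q)))"
      unfolding frame_def h phase_def exp_add by simp
    also have "\<dots> = poly_gauss P A B x"
      unfolding e poly_gauss_def P_def C_def exp_add poly_smult pc by (simp only: mult_ac)
    finally show ?thesis .
  qed
  moreover have "Re A < 0" using rho_pos by (simp add: A_def power2_eq_square)
  ultimately show thesis using that by blast
qed

lemma L2_frame: "L2 (frame m)"
  using frame_poly_gauss[of m] L2_poly_gauss by metis

lemma schwartz_frame: "schwartz (frame m)"
  using frame_poly_gauss[of m] schwartz_poly_gauss by metis

lemma cderiv_frame: "cderiv 2 (frame m) = ddframe m"
proof -
  have 1: "(\<lambda>x. vector_derivative (frame m) (at x)) = dframe m"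
    by (rule ext) (rule vector_derivative_at[OF frame_has_vector_derivative])
  have 2: "(\<lambda>x. vector_derivative (dframe m) (at x)) = ddframe m"
    by (rule ext) (rule vector_derivative_at[OF dframe_has_vector_derivative])
  show ?thesis by (simp add: cderiv_def numeral_2_eq_2 1 2)
qed

lemma mult_frame:
  "complex_of_real x * frame m x = q * frame m x + \<zeta> * sqrt (m / 2) * frame (m - 1) x
     + cnj \<zeta> * sqrt (Suc m / 2) * frame (Suc m) x"
proof -
  let ?w = "(x - q) / \<rho>"
  have w: "complex_of_real x = q + \<rho> * complex_of_real ?w" using rho_pos by (simp add: field_simps)
  \<comment> \<open>At \<open>m = 0\<close> the two powers of \<open>\<omega>\<close> may differ,
    but \<open>sqrt (m / 2)\<close> vanishes.\<close>
  have 1: "\<omega> ^ m * (sqrt (m / 2) * z) = \<omega> * \<omega> ^ (m - 1) * (sqrt (m / 2) * z)" for z :: complex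
    by (cases m) auto
  have 2: "\<omega> ^ m = cnj \<omega> * \<omega> ^ Suc m" using omega_cnj by (simp add: mult.assoc[symmetric] mult.commute)
  have "complex_of_real x * frame m x = q * frame m x + \<rho> * (\<kappa> / sqrt \<rho> * (\<omega> ^ m * (complex_of_real ?w * hermite_c m ?w)) * phase x)"
  proof -
    have "(q + \<rho> * W) * frame m x = q * frame m x + \<rho> * (\<kappa> / sqrt \<rho> * (\<omega> ^ m * (W * hermite_c m ?w)) * phase x)" for W :: complex
      by (simp add: frame_def add_divide_distrib algebra_simps)
    then show ?thesis by (subst w) (simp only:)
  qed
  also have "\<omega> ^ m * (complex_of_real ?w * hermite_c m ?w) =
      \<omega> * \<omega> ^ (m - 1) * (sqrt (m / 2) * hermite_c (m - 1) ?w) + cnj \<omega> * \<omega> ^ Suc m * (sqrt (Suc m / 2) * hermite_c (Suc m) ?w)"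
    unfolding mult_hermite_c distrib_left 1 2[symmetric] by simp
  finally show ?thesis by (simp add: frame_def \<zeta>_def algebra_simps)
qed

lemma dframe_eq:
  "dframe m x = \<i> * p * frame m x - \<i> * (\<zeta>\<^sub>1 * sqrt (m / 2) * frame (m - 1) x
     + cnj \<zeta>\<^sub>1 * sqrt (Suc m / 2) * frame (Suc m) x)"
proof -
  let ?w = "(x - q) / \<rho>"
  have 1: "\<omega> ^ m * (sqrt (m / 2) * z) = \<omega> * \<omega> ^ (m - 1) * (sqrt (m / 2) * z)" for z :: complex
    by (cases m) auto
  have 2: "\<omega> ^ m = cnj \<omega> * \<omega> ^ Suc m" using omega_cnj by (simp add: mult.assoc[symmetric] mult.commute)
  have "dframe m x = \<i> * p * frame m x + \<i> * \<sigma> * (complex_of_real x * frame m x - q * frame m x)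
     + 1 / \<rho> * (\<kappa> / sqrt \<rho> * (\<omega> ^ m * dhermite_c m ?w) * phase x)"
    by (simp add: dframe_def frame_def algebra_simps)
  also have "\<omega> ^ m * dhermite_c m ?w =
      \<omega> * \<omega> ^ (m - 1) * (sqrt (m / 2) * hermite_c (m - 1) ?w) - cnj \<omega> * \<omega> ^ Suc m * (sqrt (Suc m / 2) * hermite_c (Suc m) ?w)"
    unfolding dhermite_c_def right_diff_distrib 1 2[symmetric] by simp
  also have "1 / \<rho> * (\<kappa> / sqrt \<rho> * (\<omega> * \<omega> ^ (m - 1) * (sqrt (m / 2) * hermite_c (m - 1) ?w) - cnj \<omega> * \<omega> ^ Suc m * (sqrt (Suc m / 2) * hermite_c (Suc m) ?w)) * phase x)
    = \<omega> / \<rho> * sqrt (m / 2) * frame (m - 1) x - cnj \<omega> / \<rho> * sqrt (Suc m / 2) * frame (Suc m) x"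
    by (simp add: frame_def algebra_simps)
  also have "complex_of_real x * frame m x - q * frame m x = \<zeta> * sqrt (m / 2) * frame (m - 1) x
     + cnj \<zeta> * sqrt (Suc m / 2) * frame (Suc m) x" using mult_frame[of x m] by simp
  finally show ?thesis by (simp add: \<zeta>\<^sub>1_def algebra_simps)
qed

text \<open>The inverse of squeeze, chirp and translation, a unitary map of \<open>L2\<close>.
  Orthonormality and completeness of the frame are pulled back to the Hermite functions through
  it.\<close>

definition unframe :: "(real \<Rightarrow> complex) \<Rightarrow> real \<Rightarrow> complex" where
  "unframe u y = complex_of_real (sqrt \<rho>) * u (q + \<rho> * y) * cnj (phase (q + \<rho> * y))"

lemma L2_unframe:
  assumes "L2 u" shows "L2 (unframe u)" "L2norm (unframe u) = L2norm u"
proof -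
  have n: "(cmod (unframe u y))\<^sup>2 = \<rho> * (cmod (u (q + \<rho> * y)))\<^sup>2" for y
    using rho_pos by (simp add: unframe_def norm_mult power_mult_distrib)
  have "integrable lborel (\<lambda>y. (cmod (u (q + \<rho> * y)))\<^sup>2)"
    using assms rho_pos by (intro lborel_integrable_real_affine) (auto simp: L2_def)
  moreover have "unframe u \<in> borel_measurable borel"
  proof -
    have [measurable]: "u \<in> borel_measurable borel" using assms by (simp add: L2_def)
    have "continuous_on UNIV (\<lambda>y. cnj (phase (q + \<rho> * y)))" unfolding phase_def by (intro continuous_intros) auto
    then have [measurable]: "(\<lambda>y. cnj (phase (q + \<rho> * y))) \<in> borel_measurable borel" by (rule borel_measurable_continuous_onI)
    show ?thesis unfolding unframe_def[abs_def] by measurable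
  qed
  ultimately show "L2 (unframe u)" by (simp add: L2_def n)
  have "(LINT x|lborel. (cmod (u x))\<^sup>2) = \<bar>\<rho>\<bar> *\<^sub>R (LINT y|lborel. (cmod (u (q + \<rho> * y)))\<^sup>2)"
    using rho_pos by (intro lborel_integral_real_affine) auto
  then show "L2norm (unframe u) = L2norm u" using rho_pos by (simp add: L2norm_def n)
qed

lemma pair_frame: "pair u (frame m) = cnj (\<kappa> * \<omega> ^ m) * pair (unframe u) (hermite_c m)"
proof -
  have "pair u (frame m) = \<bar>\<rho>\<bar> *\<^sub>R (LINT y|lborel. u (q + \<rho> * y) * cnj (frame m (q + \<rho> * y)))"
    unfolding pair_def using rho_pos by (intro lborel_integral_real_affine) auto
  also have "\<dots> = (LINT y|lborel. \<rho> * (u (q + \<rho> * y) * cnj (frame m (q + \<rho> * y))))"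
    using rho_pos by (simp add: scaleR_conv_of_real)
  also have "\<dots> = (LINT y|lborel. cnj (\<kappa> * \<omega> ^ m) * (unframe u y * cnj (hermite_c m y)))"
  proof (intro Bochner_Integration.integral_cong refl)
    fix y
    have "complex_of_real \<rho> = complex_of_real (sqrt \<rho>) * complex_of_real (sqrt \<rho>)"
      using rho_pos by (simp flip: of_real_mult)
    then have "complex_of_real \<rho> / sqrt \<rho> = sqrt \<rho>" using rho_pos by simp
    moreover have "(q + \<rho> * y - q) / \<rho> = y" using rho_pos by simp
    ultimately show "\<rho> * (u (q + \<rho> * y) * cnj (frame m (q + \<rho> * y))) = cnj (\<kappa> * \<omega> ^ m) * (unframe u y * cnj (hermite_c m y))"
      using rho_pos by (simp add: frame_def unframe_def field_simps)
  qed
  also have "\<dots> = cnj (\<kappa> * \<omega> ^ m) * pair (unframe u) (hermite_c m)" by (simp add: pair_def)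
  finally show ?thesis .
qed

lemma pair_frame_frame: "pair (frame n) (frame m) = (if n = m then 1 else 0)"
proof -
  have "unframe (frame n) y = (\<kappa> * \<omega> ^ n) * hermite_c n y" for y
  proof -
    have "phase (q + \<rho> * y) * cnj (phase (q + \<rho> * y)) = 1"
      using norm_phase complex_norm_square[of "phase (q + \<rho> * y)"] by simp
    then show ?thesis using rho_pos by (simp add: frame_def unframe_def mult.assoc)
  qed
  then have "unframe (frame n) = (\<lambda>y. (\<kappa> * \<omega> ^ n) * hermite_c n y)" by (rule ext)
  then have "pair (frame n) (frame m) = cnj (\<kappa> * \<omega> ^ m) * ((\<kappa> * \<omega> ^ n) * (if n = m then 1 else 0))"
    unfolding pair_frame by (simp only: pair_cmult_left pair_hermite_c)
  also have "\<dots> = (if n = m then 1 else 0)"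
  proof (cases "n = m")
    case True
    have "cnj (\<kappa> * \<omega> ^ m) * (\<kappa> * \<omega> ^ m) = (\<kappa> * cnj \<kappa>) * (\<omega> * cnj \<omega>) ^ m"
      by (simp add: power_mult_distrib mult_ac)
    then show ?thesis using True by (simp add: kappa_cnj omega_cnj)
  qed simp
  finally show ?thesis .
qed

lemma parseval_frame:
  assumes "L2 u" shows "(\<lambda>m. (cmod (pair u (frame m)))\<^sup>2) sums (L2norm u)\<^sup>2"
proof -
  have "(cmod (pair u (frame m)))\<^sup>2 = (cmod (pair (unframe u) (hermite_c m)))\<^sup>2" for m
    by (simp add: pair_frame norm_mult norm_power norm_kappa norm_omega)
  then show ?thesis using parseval_hermite[OF L2_unframe(1)[OF assms]] L2_unframe(2)[OF assms] by simp
qed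


section \<open>The matrix between the fixed and the moving basis\<close>

definition overlap :: "nat \<Rightarrow> nat \<Rightarrow> complex" where
  "overlap n m = pair (frame m) (hermite_c n)"

lemma pair_dframe: "pair (dframe m) (hermite_c n) = - pair (frame m) (dhermite_c n)"
proof -
  obtain P A B where f: "frame m = poly_gauss P A B" and A: "Re A < 0" using frame_poly_gauss by blast
  have "dframe m = poly_gauss (gauss_deriv A B P) A B"
  proof
    fix x show "dframe m x = poly_gauss (gauss_deriv A B P) A B x"
      by (rule vector_derivative_unique_at[OF frame_has_vector_derivative])
         (simp add: f poly_gauss_has_vector_derivative)
  qed
  moreover have "dhermite_c n = poly_gauss (gauss_deriv (- 1/2) 0 (smult (1 / complex_of_real (hermite_scale n)) (hermite_cpoly n))) (- 1/2) 0"
    unfolding gauss_deriv_hermite_c by (rule ext) (simp add: dhermite_c_def)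
  ultimately show ?thesis unfolding f hermite_c_poly_gauss
    by (simp only:) (rule pair_by_parts[OF A], simp)
qed

lemma overlap_position:
  "q * overlap n m + \<zeta> * sqrt (m / 2) * overlap n (m - 1) + cnj \<zeta> * sqrt (Suc m / 2) * overlap n (Suc m)
   = sqrt (n / 2) * overlap (n - 1) m + sqrt (Suc n / 2) * overlap (Suc n) m"
  using pair_mult_real[of "frame m" "hermite_c n"] unfolding mult_hermite_c mult_frame
  by (simp add: pair_add_left pair_add_right L2_cmult L2_add L2_hermite_c L2_frame pair_cmult_left pair_cmult_right overlap_def
      del: of_nat_Suc)

lemma overlap_momentum:
  "p * overlap n m - (\<zeta>\<^sub>1 * sqrt (m / 2) * overlap n (m - 1) + cnj \<zeta>\<^sub>1 * sqrt (Suc m / 2) * overlap n (Suc m))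
   = \<i> * (sqrt (n / 2) * overlap (n - 1) m - sqrt (Suc n / 2) * overlap (Suc n) m)"
proof -
  have "dframe m = (\<lambda>x. (\<i> * p) * frame m x - ((\<i> * \<zeta>\<^sub>1 * sqrt (m / 2)) * frame (m - 1) x
     + (\<i> * cnj \<zeta>\<^sub>1 * sqrt (Suc m / 2)) * frame (Suc m) x))"
    by (rule ext) (simp add: dframe_eq algebra_simps)
  then have 1: "pair (dframe m) (hermite_c n) = (\<i> * p) * overlap n m - ((\<i> * \<zeta>\<^sub>1 * sqrt (m / 2)) * overlap n (m - 1)
     + (\<i> * cnj \<zeta>\<^sub>1 * sqrt (Suc m / 2)) * overlap n (Suc m))"
    by (simp only:) (simp add: pair_add_left pair_diff_left L2_cmult L2_add L2_hermite_c L2_frame pair_cmult_left overlap_def)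
  have 2: "pair (frame m) (dhermite_c n) = sqrt (n / 2) * overlap (n - 1) m - sqrt (Suc n / 2) * overlap (Suc n) m"
    unfolding dhermite_c_def[abs_def]
    by (simp add: pair_diff_right L2_cmult L2_hermite_c L2_frame pair_cmult_right overlap_def)
  have "(- \<i>) * pair (dframe m) (hermite_c n) = \<i> * pair (frame m) (dhermite_c n)"
    unfolding pair_dframe by simp
  then show ?thesis unfolding 1 2 by (simp add: algebra_simps)
qed

text \<open>Adding \<open>- \<i>\<close> times the momentum relation to the position relation
  cancels the entry at \<open>Suc n\<close>. What remains is the hypothesis of the intertwining
  bounds, with coefficients linear in the frame data. So the constant \<open>K\<close> there only
  has to bound the squared sizes of \<open>\<zeta>\<close>, \<open>\<zeta>\<^sub>1\<close>,
  \<open>q\<close> and \<open>p\<close>.\<close>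

lemma overlap_raise:
  "complex_of_real (sqrt (real n)) * overlap (n - 1) m =
     ((\<zeta> + \<i> * \<zeta>\<^sub>1) / 2) * complex_of_real (sqrt (real m)) * overlap n (m - 1)
     + ((cnj \<zeta> + \<i> * cnj \<zeta>\<^sub>1) / 2) * complex_of_real (sqrt (real (Suc m))) * overlap n (Suc m)
     + ((q - \<i> * p) / sqrt 2) * overlap n m"
proof -
  define r where "r = complex_of_real (sqrt 2)"
  have r: "r * r = 2" "r \<noteq> 0" by (simp_all add: r_def flip: of_real_mult)
  have s: "complex_of_real (sqrt (k / 2)) = complex_of_real (sqrt k) / r" for k :: real
    by (simp add: r_def real_sqrt_divide)
  let ?a = "complex_of_real (sqrt (real n)) * overlap (n - 1) m" and ?b = "complex_of_real (sqrt (real (Suc n))) * overlap (Suc n) m"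
  let ?c = "complex_of_real (sqrt (real m)) * overlap n (m - 1)" and ?d = "complex_of_real (sqrt (real (Suc m))) * overlap n (Suc m)"
  let ?e = "overlap n m"
  have X: "q * ?e * r + \<zeta> * ?c + cnj \<zeta> * ?d = ?a + ?b"
    using arg_cong[OF overlap_position[of n m], of "\<lambda>z. z * r"] r(2) unfolding s by (simp add: algebra_simps)
  have P: "p * ?e * r - (\<zeta>\<^sub>1 * ?c + cnj \<zeta>\<^sub>1 * ?d) = \<i> * (?a - ?b)"
    using arg_cong[OF overlap_momentum[of n m], of "\<lambda>z. z * r"] r(2) unfolding s by (simp add: algebra_simps)
  have "2 * ?a = (?a + ?b) - \<i> * (\<i> * (?a - ?b))" by (simp add: algebra_simps)
  also have "\<dots> = (q - \<i> * p) * ?e * r + (\<zeta> + \<i> * \<zeta>\<^sub>1) * ?c + (cnj \<zeta> + \<i> * cnj \<zeta>\<^sub>1) * ?d"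
    unfolding X[symmetric] P[symmetric] by (simp add: algebra_simps)
  finally have 0: "2 * ?a = (q - \<i> * p) * ?e * r + (\<zeta> + \<i> * \<zeta>\<^sub>1) * ?c + (cnj \<zeta> + \<i> * cnj \<zeta>\<^sub>1) * ?d" .
  have 1: "?a = ((q - \<i> * p) * ?e * r + (\<zeta> + \<i> * \<zeta>\<^sub>1) * ?c + (cnj \<zeta> + \<i> * cnj \<zeta>\<^sub>1) * ?d) / 2"
    unfolding 0[symmetric] by simp
  have "r / 2 = 1 / r" using r by (simp add: field_simps)
  then have "(q - \<i> * p) * ?e * r / 2 = ((q - \<i> * p) / r) * ?e"
    by (metis mult.assoc mult.commute times_divide_eq_right mult.right_neutral)
  moreover have "z * ?c / 2 = z / 2 * complex_of_real (sqrt (real m)) * overlap n (m - 1)"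
    "z * ?d / 2 = z / 2 * complex_of_real (sqrt (real (Suc m))) * overlap n (Suc m)" for z
    by simp_all
  ultimately show ?thesis
    unfolding 1 r_def[symmetric] add_divide_distrib[of "_ * r + _"] add_divide_distrib[of "_ * r"] by (simp only: add_ac)
qed

lemma overlap_contraction:
  "(\<Sum>n<R. (cmod (\<Sum>m<N. overlap n m * b m))\<^sup>2) \<le> (\<Sum>m<N. (cmod (b m))\<^sup>2)"
proof -
  define f where "f = (\<lambda>x. \<Sum>m<N. b m * frame m x)"
  have f: "L2 f" unfolding f_def by (intro L2_sum L2_cmult L2_frame)
  have "pair f (hermite_c n) = (\<Sum>m<N. overlap n m * b m)" for n
    unfolding f_def overlap_def
    by (subst pair_sum_left) (auto intro: L2_cmult L2_frame L2_hermite_c simp: pair_cmult_left mult.commute)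
  then have "(\<Sum>n<R. (cmod (\<Sum>m<N. overlap n m * b m))\<^sup>2) \<le> (L2norm f)\<^sup>2"
    using bessel[OF L2_hermite_c pair_hermite_c f, of R] by simp
  also have "\<dots> = (\<Sum>m<N. (cmod (b m))\<^sup>2)"
    unfolding f_def by (rule L2norm_orthonormal_sum[OF L2_frame pair_frame_frame])
  finally show ?thesis .
qed

text \<open>Bessel's inequality for \<open>u\<close> minus its partial frame expansion; Parseval in
  the frame turns the squared norm of that difference into a tail of coefficients.\<close>

lemma overlap_remainder:
  assumes u: "L2 u"
  shows "(\<Sum>n<R. (cmod (pair u (hermite_c n) - (\<Sum>m<N. overlap n m * pair u (frame m))))\<^sup>2)
     \<le> (\<Sum>m. (cmod (pair u (frame m)))\<^sup>2) - (\<Sum>m<N. (cmod (pair u (frame m)))\<^sup>2)"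
proof -
  define f where "f = (\<lambda>x. \<Sum>m<N. pair u (frame m) * frame m x)"
  have f: "L2 f" unfolding f_def by (intro L2_sum L2_cmult L2_frame)
  have "pair f (hermite_c n) = (\<Sum>m<N. pair u (frame m) * overlap n m)" for n
    unfolding f_def overlap_def
    by (subst pair_sum_left) (auto intro: L2_cmult L2_frame L2_hermite_c simp: pair_cmult_left)
  then have fn: "pair f (hermite_c n) = (\<Sum>m<N. overlap n m * pair u (frame m))" for n
    by (simp only: mult.commute)
  have "pair (\<lambda>x. u x - f x) (hermite_c n) = pair u (hermite_c n) - (\<Sum>m<N. overlap n m * pair u (frame m))" for n
    by (simp add: pair_diff_left u f L2_hermite_c fn)
  then have "(\<Sum>n<R. (cmod (pair u (hermite_c n) - (\<Sum>m<N. overlap n m * pair u (frame m))))\<^sup>2) \<le> (L2norm (\<lambda>x. u x - f x))\<^sup>2"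
    using bessel[OF L2_hermite_c pair_hermite_c L2_diff[OF u f], of R] by simp
  also have "\<dots> = (L2norm u)\<^sup>2 - (\<Sum>m<N. (cmod (pair u (frame m)))\<^sup>2)"
    unfolding f_def by (subst orthonormal_expansion[OF L2_frame pair_frame_frame u]) simp
  also have "(L2norm u)\<^sup>2 = (\<Sum>m. (cmod (pair u (frame m)))\<^sup>2)"
    using parseval_frame[OF u] by (rule sums_unique)
  finally show ?thesis .
qed

text \<open>The phase space observable \<open>\<epsilon> X + \<delta> D\<close> applied to a frame function.\<close>
definition observable :: "real \<Rightarrow> real \<Rightarrow> nat \<Rightarrow> real \<Rightarrow> complex" where
  "observable \<epsilon> \<delta> m x = (\<epsilon> * q + \<delta> * p) * frame m x
     + ((\<epsilon> * \<zeta> - \<delta> * \<zeta>\<^sub>1) * sqrt (m / 2) * frame (m - 1) x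
      + cnj (\<epsilon> * \<zeta> - \<delta> * \<zeta>\<^sub>1) * sqrt (Suc m / 2) * frame (Suc m) x)"

lemma L2_observable: "L2 (observable \<epsilon> \<delta> m)"
  unfolding observable_def[abs_def] by (intro L2_add L2_cmult L2_frame)

lemma L2norm_frame [simp]: "L2norm (frame m) = 1"
proof -
  have "(L2norm (frame m))\<^sup>2 = 1" by (simp add: L2norm_sq pair_frame_frame)
  then show ?thesis using L2norm_nonneg[of "frame m"] by (simp add: power2_eq_1_iff)
qed

lemma L2norm_observable:
  "L2norm (observable \<epsilon> \<delta> m) \<le> \<bar>\<epsilon> * q + \<delta> * p\<bar> + cmod (\<epsilon> * \<zeta> - \<delta> * \<zeta>\<^sub>1) * (sqrt (m / 2) + sqrt (Suc m / 2))"
proof -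
  let ?\<eta> = "\<epsilon> * \<zeta> - \<delta> * \<zeta>\<^sub>1"
  have "L2norm (observable \<epsilon> \<delta> m) \<le> L2norm (\<lambda>x. complex_of_real (\<epsilon> * q + \<delta> * p) * frame m x)
     + (L2norm (\<lambda>x. (?\<eta> * sqrt (m / 2)) * frame (m - 1) x) + L2norm (\<lambda>x. (cnj ?\<eta> * sqrt (Suc m / 2)) * frame (Suc m) x))"
    unfolding observable_def[abs_def]
    by (intro order_trans[OF L2norm_triangle] add_left_mono L2norm_triangle L2_add L2_cmult L2_frame)
  also have "\<dots> = \<bar>\<epsilon> * q + \<delta> * p\<bar> + cmod ?\<eta> * (sqrt (m / 2) + sqrt (Suc m / 2))"
    unfolding L2norm_cmult norm_of_real norm_mult complex_mod_cnj by (simp add: distrib_left)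
  finally show ?thesis .
qed

lemma pair_observable:
  assumes "L2 u"
  shows "pair u (observable \<epsilon> \<delta> m) = (\<epsilon> * q + \<delta> * p) * pair u (frame m)
     + (cnj (\<epsilon> * \<zeta> - \<delta> * \<zeta>\<^sub>1) * sqrt (m / 2) * pair u (frame (m - 1))
      + (\<epsilon> * \<zeta> - \<delta> * \<zeta>\<^sub>1) * sqrt (Suc m / 2) * pair u (frame (Suc m)))"
  unfolding observable_def[abs_def] using assms
  by (simp add: pair_add_right L2_add L2_cmult L2_frame pair_cmult_right)

lemma pair_hermite_observable:
  "pair (hermite_c n) (observable \<epsilon> \<delta> m) =
    cnj ((\<epsilon> + \<i> * \<delta>) * sqrt (n / 2) * overlap (n - 1) m + (\<epsilon> - \<i> * \<delta>) * sqrt (Suc n / 2) * overlap (Suc n) m)"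
proof -
  have c: "pair (hermite_c n) (frame k) = cnj (overlap n k)" for k by (simp add: overlap_def pair_cnj)
  have "pair (hermite_c n) (observable \<epsilon> \<delta> m) = cnj (\<epsilon> * (q * overlap n m + \<zeta> * sqrt (m / 2) * overlap n (m - 1) + cnj \<zeta> * sqrt (Suc m / 2) * overlap n (Suc m))
     + \<delta> * (p * overlap n m - (\<zeta>\<^sub>1 * sqrt (m / 2) * overlap n (m - 1) + cnj \<zeta>\<^sub>1 * sqrt (Suc m / 2) * overlap n (Suc m))))"
    unfolding pair_observable[OF L2_hermite_c] c by (simp add: algebra_simps)
  also have "\<dots> = cnj ((\<epsilon> + \<i> * \<delta>) * sqrt (n / 2) * overlap (n - 1) m + (\<epsilon> - \<i> * \<delta>) * sqrt (Suc n / 2) * overlap (Suc n) m)"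
    unfolding overlap_position overlap_momentum by (simp add: algebra_simps)
  finally show ?thesis .
qed

text \<open>Against the fixed basis the observable has two bands, with entries of size
  \<open>sqrt (\<epsilon>^2 + \<delta>^2)\<close> times at most \<open>sqrt (n + 1)\<close>, and
  column \<open>m\<close> of the overlap matrix has \<open>l2\<close> norm at most 1. The bound is
  therefore free of \<open>m\<close> and of all squeezing parameters.\<close>

lemma observable_low_modes:
  "cmod (\<Sum>n<N. d n * pair (hermite_c n) (observable \<epsilon> \<delta> m))
     \<le> 2 * sqrt (\<epsilon>\<^sup>2 + \<delta>\<^sup>2) * sqrt (\<Sum>n<N. real (Suc n) * (cmod (d n))\<^sup>2)"
proof -
  define S where "S = sqrt (\<Sum>n<N. real (Suc n) * (cmod (d n))\<^sup>2)"
  have S0: "S \<ge> 0" unfolding S_def by (intro real_sqrt_ge_zero sum_nonneg) auto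
  have ov: "(\<Sum>n<k. (cmod (overlap n m))\<^sup>2) \<le> 1" for k
    using bessel[OF L2_hermite_c pair_hermite_c L2_frame[of m], where N = k] by (simp add: overlap_def)
  define a1 where "a1 = (\<lambda>n. d n * sqrt (n / 2))"
  define b1 where "b1 = (\<lambda>n. if n = 0 then 0 else cnj (overlap (n - 1) m))"
  define a2 where "a2 = (\<lambda>n. d n * sqrt (Suc n / 2))"
  define b2 where "b2 = (\<lambda>n. cnj (overlap (Suc n) m))"
  have "(\<Sum>n<N. d n * pair (hermite_c n) (observable \<epsilon> \<delta> m)) =
     (\<Sum>n<N. (\<epsilon> - \<i> * \<delta>) * (a1 n * b1 n) + (\<epsilon> + \<i> * \<delta>) * (a2 n * b2 n))"
    by (rule sum.cong) (auto simp: pair_hermite_observable a1_def b1_def a2_def b2_def algebra_simps)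
  also have "\<dots> = (\<epsilon> - \<i> * \<delta>) * (\<Sum>n<N. a1 n * b1 n) + (\<epsilon> + \<i> * \<delta>) * (\<Sum>n<N. a2 n * b2 n)"
    by (simp only: sum.distrib sum_distrib_left)
  finally have eq: "(\<Sum>n<N. d n * pair (hermite_c n) (observable \<epsilon> \<delta> m)) = \<dots>" .
  have k: "cmod (\<epsilon> - \<i> * \<delta>) = sqrt (\<epsilon>\<^sup>2 + \<delta>\<^sup>2)" "cmod (\<epsilon> + \<i> * \<delta>) = sqrt (\<epsilon>\<^sup>2 + \<delta>\<^sup>2)"
    by (simp_all add: cmod_def)
  have A1: "cmod (\<Sum>n<N. a1 n * b1 n) \<le> S * 1"
  proof (rule order_trans[OF sum_mult_norm_le_sqrt mult_mono])
    show "sqrt (\<Sum>n<N. (cmod (a1 n))\<^sup>2) \<le> S" unfolding S_def a1_def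
    proof (intro real_sqrt_le_mono sum_mono)
      fix n show "(cmod (d n * sqrt (n / 2)))\<^sup>2 \<le> real (Suc n) * (cmod (d n))\<^sup>2"
        using mult_right_mono[of "real n / 2" "real (Suc n)" "(cmod (d n))\<^sup>2", OF _ zero_le_power2]
        by (simp add: norm_mult power_mult_distrib mult.commute)
    qed
    have "(\<Sum>n<N. (cmod (b1 n))\<^sup>2) \<le> (\<Sum>n<Suc N. (cmod (b1 n))\<^sup>2)" by simp
    also have "\<dots> = (\<Sum>n<N. (cmod (overlap n m))\<^sup>2)"
      by (subst sum.lessThan_Suc_shift) (simp add: b1_def)
    finally show "sqrt (\<Sum>n<N. (cmod (b1 n))\<^sup>2) \<le> 1" using ov[of N] by simp
  qed (use S0 in \<open>auto intro!: real_sqrt_ge_zero sum_nonneg\<close>)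
  have A2: "cmod (\<Sum>n<N. a2 n * b2 n) \<le> S * 1"
  proof (rule order_trans[OF sum_mult_norm_le_sqrt mult_mono])
    show "sqrt (\<Sum>n<N. (cmod (a2 n))\<^sup>2) \<le> S" unfolding S_def a2_def
      by (intro real_sqrt_le_mono sum_mono) (simp add: norm_mult power_mult_distrib mult.commute mult_right_mono)
    have "(\<Sum>n<N. (cmod (b2 n))\<^sup>2) \<le> (cmod (overlap 0 m))\<^sup>2 + (\<Sum>n<N. (cmod (overlap (Suc n) m))\<^sup>2)"
      by (simp add: b2_def)
    also have "\<dots> = (\<Sum>n<Suc N. (cmod (overlap n m))\<^sup>2)" by (rule sum.lessThan_Suc_shift[symmetric])
    finally show "sqrt (\<Sum>n<N. (cmod (b2 n))\<^sup>2) \<le> 1" using ov[of "Suc N"] by simp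
  qed (use S0 in \<open>auto intro!: real_sqrt_ge_zero sum_nonneg\<close>)
  have "cmod (\<Sum>n<N. d n * pair (hermite_c n) (observable \<epsilon> \<delta> m))
     \<le> sqrt (\<epsilon>\<^sup>2 + \<delta>\<^sup>2) * S + sqrt (\<epsilon>\<^sup>2 + \<delta>\<^sup>2) * S"
    unfolding eq using A1 A2
    by (intro order_trans[OF norm_triangle_ineq] add_mono) (simp_all add: norm_mult k mult_left_mono)
  then show ?thesis by (simp add: S_def)
qed

text \<open>The partial Hermite sum of \<open>u\<close> meets the observable in its fixed-basis
  form, where low modes contribute little; the remainder meets it in its frame form, where its norm
  is at most \<open>Q\<close>. Combining both descriptions yields a bound in which the squeezing
  enters only through \<open>G0\<close> and \<open>Q\<close>.\<close>

lemma observable_lower_bound: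
  fixes G0 Q s :: real
  assumes u: "L2 u" and s: "s > 0"
    and pos: "G0 > 0" "\<epsilon>\<^sup>2 + \<delta>\<^sup>2 > 0" "Q > 0" "L2norm u > 0"
    and sums: "summable (\<lambda>n. (real n + 1/2) powr s * (cmod (pair u (hermite_c n)))\<^sup>2)"
    and G: "G0 \<le> cmod (pair u (observable \<epsilon> \<delta> m))" and Q: "L2norm (observable \<epsilon> \<delta> m) \<le> Q"
  shows "(G0\<^sup>2 / (32 * (\<epsilon>\<^sup>2 + \<delta>\<^sup>2) * (L2norm u)\<^sup>2)) powr s * (G0 / (2 * Q))\<^sup>2
      \<le> (\<Sum>n. (real n + 1/2) powr s * (cmod (pair u (hermite_c n)))\<^sup>2)"
proof -
  define d where "d = (\<lambda>n. pair u (hermite_c n))"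
  have par: "(\<lambda>n. (cmod (d n))\<^sup>2) sums (L2norm u)\<^sup>2" unfolding d_def by (rule parseval_hermite[OF u])
  have "(G0\<^sup>2 / (32 * (sqrt (\<epsilon>\<^sup>2 + \<delta>\<^sup>2))\<^sup>2 * (L2norm u)\<^sup>2)) powr s * (G0 / (2 * Q))\<^sup>2
      \<le> (\<Sum>n. (real n + 1/2) powr s * (cmod (d n))\<^sup>2)"
  proof (rule weighted_sum_lower_bound[OF s])
    show "summable (\<lambda>n. (cmod (d n))\<^sup>2)" "(\<Sum>n. (cmod (d n))\<^sup>2) = (L2norm u)\<^sup>2"
      using par by (auto simp: sums_iff)
    fix N
    define S where "S = (\<lambda>x. \<Sum>n<N. d n * hermite_c n x)"
    have S: "L2 S" unfolding S_def by (intro L2_sum L2_cmult L2_hermite_c)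
    have "pair u (observable \<epsilon> \<delta> m) = pair S (observable \<epsilon> \<delta> m) + pair (\<lambda>x. u x - S x) (observable \<epsilon> \<delta> m)"
      by (simp add: pair_diff_left u S L2_observable)
    then have "G0 \<le> cmod (pair S (observable \<epsilon> \<delta> m)) + cmod (pair (\<lambda>x. u x - S x) (observable \<epsilon> \<delta> m))"
      using G norm_triangle_ineq by (metis order_trans)
    also have "cmod (pair S (observable \<epsilon> \<delta> m)) \<le> 2 * sqrt (\<epsilon>\<^sup>2 + \<delta>\<^sup>2) * sqrt (\<Sum>n<N. real (Suc n) * (cmod (d n))\<^sup>2)"
    proof -
      have "pair S (observable \<epsilon> \<delta> m) = (\<Sum>n<N. d n * pair (hermite_c n) (observable \<epsilon> \<delta> m))"
        unfolding S_def by (subst pair_sum_left) (auto intro: L2_cmult L2_hermite_c L2_observable simp: pair_cmult_left)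
      then show ?thesis using observable_low_modes by simp
    qed
    also have "cmod (pair (\<lambda>x. u x - S x) (observable \<epsilon> \<delta> m)) \<le> sqrt ((\<Sum>n. (cmod (d n))\<^sup>2) - (\<Sum>n<N. (cmod (d n))\<^sup>2)) * Q"
    proof -
      have "(L2norm (\<lambda>x. u x - S x))\<^sup>2 = (\<Sum>n. (cmod (d n))\<^sup>2) - (\<Sum>n<N. (cmod (d n))\<^sup>2)"
        unfolding S_def using par
        by (subst orthonormal_expansion[OF L2_hermite_c pair_hermite_c u]) (simp add: d_def sums_iff)
      then have "L2norm (\<lambda>x. u x - S x) = sqrt ((\<Sum>n. (cmod (d n))\<^sup>2) - (\<Sum>n<N. (cmod (d n))\<^sup>2))"
        by (metis L2norm_nonneg real_sqrt_abs abs_of_nonneg)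
      moreover have "L2norm (\<lambda>x. u x - S x) * L2norm (observable \<epsilon> \<delta> m) \<le> L2norm (\<lambda>x. u x - S x) * Q"
        using Q by (rule mult_left_mono) simp
      ultimately show ?thesis
        using cauchy_schwarz_pair[OF L2_diff[OF u S] L2_observable[of \<epsilon> \<delta> m]] by simp
    qed
    finally show "G0 \<le> 2 * sqrt (\<epsilon>\<^sup>2 + \<delta>\<^sup>2) * sqrt (\<Sum>n<N. real (Suc n) * (cmod (d n))\<^sup>2)
        + sqrt ((\<Sum>n. (cmod (d n))\<^sup>2) - (\<Sum>n<N. (cmod (d n))\<^sup>2)) * Q" by simp
  qed (use pos sums in \<open>auto simp: d_def\<close>)
  then show ?thesis using pos(2) by (simp add: d_def)
qed

end

subsection \<open>The resonant drive\<close>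

lemma deriv_bounds:
  fixes F F' :: "real \<Rightarrow> real"
  assumes "a \<le> b" "{a..b} \<subseteq> S"
    and F: "\<And>x. a \<le> x \<Longrightarrow> x \<le> b \<Longrightarrow> (F has_real_derivative F' x) (at x within S)"
    and b: "\<And>x. a \<le> x \<Longrightarrow> x \<le> b \<Longrightarrow> lo \<le> F' x \<and> F' x \<le> hi"
  shows "lo * (b - a) \<le> F b - F a" "F b - F a \<le> hi * (b - a)"
proof -
  have "lo * (b - a) \<le> F b - F a \<and> F b - F a \<le> hi * (b - a)"
  proof (cases "a = b")
    case False
    then have "a < b" using assms by simp
    have "\<exists>x\<in>{a<..<b}. F b - F a = (\<lambda>h. h * F' x) (b - a)"
    proof (rule mvt_simple[OF \<open>a < b\<close>])
      fix x assume "a \<le> x" "x \<le> b"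
      then have "(F has_real_derivative F' x) (at x within {a..b})"
        using F DERIV_subset assms(2) by blast
      then show "(F has_derivative (\<lambda>h. h * F' x)) (at x within {a..b})"
        by (simp add: has_field_derivative_def mult.commute[of _ "F' x"])
    qed
    then obtain x where "x \<in> {a<..<b}" "F b - F a = (b - a) * F' x" by auto
    then show ?thesis using b[of x] \<open>a < b\<close> by (auto simp: mult.commute intro!: mult_left_mono)
  qed simp
  then show "lo * (b - a) \<le> F b - F a" "F b - F a \<le> hi * (b - a)" by auto
qed

lemma deriv_nonneg_mono:
  fixes F :: "real \<Rightarrow> real"
  assumes "t0 \<le> a" "a \<le> b"
    and F: "\<And>x. x \<ge> t0 \<Longrightarrow> (F has_real_derivative F' x) (at x within {t0..})"
    and b: "\<And>x. x \<ge> a \<Longrightarrow> 0 \<le> F' x"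
  shows "F a \<le> F b"
proof -
  have "(F has_real_derivative F' x) (at x within {a..b})" if "a \<le> x" "x \<le> b" for x
    by (rule DERIV_subset[OF F]) (use that assms in auto)
  show ?thesis
  proof (cases "a = b")
    case False
    then have "a < b" using assms by simp
    have "\<exists>x\<in>{a<..<b}. F b - F a = (\<lambda>h. h * F' x) (b - a)"
    proof (rule mvt_simple[OF \<open>a < b\<close>])
      fix x assume "a \<le> x" "x \<le> b"
      then have "(F has_real_derivative F' x) (at x within {a..b})" 
        by (intro DERIV_subset[OF F]) (use assms in auto)
      then show "(F has_derivative (\<lambda>h. h * F' x)) (at x within {a..b})"
        by (simp add: has_field_derivative_def mult.commute[of _ "F' x"])
    qed
    then obtain x where x: "x \<in> {a<..<b}" "F b - F a = (b - a) * F' x" by auto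
    have "0 \<le> (b - a) * F' x" using x b[of x] \<open>a < b\<close> by (intro mult_nonneg_nonneg) auto
    then show ?thesis using x by simp
  qed simp
qed

lemma deriv_compare:
  fixes F G :: "real \<Rightarrow> real"
  assumes "t0 \<le> a" "a \<le> b"
    and F: "\<And>x. x \<ge> t0 \<Longrightarrow> (F has_real_derivative F' x) (at x within {t0..})"
    and G: "\<And>x. x \<ge> t0 \<Longrightarrow> (G has_real_derivative G' x) (at x within {t0..})"
    and b: "\<And>x. x \<ge> a \<Longrightarrow> \<bar>F' x\<bar> \<le> G' x"
  shows "\<bar>F b - F a\<bar> \<le> G b - G a"
proof -
  have "G a - F a \<le> G b - F b"
    by (rule deriv_nonneg_mono[where F = "\<lambda>x. G x - F x" and F' = "\<lambda>x. G' x - F' x" and ?t0.0 = t0, OF assms(1,2)])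
       (use F G b abs_le_D1 in \<open>auto intro: DERIV_diff simp: abs_le_iff\<close>)
  moreover have "G a + F a \<le> G b + F b"
    by (rule deriv_nonneg_mono[where F = "\<lambda>x. G x + F x" and F' = "\<lambda>x. G' x + F' x" and ?t0.0 = t0, OF assms(1,2)])
       (use F G b in \<open>auto intro: DERIV_add simp: abs_le_iff\<close>, smt (verit) b)
  ultimately show ?thesis by (simp add: abs_le_iff)
qed

lemma deriv_eq_imp_eq:
  fixes F G :: "real \<Rightarrow> real"
  assumes "t0 \<le> t" "F t0 = G t0"
    and F: "\<And>x. x \<ge> t0 \<Longrightarrow> (F has_real_derivative D x) (at x within {t0..})"
    and G: "\<And>x. x \<ge> t0 \<Longrightarrow> (G has_real_derivative D x) (at x within {t0..})"
  shows "F t = G t"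
proof -
  have "\<bar>(F t - G t) - (F t0 - G t0)\<bar> \<le> 0 - 0"
  proof (rule deriv_compare[where F = "\<lambda>x. F x - G x" and F' = "\<lambda>x. 0" and G = "\<lambda>x. 0" and G' = "\<lambda>x. 0"])
    show "((\<lambda>x. F x - G x) has_real_derivative 0) (at x within {t0..})" if "x \<ge> t0" for x
      using DERIV_diff[OF F[OF that] G[OF that]] by simp
  qed (use assms in auto)
  then show ?thesis using assms by simp
qed

lemma half_line_antiderivative:
  fixes f :: "real \<Rightarrow> real"
  assumes "continuous_on {t0..} f"
  obtains F where "F t0 = 0" "\<And>t. t \<ge> t0 \<Longrightarrow> (F has_real_derivative f t) (at t within {t0..})"
proof (rule that[of "\<lambda>t. integral {t0..t} f"])
  fix t assume t: "t \<ge> t0"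
  have "((\<lambda>t. integral {t0..t} f) has_real_derivative f t) (at t within {t0..t + 1})"
    by (rule integral_has_real_derivative) (use t assms in \<open>auto intro: continuous_on_subset\<close>)
  moreover have "at t within {t0..t + 1} = at t within {t0..}"
    by (rule at_within_nhd[of _ "{..<t + 1}"]) (use t in auto)
  ultimately show "((\<lambda>t. integral {t0..t} f) has_real_derivative f t) (at t within {t0..})" by simp
qed simp

lemma has_real_derivative_shift:
  fixes F :: "real \<Rightarrow> real"
  assumes "(F has_real_derivative D) (at (t + a) within {t0..})" "a \<ge> 0" "t \<ge> t0"
  shows "((\<lambda>s. F (s + a)) has_real_derivative D) (at t within {t0..})"
proof -
  have "((F \<circ> (\<lambda>s. s + a)) has_real_derivative D * 1) (at t within {t0..})"
  proof (rule DERIV_image_chain)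
    show "(F has_real_derivative D) (at (t + a) within (\<lambda>s. s + a) ` {t0..})"
      by (rule DERIV_subset[OF assms(1)]) (use assms in auto)
    show "((\<lambda>s. s + a) has_real_derivative 1) (at t within {t0..})" by (auto intro!: derivative_eq_intros)
  qed
  then show ?thesis by (simp add: o_def)
qed

text \<open>If \<open>F'' = k\<close>, this is the average of \<open>k (t + a + b)\<close> over
  \<open>a\<close> and \<open>b\<close> in the unit interval. It keeps bounds and monotonicity of
  \<open>k\<close> and is two derivatives smoother, and its derivatives are again second
  differences.\<close>

definition second_diff :: "(real \<Rightarrow> real) \<Rightarrow> real \<Rightarrow> real" where
  "second_diff F t = F (t + 2) - 2 * F (t + 1) + F t"

lemma second_diff_has_derivative:
  assumes "\<And>t. t \<ge> t0 \<Longrightarrow> (F has_real_derivative F' t) (at t within {t0..})" "t \<ge> t0"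
  shows "(second_diff F has_real_derivative second_diff F' t) (at t within {t0..})"
proof -
  have sh: "((\<lambda>s. F (s + a)) has_real_derivative F' (t + a)) (at t within {t0..})" if "a \<ge> 0" for a
    by (rule has_real_derivative_shift) (use assms that in auto)
  have "((\<lambda>t. F (t + 2) - 2 * F (t + 1) + F t) has_real_derivative F' (t + 2) - 2 * F' (t + 1) + F' t) (at t within {t0..})"
    by (intro DERIV_add DERIV_diff DERIV_cmult sh assms) auto
  then show ?thesis by (simp add: second_diff_def[abs_def])
qed

lemma second_diff_bounds:
  assumes F: "\<And>t. t \<ge> t0 \<Longrightarrow> (F has_real_derivative F1 t) (at t within {t0..})"
    and F1: "\<And>t. t \<ge> t0 \<Longrightarrow> (F1 has_real_derivative F2 t) (at t within {t0..})"
    and t: "t \<ge> t0" and b: "\<And>x. t \<le> x \<Longrightarrow> x \<le> t + 2 \<Longrightarrow> lo \<le> F2 x \<and> F2 x \<le> hi"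
  shows "lo \<le> second_diff F t" "second_diff F t \<le> hi"
proof -
  have K: "((\<lambda>s. F (s + 1) - F s) has_real_derivative F1 (s + 1) - F1 s) (at s within {t0..})" if "s \<ge> t0" for s
    by (intro DERIV_diff has_real_derivative_shift F) (use that in auto)
  have K1: "lo \<le> F1 (s + 1) - F1 s \<and> F1 (s + 1) - F1 s \<le> hi" if "t \<le> s" "s \<le> t + 1" for s
    using deriv_bounds[of s "s + 1" "{t0..}" F1 F2 lo hi] F1 b t that by auto
  have "lo * (t + 1 - t) \<le> (F (t + 1 + 1) - F (t + 1)) - (F (t + 1) - F t)"
     "(F (t + 1 + 1) - F (t + 1)) - (F (t + 1) - F t) \<le> hi * (t + 1 - t)"
    by (rule deriv_bounds[of t "t + 1" "{t0..}" "\<lambda>s. F (s + 1) - F s" "\<lambda>s. F1 (s + 1) - F1 s"]; use K K1 t in auto)+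
  then show "lo \<le> second_diff F t" "second_diff F t \<le> hi" by (simp_all add: second_diff_def add.assoc)
qed

text \<open>Integration by parts against the bounded primitive \<open>w\<close> of \<open>k\<close>.
  Monotonicity of \<open>m\<close> makes its total variation equal to \<open>|m t - m s|\<close>, so
  nothing grows with the length of the interval. For nonnegative \<open>m\<close> the bound is the
  larger of the two endpoint values.\<close>

lemma oscillatory_integral:
  fixes m w I :: "real \<Rightarrow> real"
  assumes m: "\<And>t. t \<ge> t0 \<Longrightarrow> (m has_real_derivative m1 t) (at t within {t0..})"
    and sgn: "(\<forall>t\<ge>t0. m1 t \<ge> 0) \<or> (\<forall>t\<ge>t0. m1 t \<le> 0)"
    and w: "\<And>t. t \<ge> t0 \<Longrightarrow> (w has_real_derivative k t) (at t within {t0..})" "\<And>t. \<bar>w t\<bar> \<le> 1/2"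
    and I: "\<And>t. t \<ge> t0 \<Longrightarrow> (I has_real_derivative m t * k t) (at t within {t0..})"
    and st: "t0 \<le> s" "s \<le> t"
  shows "\<bar>I t - I s\<bar> \<le> (\<bar>m t\<bar> + \<bar>m s\<bar> + \<bar>m t - m s\<bar>) / 2"
proof -
  define B where "B = (\<lambda>t. I t - m t * w t)"
  have B: "(B has_real_derivative - (m1 t * w t)) (at t within {t0..})" if "t \<ge> t0" for t
  proof -
    have "(B has_real_derivative m t * k t - (m1 t * w t + k t * m t)) (at t within {t0..})"
      unfolding B_def by (intro DERIV_diff DERIV_mult I m w that)
    then show ?thesis by (simp add: algebra_simps)
  qed
  have bd: "\<bar>- (m1 x * w x)\<bar> \<le> \<bar>m1 x\<bar> / 2" for x
    using mult_left_mono[OF w(2)[of x], of "\<bar>m1 x\<bar>"] by (simp add: abs_mult)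
  have "\<bar>B t - B s\<bar> \<le> \<bar>m t - m s\<bar> / 2"
    using sgn
  proof
    assume sg: "\<forall>t\<ge>t0. m1 t \<ge> 0"
    have "\<bar>B t - B s\<bar> \<le> m t / 2 - m s / 2"
    proof (rule deriv_compare[OF st B])
      show "((\<lambda>x. m x / 2) has_real_derivative m1 x / 2) (at x within {t0..})" if "x \<ge> t0" for x
        by (intro DERIV_cdivide m that)
      show "\<bar>- (m1 x * w x)\<bar> \<le> m1 x / 2" if "x \<ge> s" for x using bd[of x] sg st that by auto
    qed
    then have "\<bar>B t - B s\<bar> \<le> (m t - m s) / 2" by (simp add: diff_divide_distrib)
    also have "\<dots> \<le> \<bar>m t - m s\<bar> / 2" by (rule divide_right_mono; arith)
    finally show ?thesis .
  next
    assume sg: "\<forall>t\<ge>t0. m1 t \<le> 0"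
    have "\<bar>B t - B s\<bar> \<le> (- m t / 2) - (- m s / 2)"
    proof (rule deriv_compare[OF st B])
      show "((\<lambda>x. - m x / 2) has_real_derivative - m1 x / 2) (at x within {t0..})" if "x \<ge> t0" for x
        by (intro DERIV_cdivide DERIV_minus m that)
      show "\<bar>- (m1 x * w x)\<bar> \<le> - m1 x / 2" if "x \<ge> s" for x using bd[of x] sg st that by auto
    qed
    then have "\<bar>B t - B s\<bar> \<le> (m s - m t) / 2" by (simp add: diff_divide_distrib)
    also have "\<dots> \<le> \<bar>m t - m s\<bar> / 2" by (rule divide_right_mono; arith)
    finally show ?thesis .
  qed
  moreover have "\<bar>m x * w x\<bar> \<le> \<bar>m x\<bar> / 2" for x
    using mult_left_mono[OF w(2)[of x], of "\<bar>m x\<bar>"] by (simp add: abs_mult)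
  then have "\<bar>m t * w t\<bar> \<le> \<bar>m t\<bar> / 2" "\<bar>m s * w s\<bar> \<le> \<bar>m s\<bar> / 2" by auto
  moreover have "I t - I s = (B t - B s) + (m t * w t - m s * w s)" by (simp add: B_def)
  then have "\<bar>I t - I s\<bar> \<le> \<bar>B t - B s\<bar> + (\<bar>m t * w t\<bar> + \<bar>m s * w s\<bar>)"
    by (simp only:)
  ultimately have "\<bar>I t - I s\<bar> \<le> \<bar>m t - m s\<bar> / 2 + (\<bar>m t\<bar> / 2 + \<bar>m s\<bar> / 2)"
    by (meson add_mono order_trans)
  then show ?thesis by (simp add: add_divide_distrib add_ac)
qed

text \<open>What the dynamics needs from the potential. The equation of \<open>v\<close> is linear
  with homogeneous solution \<open>exp (2 g)\<close>, so the bound by \<open>h\<close> singles out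
  one solution, and that one makes the second Hill solution decay like \<open>exp (- g)\<close>.
  Through \<open>f_bounds\<close> the size \<open>exp (2 g)\<close> can be replaced by
  \<open>f\<close>.\<close>

locale parametric_drive =
  fixes t0 :: real and f h h1 g v :: "real \<Rightarrow> real" and C :: real
  assumes t0_pos: "t0 > 0"
    and h_deriv: "\<And>t. t \<ge> t0 \<Longrightarrow> (h has_real_derivative h1 t) (at t within {t0..})"
    and h1_nonpos: "\<And>t. t \<ge> t0 \<Longrightarrow> h1 t \<le> 0" and h_nonneg: "\<And>t. t \<ge> t0 \<Longrightarrow> 0 \<le> h t"
    and h_lim: "(h \<longlongrightarrow> 0) at_top"
    and g_deriv: "\<And>t. t \<ge> t0 \<Longrightarrow> (g has_real_derivative h t * (cos t)\<^sup>2) (at t within {t0..})"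
    and g_init: "g t0 = 0"
    and v_deriv: "\<And>t. t \<ge> t0 \<Longrightarrow>
      (v has_real_derivative 2 * h t * cos t * (sin t + cos t * v t)) (at t within {t0..})"
    and v_bound: "\<And>t. t \<ge> t0 \<Longrightarrow> \<bar>v t\<bar> \<le> h t"
    and C_ge_1: "C \<ge> 1"
    and f_bounds: "\<And>t. t \<ge> t0 \<Longrightarrow> exp (2 * g t) / C \<le> f t \<and> f t \<le> C * exp (2 * g t)"

text \<open>Solved from \<open>y'' + (1 + drive) y = 0\<close> for \<open>y = exp g cos t\<close>; the function \<open>v\<close> above makes
  \<open>exp (- g) (sin t + v cos t)\<close> a second solution.\<close>
definition drive :: "(real \<Rightarrow> real) \<Rightarrow> (real \<Rightarrow> real) \<Rightarrow> real \<Rightarrow> real" where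
  "drive h h1 t = - ((h t)\<^sup>2 * cos t ^ 4 + h1 t * (cos t)\<^sup>2 - 4 * h t * cos t * sin t)"

lemma C2_on_drive:
  assumes h: "\<And>t. t \<ge> t0 \<Longrightarrow> (h has_real_derivative h1 t) (at t within {t0..})"
    and h1: "\<And>t. t \<ge> t0 \<Longrightarrow> (h1 has_real_derivative h2 t) (at t within {t0..})"
    and h2: "\<And>t. t \<ge> t0 \<Longrightarrow> (h2 has_real_derivative h3 t) (at t within {t0..})"
    and h3: "continuous_on {t0..} h3"
  shows "C2_on {t0..} (drive h h1)"
  unfolding C2_on_def
proof (intro exI conjI ballI)
  let ?c = cos and ?s = sin
  define d1 where "d1 = (\<lambda>t. - (2 * h t * h1 t * ?c t ^ 4 - 4 * (h t)\<^sup>2 * ?c t ^ 3 * ?s t + h2 t * (?c t)\<^sup>2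
      - 6 * h1 t * ?c t * ?s t - 4 * h t * ((?c t)\<^sup>2 - (?s t)\<^sup>2)))"
  define d2 where "d2 = (\<lambda>t. - (2 * ((h1 t)\<^sup>2 + h t * h2 t) * ?c t ^ 4 - 16 * h t * h1 t * ?c t ^ 3 * ?s t
      - 4 * (h t)\<^sup>2 * (?c t ^ 4 - 3 * (?c t)\<^sup>2 * (?s t)\<^sup>2) + h3 t * (?c t)\<^sup>2 - 8 * h2 t * ?c t * ?s t
      - 10 * h1 t * ((?c t)\<^sup>2 - (?s t)\<^sup>2) + 16 * h t * ?c t * ?s t))"
  have pw: "x ^ 4 = x * x * x * x" "x ^ 3 = x * x * x" for x :: real by (simp_all add: numeral_eq_Suc)
  fix t :: real assume "t \<in> {t0..}"
  then have t: "t \<ge> t0" by simp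
  show "(drive h h1 has_real_derivative d1 t) (at t within {t0..})"
    unfolding drive_def[abs_def]
    by (rule derivative_eq_intros h h1 t refl)+ (simp add: d1_def pw power2_eq_square algebra_simps)
  show "(d1 has_real_derivative d2 t) (at t within {t0..})"
    unfolding d1_def
    by (rule derivative_eq_intros h h1 h2 t refl)+ (simp add: d2_def pw power2_eq_square algebra_simps)
next
  have "continuous_on {t0..} h" "continuous_on {t0..} h1" "continuous_on {t0..} h2"
    using h h1 h2 by (auto intro!: DERIV_continuous_on)
  then show "continuous_on {t0..} (\<lambda>t. - (2 * ((h1 t)\<^sup>2 + h t * h2 t) * cos t ^ 4 - 16 * h t * h1 t * cos t ^ 3 * sin t
      - 4 * (h t)\<^sup>2 * (cos t ^ 4 - 3 * (cos t)\<^sup>2 * (sin t)\<^sup>2) + h3 t * (cos t)\<^sup>2 - 8 * h2 t * cos t * sin t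
      - 10 * h1 t * ((cos t)\<^sup>2 - (sin t)\<^sup>2) + 16 * h t * cos t * sin t))"
    using h3 by (intro continuous_intros)
qed

lemma drive_tendsto_0:
  assumes "(h \<longlongrightarrow> 0) at_top" "(h1 \<longlongrightarrow> 0) at_top"
  shows "(drive h h1 \<longlongrightarrow> 0) at_top"
proof (rule Lim_null_comparison)
  have "((\<lambda>t. (h t)\<^sup>2 + \<bar>h1 t\<bar> + 4 * \<bar>h t\<bar>) \<longlongrightarrow> 0\<^sup>2 + \<bar>0\<bar> + 4 * \<bar>0\<bar>) at_top"
    by (intro tendsto_intros assms)
  then show "((\<lambda>t. (h t)\<^sup>2 + \<bar>h1 t\<bar> + 4 * \<bar>h t\<bar>) \<longlongrightarrow> 0) at_top" by simp
  have "norm (drive h h1 t) \<le> (h t)\<^sup>2 + \<bar>h1 t\<bar> + 4 * \<bar>h t\<bar>" for t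
  proof -
    have c: "\<bar>cos t\<bar> \<le> 1" "\<bar>sin t\<bar> \<le> 1" by auto
    have "\<bar>(h t)\<^sup>2 * cos t ^ 4\<bar> \<le> (h t)\<^sup>2"
    proof -
      have "cos t ^ 4 \<le> 1" using power_le_one[of "\<bar>cos t\<bar>" 4] c by simp
      moreover have "0 \<le> cos t ^ 4" by (rule zero_le_even_power) simp
      ultimately show ?thesis by (simp add: abs_mult mult_left_le)
    qed
    moreover have "\<bar>h1 t * (cos t)\<^sup>2\<bar> \<le> \<bar>h1 t\<bar>"
      using c mult_left_le[of "(cos t)\<^sup>2" "\<bar>h1 t\<bar>"] by (simp add: abs_mult abs_square_le_1)
    moreover have "\<bar>4 * h t * cos t * sin t\<bar> \<le> 4 * \<bar>h t\<bar>"
    proof -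
      have "\<bar>cos t * sin t\<bar> \<le> 1 * 1" unfolding abs_mult using c by (intro mult_mono) auto
      then have "4 * \<bar>h t\<bar> * \<bar>cos t * sin t\<bar> \<le> 4 * \<bar>h t\<bar> * 1" by (intro mult_left_mono) auto
      then show ?thesis by (simp add: abs_mult mult.assoc)
    qed
    ultimately show ?thesis unfolding drive_def real_norm_def by linarith
  qed
  then show "\<forall>\<^sub>F t in at_top. norm (drive h h1 t) \<le> (h t)\<^sup>2 + \<bar>h1 t\<bar> + 4 * \<bar>h t\<bar>" by simp
qed

text \<open>\<open>vector_derivative\<close> is a choice; it is determined here because the filter
  \<open>at t within {t0..}\<close> is nontrivial, also at the left endpoint.\<close>

lemma dR_eqI:
  assumes "t \<ge> t0" "(f has_real_derivative D) (at t within {t0..})"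
  shows "dR t0 f t = D"
  unfolding dR_def
proof (rule vector_derivative_within)
  have "at t within {t<..} \<le> at t within {t0..}" using assms(1) by (intro at_le) auto
  then show "at t within {t0..} \<noteq> bot"
    using trivial_limit_at_right_real[of t] by (metis bot.extremum_uniqueI)
  show "(f has_vector_derivative D) (at t within {t0..})"
    using assms(2) by (simp add: has_real_derivative_iff_has_vector_derivative)
qed

lemma classM_parametric_drive:
  assumes t0: "t0 > 0" and f: "classM t0 f"
  obtains h h1 g v C where "parametric_drive t0 f h h1 g v C"
    "C2_on {t0..} (drive h h1)" "(drive h h1 \<longlongrightarrow> 0) at_top"
proof -
  obtain f1 f2 where f1: "\<And>t. t \<ge> t0 \<Longrightarrow> (f has_real_derivative f1 t) (at t within {t0..})"
    and f2: "\<And>t. t \<ge> t0 \<Longrightarrow> (f1 has_real_derivative f2 t) (at t within {t0..})"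
    and f2c: "continuous_on {t0..} f2"
    using f unfolding classM_def C2_on_def by auto
  have fpos: "f t > 0" if "t \<ge> t0" for t
    using f that unfolding classM_def by (meson less_le_trans)
  have dR: "dR t0 f t = f1 t" if "t \<ge> t0" for t
    using that f1[OF that] by (rule dR_eqI)
  define L where "L = (\<lambda>t. ln (f t))"
  define L1 where "L1 = (\<lambda>t. f1 t / f t)"
  define L2 where "L2 = (\<lambda>t. (f2 t * f t - f1 t * f1 t) / (f t * f t))"
  have L: "(L has_real_derivative L1 t) (at t within {t0..})" if "t \<ge> t0" for t
    unfolding L_def L1_def using fpos[OF that]
    by (auto intro!: derivative_eq_intros f1 that)
  have L1: "(L1 has_real_derivative L2 t) (at t within {t0..})" if "t \<ge> t0" for t
    unfolding L1_def L2_def using fpos[OF that]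
    by (intro DERIV_divide f1 f2 that) auto
  have fc: "continuous_on {t0..} f" "continuous_on {t0..} f1"
    using f1 f2 by (auto intro!: DERIV_continuous_on)
  have L2c: "continuous_on {t0..} L2"
    unfolding L2_def using less_imp_neq[OF fpos] by (intro continuous_intros fc f2c) force
  have Lc: "continuous_on {t0..} L" using L by (auto intro!: DERIV_continuous_on)
  have L1anti: "L1 t \<le> L1 s" if "t0 \<le> s" "s \<le> t" for s t
  proof -
    have "dR t0 f t / f t \<le> dR t0 f s / f s"
      using f that unfolding classM_def monotone_on_def by auto
    then show ?thesis using that by (simp add: L1_def dR)
  qed
  have L1lim: "(L1 \<longlongrightarrow> 0) at_top"
  proof -
    have "((\<lambda>t. dR t0 f t / f t) \<longlongrightarrow> 0) at_top" using f by (simp add: classM_def)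
    then show ?thesis
      by (rule Lim_transform_eventually)
         (auto simp: eventually_at_top_linorder L1_def dR intro!: exI[of _ t0])
  qed
  have L1nn: "0 \<le> L1 t" if "t \<ge> t0" for t
    by (rule tendsto_upperbound[OF L1lim])
       (use L1anti that in \<open>auto simp: eventually_at_top_linorder intro!: exI[of _ t]\<close>)
  obtain P where P: "\<And>t. t \<ge> t0 \<Longrightarrow> (P has_real_derivative L t) (at t within {t0..})"
    using half_line_antiderivative[OF Lc] by blast
  have Pc: "continuous_on {t0..} P" using P by (auto intro!: DERIV_continuous_on)
  obtain Q where Q: "\<And>t. t \<ge> t0 \<Longrightarrow> (Q has_real_derivative P t) (at t within {t0..})"
    using half_line_antiderivative[OF Pc] by blast
  \<comment> \<open>Since \<open>P'' = f' / f\<close>, this is a local average of \<open>f' / f\<close> with two more derivatives.\<close>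
  define h where "h = second_diff P"
  define h1 where "h1 = second_diff L"
  define h2 where "h2 = second_diff L1"
  define h3 where "h3 = second_diff L2"
  have dh: "(h has_real_derivative h1 t) (at t within {t0..})"
    and dh1: "(h1 has_real_derivative h2 t) (at t within {t0..})"
    and dh2: "(h2 has_real_derivative h3 t) (at t within {t0..})" if "t \<ge> t0" for t
    unfolding h_def h1_def h2_def h3_def by (intro second_diff_has_derivative P L L1 that; assumption)+
  have h3c: "continuous_on {t0..} h3"
    unfolding h3_def second_diff_def
    by (intro continuous_intros continuous_on_compose2[OF L2c]) (auto intro!: continuous_intros)
  have hb: "0 \<le> h t" "h t \<le> L1 t" if t: "t \<ge> t0" for t
    unfolding h_def
    by (rule second_diff_bounds[where ?t0.0 = t0 and ?F1.0 = L and ?F2.0 = L1 and lo = 0 and hi = "L1 t", OF P L t];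
        use L1anti L1nn t in \<open>auto intro: order_trans\<close>)+
  have hlim: "(h \<longlongrightarrow> 0) at_top"
    by (rule tendsto_sandwich[OF _ _ tendsto_const L1lim])
       (use hb in \<open>auto simp: eventually_at_top_linorder intro!: exI[of _ t0]\<close>)
  have Ldiff: "0 \<le> L (s + 1) - L s" "L (s + 1) - L s \<le> L1 s" if "s \<ge> t0" for s
    using deriv_bounds[of s "s + 1" "{t0..}" L L1 0 "L1 s"] L L1anti L1nn that by auto
  \<comment> \<open>\<open>h1\<close> is a second difference of \<open>ln f\<close>, which is
    concave because \<open>f' / f\<close> decreases; this gives the sign. The lower bound drops the
    nonnegative increment of \<open>ln f\<close> over \<open>[t + 1, t + 2]\<close>.\<close>
  have h1np: "h1 t \<le> 0" and h1lb: "- L1 t \<le> h1 t" if t: "t \<ge> t0" for t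
  proof -
    have K: "((\<lambda>s. L (s + 1) - L s) has_real_derivative L1 (s + 1) - L1 s) (at s within {t0..})" if "s \<ge> t0" for s
      by (intro DERIV_diff has_real_derivative_shift L) (use that in auto)
    have "(L (t + 1 + 1) - L (t + 1)) - (L (t + 1) - L t) \<le> 0 * (t + 1 - t)"
    proof (rule deriv_bounds(2)[of t "t + 1" "{t0..}" "\<lambda>s. L (s + 1) - L s" "\<lambda>s. L1 (s + 1) - L1 s" "L1 (t + 2) - L1 t"])
      fix x assume x: "t \<le> x" "x \<le> t + 1"
      show "((\<lambda>s. L (s + 1) - L s) has_real_derivative L1 (x + 1) - L1 x) (at x within {t0..})" using K x t by simp
      have "L1 (t + 2) \<le> L1 (x + 1)" "L1 x \<le> L1 t" "L1 (x + 1) \<le> L1 x" by (intro L1anti; use x t in simp)+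
      then show "L1 (t + 2) - L1 t \<le> L1 (x + 1) - L1 x \<and> L1 (x + 1) - L1 x \<le> 0" by auto
    qed (use t in auto)
    then show "h1 t \<le> 0" by (simp add: h1_def second_diff_def add.assoc)
    have "0 \<le> L (t + 1 + 1) - L (t + 1)" "L (t + 1) - L t \<le> L1 t" using Ldiff[of t] Ldiff[of "t + 1"] t by auto
    then show "- L1 t \<le> h1 t" by (simp add: h1_def second_diff_def add.assoc)
  qed
  have h1lim: "(h1 \<longlongrightarrow> 0) at_top"
  proof (rule tendsto_sandwich)
    show "((\<lambda>t. - L1 t) \<longlongrightarrow> 0) at_top" using tendsto_minus[OF L1lim] by simp
    show "((\<lambda>t. 0) \<longlongrightarrow> (0::real)) at_top" by (rule tendsto_const)
  qed (use h1np h1lb in \<open>auto simp: eventually_at_top_linorder intro!: exI[of _ t0]\<close>)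
  have hc: "continuous_on {t0..} h" using dh by (auto intro!: DERIV_continuous_on)
  have hanti: "h t \<le> h s" if "t0 \<le> s" "s \<le> t" for s t
    using deriv_nonneg_mono[of t0 s t "\<lambda>x. - h x" "\<lambda>x. - h1 x"] dh h1np that by (auto intro: DERIV_minus)
  have "continuous_on {t0..} (\<lambda>t. h t * (cos t)\<^sup>2)" by (intro continuous_intros hc)
  from half_line_antiderivative[OF this] obtain g where g0: "g t0 = 0" and g: "\<And>t. t \<ge> t0 \<Longrightarrow> (g has_real_derivative h t * (cos t)\<^sup>2) (at t within {t0..})" by blast
  have gc: "continuous_on {t0..} g" using g by (auto intro!: DERIV_continuous_on)
  have gnn: "0 \<le> g t" if "t \<ge> t0" for t
    using deriv_nonneg_mono[of t0 t0 t g "\<lambda>t. h t * (cos t)\<^sup>2", OF _ that g] hb(1) g0 by simp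
  have "continuous_on {t0..} (\<lambda>t. h t * cos (2 * t))" by (intro continuous_intros hc)
  from half_line_antiderivative[OF this] obtain Ic where Ic0: "Ic t0 = 0" and Ic: "\<And>t. t \<ge> t0 \<Longrightarrow> (Ic has_real_derivative h t * cos (2 * t)) (at t within {t0..})" by blast
  have Icb: "\<bar>Ic t\<bar> \<le> h t0" if t: "t \<ge> t0" for t
  proof -
    have "\<bar>Ic t - Ic t0\<bar> \<le> (\<bar>h t\<bar> + \<bar>h t0\<bar> + \<bar>h t - h t0\<bar>) / 2"
    proof (rule oscillatory_integral[where w = "\<lambda>t. sin (2 * t) / 2" and k = "\<lambda>t. cos (2 * t)"])
      show "((\<lambda>t. sin (2 * t) / 2) has_real_derivative cos (2 * x)) (at x within {t0..})" for x
        by (auto intro!: derivative_eq_intros)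
    qed (use dh h1np Ic t in auto)
    then show ?thesis using hanti[of t0 t] hb(1)[OF t] hb(1)[of t0] t Ic0 by simp
  qed
  \<comment> \<open>\<open>cos^2\<close> is split into its mean 1/2 and
    \<open>cos (2 t) / 2\<close>. The mean part integrates exactly to a second difference of
    \<open>Q\<close>, which averages \<open>ln f\<close>; the oscillating part stays bounded. Hence
    \<open>2 g\<close> follows \<open>ln f\<close> up to a constant.\<close>
  have g_eq: "g t = (second_diff Q t - second_diff Q t0) / 2 + Ic t / 2" if t: "t \<ge> t0" for t
  proof (rule deriv_eq_imp_eq[OF t _ g])
    show "((\<lambda>t. (second_diff Q t - second_diff Q t0) / 2 + Ic t / 2) has_real_derivative h x * (cos x)\<^sup>2) (at x within {t0..})"
      if x: "x \<ge> t0" for x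
    proof -
      have "((\<lambda>t. (second_diff Q t - second_diff Q t0) / 2 + Ic t / 2) has_real_derivative (h x - 0) / 2 + h x * cos (2 * x) / 2) (at x within {t0..})"
        unfolding h_def by (intro DERIV_add DERIV_cdivide DERIV_diff second_diff_has_derivative[OF Q x] DERIV_const Ic[OF x, unfolded h_def])
      moreover have "(h x - 0) / 2 + h x * cos (2 * x) / 2 = h x * (cos x)\<^sup>2"
        by (simp only: cos_double_cos) (simp add: field_simps)
      ultimately show ?thesis by simp
    qed
  qed (simp_all add: g0 Ic0)
  have Qb: "L t \<le> second_diff Q t" "second_diff Q t \<le> L t + 2 * L1 t0" if t: "t \<ge> t0" for t
  proof -
    have "L t \<le> L x \<and> L x \<le> L t + 2 * L1 t0" if "t \<le> x" "x \<le> t + 2" for x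
    proof -
      have "0 * (x - t) \<le> L x - L t" "L x - L t \<le> L1 t0 * (x - t)"
        by (rule deriv_bounds[of t x "{t0..}" L L1 0 "L1 t0"]; use L L1nn L1anti t that in auto)+
      moreover have "L1 t0 * (x - t) \<le> L1 t0 * 2" using L1nn[of t0] that by (intro mult_left_mono) auto
      ultimately show ?thesis by simp
    qed
    then show "L t \<le> second_diff Q t" "second_diff Q t \<le> L t + 2 * L1 t0"
      using second_diff_bounds[of t0 Q P L t "L t" "L t + 2 * L1 t0"] Q P t by auto
  qed
  \<comment> \<open>The three terms pay for the starting value, for replacing \<open>ln f\<close> by
    its average over \<open>[t, t + 2]\<close>, and for the oscillating integral.\<close>
  define c where "c = \<bar>L t0\<bar> + 2 * L1 t0 + h t0"
  have c0: "c \<ge> 0" using L1nn[of t0] hb[of t0] by (simp add: c_def)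
  have gL: "\<bar>2 * g t - L t\<bar> \<le> c" if t: "t \<ge> t0" for t
  proof -
    have "2 * g t = second_diff Q t - second_diff Q t0 + Ic t" unfolding g_eq[OF t] by (simp add: field_simps)
    moreover have "Ic t \<le> h t0" "- h t0 \<le> Ic t" using Icb[OF t] by (simp_all add: abs_le_iff)
    moreover have "L t0 \<le> \<bar>L t0\<bar>" "- L t0 \<le> \<bar>L t0\<bar>" by simp_all
    ultimately show ?thesis
      using Qb[OF t] Qb[of t0] unfolding c_def abs_le_iff by (intro conjI; linarith)
  qed
  \<comment> \<open>After the integrating factor the equation of \<open>v\<close> reads
    \<open>(exp (- 2 g) v)' = m sin (2 t)\<close>. Since \<open>m\<close> decreases to 0, its
    oscillating integral converges.\<close>
  define m where "m = (\<lambda>t. exp (- 2 * g t) * h t)"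
  have dm: "(m has_real_derivative exp (- 2 * g t) * (h1 t - 2 * (h t * (cos t)\<^sup>2) * h t)) (at t within {t0..})" if "t \<ge> t0" for t
    unfolding m_def by (rule derivative_eq_intros g dh that refl)+ (simp add: algebra_simps)
  have m1np: "exp (- 2 * g t) * (h1 t - 2 * (h t * (cos t)\<^sup>2) * h t) \<le> 0" if "t \<ge> t0" for t
  proof -
    have "0 \<le> 2 * (h t * (cos t)\<^sup>2) * h t" using hb(1)[OF that] by (intro mult_nonneg_nonneg) auto
    then have "h1 t - 2 * (h t * (cos t)\<^sup>2) * h t \<le> 0" using h1np[OF that] by linarith
    then show ?thesis by (simp add: mult_le_0_iff)
  qed
  have mnn: "0 \<le> m t" and mh: "m t \<le> h t" if "t \<ge> t0" for t
    using hb(1)[OF that] gnn[OF that] by (auto simp: m_def mult_left_le_one_le)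
  have manti: "m t \<le> m s" if "t0 \<le> s" "s \<le> t" for s t
    using deriv_nonneg_mono[of t0 s t "\<lambda>x. - m x" "\<lambda>x. - (exp (- 2 * g x) * (h1 x - 2 * (h x * (cos x)\<^sup>2) * h x))"] dm m1np that
    by (auto intro: DERIV_minus)
  have mc: "continuous_on {t0..} m" using dm by (auto intro!: DERIV_continuous_on)
  have mlim: "(m \<longlongrightarrow> 0) at_top"
    by (rule tendsto_sandwich[OF _ _ tendsto_const hlim])
       (use mnn mh in \<open>auto simp: eventually_at_top_linorder intro!: exI[of _ t0]\<close>)
  have "continuous_on {t0..} (\<lambda>t. m t * sin (2 * t))" by (intro continuous_intros mc)
  from half_line_antiderivative[OF this] obtain I where I: "\<And>t. t \<ge> t0 \<Longrightarrow> (I has_real_derivative m t * sin (2 * t)) (at t within {t0..})" by blast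
  have Ib: "\<bar>I t - I s\<bar> \<le> m s" if st: "t0 \<le> s" "s \<le> t" for s t
  proof -
    have "\<bar>I t - I s\<bar> \<le> (\<bar>m t\<bar> + \<bar>m s\<bar> + \<bar>m t - m s\<bar>) / 2"
    proof (rule oscillatory_integral[where w = "\<lambda>t. - cos (2 * t) / 2" and k = "\<lambda>t. sin (2 * t)"])
      show "((\<lambda>t. - cos (2 * t) / 2) has_real_derivative sin (2 * x)) (at x within {t0..})" for x
        by (auto intro!: derivative_eq_intros)
    qed (use dm m1np I st in auto)
    then show ?thesis using manti[OF st] mnn[of t] mnn[of s] st by simp
  qed
  \<comment> \<open>Subtracting the limit \<open>J\<close> of \<open>I\<close> removes the
    homogeneous solution \<open>exp (2 g)\<close>: the tail \<open>I - J\<close> is at most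
    \<open>m\<close> in modulus, which gives \<open>|v| <= h\<close>.\<close>
  obtain J where J: "(\<lambda>n. I (real n)) \<longlonglongrightarrow> J"
  proof -
    have "Cauchy (\<lambda>n. I (real n))"
    proof (rule metric_CauchyI)
      fix e :: real assume "e > 0"
      then have "eventually (\<lambda>t. m t < e) at_top" using mlim by (intro order_tendstoD)
      then obtain T where T: "\<And>t. t \<ge> T \<Longrightarrow> m t < e" by (auto simp: eventually_at_top_linorder)
      obtain M where M: "real M \<ge> max T t0" using real_arch_simple by blast
      have "dist (I (real i)) (I (real j)) < e" if "M \<le> j" "j \<le> i" for i j
      proof -
        have "real j \<ge> real M" using that by simp
        then have "\<bar>I (real i) - I (real j)\<bar> \<le> m (real j)" "m (real j) < e" using Ib[of j i] T[of j] M that by auto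
        then show ?thesis by (simp add: dist_real_def)
      qed
      then show "\<exists>M. \<forall>i\<ge>M. \<forall>j\<ge>M. dist (I (real i)) (I (real j)) < e"
        by (metis dist_commute nle_le)
    qed
    then show thesis using that by (auto simp: Cauchy_convergent_iff convergent_def)
  qed
  have IJ: "\<bar>I t - J\<bar> \<le> m t" if t: "t \<ge> t0" for t
  proof -
    have "(\<lambda>n. \<bar>I (real n) - I t\<bar>) \<longlonglongrightarrow> \<bar>J - I t\<bar>" by (intro tendsto_intros J)
    moreover obtain M where "real M \<ge> t" using real_arch_simple by blast
    then have "\<forall>\<^sub>F n in sequentially. \<bar>I (real n) - I t\<bar> \<le> m t"
      using Ib[OF t] unfolding eventually_sequentially by (intro exI[of _ M]) (auto intro: order_trans)
    ultimately have "\<bar>J - I t\<bar> \<le> m t" by (intro tendsto_upperbound) auto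
    then show ?thesis by (simp add: abs_minus_commute)
  qed
  define v where "v = (\<lambda>t. exp (2 * g t) * (I t - J))"
  have emg: "exp (2 * g t) * m t = h t" for t by (simp add: m_def exp_minus)
  have dv: "(v has_real_derivative 2 * h t * cos t * (sin t + cos t * v t)) (at t within {t0..})" if t: "t \<ge> t0" for t
  proof -
    have "(v has_real_derivative (exp (2 * g t) * (2 * (h t * (cos t)\<^sup>2))) * (I t - J) + exp (2 * g t) * (m t * sin (2 * t))) (at t within {t0..})"
      unfolding v_def by (rule derivative_eq_intros g I t refl)+ (simp add: algebra_simps)
    moreover have "exp (2 * g t) * (m t * sin (2 * t)) = h t * (2 * sin t * cos t)"
      unfolding mult.assoc[symmetric] emg by (simp add: sin_double)
    then have "(exp (2 * g t) * (2 * (h t * (cos t)\<^sup>2))) * (I t - J) + exp (2 * g t) * (m t * sin (2 * t))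
        = 2 * h t * cos t * (sin t + cos t * v t)"
      by (simp only:) (simp add: v_def power2_eq_square algebra_simps)
    ultimately show ?thesis by simp
  qed
  have vb: "\<bar>v t\<bar> \<le> h t" if "t \<ge> t0" for t
    using mult_left_mono[OF IJ[OF that], of "exp (2 * g t)"] emg by (simp add: v_def abs_mult)
  have "parametric_drive t0 f h h1 g v (exp c)"
  proof
    show "1 \<le> exp c" using c0 by simp
    fix t assume t: "t \<ge> t0"
    have fL: "f t = exp (L t)" using fpos[OF t] by (simp add: L_def)
    show "exp (2 * g t) / exp c \<le> f t \<and> f t \<le> exp c * exp (2 * g t)"
      using gL[OF t] unfolding fL exp_diff[symmetric] exp_add[symmetric] exp_le_cancel_iff by (simp add: abs_le_iff)
  qed (use t0 dh h1np hb hlim g g0 dv vb in auto)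
  then show thesis using that C2_on_drive[OF dh dh1 dh2 h3c] drive_tendsto_0[OF hlim h1lim] by blast
qed

section \<open>The two Hill solutions and the forced trajectory\<close>

context parametric_drive
begin

definition y :: "real \<Rightarrow> real" where "y t = exp (g t) * cos t"
definition y' :: "real \<Rightarrow> real" where "y' t = exp (g t) * (h t * (cos t) ^ 3 - sin t)"
definition z :: "real \<Rightarrow> real" where "z t = exp (- g t) * (sin t + cos t * v t)"
definition z' :: "real \<Rightarrow> real" where
  "z' t = exp (- g t) * (cos t - sin t * v t + h t * (cos t)\<^sup>2 * (sin t + cos t * v t))"

text \<open>The sum of the bounds for the two squared components of \<open>(z, z')\<close> without
  the factor \<open>exp (- g)\<close>; it also covers \<open>(y, y')\<close> without the factor
  \<open>exp g\<close>. Both use that \<open>h\<close> and \<open>|v|\<close> are at most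
  \<open>h t0\<close>.\<close>

definition flow_const :: real where "flow_const = (1 + h t0)\<^sup>2 + (1 + h t0) ^ 4"

lemma h_le_init: "t \<ge> t0 \<Longrightarrow> h t \<le> h t0"
  using deriv_nonneg_mono[of t0 t0 t "\<lambda>x. - h x" "\<lambda>x. - h1 x"] h_deriv h1_nonpos by (auto intro: DERIV_minus)

lemma y_deriv: "t \<ge> t0 \<Longrightarrow> (y has_real_derivative y' t) (at t within {t0..})"
  unfolding y_def[abs_def]
  by (rule derivative_eq_intros g_deriv refl | assumption)+
     (simp add: y'_def power2_eq_square power3_eq_cube algebra_simps)

lemma y'_deriv: "t \<ge> t0 \<Longrightarrow> (y' has_real_derivative - (1 + drive h h1 t) * y t) (at t within {t0..})"
  unfolding y'_def[abs_def]
  by (rule derivative_eq_intros g_deriv h_deriv refl | assumption)+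
     (simp add: y_def drive_def power2_eq_square power3_eq_cube power4_eq_xxxx algebra_simps)

lemma z_deriv: "t \<ge> t0 \<Longrightarrow> (z has_real_derivative z' t) (at t within {t0..})"
  unfolding z_def[abs_def]
  by (rule derivative_eq_intros g_deriv v_deriv refl | assumption)+
     (simp add: z'_def power2_eq_square power3_eq_cube algebra_simps)

lemma z'_deriv: "t \<ge> t0 \<Longrightarrow> (z' has_real_derivative - (1 + drive h h1 t) * z t) (at t within {t0..})"
  unfolding z'_def[abs_def]
  by (rule derivative_eq_intros g_deriv h_deriv v_deriv refl | assumption)+
     (simp add: z_def drive_def power2_eq_square power3_eq_cube power4_eq_xxxx algebra_simps)

lemma wronskian: "y t * z' t - y' t * z t = 1"
proof -
  have "y t * z' t - y' t * z t = exp (g t) * exp (- g t) * (cos t * cos t + sin t * sin t)"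
    by (simp add: y_def y'_def z_def z'_def power2_eq_square power3_eq_cube algebra_simps del: sin_cos_squared_add3)
  moreover have "cos t * cos t + sin t * sin t = 1" using sin_cos_squared_add2[of t] by (simp add: power2_eq_square)
  ultimately show ?thesis by (simp add: exp_minus)
qed

lemma flow_const_ge_1: "flow_const \<ge> 1"
proof -
  have "1 \<le> (1 + h t0)\<^sup>2" using h_nonneg[of t0] by (intro one_le_power) auto
  moreover have "0 \<le> (1 + h t0) ^ 4" using h_nonneg[of t0] by simp
  ultimately show ?thesis unfolding flow_const_def by linarith
qed

lemma y_bound:
  assumes t: "t \<ge> t0" shows "(y t)\<^sup>2 + (y' t)\<^sup>2 \<le> flow_const * exp (2 * g t)"
proof -
  have H: "0 \<le> h t" "h t \<le> h t0" using h_nonneg[OF t] h_le_init[OF t] by auto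
  have c: "\<bar>cos t ^ 3\<bar> \<le> 1" by (simp add: power_abs power_le_one)
  have "\<bar>h t * cos t ^ 3 - sin t\<bar> \<le> \<bar>h t * cos t ^ 3\<bar> + \<bar>sin t\<bar>" by (rule abs_triangle_ineq4)
  also have "\<dots> \<le> h t0 * 1 + 1"
    unfolding abs_mult using H c by (intro add_mono mult_mono) auto
  finally have "\<bar>h t * cos t ^ 3 - sin t\<bar> \<le> 1 + h t0" by simp
  then have 1: "(h t * cos t ^ 3 - sin t)\<^sup>2 \<le> (1 + h t0)\<^sup>2" by (rule power2_le_iff_abs_le[THEN iffD2, rotated]) (use H in auto)
  have 2: "(cos t)\<^sup>2 \<le> (1 + h t0) ^ 4"
    using one_le_power[of "1 + h t0" 4] H by (intro order_trans[OF _ one_le_power]) (auto simp: abs_square_le_1)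
  have "(y t)\<^sup>2 + (y' t)\<^sup>2 = exp (2 * g t) * ((cos t)\<^sup>2 + (h t * cos t ^ 3 - sin t)\<^sup>2)"
    by (simp add: y_def y'_def power_mult_distrib exp_double distrib_left)
  also have "\<dots> \<le> exp (2 * g t) * flow_const"
    unfolding flow_const_def using 1 2 by (intro mult_left_mono) auto
  finally show ?thesis by (simp add: mult.commute)
qed

lemma z_bound:
  assumes t: "t \<ge> t0" shows "(z t)\<^sup>2 + (z' t)\<^sup>2 \<le> flow_const * exp (- (2 * g t))"
proof -
  have H: "0 \<le> h t" "h t \<le> h t0" "\<bar>v t\<bar> \<le> h t0" using h_nonneg[OF t] h_le_init[OF t] v_bound[OF t] by auto
  have k: "\<bar>sin t + cos t * v t\<bar> \<le> 1 + h t0"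
    using H mult_mono[of "\<bar>cos t\<bar>" 1 "\<bar>v t\<bar>" "h t0"]
    by (intro order_trans[OF abs_triangle_ineq] add_mono) (auto simp: abs_mult)
  have l: "\<bar>cos t - sin t * v t\<bar> \<le> 1 + h t0"
    using H mult_mono[of "\<bar>sin t\<bar>" 1 "\<bar>v t\<bar>" "h t0"]
    by (intro order_trans[OF abs_triangle_ineq4] add_mono) (auto simp: abs_mult)
  have "\<bar>h t * (cos t)\<^sup>2\<bar> \<le> h t0 * 1" unfolding abs_mult using H by (intro mult_mono) (auto simp: abs_square_le_1)
  then have "\<bar>h t * (cos t)\<^sup>2 * (sin t + cos t * v t)\<bar> \<le> h t0 * (1 + h t0)"
    unfolding abs_mult[of "h t * (cos t)\<^sup>2"] using k H by (intro mult_mono) auto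
  then have "\<bar>cos t - sin t * v t + h t * (cos t)\<^sup>2 * (sin t + cos t * v t)\<bar> \<le> (1 + h t0) + h t0 * (1 + h t0)"
    using l by (intro order_trans[OF abs_triangle_ineq] add_mono) auto
  also have "\<dots> = (1 + h t0)\<^sup>2" by (simp add: power2_eq_square algebra_simps)
  finally have 1: "(cos t - sin t * v t + h t * (cos t)\<^sup>2 * (sin t + cos t * v t))\<^sup>2 \<le> ((1 + h t0)\<^sup>2)\<^sup>2"
    by (rule power2_le_iff_abs_le[THEN iffD2, rotated]) auto
  have 2: "(sin t + cos t * v t)\<^sup>2 \<le> (1 + h t0)\<^sup>2"
    using k by (rule power2_le_iff_abs_le[THEN iffD2, rotated]) (use H in auto)
  have e: "exp (- (2 * g t)) = (exp (- g t))\<^sup>2" by (simp add: power2_eq_square flip: exp_add)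
  have "(z t)\<^sup>2 + (z' t)\<^sup>2 = exp (- (2 * g t)) * ((sin t + cos t * v t)\<^sup>2 + (cos t - sin t * v t + h t * (cos t)\<^sup>2 * (sin t + cos t * v t))\<^sup>2)"
    by (simp only: e z_def z'_def power_mult_distrib distrib_left[symmetric])
  also have "\<dots> \<le> exp (- (2 * g t)) * flow_const"
    unfolding flow_const_def using 1 2 by (intro mult_left_mono) (auto simp flip: power_mult)
  finally show ?thesis by (simp add: mult.commute)
qed

text \<open>\<open>y\<close> itself has zeros, so the lower bound is for the phase space vector:
  Wronskian 1 and Cauchy-Schwarz bound it below by the inverse of the size of
  \<open>(z, z')\<close>.\<close>

lemma y_lower:
  assumes t: "t \<ge> t0" shows "exp (2 * g t) / flow_const \<le> (y t)\<^sup>2 + (y' t)\<^sup>2"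
proof -
  have "1 = (y t * z' t - y' t * z t)\<^sup>2" by (simp add: wronskian)
  also have "\<dots> \<le> ((y t)\<^sup>2 + (y' t)\<^sup>2) * ((z t)\<^sup>2 + (z' t)\<^sup>2)"
  proof -
    have "((y t)\<^sup>2 + (y' t)\<^sup>2) * ((z t)\<^sup>2 + (z' t)\<^sup>2) - (y t * z' t - y' t * z t)\<^sup>2 = (y t * z t + y' t * z' t)\<^sup>2"
      by (simp add: power2_eq_square algebra_simps)
    then show ?thesis using zero_le_power2[of "y t * z t + y' t * z' t"] by linarith
  qed
  also have "\<dots> \<le> ((y t)\<^sup>2 + (y' t)\<^sup>2) * (flow_const * exp (- (2 * g t)))"
    by (intro mult_left_mono z_bound t) auto
  finally show ?thesis using flow_const_ge_1 by (simp add: exp_minus field_simps)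
qed

lemma g_nonneg: "t \<ge> t0 \<Longrightarrow> 0 \<le> g t"
  using deriv_nonneg_mono[of t0 t0 t g "\<lambda>t. h t * (cos t)\<^sup>2", OF _ _ g_deriv] h_nonneg g_init by simp

lemma g_mono: "t0 \<le> s \<Longrightarrow> s \<le> t \<Longrightarrow> g s \<le> g t"
  using deriv_nonneg_mono[of t0 s t g "\<lambda>t. h t * (cos t)\<^sup>2", OF _ _ g_deriv] h_nonneg by simp

text \<open>The secular term comes from \<open>\<integral> exp (- g) sin\<^sup>2\<close>: the forcing resonates with the decaying
  solution \<open>z\<close>, and the response is carried by the growing solution \<open>y\<close>.\<close>
lemma forced_trajectory:
  assumes a: "a \<noteq> 0"
    and f': "\<And>t. t \<ge> t0 \<Longrightarrow> (f has_real_derivative f' t) (at t within {t0..})"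
    and \<kappa>: "\<kappa> < 2" "\<And>t. t \<ge> t0 \<Longrightarrow> t * f' t / f t \<le> \<kappa>"
    and small: "((\<lambda>t. f t / t\<^sup>2) \<longlongrightarrow> 0) at_top"
  obtains q p A c t1 where "q t0 = 0" "p t0 = 0"
    "\<And>t. t \<ge> t0 \<Longrightarrow> (q has_real_derivative - p t) (at t within {t0..})"
    "\<And>t. t \<ge> t0 \<Longrightarrow> (p has_real_derivative (1 + drive h h1 t) * q t + a * sin t) (at t within {t0..})"
    "A > 0" "\<And>t. t \<ge> t0 \<Longrightarrow> (q t)\<^sup>2 + (p t)\<^sup>2 \<le> A * t\<^sup>2" "\<And>t. t \<ge> t0 \<Longrightarrow> f t \<le> A * t\<^sup>2"
    "c > 0" "t1 \<ge> t0" "\<And>t. t \<ge> t1 \<Longrightarrow> c * t\<^sup>2 \<le> (q t)\<^sup>2 + (p t)\<^sup>2"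
proof -
  have fpos: "f t > 0" if "t \<ge> t0" for t
    using f_bounds[OF that] C_ge_1 by (metis divide_pos_pos exp_gt_zero less_le_trans zero_less_one)
  have cont: "continuous_on {t0..} y" "continuous_on {t0..} z" "continuous_on {t0..} g" "continuous_on {t0..} v"
    using y_deriv z_deriv g_deriv v_deriv by (auto intro!: DERIV_continuous_on)
  have "continuous_on {t0..} (\<lambda>t. y t * (a * sin t))" by (intro continuous_intros cont)
  from half_line_antiderivative[OF this] obtain I1 where I1: "I1 t0 = 0"
    "\<And>t. t \<ge> t0 \<Longrightarrow> (I1 has_real_derivative y t * (a * sin t)) (at t within {t0..})" by blast
  have "continuous_on {t0..} (\<lambda>t. z t * (a * sin t))" by (intro continuous_intros cont)
  from half_line_antiderivative[OF this] obtain I2 where I2: "I2 t0 = 0"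
    "\<And>t. t \<ge> t0 \<Longrightarrow> (I2 has_real_derivative z t * (a * sin t)) (at t within {t0..})" by blast
  have "continuous_on {t0..} (\<lambda>t. exp (- g t))" by (intro continuous_intros cont)
  from half_line_antiderivative[OF this] obtain J where J: "J t0 = 0"
    "\<And>t. t \<ge> t0 \<Longrightarrow> (J has_real_derivative exp (- g t)) (at t within {t0..})" by blast
  have "continuous_on {t0..} (\<lambda>t. exp (- g t) * cos (2 * t))" by (intro continuous_intros cont)
  from half_line_antiderivative[OF this] obtain B where B: "B t0 = 0"
    "\<And>t. t \<ge> t0 \<Longrightarrow> (B has_real_derivative exp (- g t) * cos (2 * t)) (at t within {t0..})" by blast
  have "continuous_on {t0..} (\<lambda>t. exp (- g t) * v t * sin (2 * t))" by (intro continuous_intros cont)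
  from half_line_antiderivative[OF this] obtain V where V: "V t0 = 0"
    "\<And>t. t \<ge> t0 \<Longrightarrow> (V has_real_derivative exp (- g t) * v t * sin (2 * t)) (at t within {t0..})" by blast
  \<comment> \<open>Variation of constants with Wronskian 1. \<open>I2\<close> multiplies the
    growing solution and carries the secular growth, \<open>I1\<close> multiplies the decaying
    one.\<close>
  define q where "q = (\<lambda>t. y t * I2 t - z t * I1 t)"
  define p where "p = (\<lambda>t. z' t * I1 t - y' t * I2 t)"
  have q_deriv: "(q has_real_derivative - p t) (at t within {t0..})" if t: "t \<ge> t0" for t
    unfolding q_def by (rule derivative_eq_intros y_deriv z_deriv I1(2) I2(2) t refl)+ (simp add: p_def algebra_simps)
  have p_deriv: "(p has_real_derivative (1 + drive h h1 t) * q t + a * sin t) (at t within {t0..})" if t: "t \<ge> t0" for t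
  proof -
    have "(p has_real_derivative (1 + drive h h1 t) * q t + a * sin t * (y t * z' t - y' t * z t)) (at t within {t0..})"
      unfolding p_def by (rule derivative_eq_intros y'_deriv z'_deriv I1(2) I2(2) t refl)+ (simp add: q_def algebra_simps)
    then show ?thesis by (simp add: wronskian)
  qed
  \<comment> \<open>\<open>y sin t\<close> is \<open>exp g sin (2 t) / 2\<close>, without a mean
    part, and \<open>exp g\<close> is monotone, so the integral stays of the size of its
    amplitude.\<close>
  have I1b: "\<bar>I1 t\<bar> \<le> \<bar>a\<bar> / 2 * exp (g t)" if t: "t \<ge> t0" for t
  proof -
    have "\<bar>2 / a * I1 t - 2 / a * I1 t0\<bar> \<le> (\<bar>exp (g t)\<bar> + \<bar>exp (g t0)\<bar> + \<bar>exp (g t) - exp (g t0)\<bar>) / 2"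
    proof (rule oscillatory_integral[where w = "\<lambda>t. - cos (2 * t) / 2" and k = "\<lambda>t. sin (2 * t)" and ?m1.0 = "\<lambda>t. exp (g t) * (h t * (cos t)\<^sup>2)"])
      show "((\<lambda>t. exp (g t)) has_real_derivative exp (g x) * (h x * (cos x)\<^sup>2)) (at x within {t0..})" if "x \<ge> t0" for x
        by (auto intro!: derivative_eq_intros g_deriv that)
      show "((\<lambda>t. - cos (2 * t) / 2) has_real_derivative sin (2 * x)) (at x within {t0..})" for x
        by (auto intro!: derivative_eq_intros)
      show "((\<lambda>t. 2 / a * I1 t) has_real_derivative exp (g x) * sin (2 * x)) (at x within {t0..})" if "x \<ge> t0" for x
      proof -
        have "((\<lambda>t. 2 / a * I1 t) has_real_derivative 2 / a * (y x * (a * sin x))) (at x within {t0..})"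
          by (intro DERIV_cmult I1 that)
        moreover have "2 / a * (y x * (a * sin x)) = exp (g x) * sin (2 * x)" using a by (simp add: y_def sin_double)
        ultimately show ?thesis by simp
      qed
    qed (use t h_nonneg in auto)
    also have "\<dots> = exp (g t)" using g_nonneg[OF t] by (simp add: g_init)
    finally have "\<bar>2 / a * I1 t\<bar> \<le> exp (g t)" by (simp add: I1)
    then show ?thesis using a by (simp add: abs_mult field_simps)
  qed
  \<comment> \<open>\<open>2 z sin t = exp (- g) (1 - cos (2 t) + v sin (2 t))\<close>. Here
    \<open>J\<close> is the secular part, \<open>B\<close> oscillates with monotone amplitude, and
    the growth of \<open>V\<close> is eventually small against that of \<open>J\<close> because
    \<open>|v| <= h\<close> tends to 0.\<close>
  have I2eq: "I2 t = a / 2 * (J t - B t + V t)" if t: "t \<ge> t0" for t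
  proof (rule deriv_eq_imp_eq[OF t _ I2(2)])
    show "((\<lambda>t. a / 2 * (J t - B t + V t)) has_real_derivative z x * (a * sin x)) (at x within {t0..})" if x: "x \<ge> t0" for x
    proof -
      have "((\<lambda>t. a / 2 * (J t - B t + V t)) has_real_derivative a / 2 * (exp (- g x) - exp (- g x) * cos (2 * x) + exp (- g x) * v x * sin (2 * x))) (at x within {t0..})"
        by (intro DERIV_cmult DERIV_add DERIV_diff J B V x)
      moreover have "a / 2 * (exp (- g x) - exp (- g x) * cos (2 * x) + exp (- g x) * v x * sin (2 * x)) = z x * (a * sin x)"
        unfolding z_def cos_double_sin sin_double by (simp add: power2_eq_square algebra_simps)
      ultimately show ?thesis by (simp only:)
    qed
  qed (simp_all add: I2 J B V)
  have Bb: "\<bar>B t\<bar> \<le> 1" if t: "t \<ge> t0" for t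
  proof -
    have "\<bar>B t - B t0\<bar> \<le> (\<bar>exp (- g t)\<bar> + \<bar>exp (- g t0)\<bar> + \<bar>exp (- g t) - exp (- g t0)\<bar>) / 2"
    proof (rule oscillatory_integral[where w = "\<lambda>t. sin (2 * t) / 2" and k = "\<lambda>t. cos (2 * t)" and ?m1.0 = "\<lambda>t. - (exp (- g t) * (h t * (cos t)\<^sup>2))"])
      show "((\<lambda>t. exp (- g t)) has_real_derivative - (exp (- g x) * (h x * (cos x)\<^sup>2))) (at x within {t0..})" if "x \<ge> t0" for x
        by (auto intro!: derivative_eq_intros g_deriv that)
      show "((\<lambda>t. sin (2 * t) / 2) has_real_derivative cos (2 * x)) (at x within {t0..})" for x
        by (auto intro!: derivative_eq_intros)
    qed (use t h_nonneg B in auto)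
    also have "\<dots> = 1" using g_nonneg[OF t] by (simp add: g_init)
    finally show ?thesis by (simp add: B)
  qed
  have Vdiff: "\<bar>V t - V s\<bar> \<le> \<epsilon> * J t - \<epsilon> * J s" if st: "t0 \<le> s" "s \<le> t" and \<epsilon>: "\<And>x. x \<ge> s \<Longrightarrow> h x \<le> \<epsilon>" for s t \<epsilon>
  proof (rule deriv_compare[OF st V(2)])
    show "((\<lambda>t. \<epsilon> * J t) has_real_derivative \<epsilon> * exp (- g x)) (at x within {t0..})" if "x \<ge> t0" for x
      by (intro DERIV_cmult J that)
    show "\<bar>exp (- g x) * v x * sin (2 * x)\<bar> \<le> \<epsilon> * exp (- g x)" if "x \<ge> s" for x
    proof -
      have "\<bar>v x\<bar> * \<bar>sin (2 * x)\<bar> \<le> \<epsilon> * 1" using v_bound[of x] \<epsilon>[OF that] st that by (intro mult_mono) auto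
      then have "exp (- g x) * (\<bar>v x\<bar> * \<bar>sin (2 * x)\<bar>) \<le> exp (- g x) * \<epsilon>" by (intro mult_left_mono) auto
      then show ?thesis by (simp add: abs_mult mult_ac)
    qed
  qed
  have Jnn: "0 \<le> J t" if "t \<ge> t0" for t
    using deriv_nonneg_mono[of t0 t0 t J "\<lambda>t. exp (- g t)", OF _ that J(2)] J by simp
  have Jmono: "J s \<le> J t" if "t0 \<le> s" "s \<le> t" for s t
    using deriv_nonneg_mono[of t0 s t J "\<lambda>t. exp (- g t)", OF that J(2)] by simp
  have Jlow: "(t - t0) * exp (- g t) \<le> J t" if t: "t \<ge> t0" for t
  proof -
    have "exp (- g t) * (t - t0) \<le> J t - J t0"
      by (rule deriv_bounds(1)[of t0 t "{t0..}" J "\<lambda>t. exp (- g t)" _ 1])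
         (use t J g_mono g_nonneg in auto)
    then show ?thesis by (simp add: J mult.commute)
  qed
  define L where "L = (\<lambda>t. ln (f t))"
  have L: "(L has_real_derivative f' t / f t) (at t within {t0..})" if "t \<ge> t0" for t
    unfolding L_def using fpos[OF that] by (auto intro!: derivative_eq_intros f' that)
  define C1 where "C1 = exp (ln C / 2)"
  have C1: "C1 \<ge> 1" "C1 > 0" "C1\<^sup>2 = C" using C_ge_1 by (auto simp: C1_def power2_eq_square simp flip: exp_add)
  have gL: "exp (- g t) \<le> C1 * exp (- L t / 2)" "exp (- L t / 2) \<le> C1 * exp (- g t)" if t: "t \<ge> t0" for t
  proof -
    have "exp (2 * g t - ln C) \<le> exp (L t)" "exp (L t) \<le> exp (ln C + 2 * g t)"
      using f_bounds[OF t] fpos[OF t] C_ge_1 by (auto simp: exp_diff exp_add L_def)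
    then have "2 * g t - ln C \<le> L t" "L t \<le> ln C + 2 * g t" by simp_all
    then show "exp (- g t) \<le> C1 * exp (- L t / 2)" "exp (- L t / 2) \<le> C1 * exp (- g t)"
      unfolding C1_def exp_add[symmetric] by simp_all
  qed
  define D where "D = C1 * C1 / (1 - \<kappa> / 2)"
  have k2: "1 - \<kappa> / 2 > 0" using \<kappa> by simp
  have D: "D > 0" using k2 C1 by (simp add: D_def)
  \<comment> \<open>\<open>E\<close> is \<open>t / sqrt f\<close>, whose derivative is at least
    \<open>(1 - \<kappa> / 2) / sqrt f\<close>, and \<open>\<kappa> < 2\<close> keeps this factor
    positive. So the integral of \<open>exp (- g)\<close> is at most a multiple of
    \<open>t exp (- g)\<close>, the size of \<open>E\<close>.\<close>
  have Jup: "J t \<le> D * (t * exp (- g t))" if t: "t \<ge> t0" for t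
  proof -
    define E where "E = (\<lambda>t. t * exp (- L t / 2))"
    have E: "(E has_real_derivative exp (- L t / 2) * (1 - t * f' t / f t / 2)) (at t within {t0..})" if "t \<ge> t0" for t
      unfolding E_def by (auto intro!: derivative_eq_intros L that simp: algebra_simps)
    have "\<bar>J t - J t0\<bar> \<le> C1 / (1 - \<kappa> / 2) * E t - C1 / (1 - \<kappa> / 2) * E t0"
    proof (rule deriv_compare[OF order_refl t J(2)])
      show "((\<lambda>t. C1 / (1 - \<kappa> / 2) * E t) has_real_derivative C1 / (1 - \<kappa> / 2) * (exp (- L x / 2) * (1 - x * f' x / f x / 2))) (at x within {t0..})" if "x \<ge> t0" for x
        by (intro DERIV_cmult E that)
      fix x assume x: "x \<ge> t0"
      have "exp (- g x) \<le> C1 * exp (- L x / 2)" by (rule gL(1)[OF x])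
      also have "\<dots> = C1 / (1 - \<kappa> / 2) * (exp (- L x / 2) * (1 - \<kappa> / 2))" using k2 by simp
      also have "\<dots> \<le> C1 / (1 - \<kappa> / 2) * (exp (- L x / 2) * (1 - x * f' x / f x / 2))"
        using \<kappa>(2)[OF x] k2 C1 by (intro mult_left_mono) auto
      finally show "\<bar>exp (- g x)\<bar> \<le> C1 / (1 - \<kappa> / 2) * (exp (- L x / 2) * (1 - x * f' x / f x / 2))" by simp
    qed
    moreover have "0 \<le> C1 / (1 - \<kappa> / 2) * E t0" using k2 C1 t0_pos by (simp add: E_def)
    ultimately have "J t \<le> C1 / (1 - \<kappa> / 2) * E t" using J(1) by (simp add: abs_le_iff)
    also have "\<dots> \<le> C1 / (1 - \<kappa> / 2) * (t * (C1 * exp (- g t)))"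
      unfolding E_def using k2 C1 t0_pos t gL(2)[OF t] by (intro mult_left_mono) auto
    finally show ?thesis by (simp add: D_def mult_ac)
  qed
  define A1 where "A1 = f t0 / t0\<^sup>2"
  have A1: "A1 > 0" using fpos[of t0] t0_pos by (simp add: A1_def)
  \<comment> \<open>\<open>t f' / f <= 2\<close> makes \<open>f / t^2\<close> non-increasing, so its
    value at \<open>t0\<close> is a global bound.\<close>
  have fA: "f t \<le> A1 * t\<^sup>2" if t: "t \<ge> t0" for t
  proof -
    have "2 * ln t0 - L t0 \<le> 2 * ln t - L t"
    proof (rule deriv_nonneg_mono[OF order_refl t])
      show "((\<lambda>t. 2 * ln t - L t) has_real_derivative 2 * (1 / x) - f' x / f x) (at x within {t0..})" if "x \<ge> t0" for x
        using that t0_pos L[OF that] by (auto intro!: derivative_eq_intros)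
      show "0 \<le> 2 * (1 / x) - f' x / f x" if "x \<ge> t0" for x
      proof -
        have "x * (f' x / f x) \<le> 2" using \<kappa>(2)[OF that] \<kappa>(1) by simp
        then show ?thesis using that t0_pos by (simp add: field_simps)
      qed
    qed
    then have "exp (L t) \<le> exp (L t0 + 2 * ln t - 2 * ln t0)" by simp
    also have "\<dots> = A1 * t\<^sup>2"
      using t t0_pos fpos[of t0] by (simp add: exp_add exp_diff exp_double A1_def L_def)
    finally show ?thesis using fpos[OF t] by (simp add: L_def)
  qed
  have eg: "exp (2 * g t) \<le> C * A1 * t\<^sup>2" if t: "t \<ge> t0" for t
  proof -
    have "exp (2 * g t) \<le> C * f t" using f_bounds[OF t] C_ge_1 by (simp add: field_simps)
    also have "\<dots> \<le> C * (A1 * t\<^sup>2)" using fA[OF t] C_ge_1 by (intro mult_left_mono) auto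
    finally show ?thesis by (simp add: mult_ac)
  qed
  have esq: "exp (2 * x) = (exp x)\<^sup>2" for x :: real by (simp add: exp_double)
  \<comment> \<open>Turns the bounded error left by \<open>B\<close> into a multiple of
    \<open>t exp (- g)\<close>.\<close>
  have eg1: "1 \<le> C1 * sqrt A1 * (t * exp (- g t))" if t: "t \<ge> t0" for t
  proof -
    have "(exp (g t))\<^sup>2 \<le> (C1 * sqrt A1 * t)\<^sup>2"
      using eg[OF t] A1 C1(3) by (simp add: esq[symmetric] power_mult_distrib)
    then have "exp (g t) \<le> C1 * sqrt A1 * t"
      by (rule power2_le_imp_le) (use C1 A1 t t0_pos in auto)
    then have "exp (g t) * exp (- g t) \<le> (C1 * sqrt A1 * t) * exp (- g t)" by (intro mult_right_mono) auto
    then show ?thesis by (simp add: exp_minus mult_ac)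
  qed
  define E2 where "E2 = \<bar>a\<bar> / 2 * ((1 + h t0) * D + C1 * sqrt A1)"
  have E2: "E2 \<ge> 0" unfolding E2_def using D C1 A1 h_nonneg[of t0] by auto
  have I2up: "\<bar>I2 t\<bar> \<le> E2 * (t * exp (- g t))" if t: "t \<ge> t0" for t
  proof -
    have "\<bar>V t\<bar> \<le> h t0 * J t"
      using Vdiff[OF order_refl t, of "h t0"] h_le_init J V by simp
    then have "\<bar>J t - B t + V t\<bar> \<le> (1 + h t0) * J t + 1"
      using Bb[OF t] Jnn[OF t] by (simp add: abs_le_iff algebra_simps)
    also have "\<dots> \<le> (1 + h t0) * (D * (t * exp (- g t))) + C1 * sqrt A1 * (t * exp (- g t))"
      using Jup[OF t] eg1[OF t] h_nonneg[of t0] by (intro add_mono mult_left_mono) auto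
    finally have "\<bar>a\<bar> / 2 * \<bar>J t - B t + V t\<bar> \<le> \<bar>a\<bar> / 2 * ((1 + h t0) * (D * (t * exp (- g t))) + C1 * sqrt A1 * (t * exp (- g t)))"
      by (intro mult_left_mono) auto
    also have "\<dots> = E2 * (t * exp (- g t))" unfolding E2_def by (simp add: algebra_simps)
    finally show ?thesis unfolding I2eq[OF t] abs_mult by simp
  qed
  define K where "K = flow_const"
  have K: "K \<ge> 1" unfolding K_def by (rule flow_const_ge_1)
  have I1z: "(I1 t)\<^sup>2 * ((z t)\<^sup>2 + (z' t)\<^sup>2) \<le> a\<^sup>2 * K" if t: "t \<ge> t0" for t
  proof -
    have "(I1 t)\<^sup>2 \<le> (\<bar>a\<bar> / 2 * exp (g t))\<^sup>2"
      using I1b[OF t] by (subst power2_le_iff_abs_le) auto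
    also have "\<dots> \<le> a\<^sup>2 * exp (2 * g t)" by (simp add: power_mult_distrib esq power_divide)
    finally have "(I1 t)\<^sup>2 * ((z t)\<^sup>2 + (z' t)\<^sup>2) \<le> (a\<^sup>2 * exp (2 * g t)) * (K * exp (- (2 * g t)))"
      unfolding K_def by (intro mult_mono z_bound t) auto
    also have "\<dots> = a\<^sup>2 * K" by (simp add: exp_minus field_simps)
    finally show ?thesis .
  qed
  have qp: "(q t)\<^sup>2 + (p t)\<^sup>2 = (I2 t)\<^sup>2 * ((y t)\<^sup>2 + (y' t)\<^sup>2) + (I1 t)\<^sup>2 * ((z t)\<^sup>2 + (z' t)\<^sup>2) - 2 * (I2 t * y t * (I1 t * z t) + I2 t * y' t * (I1 t * z' t))" for t
    unfolding q_def p_def by (simp add: power2_eq_square algebra_simps)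
  \<comment> \<open>Young's inequality with a parameter: \<open>\<epsilon> = 1\<close> serves the
    upper bound, and \<open>\<epsilon> = 1/2\<close> leaves half of the growing part in the lower
    bound.\<close>
  have cross: "2 * (I2 t * y t * (I1 t * z t) + I2 t * y' t * (I1 t * z' t)) \<le> \<epsilon> * ((I2 t)\<^sup>2 * ((y t)\<^sup>2 + (y' t)\<^sup>2)) + (I1 t)\<^sup>2 * ((z t)\<^sup>2 + (z' t)\<^sup>2) / \<epsilon>"
      "- (2 * (I2 t * y t * (I1 t * z t) + I2 t * y' t * (I1 t * z' t))) \<le> \<epsilon> * ((I2 t)\<^sup>2 * ((y t)\<^sup>2 + (y' t)\<^sup>2)) + (I1 t)\<^sup>2 * ((z t)\<^sup>2 + (z' t)\<^sup>2) / \<epsilon>"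
    if \<epsilon>: "\<epsilon> > 0" for t \<epsilon>
  proof -
    have 1: "2 * (b * d) \<le> \<epsilon> * b\<^sup>2 + d\<^sup>2 / \<epsilon> \<and> - (2 * (b * d)) \<le> \<epsilon> * b\<^sup>2 + d\<^sup>2 / \<epsilon>" for b d
    proof -
      have "0 \<le> (\<epsilon> * b - d)\<^sup>2 / \<epsilon>" "0 \<le> (\<epsilon> * b + d)\<^sup>2 / \<epsilon>" using \<epsilon> by auto
      then show ?thesis using \<epsilon> by (simp add: power2_eq_square field_simps)
    qed
    have "2 * (I2 t * y t * (I1 t * z t)) + 2 * (I2 t * y' t * (I1 t * z' t)) \<le> (\<epsilon> * (I2 t * y t)\<^sup>2 + (I1 t * z t)\<^sup>2 / \<epsilon>) + (\<epsilon> * (I2 t * y' t)\<^sup>2 + (I1 t * z' t)\<^sup>2 / \<epsilon>)"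
      using 1 by (intro add_mono) auto
    then show "2 * (I2 t * y t * (I1 t * z t) + I2 t * y' t * (I1 t * z' t)) \<le> \<epsilon> * ((I2 t)\<^sup>2 * ((y t)\<^sup>2 + (y' t)\<^sup>2)) + (I1 t)\<^sup>2 * ((z t)\<^sup>2 + (z' t)\<^sup>2) / \<epsilon>"
      by (simp add: power_mult_distrib algebra_simps add_divide_distrib)
    have "- (2 * (I2 t * y t * (I1 t * z t))) + - (2 * (I2 t * y' t * (I1 t * z' t))) \<le> (\<epsilon> * (I2 t * y t)\<^sup>2 + (I1 t * z t)\<^sup>2 / \<epsilon>) + (\<epsilon> * (I2 t * y' t)\<^sup>2 + (I1 t * z' t)\<^sup>2 / \<epsilon>)"
      using 1 by (intro add_mono) auto
    then show "- (2 * (I2 t * y t * (I1 t * z t) + I2 t * y' t * (I1 t * z' t))) \<le> \<epsilon> * ((I2 t)\<^sup>2 * ((y t)\<^sup>2 + (y' t)\<^sup>2)) + (I1 t)\<^sup>2 * ((z t)\<^sup>2 + (z' t)\<^sup>2) / \<epsilon>"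
      by (simp add: power_mult_distrib algebra_simps add_divide_distrib)
  qed
  define A where "A = 2 * (E2\<^sup>2 * K) + 2 * a\<^sup>2 * K / t0\<^sup>2 + A1"
  have A: "A > 0" unfolding A_def using A1 K E2 by (intro add_nonneg_pos add_nonneg_nonneg) auto
  have up: "(q t)\<^sup>2 + (p t)\<^sup>2 \<le> A * t\<^sup>2" if t: "t \<ge> t0" for t
  proof -
    have "(q t)\<^sup>2 + (p t)\<^sup>2 \<le> 2 * ((I2 t)\<^sup>2 * ((y t)\<^sup>2 + (y' t)\<^sup>2)) + 2 * ((I1 t)\<^sup>2 * ((z t)\<^sup>2 + (z' t)\<^sup>2))"
      using qp[of t] cross(2)[of 1 t] by simp
    also have "\<dots> \<le> 2 * ((E2 * (t * exp (- g t)))\<^sup>2 * (K * exp (2 * g t))) + 2 * (a\<^sup>2 * K)"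
    proof -
      have i: "(I2 t)\<^sup>2 \<le> (E2 * (t * exp (- g t)))\<^sup>2" using I2up[OF t] E2 t t0_pos by (subst power2_le_iff_abs_le) auto
      have "(y t)\<^sup>2 + (y' t)\<^sup>2 \<le> K * exp (2 * g t)" unfolding K_def by (rule y_bound[OF t])
      then have "(I2 t)\<^sup>2 * ((y t)\<^sup>2 + (y' t)\<^sup>2) \<le> (E2 * (t * exp (- g t)))\<^sup>2 * (K * exp (2 * g t))"
        using i by (intro mult_mono) auto
      then show ?thesis using I1z[OF t] by linarith
    qed
    also have "(E2 * (t * exp (- g t)))\<^sup>2 * (K * exp (2 * g t)) = E2\<^sup>2 * K * t\<^sup>2"
      unfolding esq by (simp add: power_mult_distrib exp_minus field_simps)
    also have "2 * (a\<^sup>2 * K) \<le> 2 * a\<^sup>2 * K / t0\<^sup>2 * t\<^sup>2"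
    proof -
      have "1 \<le> t\<^sup>2 / t0\<^sup>2" using t t0_pos by (simp add: power_mono)
      then have "2 * (a\<^sup>2 * K) * 1 \<le> 2 * (a\<^sup>2 * K) * (t\<^sup>2 / t0\<^sup>2)" using K by (intro mult_left_mono) auto
      then show ?thesis by simp
    qed
    finally have "(q t)\<^sup>2 + (p t)\<^sup>2 \<le> (2 * (E2\<^sup>2 * K) + 2 * a\<^sup>2 * K / t0\<^sup>2) * t\<^sup>2" by (simp add: algebra_simps)
    also have "\<dots> \<le> A * t\<^sup>2" using A1 by (intro mult_right_mono) (auto simp: A_def)
    finally show ?thesis .
  qed
  have fup: "f t \<le> A * t\<^sup>2" if t: "t \<ge> t0" for t
  proof -
    have "A1 * t\<^sup>2 \<le> A * t\<^sup>2" unfolding A_def using K by (intro mult_right_mono) auto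
    then show ?thesis using fA[OF t] by linarith
  qed
  \<comment> \<open>Once \<open>h < 1/2\<close>, further growth of \<open>V\<close> consumes at most
    half of that of \<open>J\<close>; \<open>C2\<close> collects the bound of \<open>B\<close> and
    what \<open>V\<close> has gathered before.\<close>
  have "eventually (\<lambda>t. h t < 1/2) at_top" using h_lim by (intro order_tendstoD) auto
  then obtain T0 where T0: "\<And>t. t \<ge> T0 \<Longrightarrow> h t < 1/2" by (auto simp: eventually_at_top_linorder)
  define s where "s = max T0 t0"
  define C2 where "C2 = 1 + \<bar>V s\<bar>"
  have I2low: "\<bar>a\<bar> / 2 * ((t - t0) / 2 * exp (- g t) - C2) \<le> \<bar>I2 t\<bar>" if t: "t \<ge> s" for t
  proof -
    have tt: "t \<ge> t0" "t0 \<le> s" using t by (auto simp: s_def)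
    have "\<bar>V t - V s\<bar> \<le> 1/2 * J t - 1/2 * J s"
      using T0 by (intro Vdiff tt t) (auto simp: s_def less_imp_le)
    then have "J t / 2 - C2 \<le> J t - B t + V t"
      using Bb[OF tt(1)] Jnn[OF tt(2)] unfolding C2_def by (simp add: abs_le_iff) linarith
    then have "(t - t0) / 2 * exp (- g t) - C2 \<le> \<bar>J t - B t + V t\<bar>"
      using Jlow[OF tt(1)] by simp
    then show ?thesis unfolding I2eq[OF tt(1)] abs_mult by (simp add: mult_left_mono)
  qed
  \<comment> \<open>Chosen so that \<open>C2 * exp (g t) <= t / 8\<close> as soon as
    \<open>f <= \<delta>^2 t^2\<close>. The constant error is then at most half of the secular part,
    which is at least \<open>t / 4\<close> for \<open>t >= 2 t0\<close>.\<close>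
  define \<delta> where "\<delta> = 1 / (8 * C2 * C1)"
  have C2: "C2 > 0" unfolding C2_def by (simp add: add_pos_nonneg)
  have \<delta>: "\<delta> > 0" using C2 C1 by (simp add: \<delta>_def)
  have "eventually (\<lambda>t. f t / t\<^sup>2 < \<delta>\<^sup>2) at_top" using small \<delta> by (intro order_tendstoD) auto
  then obtain T1 where T1: "\<And>t. t \<ge> T1 \<Longrightarrow> f t / t\<^sup>2 < \<delta>\<^sup>2" by (auto simp: eventually_at_top_linorder)
  define M where "M = \<bar>a\<bar> / 16"
  have M: "M > 0" using a by (simp add: M_def)
  define c where "c = M\<^sup>2 / (4 * K)"
  have c: "c > 0" using M K by (simp add: c_def)
  \<comment> \<open>Beyond \<open>T2\<close> the non-resonant part, bounded by \<open>a^2 K\<close>,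
    is at most \<open>c t^2\<close>, a quarter of the lower bound for the resonant part.\<close>
  define T2 where "T2 = sqrt (a\<^sup>2 * K / c)"
  define t1 where "t1 = max (max s T1) (max (2 * t0) T2)"
  have t1: "t1 \<ge> t0" by (simp add: t1_def s_def)
  have low: "c * t\<^sup>2 \<le> (q t)\<^sup>2 + (p t)\<^sup>2" if t: "t \<ge> t1" for t
  proof -
    have tt: "t \<ge> s" "t \<ge> T1" "t \<ge> 2 * t0" "t \<ge> T2" "t \<ge> t0" "t > 0" using t t0_pos by (auto simp: t1_def s_def)
    have "exp (2 * g t) \<le> C * f t" using f_bounds[OF tt(5)] C_ge_1 by (simp add: field_simps)
    also have "\<dots> \<le> C * (\<delta>\<^sup>2 * t\<^sup>2)"
      using T1[OF tt(2)] tt(6) C_ge_1 by (intro mult_left_mono) (auto simp: field_simps)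
    finally have "(exp (g t))\<^sup>2 \<le> (C1 * \<delta> * t)\<^sup>2" by (simp add: esq[symmetric] power_mult_distrib C1)
    then have "exp (g t) \<le> C1 * \<delta> * t" by (rule power2_le_imp_le) (use C1 \<delta> tt in auto)
    also have "\<dots> = t / (8 * C2)" using C1 by (simp add: \<delta>_def)
    finally have "C2 * exp (g t) \<le> t / 8" using C2 by (simp add: field_simps)
    moreover have "t / 4 \<le> (t - t0) / 2" using tt by simp
    ultimately have "t / 8 \<le> (t - t0) / 2 - C2 * exp (g t)" by linarith
    also have "\<dots> = ((t - t0) / 2 * exp (- g t) - C2) * exp (g t)" by (simp add: exp_minus algebra_simps)
    finally have "\<bar>a\<bar> / 2 * (t / 8) \<le> \<bar>a\<bar> / 2 * (((t - t0) / 2 * exp (- g t) - C2) * exp (g t))"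
      by (intro mult_left_mono) auto
    also have "\<dots> \<le> \<bar>I2 t\<bar> * exp (g t)"
      using mult_right_mono[OF I2low[OF tt(1)], of "exp (g t)"] by (simp add: mult.assoc)
    finally have "M * t \<le> \<bar>I2 t\<bar> * exp (g t)" by (simp add: M_def)
    then have "(M * t)\<^sup>2 \<le> (\<bar>I2 t\<bar> * exp (g t))\<^sup>2" using M tt by (intro power_mono) auto
    then have "M\<^sup>2 * t\<^sup>2 / K \<le> (I2 t)\<^sup>2 * (exp (2 * g t) / K)"
      unfolding esq using K by (simp add: power_mult_distrib divide_right_mono)
    also have "\<dots> \<le> (I2 t)\<^sup>2 * ((y t)\<^sup>2 + (y' t)\<^sup>2)"
      unfolding K_def by (intro mult_left_mono y_lower tt) auto
    finally have 1: "4 * (c * t\<^sup>2) \<le> (I2 t)\<^sup>2 * ((y t)\<^sup>2 + (y' t)\<^sup>2)" by (simp add: c_def)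
    have "a\<^sup>2 * K \<le> c * t\<^sup>2"
    proof -
      have "a\<^sup>2 * K / c = T2\<^sup>2" unfolding T2_def using c K by simp
      also have "\<dots> \<le> t\<^sup>2" using tt c K by (intro power_mono) (auto simp: T2_def)
      finally show ?thesis using c by (simp add: field_simps)
    qed
    then have 2: "(I1 t)\<^sup>2 * ((z t)\<^sup>2 + (z' t)\<^sup>2) \<le> c * t\<^sup>2" using I1z[OF tt(5)] by linarith
    have "(q t)\<^sup>2 + (p t)\<^sup>2 \<ge> (I2 t)\<^sup>2 * ((y t)\<^sup>2 + (y' t)\<^sup>2) / 2 - (I1 t)\<^sup>2 * ((z t)\<^sup>2 + (z' t)\<^sup>2)"
      using qp[of t] cross(1)[of "1/2" t] by simp
    then show ?thesis using 1 2 by linarith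
  qed
  have q0: "q t0 = 0" "p t0 = 0" by (simp_all add: q_def p_def I1 I2)
  show thesis by (rule that[OF q0 q_deriv p_deriv A up fup c t1 low])
qed

end

subsection \<open>Transport of the Hermite basis\<close>

lemma has_vector_derivative_iff_quotient:
  fixes f :: "real \<Rightarrow> complex"
  shows "(f has_vector_derivative D) (at x within S) \<longleftrightarrow>
    ((\<lambda>y. (f y - f x) / complex_of_real (y - x)) \<longlongrightarrow> D) (at x within S)"
proof -
  have "(f has_vector_derivative D) (at x within S) \<longleftrightarrow>
    ((\<lambda>y. norm (f y - f x - (y - x) *\<^sub>R D) / norm (y - x)) \<longlongrightarrow> 0) (at x within S)"
    by (simp add: has_vector_derivative_def has_derivative_iff_norm bounded_linear_scaleR_left)
  also have "\<dots> \<longleftrightarrow> ((\<lambda>y. norm ((f y - f x) / complex_of_real (y - x) - D)) \<longlongrightarrow> 0) (at x within S)"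
  proof (rule Lim_cong_within)
    fix y assume "y \<noteq> x"
    then have "(f y - f x) / complex_of_real (y - x) - D = (f y - f x - (y - x) *\<^sub>R D) / complex_of_real (y - x)"
      by (simp add: field_simps scaleR_conv_of_real)
    then show "norm (f y - f x - (y - x) *\<^sub>R D) / norm (y - x) = norm ((f y - f x) / complex_of_real (y - x) - D)"
      by (simp only: norm_divide norm_of_real real_norm_def)
  qed auto
  also have "\<dots> \<longleftrightarrow> ((\<lambda>y. (f y - f x) / complex_of_real (y - x)) \<longlongrightarrow> D) (at x within S)"
    by (simp only: tendsto_norm_zero_iff LIM_zero_iff)
  finally show ?thesis .
qed

lemma weak_product_rule:
  fixes u e e' :: "real \<Rightarrow> real \<Rightarrow> complex"
  assumes t: "t \<ge> t0"
    and u: "\<And>\<tau>. \<tau> \<ge> t0 \<Longrightarrow> L2 (u \<tau>)" and M: "\<And>\<tau>. \<tau> \<in> {t0..t + 1} \<Longrightarrow> L2norm (u \<tau>) \<le> M"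
    and e: "\<And>\<tau>. \<tau> \<ge> t0 \<Longrightarrow> L2 (e \<tau>)" and e't: "L2 (e' t)"
    and deriv: "\<And>\<tau> x. \<tau> \<ge> t0 \<Longrightarrow> ((\<lambda>\<tau>. e \<tau> x) has_vector_derivative e' \<tau> x) (at \<tau> within {t0..})"
    and dom: "\<And>\<tau> x. \<tau> \<in> {t0..t + 1} \<Longrightarrow> cmod (e' \<tau> x) \<le> C / (1 + x\<^sup>2)"
    and weak: "((\<lambda>\<tau>. pair (u \<tau>) (e t)) has_vector_derivative D) (at t within {t0..})"
    and cont: "((\<lambda>\<tau>. pair (u \<tau>) (e' t)) \<longlongrightarrow> pair (u t) (e' t)) (at t within {t0..})"
  shows "((\<lambda>\<tau>. pair (u \<tau>) (e \<tau>)) has_vector_derivative D + pair (u t) (e' t)) (at t within {t0..})"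
proof -
  define r where "r = (\<lambda>\<tau> x. (1 / complex_of_real (\<tau> - t)) * (e \<tau> x - e t x) - e' t x)"
  have r: "L2 (r \<tau>)" if "\<tau> \<ge> t0" for \<tau>
    unfolding r_def by (intro L2_diff L2_cmult e e't that t)
  have rlim: "((\<lambda>\<tau>. L2norm (r \<tau>)) \<longlongrightarrow> 0) (at t within {t0..})"
    unfolding tendsto_at_iff_sequentially
  proof (intro allI impI)
    fix X assume X: "\<forall>i. X i \<in> {t0..} - {t}" and Xt: "X \<longlonglongrightarrow> t"
    have "eventually (\<lambda>i. X i < t + 1) sequentially" using Xt by (intro order_tendstoD) auto
    then obtain N where N: "\<And>i. i \<ge> N \<Longrightarrow> X i < t + 1" by (auto simp: eventually_sequentially)
    \<comment> \<open>Dropping an initial segment keeps the times in \<open>[t0, t + 1]\<close>,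
      where the majorant is available.\<close>
    define Y where "Y = (\<lambda>i. X (i + N))"
    have Y: "Y i \<in> {t0..t + 1}" "Y i \<noteq> t" for i using X N[of "i + N"] by (auto simp: Y_def less_imp_le)
    have Yt: "Y \<longlonglongrightarrow> t" unfolding Y_def by (rule LIMSEQ_ignore_initial_segment[OF Xt])
    have "(\<lambda>i. LINT x|lborel. (cmod (r (Y i) x))\<^sup>2) \<longlonglongrightarrow> (LINT (x::real)|lborel. 0 :: real)"
    proof (rule integral_dominated_convergence)
      show "integrable lborel (\<lambda>x::real. (2 * \<bar>C\<bar>)\<^sup>2 * (1 / (1 + x\<^sup>2)))"
        by (intro integrable_mult_right integrable_inverse_quadratic)
      show "(\<lambda>x. (cmod (r (Y i) x))\<^sup>2) \<in> borel_measurable lborel" for i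
        using r[of "Y i"] Y[of i] by (auto simp: L2_def)
      show "AE x in lborel. (\<lambda>i. (cmod (r (Y i) x))\<^sup>2) \<longlonglongrightarrow> 0"
      proof (intro AE_I2)
        fix x
        have "((\<lambda>\<tau>. (e \<tau> x - e t x) / complex_of_real (\<tau> - t)) \<longlongrightarrow> e' t x) (at t within {t0..})"
          by (rule has_vector_derivative_iff_quotient[THEN iffD1, OF deriv[OF t]])
        then have "((\<lambda>\<tau>. (e \<tau> x - e t x) / complex_of_real (\<tau> - t)) \<circ> Y) \<longlonglongrightarrow> e' t x"
          unfolding tendsto_at_iff_sequentially using Y Yt by auto
        then have "(\<lambda>i. r (Y i) x) \<longlonglongrightarrow> 0"
          unfolding r_def by (intro LIM_zero) (simp add: o_def)
        then have "(\<lambda>i. (cmod (r (Y i) x))\<^sup>2) \<longlonglongrightarrow> (cmod 0)\<^sup>2" by (intro tendsto_intros)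
        then show "(\<lambda>i. (cmod (r (Y i) x))\<^sup>2) \<longlonglongrightarrow> 0" by simp
      qed
      show "AE x in lborel. norm ((cmod (r (Y i) x))\<^sup>2) \<le> (2 * \<bar>C\<bar>)\<^sup>2 * (1 / (1 + x\<^sup>2))" for i
      proof (intro AE_I2)
        fix x :: real
        have p: "1 + x\<^sup>2 \<ge> 1" "1 + x\<^sup>2 > 0" by (simp_all add: add_pos_nonneg)
        \<comment> \<open>The mean value inequality gives a majorant of the difference quotient that
          does not depend on the step.\<close>
        have "cmod (e (Y i) x - e t x) \<le> C / (1 + x\<^sup>2) * norm (Y i - t)"
        proof (rule differentiable_bound[where S = "{t0..t + 1}"])
          fix \<tau> assume \<tau>: "\<tau> \<in> {t0..t + 1}"
          have "((\<lambda>\<tau>. e \<tau> x) has_vector_derivative e' \<tau> x) (at \<tau> within {t0..t + 1})"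
            by (rule has_vector_derivative_within_subset[OF deriv]) (use \<tau> in auto)
          then show "((\<lambda>\<tau>. e \<tau> x) has_derivative (\<lambda>h. h *\<^sub>R e' \<tau> x)) (at \<tau> within {t0..t + 1})"
            by (simp add: has_vector_derivative_def)
          show "onorm (\<lambda>h. h *\<^sub>R e' \<tau> x) \<le> C / (1 + x\<^sup>2)"
          proof (rule onorm_bound)
            show "0 \<le> C / (1 + x\<^sup>2)" using dom[OF \<tau>] by (rule order_trans[OF norm_ge_zero])
            show "norm (h *\<^sub>R e' \<tau> x) \<le> C / (1 + x\<^sup>2) * norm h" for h
              using mult_right_mono[OF dom[OF \<tau>, of x], of "\<bar>h\<bar>"] by (simp add: mult.commute)
          qed
        qed (use Y[of i] t in auto)
        then have "cmod ((1 / complex_of_real (Y i - t)) * (e (Y i) x - e t x)) \<le> C / (1 + x\<^sup>2)"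
        proof -
          assume le: "cmod (e (Y i) x - e t x) \<le> C / (1 + x\<^sup>2) * norm (Y i - t)"
          have d: "norm (Y i - t) > 0" using Y[of i] by simp
          have "cmod ((1 / complex_of_real (Y i - t)) * (e (Y i) x - e t x)) = cmod (e (Y i) x - e t x) / norm (Y i - t)"
            by (simp add: norm_mult norm_divide del: of_real_diff)
          also have "\<dots> \<le> C / (1 + x\<^sup>2)" unfolding pos_divide_le_eq[OF d] by (rule le)
          finally show ?thesis .
        qed
        then have "cmod (r (Y i) x) \<le> C / (1 + x\<^sup>2) + C / (1 + x\<^sup>2)"
          unfolding r_def using dom[of t x] t by (intro order_trans[OF norm_triangle_ineq4] add_mono) auto
        also have "\<dots> \<le> 2 * \<bar>C\<bar> / (1 + x\<^sup>2)"
          using p by (simp add: divide_right_mono flip: add_divide_distrib)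
        finally have "(cmod (r (Y i) x))\<^sup>2 \<le> (2 * \<bar>C\<bar> / (1 + x\<^sup>2))\<^sup>2" by (intro power_mono) auto
        also have "\<dots> \<le> (2 * \<bar>C\<bar>)\<^sup>2 * (1 / (1 + x\<^sup>2))"
        proof -
          have "1 + x\<^sup>2 \<le> (1 + x\<^sup>2)\<^sup>2" using p by (simp add: power2_eq_square mult_le_cancel_left1)
          then show ?thesis unfolding power_divide times_divide_eq_right mult_1_right
            using p by (intro divide_left_mono) auto
        qed
        finally show "norm ((cmod (r (Y i) x))\<^sup>2) \<le> (2 * \<bar>C\<bar>)\<^sup>2 * (1 / (1 + x\<^sup>2))" by simp
      qed
    qed simp
    then have "(\<lambda>i. sqrt (LINT x|lborel. (cmod (r (Y i) x))\<^sup>2)) \<longlonglongrightarrow> sqrt 0"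
      by (intro tendsto_real_sqrt) simp
    then have "(\<lambda>i. L2norm (r (X (i + N)))) \<longlonglongrightarrow> 0" by (simp add: L2norm_def Y_def)
    then show "((\<lambda>\<tau>. L2norm (r \<tau>)) \<circ> X) \<longlonglongrightarrow> 0" unfolding o_def by (rule LIMSEQ_offset)
  qed
  have near: "eventually (\<lambda>\<tau>. \<tau> \<in> {t0..t + 1} \<and> \<tau> \<noteq> t) (at t within {t0..})"
    unfolding eventually_at_filter eventually_nhds
    by (intro exI[of _ "{..<t + 1}"]) auto
  have lim1: "((\<lambda>\<tau>. pair (u \<tau>) (r \<tau>)) \<longlongrightarrow> 0) (at t within {t0..})"
  proof (rule Lim_null_comparison)
    show "\<forall>\<^sub>F \<tau> in at t within {t0..}. norm (pair (u \<tau>) (r \<tau>)) \<le> M * L2norm (r \<tau>)"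
      using near
    proof eventually_elim
      case (elim \<tau>)
      then have "norm (pair (u \<tau>) (r \<tau>)) \<le> L2norm (u \<tau>) * L2norm (r \<tau>)" by (intro cauchy_schwarz_pair u r) auto
      also have "\<dots> \<le> M * L2norm (r \<tau>)" using elim M by (intro mult_right_mono) auto
      finally show ?case .
    qed
    show "((\<lambda>\<tau>. M * L2norm (r \<tau>)) \<longlongrightarrow> 0) (at t within {t0..})"
      using tendsto_mult[OF tendsto_const rlim, of M] by simp
  qed
  have lim3: "((\<lambda>\<tau>. (pair (u \<tau>) (e t) - pair (u t) (e t)) / complex_of_real (\<tau> - t)) \<longlongrightarrow> D) (at t within {t0..})"
    by (rule has_vector_derivative_iff_quotient[THEN iffD1, OF weak])
  have "((\<lambda>\<tau>. (pair (u \<tau>) (e t) - pair (u t) (e t)) / complex_of_real (\<tau> - t) + pair (u \<tau>) (e' t) + pair (u \<tau>) (r \<tau>)) \<longlongrightarrow> D + pair (u t) (e' t) + 0) (at t within {t0..})"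
    by (intro tendsto_add lim1 lim3 cont)
  moreover have "\<forall>\<^sub>F \<tau> in at t within {t0..}. (pair (u \<tau>) (e t) - pair (u t) (e t)) / complex_of_real (\<tau> - t) + pair (u \<tau>) (e' t) + pair (u \<tau>) (r \<tau>)
     = (pair (u \<tau>) (e \<tau>) - pair (u t) (e t)) / complex_of_real (\<tau> - t)"
    using near
  proof eventually_elim
    case (elim \<tau>)
    then have \<tau>: "\<tau> \<ge> t0" "\<tau> \<noteq> t" by auto
    have "pair (u \<tau>) (r \<tau>) = (1 / complex_of_real (\<tau> - t)) * (pair (u \<tau>) (e \<tau>) - pair (u \<tau>) (e t)) - pair (u \<tau>) (e' t)"
    proof -
      have "pair (u \<tau>) (r \<tau>) = pair (u \<tau>) (\<lambda>x. (1 / complex_of_real (\<tau> - t)) * (e \<tau> x - e t x)) - pair (u \<tau>) (e' t)"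
        unfolding r_def by (intro pair_diff_right L2_cmult L2_diff u e e't \<tau> t)
      also have "pair (u \<tau>) (\<lambda>x. (1 / complex_of_real (\<tau> - t)) * (e \<tau> x - e t x))
          = cnj (1 / complex_of_real (\<tau> - t)) * pair (u \<tau>) (\<lambda>x. e \<tau> x - e t x)"
        by (rule pair_cmult_right)
      also have "pair (u \<tau>) (\<lambda>x. e \<tau> x - e t x) = pair (u \<tau>) (e \<tau>) - pair (u \<tau>) (e t)"
        by (intro pair_diff_right u e \<tau> t)
      finally show ?thesis by (simp del: of_real_diff)
    qed
    then show ?case using \<tau> by (simp add: diff_divide_distrib add_divide_distrib)
  qed
  ultimately show ?thesis
    unfolding has_vector_derivative_iff_quotient using Lim_transform_eventually by fastforce
qed

text \<open>The equation \<open>(1 / i) \<partial>\<^sub>t u = H u\<close> runs the usual Schroedinger equation backwards, so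
  Hamilton's equations appear with \<open>q' = - p\<close> and \<open>p' = Q q + F\<close>. The real and imaginary parts of
  \<open>\<zeta>\<close> are two solutions of Hill's equation with Wronskian 1; their modulus \<open>\<rho>\<close> solves the Ermakov equation.\<close>
locale moving_frame =
  fixes t0 :: real and Q F q p :: "real \<Rightarrow> real" and \<zeta> \<zeta>' :: "real \<Rightarrow> complex"
  assumes zeta_deriv: "\<And>t. t \<ge> t0 \<Longrightarrow> (\<zeta> has_vector_derivative \<zeta>' t) (at t within {t0..})"
    and zeta'_deriv: "\<And>t. t \<ge> t0 \<Longrightarrow> (\<zeta>' has_vector_derivative - complex_of_real (Q t) * \<zeta> t) (at t within {t0..})"
    and symplectic: "\<And>t. t \<ge> t0 \<Longrightarrow> Im (cnj (\<zeta> t) * \<zeta>' t) = 1"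
    and q_deriv: "\<And>t. t \<ge> t0 \<Longrightarrow> (q has_real_derivative - p t) (at t within {t0..})"
    and p_deriv: "\<And>t. t \<ge> t0 \<Longrightarrow> (p has_real_derivative Q t * q t + F t) (at t within {t0..})"
    and Q_cont: "continuous_on {t0..} Q" and F_cont: "continuous_on {t0..} F"
    and zeta_init: "\<zeta> t0 = 1" and zeta'_init: "\<zeta>' t0 = \<i>" and q_init: "q t0 = 0" and p_init: "p t0 = 0"
begin

definition \<rho> :: "real \<Rightarrow> real" where "\<rho> t = cmod (\<zeta> t)"
definition \<omega> :: "real \<Rightarrow> complex" where "\<omega> t = \<zeta> t / \<rho> t"
definition \<sigma> :: "real \<Rightarrow> real" where "\<sigma> t = - Re (cnj (\<zeta> t) * \<zeta>' t) / (\<rho> t)\<^sup>2"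
text \<open>The classical rate \<open>H(q, p) + p q'\<close>, where \<open>q' = - p\<close>, plus
  the zero-point term \<open>1 / (2 \<rho>^2)\<close>. The excited levels get their extra
  \<open>m / \<rho>^2\<close> from the rotation of \<open>\<omega> ^ m\<close>.\<close>

definition \<theta>' :: "real \<Rightarrow> real" where
  "\<theta>' t = - (p t)\<^sup>2 / 2 + 1 / (2 * (\<rho> t)\<^sup>2) + Q t * (q t)\<^sup>2 / 2 + F t * q t"
definition \<theta> :: "real \<Rightarrow> real" where
  "\<theta> = (SOME G. G t0 = 0 \<and> (\<forall>t\<ge>t0. (G has_real_derivative \<theta>' t) (at t within {t0..})))"
definition \<kappa> :: "real \<Rightarrow> complex" where "\<kappa> t = exp (\<i> * complex_of_real (\<theta> t))"

lemma rho_pos: "t \<ge> t0 \<Longrightarrow> \<rho> t > 0"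
  using symplectic[of t] by (auto simp: \<rho>_def)

lemma rho_sq: "(\<rho> t)\<^sup>2 = (Re (\<zeta> t))\<^sup>2 + (Im (\<zeta> t))\<^sup>2"
  by (simp add: \<rho>_def cmod_power2)

lemma squeezed_frame: "t \<ge> t0 \<Longrightarrow> squeezed_frame (\<kappa> t) (\<omega> t) (\<rho> t)"
  using rho_pos[of t] by (simp add: squeezed_frame_def \<kappa>_def \<omega>_def norm_divide) (simp add: \<rho>_def)

lemma omega_rho: "t \<ge> t0 \<Longrightarrow> complex_of_real (\<rho> t) * \<omega> t = \<zeta> t"
  using rho_pos[of t] by (simp add: \<omega>_def)

text \<open>The real part of \<open>cnj \<zeta> * \<zeta>'\<close> is
  \<open>- \<sigma> \<rho>^2\<close> by definition of \<open>\<sigma>\<close>, and its imaginary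
  part is 1. This identifies the entry \<open>\<zeta>\<^sub>1\<close> of the frame at time
  \<open>t\<close> with the derivative \<open>\<zeta>'\<close>.\<close>

lemma zeta'_eq: "t \<ge> t0 \<Longrightarrow> - complex_of_real (\<sigma> t) * \<zeta> t + \<i> * \<omega> t / \<rho> t = \<zeta>' t"
proof -
  assume t: "t \<ge> t0"
  have r: "complex_of_real ((\<rho> t)\<^sup>2) \<noteq> 0" using rho_pos[OF t] by simp
  have "complex_of_real ((\<rho> t)\<^sup>2) * (- complex_of_real (\<sigma> t) * \<zeta> t + \<i> * \<omega> t / \<rho> t) = (Re (cnj (\<zeta> t) * \<zeta>' t) + \<i>) * \<zeta> t"
  proof -
    have "complex_of_real ((\<rho> t)\<^sup>2) * complex_of_real (\<sigma> t) = - Re (cnj (\<zeta> t) * \<zeta>' t)"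
      using r unfolding of_real_mult[symmetric] of_real_eq_iff of_real_minus[symmetric] by (simp add: \<sigma>_def)
    moreover have "complex_of_real ((\<rho> t)\<^sup>2) * (\<i> * \<omega> t / \<rho> t) = \<i> * \<zeta> t"
      using rho_pos[OF t] by (simp add: \<omega>_def power2_eq_square)
    moreover have "P * (- s * z + X) = - (P * s) * z + P * X" for P s z X :: complex
      by (simp add: algebra_simps)
    ultimately show ?thesis by (simp only:) (simp add: distrib_right)
  qed
  also have "Re (cnj (\<zeta> t) * \<zeta>' t) + \<i> = cnj (\<zeta> t) * \<zeta>' t"
    using symplectic[OF t] by (simp add: complex_eq_iff)
  also have "cnj (\<zeta> t) * \<zeta>' t * \<zeta> t = complex_of_real ((\<rho> t)\<^sup>2) * \<zeta>' t"
    unfolding \<rho>_def complex_norm_square by simp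
  finally show ?thesis using r by (simp only: mult_cancel_left) simp
qed

lemma rho_deriv: "t \<ge> t0 \<Longrightarrow> (\<rho> has_real_derivative - \<sigma> t * \<rho> t) (at t within {t0..})"
proof -
  assume t: "t \<ge> t0"
  have c: "(\<lambda>t. sqrt ((Re (\<zeta> t))\<^sup>2 + (Im (\<zeta> t))\<^sup>2)) = \<rho>"
    by (rule ext) (simp add: \<rho>_def cmod_def)
  have pos: "(Re (\<zeta> t))\<^sup>2 + (Im (\<zeta> t))\<^sup>2 > 0" using rho_pos[OF t] by (simp flip: rho_sq)
  have "((\<lambda>t. sqrt ((Re (\<zeta> t))\<^sup>2 + (Im (\<zeta> t))\<^sup>2)) has_real_derivative
     (2 * Re (\<zeta> t) * Re (\<zeta>' t) + 2 * Im (\<zeta> t) * Im (\<zeta>' t)) * (inverse (sqrt ((Re (\<zeta> t))\<^sup>2 + (Im (\<zeta> t))\<^sup>2)) / 2)) (at t within {t0..})"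
    using pos by (auto intro!: derivative_eq_intros zeta_deriv[OF t] simp: mult_ac)
  moreover have "(2 * Re (\<zeta> t) * Re (\<zeta>' t) + 2 * Im (\<zeta> t) * Im (\<zeta>' t)) * (inverse (sqrt ((Re (\<zeta> t))\<^sup>2 + (Im (\<zeta> t))\<^sup>2)) / 2) = - \<sigma> t * \<rho> t"
  proof -
    have s: "sqrt ((Re (\<zeta> t))\<^sup>2 + (Im (\<zeta> t))\<^sup>2) = \<rho> t" by (simp add: \<rho>_def cmod_def)
    show ?thesis unfolding s using rho_pos[OF t] by (simp add: \<sigma>_def power2_eq_square field_simps)
  qed
  ultimately show ?thesis unfolding c by simp
qed

text \<open>The Riccati form of the Ermakov equation. With \<open>A\<close> the real part of
  \<open>cnj \<zeta> * \<zeta>'\<close>, the term \<open>1 / \<rho>^4\<close> comes from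
  \<open>|\<zeta>|^2 |\<zeta>'|^2 = A^2 + 1\<close>, that is, from the symplectic
  normalisation.\<close>

lemma sigma_deriv: "t \<ge> t0 \<Longrightarrow> (\<sigma> has_real_derivative (\<sigma> t)\<^sup>2 - 1 / (\<rho> t) ^ 4 + Q t) (at t within {t0..})"
proof -
  assume t: "t \<ge> t0"
  define A where "A = (\<lambda>t. Re (cnj (\<zeta> t) * \<zeta>' t))"
  have r: "\<rho> t > 0" by (rule rho_pos[OF t])
  have "((\<lambda>t. Re (\<zeta> t) * Re (\<zeta>' t) + Im (\<zeta> t) * Im (\<zeta>' t)) has_real_derivative
     (Re (\<zeta>' t))\<^sup>2 + (Im (\<zeta>' t))\<^sup>2 - Q t * ((Re (\<zeta> t))\<^sup>2 + (Im (\<zeta> t))\<^sup>2)) (at t within {t0..})"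
    by (auto intro!: derivative_eq_intros zeta_deriv[OF t] zeta'_deriv[OF t] simp: power2_eq_square algebra_simps)
  then have Ad: "(A has_real_derivative (Re (\<zeta>' t))\<^sup>2 + (Im (\<zeta>' t))\<^sup>2 - Q t * (\<rho> t)\<^sup>2) (at t within {t0..})"
    by (simp add: A_def rho_sq)
  have n: "((Re (\<zeta>' t))\<^sup>2 + (Im (\<zeta>' t))\<^sup>2) * (\<rho> t)\<^sup>2 = (A t)\<^sup>2 + 1"
  proof -
    have "(cmod (cnj (\<zeta> t) * \<zeta>' t))\<^sup>2 = (A t)\<^sup>2 + 1"
      unfolding cmod_power2 symplectic[OF t] A_def by simp
    then show ?thesis by (simp add: norm_mult power_mult_distrib cmod_power2[of "\<zeta>' t"] \<rho>_def mult.commute)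
  qed
  have sA: "\<sigma> t = - A t / (\<rho> t)\<^sup>2" by (simp add: \<sigma>_def A_def)
  have "((\<lambda>t. - A t / (\<rho> t)\<^sup>2) has_real_derivative
     (- ((Re (\<zeta>' t))\<^sup>2 + (Im (\<zeta>' t))\<^sup>2 - Q t * (\<rho> t)\<^sup>2) * (\<rho> t)\<^sup>2 - (- A t) * (2 * \<rho> t * (- \<sigma> t * \<rho> t))) / ((\<rho> t)\<^sup>2 * (\<rho> t)\<^sup>2)) (at t within {t0..})"
    using r by (intro DERIV_divide DERIV_minus Ad) (auto intro!: derivative_eq_intros rho_deriv t)
  moreover have "(- ((Re (\<zeta>' t))\<^sup>2 + (Im (\<zeta>' t))\<^sup>2 - Q t * (\<rho> t)\<^sup>2) * (\<rho> t)\<^sup>2 - (- A t) * (2 * \<rho> t * (- \<sigma> t * \<rho> t))) / ((\<rho> t)\<^sup>2 * (\<rho> t)\<^sup>2)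
     = (\<sigma> t)\<^sup>2 - 1 / (\<rho> t) ^ 4 + Q t"
  proof -
    have s1: "A t = - \<sigma> t * (\<rho> t)\<^sup>2" using sA r by simp
    have "- ((Re (\<zeta>' t))\<^sup>2 + (Im (\<zeta>' t))\<^sup>2 - Q t * (\<rho> t)\<^sup>2) * (\<rho> t)\<^sup>2 - (- A t) * (2 * \<rho> t * (- \<sigma> t * \<rho> t))
       = - ((A t)\<^sup>2 + 1) + Q t * ((\<rho> t)\<^sup>2 * (\<rho> t)\<^sup>2) - 2 * A t * \<sigma> t * (\<rho> t)\<^sup>2"
      unfolding n[symmetric] by (simp add: power2_eq_square algebra_simps)
    also have "\<dots> = ((\<sigma> t)\<^sup>2 + Q t) * ((\<rho> t)\<^sup>2 * (\<rho> t)\<^sup>2) - 1"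
      unfolding s1 by (simp add: power2_eq_square algebra_simps)
    finally show ?thesis using r by (simp only:) (simp add: diff_divide_distrib power2_eq_square power4_eq_xxxx)
  qed
  moreover have "\<sigma> = (\<lambda>t. - A t / (\<rho> t)\<^sup>2)" by (rule ext) (simp add: \<sigma>_def A_def)
  ultimately show ?thesis by simp
qed

lemma continuous_data:
  "continuous_on {t0..} \<rho>" "continuous_on {t0..} \<sigma>" "continuous_on {t0..} q" "continuous_on {t0..} p"
  using rho_deriv sigma_deriv q_deriv p_deriv by (auto intro!: DERIV_continuous_on)

lemma continuous_chi': "continuous_on {t0..} \<theta>'"
  unfolding \<theta>'_def using rho_pos by (intro continuous_intros continuous_data Q_cont F_cont) force+

lemma chi: "\<theta> t0 = 0" "t \<ge> t0 \<Longrightarrow> (\<theta> has_real_derivative \<theta>' t) (at t within {t0..})"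
proof -
  have "\<exists>G. G t0 = 0 \<and> (\<forall>t\<ge>t0. (G has_real_derivative \<theta>' t) (at t within {t0..}))"
    using half_line_antiderivative[OF continuous_chi'] by metis
  from someI_ex[OF this] show "\<theta> t0 = 0" "t \<ge> t0 \<Longrightarrow> (\<theta> has_real_derivative \<theta>' t) (at t within {t0..})"
    unfolding \<theta>_def by auto
qed

end

text \<open>The prefactor has degree two because the time derivative of a frame function contains
  the square of the rescaled variable. A single constant covers the Hermite function and its
  derivative.\<close>

lemma hermite_c_decay:
  obtains H where "H > 0"
    "\<And>w. (1 + \<bar>w\<bar> + w\<^sup>2) * (cmod (hermite_c m w) + cmod (dhermite_c m w)) \<le> H / (1 + w\<^sup>2)"
proof -
  define P where "P = smult (1 / complex_of_real (hermite_scale m)) (hermite_cpoly m)"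
  define P' where "P' = gauss_deriv (- 1/2) 0 P"
  have h: "hermite_c m = poly_gauss P (- 1/2) 0" by (simp add: hermite_c_poly_gauss P_def)
  have h': "dhermite_c m = poly_gauss P' (- 1/2) 0"
    unfolding P'_def P_def gauss_deriv_hermite_c by (rule ext) (simp add: dhermite_c_def)
  obtain C1 where C1: "C1 > 0" "\<And>x. cmod (poly_gauss ([:1, 0, 1:] * P) (- 1/2) 0 x) \<le> C1 / (1 + x\<^sup>2)"
    using poly_gauss_decay[of "- 1/2" "[:1, 0, 1:] * P" 0] by auto
  obtain C2 where C2: "C2 > 0" "\<And>x. cmod (poly_gauss ([:1, 0, 1:] * P') (- 1/2) 0 x) \<le> C2 / (1 + x\<^sup>2)"
    using poly_gauss_decay[of "- 1/2" "[:1, 0, 1:] * P'" 0] by auto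
  have sq: "cmod (poly_gauss ([:1, 0, 1:] * R) A B w) = (1 + w\<^sup>2) * cmod (poly_gauss R A B w)" for R A B w
  proof -
    have "poly_gauss ([:1, 0, 1:] * R) A B w = complex_of_real (1 + w\<^sup>2) * poly_gauss R A B w"
      by (simp add: poly_gauss_def power2_eq_square algebra_simps)
    moreover have "\<bar>1 + w\<^sup>2\<bar> = 1 + w\<^sup>2" by (simp add: add_nonneg_nonneg)
    ultimately show ?thesis by (simp only: norm_mult norm_of_real)
  qed
  have "(1 + \<bar>w\<bar> + w\<^sup>2) * (cmod (hermite_c m w) + cmod (dhermite_c m w)) \<le> 2 * (C1 + C2) / (1 + w\<^sup>2)" for w :: real
  proof -
    have "1 + \<bar>w\<bar> + w\<^sup>2 \<le> 2 * (1 + w\<^sup>2)"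
    proof -
      have "0 \<le> (\<bar>w\<bar> - 1)\<^sup>2" by simp
      then show ?thesis by (simp add: power2_eq_square algebra_simps)
    qed
    then have "(1 + \<bar>w\<bar> + w\<^sup>2) * (cmod (hermite_c m w) + cmod (dhermite_c m w)) \<le> 2 * (1 + w\<^sup>2) * (cmod (hermite_c m w) + cmod (dhermite_c m w))"
      by (intro mult_right_mono) auto
    also have "\<dots> = 2 * ((1 + w\<^sup>2) * cmod (hermite_c m w) + (1 + w\<^sup>2) * cmod (dhermite_c m w))"
      by (simp add: algebra_simps)
    also have "\<dots> \<le> 2 * (C1 / (1 + w\<^sup>2) + C2 / (1 + w\<^sup>2))"
      using C1(2)[of w] C2(2)[of w] unfolding sq h h' by (intro mult_left_mono add_mono) auto
    finally show ?thesis by (simp add: add_divide_distrib)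
  qed
  then show thesis using C1(1) C2(1) by (intro that[of "2 * (C1 + C2)"]) auto
qed

section \<open>The moving basis solves the Schroedinger equation\<close>

context moving_frame
begin

definition E :: "real \<Rightarrow> nat \<Rightarrow> real \<Rightarrow> complex" where
  "E t = squeezed_frame.frame (\<kappa> t) (\<omega> t) (\<rho> t) (\<sigma> t) (q t) (p t)"

definition E' :: "nat \<Rightarrow> real \<Rightarrow> real \<Rightarrow> complex" where
  "E' m t x = \<kappa> t * \<omega> t ^ m / sqrt (\<rho> t) *
     ((\<i> * complex_of_real (\<theta>' t + m / (\<rho> t)\<^sup>2
         + (((\<sigma> t)\<^sup>2 - 1 / (\<rho> t) ^ 4 + Q t) * (x - q t)\<^sup>2 / 2 + \<sigma> t * (x - q t) * p t + (Q t * q t + F t) * (x - q t) + (p t)\<^sup>2)) + \<sigma> t / 2)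
        * hermite_c m ((x - q t) / \<rho> t)
      + (\<sigma> t * (x - q t) + p t) / \<rho> t * dhermite_c m ((x - q t) / \<rho> t))
     * squeezed_frame.phase (\<sigma> t) (q t) (p t) x"

lemma E_has_vector_derivative:
  assumes t: "t \<ge> t0"
  shows "((\<lambda>\<tau>. E \<tau> m x) has_vector_derivative E' m t x) (at t within {t0..})"
proof -
  have r: "\<rho> t > 0" by (rule rho_pos[OF t])
  let ?w = "(x - q t) / \<rho> t"
  define \<Psi> where "\<Psi> = (\<lambda>t. \<sigma> t * (x - q t)\<^sup>2 / 2 + p t * (x - q t))"
  define \<Psi>' where "\<Psi>' = ((\<sigma> t)\<^sup>2 - 1 / (\<rho> t) ^ 4 + Q t) * (x - q t)\<^sup>2 / 2 + \<sigma> t * (x - q t) * p t + (Q t * q t + F t) * (x - q t) + (p t)\<^sup>2"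
  have k: "(\<kappa> has_vector_derivative \<i> * \<theta>' t * \<kappa> t) (at t within {t0..})"
  proof -
    have "((\<lambda>t. \<i> * complex_of_real (\<theta> t)) has_vector_derivative \<i> * complex_of_real (\<theta>' t)) (at t within {t0..})"
      by (intro has_vector_derivative_mult_right has_vector_derivative_of_real chi t)
    from field_vector_diff_chain_within[OF this DERIV_subset[OF DERIV_exp subset_UNIV]]
    show ?thesis by (simp add: \<kappa>_def[abs_def] o_def)
  qed
  have ph: "((\<lambda>t. exp (\<i> * complex_of_real (\<Psi> t))) has_vector_derivative \<i> * \<Psi>' * exp (\<i> * complex_of_real (\<Psi> t))) (at t within {t0..})"
  proof -
    have "(\<Psi> has_real_derivative \<Psi>') (at t within {t0..})"
    proof -
      have q1: "((\<lambda>t. x - q t) has_real_derivative p t) (at t within {t0..})"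
        using DERIV_diff[OF DERIV_const q_deriv[OF t], of x] by simp
      have "((\<lambda>t. \<sigma> t * ((x - q t) * (x - q t)) / 2 + p t * (x - q t)) has_real_derivative
         (((\<sigma> t)\<^sup>2 - 1 / (\<rho> t) ^ 4 + Q t) * ((x - q t) * (x - q t)) + (p t * (x - q t) + p t * (x - q t)) * \<sigma> t) / 2
         + ((Q t * q t + F t) * (x - q t) + p t * p t)) (at t within {t0..})"
        by (intro DERIV_add DERIV_cdivide DERIV_mult sigma_deriv q1 p_deriv t)
      moreover have "(((\<sigma> t)\<^sup>2 - 1 / (\<rho> t) ^ 4 + Q t) * ((x - q t) * (x - q t)) + (p t * (x - q t) + p t * (x - q t)) * \<sigma> t) / 2
         + ((Q t * q t + F t) * (x - q t) + p t * p t) = \<Psi>'"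
        unfolding \<Psi>'_def power2_eq_square add_divide_distrib by (simp add: mult_ac)
      ultimately show ?thesis unfolding \<Psi>_def power2_eq_square by (simp only:)
    qed
    then have "((\<lambda>t. \<i> * complex_of_real (\<Psi> t)) has_vector_derivative \<i> * complex_of_real \<Psi>') (at t within {t0..})"
      by (intro has_vector_derivative_mult_right has_vector_derivative_of_real)
    from field_vector_diff_chain_within[OF this DERIV_subset[OF DERIV_exp subset_UNIV]]
    show ?thesis by (simp add: o_def)
  qed
  have om: "(\<omega> has_vector_derivative \<i> / (\<rho> t)\<^sup>2 * \<omega> t) (at t within {t0..})"
  proof -
    have ir: "((\<lambda>t. 1 / \<rho> t) has_real_derivative \<sigma> t / \<rho> t) (at t within {t0..})"
      using r by (auto intro!: derivative_eq_intros rho_deriv t simp: field_simps)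
    have "((\<lambda>t. \<zeta> t * complex_of_real (1 / \<rho> t)) has_vector_derivative
       \<zeta> t * complex_of_real (\<sigma> t / \<rho> t) + \<zeta>' t * complex_of_real (1 / \<rho> t)) (at t within {t0..})"
      by (intro has_vector_derivative_mult has_vector_derivative_of_real ir zeta_deriv t)
    moreover have "\<zeta> t * complex_of_real (\<sigma> t / \<rho> t) + \<zeta>' t * complex_of_real (1 / \<rho> t) = \<i> / (\<rho> t)\<^sup>2 * \<omega> t"
      unfolding zeta'_eq[OF t, symmetric] using r by (simp add: field_simps power2_eq_square)
    ultimately show ?thesis by (simp add: \<omega>_def[abs_def])
  qed
  have omm: "((\<lambda>t. \<omega> t ^ m) has_vector_derivative \<i> * m / (\<rho> t)\<^sup>2 * \<omega> t ^ m) (at t within {t0..})"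
  proof -
    have "((\<lambda>z. z ^ m) has_field_derivative of_nat m * \<omega> t ^ (m - 1)) (at (\<omega> t))"
      by (auto intro!: derivative_eq_intros)
    from field_vector_diff_chain_within[OF om DERIV_subset[OF this subset_UNIV]]
    have "((\<lambda>t. \<omega> t ^ m) has_vector_derivative \<i> / (\<rho> t)\<^sup>2 * \<omega> t * (of_nat m * \<omega> t ^ (m - 1))) (at t within {t0..})"
      by (simp add: o_def)
    moreover have "\<i> / (\<rho> t)\<^sup>2 * \<omega> t * (of_nat m * \<omega> t ^ (m - 1)) = \<i> * m / (\<rho> t)\<^sup>2 * \<omega> t ^ m"
      by (cases m) auto
    ultimately show ?thesis by (simp only:)
  qed
  have isr: "((\<lambda>t. complex_of_real (1 / sqrt (\<rho> t))) has_vector_derivative \<sigma> t / 2 * complex_of_real (1 / sqrt (\<rho> t))) (at t within {t0..})"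
  proof -
    have "((\<lambda>t. 1 / sqrt (\<rho> t)) has_real_derivative \<sigma> t / 2 * (1 / sqrt (\<rho> t))) (at t within {t0..})"
    proof -
      have "((\<lambda>t. 1 / sqrt (\<rho> t)) has_real_derivative - ((- \<sigma> t * \<rho> t) * (inverse (sqrt (\<rho> t)) / 2)) / (sqrt (\<rho> t) * sqrt (\<rho> t))) (at t within {t0..})"
        using r by (auto intro!: derivative_eq_intros rho_deriv t)
      moreover have "- ((- \<sigma> t * \<rho> t) * (inverse (sqrt (\<rho> t)) / 2)) / (sqrt (\<rho> t) * sqrt (\<rho> t)) = \<sigma> t / 2 * (1 / sqrt (\<rho> t))"
        using r by (simp add: field_simps)
      ultimately show ?thesis by simp
    qed
    from has_vector_derivative_of_real[OF this, where 'a = complex]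
    show ?thesis by simp
  qed
  have hw: "((\<lambda>t. hermite_c m ((x - q t) / \<rho> t)) has_vector_derivative (\<sigma> t * (x - q t) + p t) / \<rho> t * dhermite_c m ?w) (at t within {t0..})"
  proof -
    have "((\<lambda>t. (x - q t) / \<rho> t) has_real_derivative (\<sigma> t * (x - q t) + p t) / \<rho> t) (at t within {t0..})"
    proof -
      have "((\<lambda>t. (x - q t) / \<rho> t) has_real_derivative ((0 - - p t) * \<rho> t - (x - q t) * (- \<sigma> t * \<rho> t)) / (\<rho> t * \<rho> t)) (at t within {t0..})"
        using r by (intro DERIV_divide DERIV_diff DERIV_const q_deriv rho_deriv t) auto
      moreover have "((0 - - p t) * \<rho> t - (x - q t) * (- \<sigma> t * \<rho> t)) / (\<rho> t * \<rho> t) = (\<sigma> t * (x - q t) + p t) / \<rho> t"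
        using r by (simp add: field_simps)
      ultimately show ?thesis by simp
    qed
    then have "((\<lambda>t. (x - q t) / \<rho> t) has_vector_derivative (\<sigma> t * (x - q t) + p t) / \<rho> t) (at t within {t0..})"
      by (simp add: has_real_derivative_iff_has_vector_derivative)
    moreover have "(hermite_c m has_vector_derivative dhermite_c m ?w) (at ?w within (\<lambda>t. (x - q t) / \<rho> t) ` {t0..})"
      unfolding dhermite_c_def by (rule hermite_c_has_vector_derivative)
    ultimately have "(hermite_c m \<circ> (\<lambda>t. (x - q t) / \<rho> t) has_vector_derivative ((\<sigma> t * (x - q t) + p t) / \<rho> t) *\<^sub>R dhermite_c m ?w) (at t within {t0..})"
      by (rule vector_diff_chain_within)
    then show ?thesis by (simp add: o_def scaleR_conv_of_real)
  qed
  have phase: "squeezed_frame.phase (\<sigma> s) (q s) (p s) x = exp (\<i> * complex_of_real (\<Psi> s))" if "s \<ge> t0" for s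
    using squeezed_frame.phase_def[OF squeezed_frame[OF that]] by (simp add: \<Psi>_def)
  have Eeq: "E s m x = \<kappa> s * \<omega> s ^ m * complex_of_real (1 / sqrt (\<rho> s)) * hermite_c m ((x - q s) / \<rho> s) * exp (\<i> * complex_of_real (\<Psi> s))" if "s \<ge> t0" for s
    unfolding E_def squeezed_frame.frame_def[OF squeezed_frame[OF that]] phase[OF that] by simp
  define k0 o0 s0 h0 d0 p0 where "k0 = \<kappa> t" "o0 = \<omega> t ^ m" "s0 = complex_of_real (1 / sqrt (\<rho> t))" "h0 = hermite_c m ?w" "d0 = dhermite_c m ?w" "p0 = exp (\<i> * complex_of_real (\<Psi> t))"
  have "((\<lambda>s. \<kappa> s * \<omega> s ^ m * complex_of_real (1 / sqrt (\<rho> s)) * hermite_c m ((x - q s) / \<rho> s) * exp (\<i> * complex_of_real (\<Psi> s))) has_vector_derivative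
     (\<kappa> t * \<omega> t ^ m * complex_of_real (1 / sqrt (\<rho> t)) * hermite_c m ?w) * (\<i> * \<Psi>' * exp (\<i> * complex_of_real (\<Psi> t)))
     + ((\<kappa> t * \<omega> t ^ m * complex_of_real (1 / sqrt (\<rho> t))) * ((\<sigma> t * (x - q t) + p t) / \<rho> t * dhermite_c m ?w)
        + ((\<kappa> t * \<omega> t ^ m) * (\<sigma> t / 2 * complex_of_real (1 / sqrt (\<rho> t)))
           + (\<kappa> t * (\<i> * m / (\<rho> t)\<^sup>2 * \<omega> t ^ m) + \<i> * \<theta>' t * \<kappa> t * \<omega> t ^ m) * complex_of_real (1 / sqrt (\<rho> t))) * hermite_c m ?w)
       * exp (\<i> * complex_of_real (\<Psi> t))) (at t within {t0..})"
    by (intro has_vector_derivative_mult k omm isr hw ph)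
  also have "(\<kappa> t * \<omega> t ^ m * complex_of_real (1 / sqrt (\<rho> t)) * hermite_c m ?w) * (\<i> * \<Psi>' * exp (\<i> * complex_of_real (\<Psi> t)))
     + ((\<kappa> t * \<omega> t ^ m * complex_of_real (1 / sqrt (\<rho> t))) * ((\<sigma> t * (x - q t) + p t) / \<rho> t * dhermite_c m ?w)
        + ((\<kappa> t * \<omega> t ^ m) * (\<sigma> t / 2 * complex_of_real (1 / sqrt (\<rho> t)))
           + (\<kappa> t * (\<i> * m / (\<rho> t)\<^sup>2 * \<omega> t ^ m) + \<i> * \<theta>' t * \<kappa> t * \<omega> t ^ m) * complex_of_real (1 / sqrt (\<rho> t))) * hermite_c m ?w)
       * exp (\<i> * complex_of_real (\<Psi> t)) = E' m t x"
    unfolding E'_def \<Psi>'_def[symmetric] phase[OF t]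
    unfolding k0_o0_s0_h0_d0_p0_def[symmetric] of_real_add of_real_divide[of 1] 
    by (simp add: algebra_simps)
  finally show ?thesis
    by (rule has_vector_derivative_transform[rotated 2]) (use t Eeq in auto)
qed

text \<open>Comparison of coefficients in \<open>x - q t\<close>: the quadratic one is the Riccati
  equation for \<open>\<sigma>\<close>, the linear one Hamilton's equation for \<open>p\<close>, the
  constant one the definition of \<open>\<theta>'\<close>. The terms with \<open>dhermite_c\<close>
  agree because the rescaled variable is transported by \<open>\<rho>' = - \<sigma> \<rho>\<close>
  and \<open>q' = - p\<close>.\<close>

lemma E'_eq_ham:
  assumes t: "t \<ge> t0" and V: "\<And>x. V t x = Q t * x\<^sup>2 / 2 + F t * x"
  shows "E' m t = (\<lambda>x. \<i> * ham V t (E t m) x)"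
proof
  fix x
  interpret fr: squeezed_frame "\<kappa> t" "\<omega> t" "\<rho> t" "\<sigma> t" "q t" "p t" by (rule squeezed_frame[OF t])
  have r: "\<rho> t > 0" by (rule rho_pos[OF t])
  let ?w = "(x - q t) / \<rho> t" and ?S = "\<sigma> t * (x - q t) + p t"
  define c h d P where "c = \<kappa> t * \<omega> t ^ m / sqrt (\<rho> t)" "h = hermite_c m ?w" "d = dhermite_c m ?w" "P = fr.phase x"
  have scal: "\<theta>' t + m / (\<rho> t)\<^sup>2 + (((\<sigma> t)\<^sup>2 - 1 / (\<rho> t) ^ 4 + Q t) * (x - q t)\<^sup>2 / 2 + \<sigma> t * (x - q t) * p t + (Q t * q t + F t) * (x - q t) + (p t)\<^sup>2)
     = - (?w\<^sup>2 - 2 * real m - 1) / (2 * (\<rho> t)\<^sup>2) + ?S\<^sup>2 / 2 + V t x"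
  proof -
    have w: "?w\<^sup>2 / (\<rho> t)\<^sup>2 = (x - q t)\<^sup>2 / (\<rho> t) ^ 4" by (simp add: power_divide power4_eq_xxxx power2_eq_square)
    have "- (?w\<^sup>2 - 2 * real m - 1) / (2 * (\<rho> t)\<^sup>2) = (real m + 1/2) / (\<rho> t)\<^sup>2 - (?w\<^sup>2 / (\<rho> t)\<^sup>2) / 2"
      using r by (simp add: field_simps)
    then have "- (?w\<^sup>2 - 2 * real m - 1) / (2 * (\<rho> t)\<^sup>2) = (real m + 1/2) / (\<rho> t)\<^sup>2 - ((x - q t)\<^sup>2 / (\<rho> t) ^ 4) / 2"
      unfolding w .
    moreover have "1 / (2 * (\<rho> t)\<^sup>2) + m / (\<rho> t)\<^sup>2 = (real m + 1/2) / (\<rho> t)\<^sup>2" by (simp add: add_divide_distrib)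
    moreover have "(1 / (\<rho> t) ^ 4) * (x - q t)\<^sup>2 = (x - q t)\<^sup>2 / (\<rho> t) ^ 4" by simp
    moreover have "x = (x - q t) + q t" by simp
    define y where "y = x - q t"
    have x: "x = y + q t" by (simp add: y_def)
    have "- (p t)\<^sup>2 / 2 + A + Q t * (q t)\<^sup>2 / 2 + F t * q t + B + (((\<sigma> t)\<^sup>2 - R + Q t) * y\<^sup>2 / 2 + \<sigma> t * y * p t + (Q t * q t + F t) * y + (p t)\<^sup>2)
      = (A + B) - R * y\<^sup>2 / 2 + (\<sigma> t * y + p t)\<^sup>2 / 2 + (Q t * (y + q t)\<^sup>2 / 2 + F t * (y + q t))" for A B R
      by (simp add: power2_eq_square field_simps)
    ultimately show ?thesis
      unfolding V \<theta>'_def y_def[symmetric] by (simp only: x[symmetric])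
  qed
  have e1: "E' m t x = c * ((\<i> * complex_of_real (- (?w\<^sup>2 - 2 * real m - 1) / (2 * (\<rho> t)\<^sup>2) + ?S\<^sup>2 / 2 + V t x) + \<sigma> t / 2) * h
      + ?S / \<rho> t * d) * P"
    unfolding E'_def scal c_h_d_P_def fr.phase_def by simp
  have e2: "ham V t (E t m) x = - (1/2) * (c * ((?w\<^sup>2 - 2 * real m - 1) * h / (\<rho> t)\<^sup>2 + 2 * \<i> * ?S * d / \<rho> t
      + (\<i> * \<sigma> t - ?S\<^sup>2) * h) * P) + V t x * (c * h * P)"
    unfolding ham_def E_def fr.cderiv_frame fr.ddframe_def fr.frame_def c_h_d_P_def by simp
  have "c * ((\<i> * (- W / (2 * R) + S\<^sup>2 / 2 + U) + s / 2) * h + S / r * d) * P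
     = \<i> * (- (1/2) * (c * (W * h / R + 2 * \<i> * S * d / r + (\<i> * s - S\<^sup>2) * h) * P) + U * (c * h * P))" for W R S U s r :: complex
    by (simp add: algebra_simps add_divide_distrib diff_divide_distrib)
  then show "E' m t x = \<i> * ham V t (E t m) x"
    unfolding e1 e2 by (simp only: of_real_add of_real_divide of_real_minus of_real_power of_real_mult of_real_numeral)
qed


text \<open>On a compact time interval all coefficients of \<open>E'\<close> are continuous, so
  their combination \<open>N\<close> is bounded. Decay in the rescaled variable \<open>w\<close>
  becomes decay in \<open>x\<close> through
  \<open>1 + x^2 <= (1 + 2 \<rho>^2 + 2 q^2) (1 + w^2)\<close>.\<close>

lemma E'_dominated:
  obtains C where "\<And>\<tau> x. \<tau> \<in> {t0..t + 1} \<Longrightarrow> cmod (E' m \<tau> x) \<le> C / (1 + x\<^sup>2)"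
proof -
  obtain H where H: "H > 0" "\<And>w. (1 + \<bar>w\<bar> + w\<^sup>2) * (cmod (hermite_c m w) + cmod (dhermite_c m w)) \<le> H / (1 + w\<^sup>2)"
    using hermite_c_decay by blast
  define A where "A = (\<lambda>\<tau>. \<bar>\<theta>' \<tau>\<bar> + m / (\<rho> \<tau>)\<^sup>2 + \<bar>(\<sigma> \<tau>)\<^sup>2 - 1 / (\<rho> \<tau>) ^ 4 + Q \<tau>\<bar> * (\<rho> \<tau>)\<^sup>2
     + \<bar>\<sigma> \<tau>\<bar> * \<rho> \<tau> * \<bar>p \<tau>\<bar> + \<bar>Q \<tau> * q \<tau> + F \<tau>\<bar> * \<rho> \<tau> + (p \<tau>)\<^sup>2 + 2 * \<bar>\<sigma> \<tau>\<bar> + \<bar>p \<tau>\<bar> / \<rho> \<tau>)"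
  define N where "N = (\<lambda>\<tau>. A \<tau> / sqrt (\<rho> \<tau>) * (1 + 2 * (\<rho> \<tau>)\<^sup>2 + 2 * (q \<tau>)\<^sup>2))"
  have cs: "continuous_on {t0..t + 1} \<rho>" "continuous_on {t0..t + 1} \<sigma>" "continuous_on {t0..t + 1} q" "continuous_on {t0..t + 1} p"
    "continuous_on {t0..t + 1} Q" "continuous_on {t0..t + 1} F" "continuous_on {t0..t + 1} \<theta>'"
    by (rule continuous_on_subset[OF _ Icc_subset_Ici_iff[THEN iffD2]], rule continuous_data Q_cont F_cont continuous_chi', simp)+
  have r0: "\<rho> \<tau> \<noteq> 0" "sqrt (\<rho> \<tau>) \<noteq> 0" if "\<tau> \<in> {t0..t + 1}" for \<tau> using rho_pos[of \<tau>] that by auto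
  have "continuous_on {t0..t + 1} N"
    unfolding N_def A_def using r0 by (intro continuous_intros cs) (auto simp: power_eq_0_iff)
  then have "bounded (N ` {t0..t + 1})" by (intro compact_imp_bounded compact_continuous_image) auto
  then have "\<exists>B. \<forall>\<tau>\<in>{t0..t + 1}. \<bar>N \<tau>\<bar> \<le> B" by (simp add: bounded_iff)
  then obtain B where B: "\<And>\<tau>. \<tau> \<in> {t0..t + 1} \<Longrightarrow> \<bar>N \<tau>\<bar> \<le> B" by blast
  have "cmod (E' m \<tau> x) \<le> (B * H) / (1 + x\<^sup>2)" if \<tau>: "\<tau> \<in> {t0..t + 1}" for \<tau> x
  proof -
    have \<tau>0: "\<tau> \<ge> t0" using \<tau> by simp
    interpret fr: squeezed_frame "\<kappa> \<tau>" "\<omega> \<tau>" "\<rho> \<tau>" "\<sigma> \<tau>" "q \<tau>" "p \<tau>" by (rule squeezed_frame[OF \<tau>0])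
    have r: "\<rho> \<tau> > 0" by (rule rho_pos[OF \<tau>0])
    define w where "w = (x - q \<tau>) / \<rho> \<tau>"
    define W where "W = 1 + \<bar>w\<bar> + w\<^sup>2"
    have W: "1 \<le> W" "\<bar>w\<bar> \<le> W" "w\<^sup>2 \<le> W" by (simp_all add: W_def)
    have xq: "x - q \<tau> = \<rho> \<tau> * w" using r by (simp add: w_def)
    define R where "R = \<theta>' \<tau> + m / (\<rho> \<tau>)\<^sup>2 + (((\<sigma> \<tau>)\<^sup>2 - 1 / (\<rho> \<tau>) ^ 4 + Q \<tau>) * (x - q \<tau>)\<^sup>2 / 2 + \<sigma> \<tau> * (x - q \<tau>) * p \<tau>
       + (Q \<tau> * q \<tau> + F \<tau>) * (x - q \<tau>) + (p \<tau>)\<^sup>2)"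
    define S where "S = (\<sigma> \<tau> * (x - q \<tau>) + p \<tau>) / \<rho> \<tau>"
    have R: "\<bar>R\<bar> \<le> \<bar>\<theta>' \<tau>\<bar> * W + m / (\<rho> \<tau>)\<^sup>2 * W + \<bar>(\<sigma> \<tau>)\<^sup>2 - 1 / (\<rho> \<tau>) ^ 4 + Q \<tau>\<bar> * (\<rho> \<tau>)\<^sup>2 * W
       + \<bar>\<sigma> \<tau>\<bar> * \<rho> \<tau> * \<bar>p \<tau>\<bar> * W + \<bar>Q \<tau> * q \<tau> + F \<tau>\<bar> * \<rho> \<tau> * W + (p \<tau>)\<^sup>2 * W"
    proof -
      have t1: "\<bar>\<theta>' \<tau>\<bar> \<le> \<bar>\<theta>' \<tau>\<bar> * W" using W(1) by (simp add: mult_le_cancel_left1)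
      have t2: "\<bar>m / (\<rho> \<tau>)\<^sup>2\<bar> \<le> m / (\<rho> \<tau>)\<^sup>2 * W" using mult_left_mono[OF W(1), of "m / (\<rho> \<tau>)\<^sup>2"] by simp
      have t3: "\<bar>((\<sigma> \<tau>)\<^sup>2 - 1 / (\<rho> \<tau>) ^ 4 + Q \<tau>) * (x - q \<tau>)\<^sup>2 / 2\<bar> \<le> \<bar>(\<sigma> \<tau>)\<^sup>2 - 1 / (\<rho> \<tau>) ^ 4 + Q \<tau>\<bar> * (\<rho> \<tau>)\<^sup>2 * W"
      proof -
        have "\<bar>((\<sigma> \<tau>)\<^sup>2 - 1 / (\<rho> \<tau>) ^ 4 + Q \<tau>) * (x - q \<tau>)\<^sup>2 / 2\<bar> = (\<bar>(\<sigma> \<tau>)\<^sup>2 - 1 / (\<rho> \<tau>) ^ 4 + Q \<tau>\<bar> * (\<rho> \<tau>)\<^sup>2) * w\<^sup>2 / 2"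
          by (simp add: xq power_mult_distrib abs_mult)
        also have "\<dots> \<le> (\<bar>(\<sigma> \<tau>)\<^sup>2 - 1 / (\<rho> \<tau>) ^ 4 + Q \<tau>\<bar> * (\<rho> \<tau>)\<^sup>2) * w\<^sup>2" by simp
        also have "\<dots> \<le> (\<bar>(\<sigma> \<tau>)\<^sup>2 - 1 / (\<rho> \<tau>) ^ 4 + Q \<tau>\<bar> * (\<rho> \<tau>)\<^sup>2) * W" using W(3) by (intro mult_left_mono) auto
        finally show ?thesis .
      qed
      have t4: "\<bar>\<sigma> \<tau> * (x - q \<tau>) * p \<tau>\<bar> \<le> \<bar>\<sigma> \<tau>\<bar> * \<rho> \<tau> * \<bar>p \<tau>\<bar> * W"
        using mult_left_mono[OF W(2), of "\<bar>\<sigma> \<tau>\<bar> * \<rho> \<tau> * \<bar>p \<tau>\<bar>"] r by (simp add: xq abs_mult mult_ac)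
      have t5: "\<bar>(Q \<tau> * q \<tau> + F \<tau>) * (x - q \<tau>)\<bar> \<le> \<bar>Q \<tau> * q \<tau> + F \<tau>\<bar> * \<rho> \<tau> * W"
        using mult_left_mono[OF W(2), of "\<bar>Q \<tau> * q \<tau> + F \<tau>\<bar> * \<rho> \<tau>"] r by (simp add: xq abs_mult mult_ac)
      have t6: "\<bar>(p \<tau>)\<^sup>2\<bar> \<le> (p \<tau>)\<^sup>2 * W" using mult_left_mono[OF W(1), of "(p \<tau>)\<^sup>2"] by simp
      have tri: "\<bar>a1 + a2 + (a3 + a4 + a5 + a6)\<bar> \<le> b1 + b2 + b3 + b4 + b5 + b6"
        if "\<bar>a1\<bar> \<le> b1" "\<bar>a2\<bar> \<le> b2" "\<bar>a3\<bar> \<le> b3" "\<bar>a4\<bar> \<le> b4" "\<bar>a5\<bar> \<le> b5" "\<bar>a6\<bar> \<le> b6"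
        for a1 a2 a3 a4 a5 a6 b1 b2 b3 b4 b5 b6 :: real using that by linarith
      show ?thesis unfolding R_def by (rule tri[OF t1 t2 t3 t4 t5 t6])
    qed
    have S: "\<bar>S\<bar> \<le> \<bar>\<sigma> \<tau>\<bar> * W + \<bar>p \<tau>\<bar> / \<rho> \<tau> * W"
    proof -
      have "S = \<sigma> \<tau> * w + p \<tau> / \<rho> \<tau>" using r by (simp add: S_def xq field_simps)
      then have "\<bar>S\<bar> \<le> \<bar>\<sigma> \<tau>\<bar> * \<bar>w\<bar> + \<bar>p \<tau>\<bar> / \<rho> \<tau> * 1"
        using abs_triangle_ineq[of "\<sigma> \<tau> * w" "p \<tau> / \<rho> \<tau>"] r by (simp add: abs_mult)
      also have "\<dots> \<le> \<bar>\<sigma> \<tau>\<bar> * W + \<bar>p \<tau>\<bar> / \<rho> \<tau> * W" using W r by (intro add_mono mult_left_mono) auto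
      finally show ?thesis .
    qed
    define hn dn where "hn = cmod (hermite_c m w)" and "dn = cmod (dhermite_c m w)"
    have nn: "hn \<ge> 0" "dn \<ge> 0" by (simp_all add: hn_def dn_def)
    have A0: "A \<tau> \<ge> 0" unfolding A_def using r by auto
    have c1: "\<bar>R\<bar> + \<bar>\<sigma> \<tau>\<bar> \<le> A \<tau> * W"
    proof -
      have "\<bar>\<sigma> \<tau>\<bar> * 1 \<le> (2 * \<bar>\<sigma> \<tau>\<bar>) * W" using W by (intro mult_mono) auto
      moreover have "0 \<le> \<bar>p \<tau>\<bar> / \<rho> \<tau> * W" using W r by (intro mult_nonneg_nonneg divide_nonneg_pos) auto
      ultimately show ?thesis using R unfolding A_def distrib_right by linarith
    qed
    have c2: "\<bar>S\<bar> \<le> A \<tau> * W"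
    proof -
      have "\<bar>\<sigma> \<tau>\<bar> + \<bar>p \<tau>\<bar> / \<rho> \<tau> \<le> A \<tau>"
      proof -
        have "0 \<le> m / (\<rho> \<tau>)\<^sup>2" "0 \<le> \<bar>(\<sigma> \<tau>)\<^sup>2 - 1 / (\<rho> \<tau>) ^ 4 + Q \<tau>\<bar> * (\<rho> \<tau>)\<^sup>2"
          "0 \<le> \<bar>\<sigma> \<tau>\<bar> * \<rho> \<tau> * \<bar>p \<tau>\<bar>" "0 \<le> \<bar>Q \<tau> * q \<tau> + F \<tau>\<bar> * \<rho> \<tau>" "0 \<le> (p \<tau>)\<^sup>2" "0 \<le> \<bar>\<sigma> \<tau>\<bar>" "0 \<le> \<bar>\<theta>' \<tau>\<bar>"
          using r by auto
        then show ?thesis unfolding A_def by linarith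
      qed
      then have "(\<bar>\<sigma> \<tau>\<bar> + \<bar>p \<tau>\<bar> / \<rho> \<tau>) * W \<le> A \<tau> * W" using W by (intro mult_right_mono) auto
      then show ?thesis using S by (simp add: distrib_right)
    qed
    have "cmod (E' m \<tau> x) = 1 / sqrt (\<rho> \<tau>) * cmod ((\<i> * complex_of_real R + \<sigma> \<tau> / 2) * hermite_c m w + complex_of_real S * dhermite_c m w)"
    proof -
      have "E' m \<tau> x = \<kappa> \<tau> * \<omega> \<tau> ^ m / sqrt (\<rho> \<tau>) * ((\<i> * complex_of_real R + \<sigma> \<tau> / 2) * hermite_c m w + complex_of_real S * dhermite_c m w) * fr.phase x"
        unfolding E'_def R_def S_def w_def by simp
      then show ?thesis using r by (simp add: norm_mult norm_divide norm_power fr.norm_kappa fr.norm_omega)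
    qed
    also have "\<dots> \<le> 1 / sqrt (\<rho> \<tau>) * (A \<tau> * W * hn + A \<tau> * W * dn)"
    proof (intro mult_left_mono order_trans[OF norm_triangle_ineq] add_mono)
      have "cmod (\<i> * complex_of_real R + \<sigma> \<tau> / 2) \<le> \<bar>R\<bar> + \<bar>\<sigma> \<tau>\<bar>"
        by (rule order_trans[OF norm_triangle_ineq]) (simp add: norm_mult norm_divide)
      then show "cmod ((\<i> * complex_of_real R + \<sigma> \<tau> / 2) * hermite_c m w) \<le> A \<tau> * W * hn"
        unfolding norm_mult hn_def using c1 by (intro mult_right_mono) auto
      show "cmod (complex_of_real S * dhermite_c m w) \<le> A \<tau> * W * dn"
        unfolding norm_mult dn_def using c2 by (intro mult_right_mono) auto
    qed (use r in auto)
    also have "\<dots> = A \<tau> / sqrt (\<rho> \<tau>) * (W * (hn + dn))" by (simp add: algebra_simps add_divide_distrib)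
    also have "\<dots> \<le> A \<tau> / sqrt (\<rho> \<tau>) * (H / (1 + w\<^sup>2))"
      using H(2)[of w] A0 r unfolding W_def hn_def dn_def by (intro mult_left_mono) auto
    also have "\<dots> \<le> A \<tau> / sqrt (\<rho> \<tau>) * (H * ((1 + 2 * (\<rho> \<tau>)\<^sup>2 + 2 * (q \<tau>)\<^sup>2) / (1 + x\<^sup>2)))"
    proof (intro mult_left_mono)
      have x: "x = \<rho> \<tau> * w + q \<tau>" using xq by simp
      have "(\<rho> \<tau> * w + q \<tau>)\<^sup>2 + (\<rho> \<tau> * w - q \<tau>)\<^sup>2 = 2 * (\<rho> \<tau>)\<^sup>2 * w\<^sup>2 + 2 * (q \<tau>)\<^sup>2"
        by (simp add: power2_eq_square algebra_simps)
      then have "x\<^sup>2 \<le> 2 * (\<rho> \<tau>)\<^sup>2 * w\<^sup>2 + 2 * (q \<tau>)\<^sup>2" unfolding x using zero_le_power2[of "\<rho> \<tau> * w - q \<tau>"] by linarith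
      moreover have "0 \<le> (\<rho> \<tau>)\<^sup>2" "0 \<le> w\<^sup>2" "0 \<le> (q \<tau>)\<^sup>2 * w\<^sup>2" by auto
      moreover have "(1 + 2 * (\<rho> \<tau>)\<^sup>2 + 2 * (q \<tau>)\<^sup>2) * (1 + w\<^sup>2) = 1 + 2 * (\<rho> \<tau>)\<^sup>2 + 2 * (q \<tau>)\<^sup>2 + w\<^sup>2 + 2 * (\<rho> \<tau>)\<^sup>2 * w\<^sup>2 + 2 * ((q \<tau>)\<^sup>2 * w\<^sup>2)"
        by (simp add: algebra_simps)
      ultimately have le: "1 + x\<^sup>2 \<le> (1 + 2 * (\<rho> \<tau>)\<^sup>2 + 2 * (q \<tau>)\<^sup>2) * (1 + w\<^sup>2)" by linarith
      have p: "1 + x\<^sup>2 > 0" "1 + w\<^sup>2 > 0" by (auto intro: add_pos_nonneg)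
      have "1 / (1 + w\<^sup>2) \<le> (1 + 2 * (\<rho> \<tau>)\<^sup>2 + 2 * (q \<tau>)\<^sup>2) / (1 + x\<^sup>2)"
        using le p by (simp add: divide_le_eq le_divide_eq field_simps)
      then have "H * (1 / (1 + w\<^sup>2)) \<le> H * ((1 + 2 * (\<rho> \<tau>)\<^sup>2 + 2 * (q \<tau>)\<^sup>2) / (1 + x\<^sup>2))" using H(1) by (intro mult_left_mono) auto
      then show "H / (1 + w\<^sup>2) \<le> H * ((1 + 2 * (\<rho> \<tau>)\<^sup>2 + 2 * (q \<tau>)\<^sup>2) / (1 + x\<^sup>2))" by simp
    qed (use A0 r in auto)
    also have "\<dots> = N \<tau> * H / (1 + x\<^sup>2)" by (simp add: N_def)
    also have "\<dots> \<le> (B * H) / (1 + x\<^sup>2)"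
      using B[OF \<tau>] H(1) by (intro divide_right_mono mult_right_mono) auto
    finally show ?thesis .
  qed
  then show thesis by (rule that)
qed

lemma E_init: "E t0 m = hermite_c m"
proof
  fix x
  have r: "\<rho> t0 = 1" "\<omega> t0 = 1" "\<kappa> t0 = 1" "\<sigma> t0 = 0"
    by (simp_all add: \<rho>_def \<omega>_def \<kappa>_def \<sigma>_def zeta_init zeta'_init chi)
  interpret fr: squeezed_frame "\<kappa> t0" "\<omega> t0" "\<rho> t0" "\<sigma> t0" "q t0" "p t0" by (rule squeezed_frame) simp
  show "E t0 m x = hermite_c m x"
    unfolding E_def fr.frame_def fr.phase_def by (simp add: r q_init p_init)
qed

text \<open>The two contributions to the derivative are \<open>\<i>\<close> and
  \<open>cnj \<i>\<close> times the same pairing and cancel. The moving coefficients are thereby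
  known for an arbitrary weak solution, without an appeal to uniqueness for the equation.\<close>

lemma pair_E_conserved:
  assumes sol: "schrod_sol t0 V u" and V: "\<And>t x. V t x = Q t * x\<^sup>2 / 2 + F t * x" and t: "t \<ge> t0"
  shows "pair (u t) (E t m) = pair (u t0) (hermite_c m)"
proof -
  have u: "L2 (u \<tau>)" if "\<tau> \<ge> t0" for \<tau> using sol that by (simp add: schrod_sol_def)
  have weak: "((\<lambda>\<tau>. pair (u \<tau>) \<psi>) has_vector_derivative (\<i> * pair (u \<tau>) (ham V \<tau> \<psi>))) (at \<tau> within {t0..})"
    if "schwartz \<psi>" "\<tau> \<ge> t0" for \<psi> \<tau> using sol that by (simp add: schrod_sol_def)
  have EL: "L2 (E \<tau> m)" "schwartz (E \<tau> m)" if "\<tau> \<ge> t0" for \<tau>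
    unfolding E_def using squeezed_frame.L2_frame[OF squeezed_frame[OF that]] squeezed_frame.schwartz_frame[OF squeezed_frame[OF that]] by auto
  \<comment> \<open>\<open>ham V \<tau> (E \<tau> m)\<close> is itself a test function, so the weak
    equation makes the pairing of \<open>u\<close> with it continuous in time, as the product rule
    requires.\<close>
  have H: "L2 (ham V \<tau> (E \<tau> m))" "schwartz (ham V \<tau> (E \<tau> m))" if \<tau>: "\<tau> \<ge> t0" for \<tau>
  proof -
    obtain P A B where PA: "E \<tau> m = poly_gauss P A B" "Re A < 0"
      unfolding E_def using squeezed_frame.frame_poly_gauss[OF squeezed_frame[OF \<tau>]] by blast
    have "ham V \<tau> (E \<tau> m) = poly_gauss (smult (- 1/2) ((gauss_deriv A B ^^ 2) P) + [:0, complex_of_real (F \<tau>), complex_of_real (Q \<tau> / 2):] * P) A B"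
      by (rule ext) (simp add: ham_def PA(1) cderiv_poly_gauss V poly_gauss_def power2_eq_square algebra_simps add_divide_distrib)
    then show "L2 (ham V \<tau> (E \<tau> m))" "schwartz (ham V \<tau> (E \<tau> m))"
      using PA(2) by (simp_all add: L2_poly_gauss schwartz_poly_gauss)
  qed
  have "((\<lambda>\<tau>. pair (u \<tau>) (E \<tau> m)) has_vector_derivative 0) (at s within {t0..})" if s: "s \<ge> t0" for s
  proof -
    have E's: "E' m s = (\<lambda>x. \<i> * ham V s (E s m) x)" by (rule E'_eq_ham[where V = V, OF s]) (rule V)
    obtain M where M: "\<And>\<tau>. \<tau> \<in> {t0..s + 1} \<Longrightarrow> L2norm (u \<tau>) \<le> M"
      using sol unfolding schrod_sol_def by meson
    obtain C where C: "\<And>\<tau> x. \<tau> \<in> {t0..s + 1} \<Longrightarrow> cmod (E' m \<tau> x) \<le> C / (1 + x\<^sup>2)"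
      using E'_dominated[where t = s and m = m] by blast
    have "((\<lambda>\<tau>. pair (u \<tau>) (E \<tau> m)) has_vector_derivative \<i> * pair (u s) (ham V s (E s m)) + pair (u s) (E' m s)) (at s within {t0..})"
    proof (rule weak_product_rule[OF s u M EL(1) _ E_has_vector_derivative C weak[OF EL(2)[OF s] s]])
      show "L2 (E' m s)" unfolding E's by (intro L2_cmult H s)
      have "continuous (at s within {t0..}) (\<lambda>\<tau>. pair (u \<tau>) (ham V s (E s m)))"
        by (rule has_vector_derivative_continuous[OF weak[OF H(2)[OF s] s]])
      then have "((\<lambda>\<tau>. pair (u \<tau>) (ham V s (E s m))) \<longlongrightarrow> pair (u s) (ham V s (E s m))) (at s within {t0..})"
        by (simp add: continuous_within)
      then show "((\<lambda>\<tau>. pair (u \<tau>) (E' m s)) \<longlongrightarrow> pair (u s) (E' m s)) (at s within {t0..})"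
        unfolding E's pair_cmult_right by (intro tendsto_intros)
    qed auto
    then show ?thesis unfolding E's pair_cmult_right by simp
  qed
  then obtain c where c: "\<And>s. s \<in> {t0..} \<Longrightarrow> pair (u s) (E s m) = c"
    using has_vector_derivative_zero_constant[of "{t0..}" "\<lambda>\<tau>. pair (u \<tau>) (E \<tau> m)"] by auto
  then show ?thesis using c[of t] c[of t0] t by (simp add: E_init)
qed

end

subsection \<open>Growth of Sobolev norms\<close>

lemma herm_coeff_eq_pair: "herm_coeff u n = pair u (hermite_c n)"
  by (simp add: herm_coeff_def pair_def hermite_c_def)

context moving_frame
begin

lemma frame_coefficients:
  assumes "schrod_sol t0 V u" "\<And>t x. V t x = Q t * x\<^sup>2 / 2 + F t * x" "t \<ge> t0"
  shows "pair (u t) (squeezed_frame.frame (\<kappa> t) (\<omega> t) (\<rho> t) (\<sigma> t) (q t) (p t) m) = herm_coeff (u t0) m"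
  using pair_E_conserved[OF assms] by (simp add: E_def herm_coeff_eq_pair)

text \<open>Conservation of the norm is not part of the definition of a weak solution. Parseval in
  both orthonormal bases, with equal coefficients, supplies it.\<close>

lemma L2norm_conserved:
  assumes sol: "schrod_sol t0 V u" and V: "\<And>t x. V t x = Q t * x\<^sup>2 / 2 + F t * x" and t: "t \<ge> t0"
  shows "L2norm (u t) = L2norm (u t0)"
proof -
  have u: "L2 (u t)" "L2 (u t0)" using sol t by (auto simp: schrod_sol_def)
  interpret fr: squeezed_frame "\<kappa> t" "\<omega> t" "\<rho> t" "\<sigma> t" "q t" "p t" by (rule squeezed_frame[OF t])
  have "(\<lambda>m. (cmod (herm_coeff (u t0) m))\<^sup>2) sums (L2norm (u t))\<^sup>2"
    using fr.parseval_frame[OF u(1)] unfolding frame_coefficients[OF sol V t] .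
  moreover have "(\<lambda>m. (cmod (herm_coeff (u t0) m))\<^sup>2) sums (L2norm (u t0))\<^sup>2"
    using parseval_hermite[OF u(2)] by (simp add: herm_coeff_eq_pair)
  ultimately have "(L2norm (u t))\<^sup>2 = (L2norm (u t0))\<^sup>2" by (rule sums_unique2)
  then show ?thesis by (simp add: power2_eq_iff_nonneg)
qed

text \<open>\<open>C\<close> is fixed before \<open>t\<close> and \<open>K\<close>, so the growth in
  time sits entirely in the size \<open>K\<close> of the classical data. The moving coefficients of
  \<open>u t\<close> are those of \<open>u t0\<close>, hence their weighted sum does not
  change.\<close>

lemma Hs_growth_upper:
  assumes s: "s > 0" and V: "\<And>t x. V t x = Q t * x\<^sup>2 / 2 + F t * x"
    and sol: "schrod_sol t0 V u" and u0: "in_Hs s (u t0)"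
  obtains C where "C > 0" "\<And>t K. \<lbrakk>t \<ge> t0; K \<ge> 1; (cmod (\<zeta> t))\<^sup>2 + (cmod (\<zeta>' t))\<^sup>2 \<le> K; (q t)\<^sup>2 + (p t)\<^sup>2 \<le> K\<rbrakk>
    \<Longrightarrow> in_Hs s (u t) \<and> (\<Sum>n. (real n + 1/2) powr s * (cmod (herm_coeff (u t) n))\<^sup>2) \<le> C * K powr s"
proof -
  show thesis
  proof (rule intertwiner_fractional_bound[OF s], goal_cases)
  case (1 C0)
  note C0 = 1
  define c where "c = (\<lambda>m. herm_coeff (u t0) m)"
  define S where "S = (\<Sum>m. real (Suc m) powr s * (cmod (c m))\<^sup>2)"
  have u: "L2 (u t)" if "t \<ge> t0" for t using sol that by (simp add: schrod_sol_def)
  have sc: "summable (\<lambda>m. (cmod (c m))\<^sup>2)"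
    using sums_summable[OF parseval_hermite[OF u[OF order_refl]]] by (simp add: c_def herm_coeff_eq_pair)
  \<comment> \<open>Passing from the weight \<open>m + 1/2\<close> to \<open>m + 1\<close> costs
    \<open>2 powr s\<close>, since \<open>m + 1 <= 2 (m + 1/2)\<close>.\<close>
  have scs: "summable (\<lambda>m. real (Suc m) powr s * (cmod (c m))\<^sup>2)"
  proof (rule summable_comparison_test')
    have "summable (\<lambda>m. (real m + 1/2) powr s * (cmod (c m))\<^sup>2)" using u0 by (simp add: in_Hs_def c_def)
    then show "summable (\<lambda>m. 2 powr s * ((real m + 1/2) powr s * (cmod (c m))\<^sup>2))" by (rule summable_mult)
    fix m :: nat
    have "real (Suc m) powr s \<le> (2 * (real m + 1/2)) powr s" using s by (intro powr_mono2) auto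
    also have "\<dots> = 2 powr s * (real m + 1/2) powr s" by (intro powr_mult)
    finally have "real (Suc m) powr s * (cmod (c m))\<^sup>2 \<le> 2 powr s * (real m + 1/2) powr s * (cmod (c m))\<^sup>2"
      by (intro mult_right_mono) auto
    then show "norm (real (Suc m) powr s * (cmod (c m))\<^sup>2) \<le> 2 powr s * ((real m + 1/2) powr s * (cmod (c m))\<^sup>2)"
      by (simp add: mult.assoc)
  qed
  have S0: "S \<ge> 0" unfolding S_def by (intro suminf_nonneg scs) auto
  have main: "in_Hs s (u t) \<and> (\<Sum>n. (real n + 1/2) powr s * (cmod (herm_coeff (u t) n))\<^sup>2) \<le> (C0 * S + 1) * K powr s"
    if t: "t \<ge> t0" and K: "K \<ge> 1" "(cmod (\<zeta> t))\<^sup>2 + (cmod (\<zeta>' t))\<^sup>2 \<le> K" "(q t)\<^sup>2 + (p t)\<^sup>2 \<le> K" for t K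
  proof -
    interpret fr: squeezed_frame "\<kappa> t" "\<omega> t" "\<rho> t" "\<sigma> t" "q t" "p t" by (rule squeezed_frame[OF t])
    have z: "fr.\<zeta> = \<zeta> t" "fr.\<zeta>\<^sub>1 = \<zeta>' t"
      using omega_rho[OF t] zeta'_eq[OF t] by (simp_all add: fr.\<zeta>_def fr.\<zeta>\<^sub>1_def)
    define d where "d = (\<lambda>n. pair (u t) (hermite_c n))"
    have ce: "pair (u t) (fr.frame m) = c m" for m
      unfolding c_def by (rule frame_coefficients[OF sol V t])
    have half: "(cmod ((a + b) / 2))\<^sup>2 \<le> (cmod a)\<^sup>2 + (cmod b)\<^sup>2" for a b
    proof -
      have "(cmod ((a + b) / 2))\<^sup>2 = (cmod (a + b))\<^sup>2 / 4" by (simp add: norm_divide power_divide)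
      also have "\<dots> \<le> (2 * ((cmod a)\<^sup>2 + (cmod b)\<^sup>2)) / 4" using norm_add_sq[of a b] by (intro divide_right_mono) auto
      also have "\<dots> = ((cmod a)\<^sup>2 + (cmod b)\<^sup>2) / 2" by simp
      also have "\<dots> \<le> (cmod a)\<^sup>2 + (cmod b)\<^sup>2"
        using zero_le_power2[of "cmod a"] zero_le_power2[of "cmod b"] unfolding add_divide_distrib
        by (intro add_mono) simp_all
      finally show ?thesis .
    qed
    have "summable (\<lambda>n. real (Suc n) powr s * (cmod (d n))\<^sup>2) \<and>
      (\<Sum>n. real (Suc n) powr s * (cmod (d n))\<^sup>2) \<le> C0 * K powr s * (\<Sum>m. real (Suc m) powr s * (cmod (c m))\<^sup>2)"
    proof (rule C0(2)[where M = fr.overlap])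
      show "(cmod ((\<zeta> t + \<i> * \<zeta>' t) / 2))\<^sup>2 \<le> K"
        using half[of "\<zeta> t" "\<i> * \<zeta>' t"] K by (simp add: norm_mult)
      show "(cmod ((cnj (\<zeta> t) + \<i> * cnj (\<zeta>' t)) / 2))\<^sup>2 \<le> K"
        using half[of "cnj (\<zeta> t)" "\<i> * cnj (\<zeta>' t)"] K by (simp add: norm_mult)
      show "(cmod ((complex_of_real (q t) - \<i> * complex_of_real (p t)) / complex_of_real (sqrt 2)))\<^sup>2 \<le> K"
      proof -
        have "(cmod (complex_of_real (q t) - \<i> * complex_of_real (p t)))\<^sup>2 = (q t)\<^sup>2 + (p t)\<^sup>2"
          by (simp add: cmod_power2)
        moreover have "0 \<le> (q t)\<^sup>2 + (p t)\<^sup>2" by simp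
        ultimately show ?thesis using K by (simp add: norm_divide power_divide)
      qed
      show "complex_of_real (sqrt (real n)) * fr.overlap (n - 1) m =
        ((\<zeta> t + \<i> * \<zeta>' t) / 2) * complex_of_real (sqrt (real m)) * fr.overlap n (m - 1)
        + ((cnj (\<zeta> t) + \<i> * cnj (\<zeta>' t)) / 2) * complex_of_real (sqrt (real (Suc m))) * fr.overlap n (Suc m)
        + ((complex_of_real (q t) - \<i> * complex_of_real (p t)) / complex_of_real (sqrt 2)) * fr.overlap n m" for n m
        using fr.overlap_raise[of n m] unfolding z .
      show "(\<Sum>n<R. (cmod (\<Sum>m<N. fr.overlap n m * b m))\<^sup>2) \<le> (\<Sum>m<N. (cmod (b m))\<^sup>2)" for b N R
        by (rule fr.overlap_contraction)
      show "(\<Sum>n<R. (cmod (d n - (\<Sum>m<N. fr.overlap n m * c m)))\<^sup>2) \<le> (\<Sum>m. (cmod (c m))\<^sup>2) - (\<Sum>m<N. (cmod (c m))\<^sup>2)" for N R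
        using fr.overlap_remainder[OF u[OF t], of N R] unfolding ce d_def .
    qed (use K sc scs in auto)
    then have sd: "summable (\<lambda>n. real (Suc n) powr s * (cmod (d n))\<^sup>2)"
      and le: "(\<Sum>n. real (Suc n) powr s * (cmod (d n))\<^sup>2) \<le> C0 * K powr s * S" by (auto simp: S_def)
    have pt: "(real n + 1/2) powr s * (cmod (d n))\<^sup>2 \<le> real (Suc n) powr s * (cmod (d n))\<^sup>2" for n
      using s by (intro mult_right_mono powr_mono2) auto
    have sd': "summable (\<lambda>n. (real n + 1/2) powr s * (cmod (d n))\<^sup>2)"
      by (rule summable_comparison_test'[OF sd, of 0]) (use pt in auto)
    have "(\<Sum>n. (real n + 1/2) powr s * (cmod (d n))\<^sup>2) \<le> (\<Sum>n. real (Suc n) powr s * (cmod (d n))\<^sup>2)"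
      by (rule suminf_le[OF pt sd' sd])
    also note le
    also have "C0 * K powr s * S \<le> (C0 * S + 1) * K powr s" by (simp add: algebra_simps)
    finally show ?thesis using sd' u[OF t] by (simp add: in_Hs_def d_def herm_coeff_eq_pair)
  qed
  show thesis
  proof (rule that[OF _ main])
    show "0 < C0 * S + 1" using C0(1) S0 by (intro add_nonneg_pos) auto
  qed
  qed
qed

text \<open>The observable enters only through classical data and initial coefficients.
  \<open>X\<close> is the intended growth: a bound of order \<open>X powr s\<close>, uniform in
  time, results as soon as \<open>G0\<close>, \<open>B\<close> and \<open>D\<close> can be chosen
  independently of \<open>t\<close>.\<close>

lemma Hs_growth_lower:
  assumes s: "s > 0" and V: "\<And>t x. V t x = Q t * x\<^sup>2 / 2 + F t * x"
    and sol: "schrod_sol t0 V u" and t: "t \<ge> t0" and ut: "in_Hs s (u t)" and nz: "L2norm (u t0) \<noteq> 0"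
    and pos: "G0 > 0" "\<epsilon>\<^sup>2 + \<delta>\<^sup>2 > 0" "B > 0"
    and D: "X > 0" "D > 0" "\<epsilon>\<^sup>2 + \<delta>\<^sup>2 \<le> D / X"
    and G: "G0 \<le> cmod (complex_of_real (\<epsilon> * q t + \<delta> * p t) * herm_coeff (u t0) m
       + (cnj (\<epsilon> * \<zeta> t - \<delta> * \<zeta>' t) * sqrt (m / 2) * herm_coeff (u t0) (m - 1)
        + (\<epsilon> * \<zeta> t - \<delta> * \<zeta>' t) * sqrt (Suc m / 2) * herm_coeff (u t0) (Suc m)))"
    and B: "\<bar>\<epsilon> * q t + \<delta> * p t\<bar> + cmod (\<epsilon> * \<zeta> t - \<delta> * \<zeta>' t) * (sqrt (m / 2) + sqrt (Suc m / 2)) \<le> B"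
  shows "(G0\<^sup>2 / (32 * D * (L2norm (u t0))\<^sup>2)) powr s * (G0 / (2 * B))\<^sup>2 * X powr s
    \<le> (\<Sum>n. (real n + 1/2) powr s * (cmod (herm_coeff (u t) n))\<^sup>2)"
proof -
  interpret fr: squeezed_frame "\<kappa> t" "\<omega> t" "\<rho> t" "\<sigma> t" "q t" "p t" by (rule squeezed_frame[OF t])
  have z: "fr.\<zeta> = \<zeta> t" "fr.\<zeta>\<^sub>1 = \<zeta>' t"
    using omega_rho[OF t] zeta'_eq[OF t] by (simp_all add: fr.\<zeta>_def fr.\<zeta>\<^sub>1_def)
  have u: "L2 (u t)" using sol t by (simp add: schrod_sol_def)
  have ce: "pair (u t) (fr.frame m) = herm_coeff (u t0) m" for m
    by (rule frame_coefficients[OF sol V t])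
  have n: "L2norm (u t) = L2norm (u t0)" by (rule L2norm_conserved[OF sol V t])
  have "L2norm (u t) > 0" using n nz L2norm_nonneg[of "u t"] by linarith
  moreover have "summable (\<lambda>n. (real n + 1/2) powr s * (cmod (pair (u t) (hermite_c n)))\<^sup>2)"
    using ut by (simp add: in_Hs_def herm_coeff_eq_pair)
  moreover have "G0 \<le> cmod (pair (u t) (fr.observable \<epsilon> \<delta> m))"
    using G unfolding fr.pair_observable[OF u] ce z .
  moreover have "L2norm (fr.observable \<epsilon> \<delta> m) \<le> B"
    using fr.L2norm_observable[of \<epsilon> \<delta> m] B unfolding z by linarith
  ultimately have le: "(G0\<^sup>2 / (32 * (\<epsilon>\<^sup>2 + \<delta>\<^sup>2) * (L2norm (u t0))\<^sup>2)) powr s * (G0 / (2 * B))\<^sup>2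
    \<le> (\<Sum>n. (real n + 1/2) powr s * (cmod (herm_coeff (u t) n))\<^sup>2)"
    using fr.observable_lower_bound[OF u s pos(1) pos(2) pos(3)] unfolding n herm_coeff_eq_pair by blast
  have N: "(L2norm (u t0))\<^sup>2 > 0" using nz by simp
  have "(G0\<^sup>2 / (32 * D * (L2norm (u t0))\<^sup>2)) powr s * X powr s = (G0\<^sup>2 / (32 * D * (L2norm (u t0))\<^sup>2) * X) powr s"
    by (rule powr_mult[symmetric])
  also have "\<dots> \<le> (G0\<^sup>2 / (32 * (\<epsilon>\<^sup>2 + \<delta>\<^sup>2) * (L2norm (u t0))\<^sup>2)) powr s"
  proof (rule powr_mono2)
    have "X * (\<epsilon>\<^sup>2 + \<delta>\<^sup>2) \<le> D" using D by (simp add: pos_le_divide_eq mult.commute)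
    then have "X / D \<le> 1 / (\<epsilon>\<^sup>2 + \<delta>\<^sup>2)" using D(2) pos(2) by (simp add: divide_simps mult.commute)
    then have "G0\<^sup>2 / (32 * (L2norm (u t0))\<^sup>2) * (X / D) \<le> G0\<^sup>2 / (32 * (L2norm (u t0))\<^sup>2) * (1 / (\<epsilon>\<^sup>2 + \<delta>\<^sup>2))"
      using N by (intro mult_left_mono) auto
    then show "G0\<^sup>2 / (32 * D * (L2norm (u t0))\<^sup>2) * X \<le> G0\<^sup>2 / (32 * (\<epsilon>\<^sup>2 + \<delta>\<^sup>2) * (L2norm (u t0))\<^sup>2)"
      by (simp add: mult_ac del: distrib_left_numeral distrib_right_numeral)
    show "0 \<le> G0\<^sup>2 / (32 * D * (L2norm (u t0))\<^sup>2) * X" using D by simp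
  qed (use s in simp)
  finally have "(G0\<^sup>2 / (32 * D * (L2norm (u t0))\<^sup>2)) powr s * X powr s * (G0 / (2 * B))\<^sup>2
    \<le> (G0\<^sup>2 / (32 * (\<epsilon>\<^sup>2 + \<delta>\<^sup>2) * (L2norm (u t0))\<^sup>2)) powr s * (G0 / (2 * B))\<^sup>2"
    by (intro mult_right_mono) auto
  then show ?thesis using le by (simp add: mult_ac)
qed

end

text \<open>The recurrence forces \<open>|c m|\<^sup>2\<close> to decay only like \<open>1 / sqrt m\<close>.\<close>
lemma ladder_kernel_trivial:
  fixes a :: complex and c :: "nat \<Rightarrow> complex"
  assumes a: "a \<noteq> 0" and sc: "summable (\<lambda>m. (cmod (c m))\<^sup>2)"
    and rec: "\<And>m. cnj a * sqrt (m / 2) * c (m - 1) + a * sqrt (Suc m / 2) * c (Suc m) = 0"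
  shows "c m = 0"
proof -
  define A where "A = (\<lambda>m. (cmod (c m))\<^sup>2)"
  have r: "real (Suc m) * A (Suc m) = real m * A (m - 1)" for m
  proof -
    have "cmod (a * sqrt (Suc m / 2) * c (Suc m)) = cmod (cnj a * sqrt (m / 2) * c (m - 1))"
      using rec[of m] by (metis add.commute add_eq_0_iff norm_minus_cancel)
    then have "(cmod a * sqrt (Suc m / 2) * cmod (c (Suc m)))\<^sup>2 = (cmod a * sqrt (m / 2) * cmod (c (m - 1)))\<^sup>2"
      by (simp add: norm_mult)
    then show ?thesis using a by (simp add: power_mult_distrib A_def)
  qed
  have A1: "A 1 = 0" using r[of 0] by simp
  have step: "A (Suc (Suc m)) = real (Suc m) / real (Suc (Suc m)) * A m" for m
    using r[of "Suc m"] by (simp add: field_simps)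
  have Ann: "A m \<ge> 0" for m by (simp add: A_def)
  \<comment> \<open>Odd entries vanish, so two neighbours are added to remove the parity;
    \<open>(m + 1) (A m + A (m + 1))\<close> is non-decreasing. The lower bound
    \<open>A 0 / (m + 1)\<close> already contradicts summability unless
    \<open>A 0 = 0\<close>.\<close>
  have S: "A 0 \<le> real (Suc m) * (A m + A (Suc m))" for m
  proof (induction m)
    case (Suc m)
    have "real (Suc m) * (A m + A (Suc m)) \<le> real (Suc m) * A m + real (Suc (Suc m)) * A (Suc m)"
      using Ann[of "Suc m"] by (simp add: distrib_left mult_right_mono)
    also have "\<dots> = real (Suc (Suc m)) * (A (Suc m) + A (Suc (Suc m)))"
      unfolding step by (simp add: field_simps)
    finally show ?case using Suc by linarith
  qed (simp add: Ann)
  have A0: "A 0 = 0"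
  proof (rule ccontr)
    assume "A 0 \<noteq> 0"
    then have p: "A 0 > 0" using Ann[of 0] by linarith
    have "summable (\<lambda>m. (A m + A (Suc m)) / A 0)"
      using sc using summable_Suc_iff[of "\<lambda>m. (cmod (c m))\<^sup>2"]
      by (intro summable_divide summable_add) (simp_all add: A_def)
    then have "summable (\<lambda>m. inverse (real (Suc m)))"
    proof (rule summable_comparison_test'[of _ 0])
      fix m
      show "norm (inverse (real (Suc m))) \<le> (A m + A (Suc m)) / A 0"
        using S[of m] p by (simp add: field_simps)
    qed
    then show False using not_summable_harmonic[where 'a = real] summable_Suc_iff[of "\<lambda>m. inverse (real m)"] by simp
  qed
  have "A m = 0 \<and> A (Suc m) = 0" for m
    by (induction m) (use A0 A1 step in auto)
  then show ?thesis by (simp add: A_def)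
qed

text \<open>The \<open>L2\<close> part of the norm is constant in time. In the upper bound it is
  absorbed because \<open>X\<close> is bounded below; in the lower bound it may help, which covers
  an initial period in which the weighted sum is not yet known to be large.\<close>

lemma Hs_norm_two_sided:
  fixes X :: "real \<Rightarrow> real"
  assumes X: "\<mu> > 0" "\<And>t. t \<ge> t0 \<Longrightarrow> \<mu> \<le> X t" and s: "s > 0" and c: "c > 0" "C > 0"
    and Hs: "\<And>t. t \<ge> t0 \<Longrightarrow> in_Hs s (u t)" and B: "\<And>t. t \<ge> t0 \<Longrightarrow> L2norm (u t) = B"
    and up: "\<And>t. t \<ge> t0 \<Longrightarrow> (\<Sum>n. (real n + 1/2) powr s * (cmod (herm_coeff (u t) n))\<^sup>2) \<le> C * X t powr s"
    and low: "\<And>t. t \<ge> t0 \<Longrightarrow> c * X t powr s \<le> (\<Sum>n. (real n + 1/2) powr s * (cmod (herm_coeff (u t) n))\<^sup>2) + B\<^sup>2"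
  shows "\<exists>c0>1. \<forall>t\<ge>t0. in_Hs s (u t) \<and> X t powr (s / 2) / c0 \<le> Hs_norm s (u t) \<and> Hs_norm s (u t) \<le> c0 * X t powr (s / 2)"
proof -
  define C' where "C' = C + B\<^sup>2 / \<mu> powr s"
  have C': "C' > 0" unfolding C'_def using c X by (intro add_pos_nonneg) auto
  define c0 where "c0 = 2 + sqrt C' + 1 / sqrt c"
  have c0: "c0 > 1" "sqrt C' \<le> c0" "1 / sqrt c \<le> c0" using c C' by (auto simp: c0_def add_pos_nonneg intro: add_nonneg_nonneg)
  have "in_Hs s (u t) \<and> X t powr (s / 2) / c0 \<le> Hs_norm s (u t) \<and> Hs_norm s (u t) \<le> c0 * X t powr (s / 2)" if t: "t \<ge> t0" for t
  proof -
    have Xt: "X t > 0" using X(1) X(2)[OF t] by linarith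
    have sq: "sqrt (X t powr s) = X t powr (s / 2)" using Xt by (simp add: powr_half_sqrt[symmetric] powr_powr)
    have "B\<^sup>2 \<le> B\<^sup>2 / \<mu> powr s * X t powr s"
    proof -
      have "\<mu> powr s \<le> X t powr s" using X(1) X(2)[OF t] s by (intro powr_mono2) auto
      then have "1 \<le> X t powr s / \<mu> powr s" using X(1) by simp
      then have "B\<^sup>2 * 1 \<le> B\<^sup>2 * (X t powr s / \<mu> powr s)" by (intro mult_left_mono) auto
      then show ?thesis by simp
    qed
    then have "(\<Sum>n. (real n + 1/2) powr s * (cmod (herm_coeff (u t) n))\<^sup>2) + B\<^sup>2 \<le> C' * X t powr s"
      using up[OF t] by (simp add: C'_def distrib_right)
    then have "Hs_norm s (u t) \<le> sqrt C' * X t powr (s / 2)"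
      unfolding Hs_norm_def B[OF t] using real_sqrt_le_mono by (fastforce simp: real_sqrt_mult sq)
    also have "\<dots> \<le> c0 * X t powr (s / 2)" using c0 by (intro mult_right_mono) auto
    finally have 1: "Hs_norm s (u t) \<le> c0 * X t powr (s / 2)" .
    have "X t powr (s / 2) / c0 \<le> sqrt c * X t powr (s / 2)"
    proof -
      have "1 \<le> sqrt c * c0" using c0(3) c by (simp add: field_simps)
      then have "X t powr (s / 2) * 1 \<le> X t powr (s / 2) * (sqrt c * c0)" by (intro mult_left_mono) auto
      then show ?thesis using c0(1) by (simp add: field_simps)
    qed
    also have "\<dots> = sqrt (c * X t powr s)" by (simp add: real_sqrt_mult sq)
    also have "\<dots> \<le> Hs_norm s (u t)" unfolding Hs_norm_def B[OF t] using low[OF t] by (rule real_sqrt_le_mono)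
    finally show ?thesis using 1 Hs[OF t] by simp
  qed
  then show ?thesis using c0(1) by blast
qed

lemma power2_cross_bound: "(a * b + c * d)\<^sup>2 \<le> (a\<^sup>2 + c\<^sup>2) * (b\<^sup>2 + d\<^sup>2)" for a b c d :: real
proof -
  have "(a\<^sup>2 + c\<^sup>2) * (b\<^sup>2 + d\<^sup>2) - (a * b + c * d)\<^sup>2 = (a * d - b * c)\<^sup>2" by algebra
  then show ?thesis by (metis diff_ge_0_iff_ge zero_le_power2)
qed

lemma exists_herm_coeff_nonzero:
  assumes u: "L2 u" and nz: "L2norm u \<noteq> 0"
  obtains m where "herm_coeff u m \<noteq> 0"
proof (rule ccontr)
  assume "\<not> thesis"
  then have "herm_coeff u m = 0" for m using that by blast
  then have "(\<lambda>m. 0::real) sums (L2norm u)\<^sup>2" using parseval_hermite[OF u] by (simp add: herm_coeff_eq_pair)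
  then show False using nz sums_unique2[OF sums_zero] by force
qed

section \<open>Growth of the norms under the resonant drive\<close>

context parametric_drive
begin

text \<open>\<open>\<alpha>\<close> and \<open>\<beta>\<close> solve \<open>\<zeta> t0 = 1\<close>,
  \<open>\<zeta>' t0 = \<i>\<close> by Cramer's rule with Wronskian 1, so that the frame starts at
  the Hermite basis. \<open>\<alpha>\<close> is the amplitude of the growing solution.\<close>

definition "\<alpha> = Complex (z' t0) (- z t0)"
definition "\<beta> = Complex (- y' t0) (y t0)"
definition "\<zeta> t = \<alpha> * complex_of_real (y t) + \<beta> * complex_of_real (z t)"
definition "\<zeta>' t = \<alpha> * complex_of_real (y' t) + \<beta> * complex_of_real (z' t)"

lemma alpha_nonzero: "\<alpha> \<noteq> 0"
  using wronskian[of t0] by (auto simp: \<alpha>_def complex_eq_iff)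

lemma moving_frame:
  assumes cont: "continuous_on {t0..} (drive h h1)" "continuous_on {t0..} F"
    and q: "q t0 = 0" "\<And>t. t \<ge> t0 \<Longrightarrow> (q has_real_derivative - p t) (at t within {t0..})"
    and p: "p t0 = 0" "\<And>t. t \<ge> t0 \<Longrightarrow> (p has_real_derivative (1 + drive h h1 t) * q t + F t) (at t within {t0..})"
  shows "moving_frame t0 (\<lambda>t. 1 + drive h h1 t) F q p \<zeta> \<zeta>'"
proof
  have of_real: "((\<lambda>t. complex_of_real (w t)) has_vector_derivative complex_of_real D) (at t within {t0..})"
    if "(w has_real_derivative D) (at t within {t0..})" for w D t
    using that by (intro has_vector_derivative_of_real) (simp add: has_real_derivative_iff_has_vector_derivative)
  show "\<zeta> t0 = 1" "\<zeta>' t0 = \<i>"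
    using wronskian[of t0] by (auto simp: \<zeta>_def \<zeta>'_def \<alpha>_def \<beta>_def complex_eq_iff algebra_simps)
  fix t assume t: "t \<ge> t0"
  have wr: "y t * z' t - y' t * z t = 1" "y t0 * z' t0 - y' t0 * z t0 = 1"
    by (rule wronskian)+
  show "(\<zeta> has_vector_derivative \<zeta>' t) (at t within {t0..})"
    unfolding \<zeta>_def[abs_def] \<zeta>'_def
    by (intro has_vector_derivative_add has_vector_derivative_mult_right of_real y_deriv z_deriv t)
  have "(\<zeta>' has_vector_derivative \<alpha> * complex_of_real (- (1 + drive h h1 t) * y t)
      + \<beta> * complex_of_real (- (1 + drive h h1 t) * z t)) (at t within {t0..})"
    unfolding \<zeta>'_def[abs_def]
    using y'_deriv[OF t] z'_deriv[OF t]
    by (intro has_vector_derivative_add has_vector_derivative_mult_right of_real) auto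
  then show "(\<zeta>' has_vector_derivative - complex_of_real (1 + drive h h1 t) * \<zeta> t) (at t within {t0..})"
    by (simp add: \<zeta>_def algebra_simps)
  have "Im (cnj (\<zeta> t) * \<zeta>' t) = (y t0 * z' t0 - y' t0 * z t0) * (y t * z' t - y' t * z t)"
    by (simp add: \<zeta>_def \<zeta>'_def \<alpha>_def \<beta>_def algebra_simps)
  then show "Im (cnj (\<zeta> t) * \<zeta>' t) = 1" unfolding wr by simp
qed (use assms in \<open>auto intro!: continuous_intros\<close>)

lemma f_pos: "t \<ge> t0 \<Longrightarrow> f t > 0"
  using f_bounds[of t] C_ge_1 by (metis divide_pos_pos exp_gt_zero less_le_trans zero_less_one)

lemma f_lower: "t \<ge> t0 \<Longrightarrow> 1 / C \<le> f t"
proof -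
  assume t: "t \<ge> t0"
  have "1 / C \<le> exp (2 * g t) / C" using g_nonneg[OF t] C_ge_1 by (intro divide_right_mono) auto
  then show "1 / C \<le> f t" using f_bounds[OF t] by linarith
qed

lemma zeta_bound:
  obtains K where "K > 0" "\<And>t. t \<ge> t0 \<Longrightarrow> (cmod (\<zeta> t))\<^sup>2 + (cmod (\<zeta>' t))\<^sup>2 \<le> K * f t"
proof
  define K where "K = 2 * ((cmod \<alpha>)\<^sup>2 + (cmod \<beta>)\<^sup>2) * flow_const * C"
  have fc: "flow_const > 0" using flow_const_ge_1 by linarith
  have ab: "(cmod \<alpha>)\<^sup>2 + (cmod \<beta>)\<^sup>2 > 0" using alpha_nonzero by (intro add_pos_nonneg) auto
  show "K > 0" unfolding K_def using fc ab C_ge_1 by (intro mult_pos_pos) auto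
  fix t assume t: "t \<ge> t0"
  have sq: "(cmod (\<alpha> * complex_of_real a + \<beta> * complex_of_real b))\<^sup>2 \<le> 2 * ((cmod \<alpha>)\<^sup>2 * a\<^sup>2 + (cmod \<beta>)\<^sup>2 * b\<^sup>2)" for a b
    using norm_add_sq[of "\<alpha> * complex_of_real a" "\<beta> * complex_of_real b"] by (simp add: norm_mult power_mult_distrib)
  have zb: "(z t)\<^sup>2 + (z' t)\<^sup>2 \<le> flow_const * exp (2 * g t)"
  proof -
    have "flow_const * exp (- (2 * g t)) \<le> flow_const * exp (2 * g t)"
      using fc g_nonneg[OF t] by (intro mult_left_mono) auto
    then show ?thesis using z_bound[OF t] by linarith
  qed
  have "(cmod (\<zeta> t))\<^sup>2 + (cmod (\<zeta>' t))\<^sup>2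
      \<le> 2 * ((cmod \<alpha>)\<^sup>2 * (y t)\<^sup>2 + (cmod \<beta>)\<^sup>2 * (z t)\<^sup>2) + 2 * ((cmod \<alpha>)\<^sup>2 * (y' t)\<^sup>2 + (cmod \<beta>)\<^sup>2 * (z' t)\<^sup>2)"
    unfolding \<zeta>_def \<zeta>'_def by (intro add_mono sq)
  also have "\<dots> = 2 * ((cmod \<alpha>)\<^sup>2 * ((y t)\<^sup>2 + (y' t)\<^sup>2) + (cmod \<beta>)\<^sup>2 * ((z t)\<^sup>2 + (z' t)\<^sup>2))"
    by (simp add: algebra_simps)
  also have "\<dots> \<le> 2 * ((cmod \<alpha>)\<^sup>2 * (flow_const * exp (2 * g t)) + (cmod \<beta>)\<^sup>2 * (flow_const * exp (2 * g t)))"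
    using y_bound[OF t] zb by (intro mult_left_mono add_mono) auto
  also have "\<dots> = 2 * ((cmod \<alpha>)\<^sup>2 + (cmod \<beta>)\<^sup>2) * flow_const * exp (2 * g t)" by (simp add: algebra_simps)
  also have "\<dots> \<le> 2 * ((cmod \<alpha>)\<^sup>2 + (cmod \<beta>)\<^sup>2) * flow_const * (C * f t)"
  proof (rule mult_left_mono)
    show "exp (2 * g t) \<le> C * f t" using f_bounds[OF t] C_ge_1 by (simp add: divide_simps mult.commute)
    show "0 \<le> 2 * ((cmod \<alpha>)\<^sup>2 + (cmod \<beta>)\<^sup>2) * flow_const" using ab fc by simp
  qed
  finally show "(cmod (\<zeta> t))\<^sup>2 + (cmod (\<zeta>' t))\<^sup>2 \<le> K * f t" by (simp add: K_def mult.assoc)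
qed

text \<open>With \<open>q = p = 0\<close> only the ladder part of the observable remains. The choice
  \<open>\<epsilon> = z'\<close>, \<open>\<delta> = z\<close> extracts the growing amplitude:
  \<open>z' \<zeta> - z \<zeta>'\<close> is the constant \<open>\<alpha>\<close>, while
  \<open>\<epsilon>^2 + \<delta>^2\<close> is at most of order \<open>1 / f\<close>. So the pairing
  is the same number \<open>w m\<close> at all times.\<close>

lemma unforced_growth:
  assumes cont: "continuous_on {t0..} (drive h h1)" and s: "s > 0"
    and sol: "schrod_sol t0 (\<lambda>t x. (1/2) * (1 + drive h h1 t) * x\<^sup>2) u"
    and u0: "in_Hs s (u t0)" and nz: "L2norm (u t0) \<noteq> 0"
  shows "\<exists>c0>1. \<forall>t\<ge>t0. in_Hs s (u t) \<and> f t powr (s/2) / c0 \<le> Hs_norm s (u t) \<and> Hs_norm s (u t) \<le> c0 * f t powr (s/2)"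
proof -
  interpret mf: moving_frame t0 "\<lambda>t. 1 + drive h h1 t" "\<lambda>_. 0" "\<lambda>_. 0" "\<lambda>_. 0" \<zeta> \<zeta>'
    by (rule moving_frame) (use cont in \<open>auto intro!: derivative_eq_intros\<close>)
  have V: "(1/2) * (1 + drive h h1 t) * x\<^sup>2 = (1 + drive h h1 t) * x\<^sup>2 / 2 + 0 * x" for t x by simp
  have cons: "t \<ge> t0 \<Longrightarrow> L2norm (u t) = L2norm (u t0)" for t by (rule mf.L2norm_conserved[OF sol V])
  obtain K0 where K0: "K0 > 0" "\<And>t. t \<ge> t0 \<Longrightarrow> (cmod (\<zeta> t))\<^sup>2 + (cmod (\<zeta>' t))\<^sup>2 \<le> K0 * f t"
    by (rule zeta_bound) blast
  define K where "K = K0 + C"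
  have K: "K > 0" using K0 C_ge_1 by (simp add: K_def)
  obtain C1 where C1: "C1 > 0" "\<And>t K. \<lbrakk>t \<ge> t0; K \<ge> 1; (cmod (\<zeta> t))\<^sup>2 + (cmod (\<zeta>' t))\<^sup>2 \<le> K; 0\<^sup>2 + 0\<^sup>2 \<le> K\<rbrakk>
    \<Longrightarrow> in_Hs s (u t) \<and> (\<Sum>n. (real n + 1/2) powr s * (cmod (herm_coeff (u t) n))\<^sup>2) \<le> C1 * K powr s"
    by (rule mf.Hs_growth_upper[OF s V sol u0]) blast
  have up: "in_Hs s (u t) \<and> (\<Sum>n. (real n + 1/2) powr s * (cmod (herm_coeff (u t) n))\<^sup>2) \<le> (C1 * K powr s) * f t powr s"
    if t: "t \<ge> t0" for t
  proof -
    have "1 \<le> C * f t" using f_lower[OF t] C_ge_1 by (simp add: divide_simps mult.commute)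
    moreover have "C * f t \<le> K * f t" "K0 * f t \<le> K * f t"
      unfolding K_def using K0(1) C_ge_1 f_pos[OF t] by (auto intro!: mult_right_mono)
    ultimately have "1 \<le> K * f t" "(cmod (\<zeta> t))\<^sup>2 + (cmod (\<zeta>' t))\<^sup>2 \<le> K * f t" "0\<^sup>2 + 0\<^sup>2 \<le> K * f t"
      using K0(2)[OF t] by simp_all
    from C1(2)[OF t this] show ?thesis by (simp add: powr_mult mult.assoc)
  qed
  define c where "c = herm_coeff (u t0)"
  define w where "w = (\<lambda>m. cnj \<alpha> * sqrt (real m / 2) * c (m - 1) + \<alpha> * sqrt (real (Suc m) / 2) * c (Suc m))"
  have L2u: "L2 (u t0)" using sol by (simp add: schrod_sol_def)
  \<comment> \<open>\<open>w\<close> is the image of the initial coefficients under a real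
    combination of \<open>X\<close> and \<open>D\<close>, which has no kernel in \<open>L2\<close>.
    Hence some entry is nonzero, and the choice of \<open>m\<close> depends on the datum
    only.\<close>
  obtain m where m: "w m \<noteq> 0"
  proof -
    obtain k where k: "c k \<noteq> 0" using exists_herm_coeff_nonzero[OF L2u nz] unfolding c_def by blast
    have "summable (\<lambda>m. (cmod (c m))\<^sup>2)"
      using sums_summable[OF parseval_hermite[OF L2u]] by (simp add: c_def herm_coeff_eq_pair)
    then have "\<not> (\<forall>m. w m = 0)"
      using ladder_kernel_trivial[OF alpha_nonzero, of c k] k unfolding w_def by blast
    then show thesis using that by blast
  qed
  define B where "B = cmod \<alpha> * (sqrt (m / 2) + sqrt (Suc m / 2)) + 1"
  have B: "B > 0" unfolding B_def by (intro add_nonneg_pos mult_nonneg_nonneg) auto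
  define D where "D = flow_const * C"
  have D: "D > 0" unfolding D_def using flow_const_ge_1 C_ge_1 by (intro mult_pos_pos) auto
  define cl where "cl = ((cmod (w m))\<^sup>2 / (32 * D * (L2norm (u t0))\<^sup>2)) powr s * (cmod (w m) / (2 * B))\<^sup>2"
  have cl: "cl > 0" unfolding cl_def using m D B nz by (intro mult_pos_pos) auto
  have low: "cl * f t powr s \<le> (\<Sum>n. (real n + 1/2) powr s * (cmod (herm_coeff (u t) n))\<^sup>2) + (L2norm (u t0))\<^sup>2"
    if t: "t \<ge> t0" for t
  proof -
    have wr: "y t * z' t - y' t * z t = 1" by (rule wronskian)
    have red: "complex_of_real (z' t) * \<zeta> t - complex_of_real (z t) * \<zeta>' t = \<alpha>"
    proof -
      have "complex_of_real (z' t) * \<zeta> t - complex_of_real (z t) * \<zeta>' t = \<alpha> * complex_of_real (y t * z' t - y' t * z t)"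
        by (simp add: \<zeta>_def \<zeta>'_def algebra_simps)
      then show ?thesis unfolding wr by simp
    qed
    have "cl * f t powr s \<le> (\<Sum>n. (real n + 1/2) powr s * (cmod (herm_coeff (u t) n))\<^sup>2)"
      unfolding cl_def
    proof (rule mf.Hs_growth_lower[OF s V sol t _ nz, where m = m and \<epsilon> = "z' t" and \<delta> = "z t"])
      show "in_Hs s (u t)" using up[OF t] by simp
      have "z t \<noteq> 0 \<or> z' t \<noteq> 0" using wr by auto
      then show "0 < (z' t)\<^sup>2 + (z t)\<^sup>2" by (auto simp: sum_power2_gt_zero_iff)
      have "exp (- (2 * g t)) \<le> C / f t"
        using f_bounds[OF t] f_pos[OF t] by (simp add: exp_minus field_simps)
      then have "flow_const * exp (- (2 * g t)) \<le> flow_const * (C / f t)"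
        using flow_const_ge_1 by (intro mult_left_mono) auto
      then show "(z' t)\<^sup>2 + (z t)\<^sup>2 \<le> D / f t" using z_bound[OF t] by (simp add: D_def)
      show "cmod (w m) \<le> cmod (complex_of_real (z' t * 0 + z t * 0) * herm_coeff (u t0) m +
        (cnj (complex_of_real (z' t) * \<zeta> t - complex_of_real (z t) * \<zeta>' t) * complex_of_real (sqrt (real m / 2)) * herm_coeff (u t0) (m - 1) +
         (complex_of_real (z' t) * \<zeta> t - complex_of_real (z t) * \<zeta>' t) * complex_of_real (sqrt (real (Suc m) / 2)) * herm_coeff (u t0) (Suc m)))"
        unfolding red w_def c_def by simp
      show "\<bar>z' t * 0 + z t * 0\<bar> + cmod (complex_of_real (z' t) * \<zeta> t - complex_of_real (z t) * \<zeta>' t) * (sqrt (real m / 2) + sqrt (real (Suc m) / 2)) \<le> B"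
        unfolding red B_def by simp
    qed (use m B D f_pos[OF t] in auto)
    then show ?thesis by (simp add: add_increasing2)
  qed
  show ?thesis
  proof (rule Hs_norm_two_sided[where \<mu> = "1 / C" and c = cl and C = "C1 * K powr s"])
    show "0 < 1 / C" using C_ge_1 by simp
    show "0 < C1 * K powr s" using C1(1) K(1) by simp
  qed (rule f_lower s cl cons low conjunct1[OF up] conjunct2[OF up]; assumption?)+
qed

text \<open>The observable \<open>(q X + p D) / (q^2 + p^2)\<close> has the value 1 on the
  trajectory, and \<open>\<epsilon>^2 + \<delta>^2 = 1 / (q^2 + p^2)\<close> is of order
  \<open>1 / t^2\<close> for late times. Its ladder coefficient \<open>w\<close> is at most frame
  size over distance, of order \<open>sqrt f / t\<close>, which tends to 0. So any mode
  \<open>m\<close> with a nonzero initial coefficient can be tested.\<close>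

lemma forced_growth:
  assumes cont: "continuous_on {t0..} (drive h h1)" and s: "s > 0" and a: "a \<noteq> 0"
    and f': "\<And>t. t \<ge> t0 \<Longrightarrow> (f has_real_derivative f' t) (at t within {t0..})"
    and \<kappa>: "\<kappa> < 2" "\<And>t. t \<ge> t0 \<Longrightarrow> t * f' t / f t \<le> \<kappa>"
    and small: "((\<lambda>t. f t / t\<^sup>2) \<longlongrightarrow> 0) at_top"
    and sol: "schrod_sol t0 (\<lambda>t x. (1/2) * (1 + drive h h1 t) * x\<^sup>2 + a * sin t * x) u"
    and u0: "in_Hs s (u t0)" and nz: "L2norm (u t0) \<noteq> 0"
  shows "\<exists>c0>1. \<forall>t\<ge>t0. in_Hs s (u t) \<and> (t\<^sup>2) powr (s/2) / c0 \<le> Hs_norm s (u t) \<and> Hs_norm s (u t) \<le> c0 * (t\<^sup>2) powr (s/2)"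
proof (rule forced_trajectory[OF a f' \<kappa> small], goal_cases)
  case (3 q p A cq t1)
  note qp = 3
  interpret mf: moving_frame t0 "\<lambda>t. 1 + drive h h1 t" "\<lambda>t. a * sin t" q p \<zeta> \<zeta>'
    by (rule moving_frame) (use cont qp in \<open>auto intro!: continuous_intros\<close>)
  have V: "(1/2) * (1 + drive h h1 t) * x\<^sup>2 + a * sin t * x = (1 + drive h h1 t) * x\<^sup>2 / 2 + a * sin t * x" for t x by simp
  have cons: "t \<ge> t0 \<Longrightarrow> L2norm (u t) = L2norm (u t0)" for t by (rule mf.L2norm_conserved[OF sol V])
  obtain K0 where K0: "K0 > 0" "\<And>t. t \<ge> t0 \<Longrightarrow> (cmod (\<zeta> t))\<^sup>2 + (cmod (\<zeta>' t))\<^sup>2 \<le> K0 * f t"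
    by (rule zeta_bound) blast
  have t2: "t0\<^sup>2 \<le> t\<^sup>2" if "t \<ge> t0" for t using that t0_pos by (intro power_mono) auto
  define K where "K = K0 * A + A + 1 / t0\<^sup>2"
  have K: "K > 0" "K0 * A \<le> K" "A \<le> K" "1 / t0\<^sup>2 \<le> K" using K0 qp(5) t0_pos by (auto simp: K_def add_pos_pos)
  obtain C1 where C1: "C1 > 0" "\<And>t K. \<lbrakk>t \<ge> t0; K \<ge> 1; (cmod (\<zeta> t))\<^sup>2 + (cmod (\<zeta>' t))\<^sup>2 \<le> K; (q t)\<^sup>2 + (p t)\<^sup>2 \<le> K\<rbrakk>
    \<Longrightarrow> in_Hs s (u t) \<and> (\<Sum>n. (real n + 1/2) powr s * (cmod (herm_coeff (u t) n))\<^sup>2) \<le> C1 * K powr s"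
    by (rule mf.Hs_growth_upper[OF s V sol u0]) blast
  have up: "in_Hs s (u t) \<and> (\<Sum>n. (real n + 1/2) powr s * (cmod (herm_coeff (u t) n))\<^sup>2) \<le> (C1 * K powr s) * (t\<^sup>2) powr s"
    if t: "t \<ge> t0" for t
  proof -
    have "1 \<le> (1 / t0\<^sup>2) * t\<^sup>2" using t2[OF t] t0_pos by (simp add: field_simps)
    also have "\<dots> \<le> K * t\<^sup>2" using K by (intro mult_right_mono) auto
    finally have 1: "1 \<le> K * t\<^sup>2" .
    have "K0 * f t \<le> K0 * (A * t\<^sup>2)" using qp(7)[OF t] K0(1) by (intro mult_left_mono) auto
    also have "\<dots> \<le> K * t\<^sup>2" using mult_right_mono[OF K(2), of "t\<^sup>2"] by (simp add: mult.assoc)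
    finally have 2: "(cmod (\<zeta> t))\<^sup>2 + (cmod (\<zeta>' t))\<^sup>2 \<le> K * t\<^sup>2" using K0(2)[OF t] by linarith
    have "A * t\<^sup>2 \<le> K * t\<^sup>2" using K by (intro mult_right_mono) auto
    then have 3: "(q t)\<^sup>2 + (p t)\<^sup>2 \<le> K * t\<^sup>2" using qp(6)[OF t] by linarith
    from C1(2)[OF t 1 2 3] show ?thesis by (simp add: powr_mult mult.assoc)
  qed
  define c where "c = herm_coeff (u t0)"
  have L2u: "L2 (u t0)" using sol by (simp add: schrod_sol_def)
  obtain m where m: "c m \<noteq> 0" using exists_herm_coeff_nonzero[OF L2u nz] unfolding c_def by blast
  \<comment> \<open>The two summands 1 let the single estimate \<open>cmod w * S <= \<eta>\<close>
    control both the neighbouring coefficients in the pairing and the bare ladder factors in the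
    norm of the observable.\<close>
  define S where "S = sqrt (m / 2) * (cmod (c (m - 1)) + 1) + sqrt (Suc m / 2) * (cmod (c (Suc m)) + 1)"
  have S: "S > 0" unfolding S_def by (intro add_nonneg_pos mult_nonneg_nonneg mult_pos_pos) (auto intro: add_nonneg_pos)
  define \<eta> where "\<eta> = min 1 (cmod (c m) / 2)"
  have \<eta>: "\<eta> > 0" "\<eta> \<le> 1" "\<eta> \<le> cmod (c m) / 2" using m by (auto simp: \<eta>_def)
  \<comment> \<open>The threshold makes \<open>(K0 / cq) (f / t^2)\<close>, the bound for
    \<open>|w|^2\<close>, at most \<open>(\<eta> / S)^2\<close>.\<close>
  have "eventually (\<lambda>t. f t / t\<^sup>2 < cq * (\<eta> / S)\<^sup>2 / K0) at_top"
    using small \<eta>(1) S K0(1) qp(8) by (intro order_tendstoD) auto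
  then obtain t2' where t2': "\<And>t. t \<ge> t2' \<Longrightarrow> f t / t\<^sup>2 < cq * (\<eta> / S)\<^sup>2 / K0" by (auto simp: eventually_at_top_linorder)
  define T where "T = max t1 t2'"
  have T: "T \<ge> t0" "T \<ge> t1" "T \<ge> t2'" using qp(9) by (auto simp: T_def)
  define G0 where "G0 = cmod (c m) / 2"
  have G0: "G0 > 0" using m by (simp add: G0_def)
  \<comment> \<open>The constant of the lower bound for \<open>D = 1 / cq\<close> and
    \<open>B = 2\<close>, the latter being the value 1 on the trajectory plus a ladder part of at
    most 1.\<close>
  define c1 where "c1 = (G0\<^sup>2 / (32 * (1 / cq) * (L2norm (u t0))\<^sup>2)) powr s * (G0 / (2 * 2))\<^sup>2"
  have c1: "c1 > 0" unfolding c1_def using G0 qp(8) nz by (intro mult_pos_pos) auto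
  have late: "c1 * (t\<^sup>2) powr s \<le> (\<Sum>n. (real n + 1/2) powr s * (cmod (herm_coeff (u t) n))\<^sup>2)"
    if tT: "t \<ge> T" for t
  proof -
    have t: "t \<ge> t0" "t > 0" "t \<ge> t1" "t \<ge> t2'" using tT T t0_pos by auto
    define r where "r = (q t)\<^sup>2 + (p t)\<^sup>2"
    have rl: "cq * t\<^sup>2 \<le> r" using qp(10)[OF t(3)] by (simp add: r_def)
    moreover have "cq * t\<^sup>2 > 0" using qp(8) t by simp
    ultimately have r: "r > 0" by linarith
    have one: "q t / r * q t + p t / r * p t = 1"
    proof -
      have "q t / r * q t + p t / r * p t = (q t * q t + p t * p t) / r" by (simp add: add_divide_distrib)
      also have "\<dots> = r / r" unfolding r_def power2_eq_square ..
      finally have "q t / r * q t + p t / r * p t = r / r" .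
      then show ?thesis using r by simp
    qed
    have inv: "(q t / r)\<^sup>2 + (p t / r)\<^sup>2 = 1 / r"
    proof -
      have "(q t / r)\<^sup>2 + (p t / r)\<^sup>2 = r / r\<^sup>2" by (simp add: power_divide add_divide_distrib r_def)
      then show ?thesis using r by (simp add: power2_eq_square)
    qed
    have inv_le: "1 / r \<le> (1 / cq) / t\<^sup>2" using rl r qp(8) t by (simp add: field_simps)
    define w where "w = complex_of_real (q t / r) * \<zeta> t - complex_of_real (p t / r) * \<zeta>' t"
    have "(cmod w)\<^sup>2 \<le> (\<bar>q t / r\<bar> * cmod (\<zeta> t) + \<bar>p t / r\<bar> * cmod (\<zeta>' t))\<^sup>2"
      unfolding w_def by (intro power_mono order_trans[OF norm_triangle_ineq4])
        (simp_all add: norm_mult norm_divide)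
    also have "\<dots> \<le> (1 / r) * ((cmod (\<zeta> t))\<^sup>2 + (cmod (\<zeta>' t))\<^sup>2)"
      using power2_cross_bound[of "\<bar>q t / r\<bar>" "cmod (\<zeta> t)" "\<bar>p t / r\<bar>" "cmod (\<zeta>' t)"] unfolding power2_abs inv .
    also have "\<dots> \<le> ((1 / cq) / t\<^sup>2) * (K0 * f t)"
      using inv_le K0(2)[OF t(1)] r qp(8) by (intro mult_mono) auto
    also have "\<dots> = K0 / cq * (f t / t\<^sup>2)" by simp
    also have "\<dots> \<le> K0 / cq * (cq * (\<eta> / S)\<^sup>2 / K0)"
      using t2'[OF t(4)] K0(1) qp(8) by (intro mult_left_mono) auto
    also have "\<dots> = (\<eta> / S)\<^sup>2" using K0(1) qp(8) by simp
    finally have "cmod w \<le> \<eta> / S" by (rule power2_le_imp_le) (use \<eta>(1) S in \<open>intro divide_nonneg_pos; simp\<close>)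
    then have wS: "cmod w * S \<le> \<eta>" using S by (simp add: field_simps)
    have nn: "0 \<le> cmod w * (sqrt (m / 2) * cmod (c (m - 1)))" "0 \<le> cmod w * (sqrt (Suc m / 2) * cmod (c (Suc m)))"
      "0 \<le> cmod w * sqrt (m / 2)" "0 \<le> cmod w * sqrt (Suc m / 2)" by auto
    have wS': "cmod w * (sqrt (m / 2) * cmod (c (m - 1))) + cmod w * (sqrt (Suc m / 2) * cmod (c (Suc m)))
      + (cmod w * sqrt (m / 2) + cmod w * sqrt (Suc m / 2)) \<le> \<eta>"
      using wS unfolding S_def distrib_left mult_1_right by linarith
    show ?thesis
      unfolding c1_def
    proof (rule mf.Hs_growth_lower[OF s V sol t(1) _ nz, where m = m and \<epsilon> = "q t / r" and \<delta> = "p t / r"])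
      show "in_Hs s (u t)" using up[OF t(1)] by simp
      show "0 < (q t / r)\<^sup>2 + (p t / r)\<^sup>2" unfolding inv using r by simp
      show "(q t / r)\<^sup>2 + (p t / r)\<^sup>2 \<le> (1 / cq) / t\<^sup>2" unfolding inv by (rule inv_le)
      let ?rest = "cnj w * complex_of_real (sqrt (real m / 2)) * c (m - 1) + w * complex_of_real (sqrt (real (Suc m) / 2)) * c (Suc m)"
      have "cmod ?rest \<le> cmod w * (sqrt (m / 2) * cmod (c (m - 1))) + cmod w * (sqrt (Suc m / 2) * cmod (c (Suc m)))"
        by (rule order_trans[OF norm_triangle_ineq]) (simp add: norm_mult)
      then have "cmod ?rest \<le> cmod (c m) / 2" using wS' nn \<eta>(3) by linarith
      moreover have "cmod (c m) - cmod ?rest \<le> cmod (c m + ?rest)" using norm_diff_ineq[of "c m" ?rest] by linarith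
      ultimately have "G0 \<le> cmod (c m + ?rest)" unfolding G0_def by linarith
      then show "G0 \<le> cmod (complex_of_real (q t / r * q t + p t / r * p t) * herm_coeff (u t0) m +
        (cnj (complex_of_real (q t / r) * \<zeta> t - complex_of_real (p t / r) * \<zeta>' t) * complex_of_real (sqrt (real m / 2)) * herm_coeff (u t0) (m - 1) +
         (complex_of_real (q t / r) * \<zeta> t - complex_of_real (p t / r) * \<zeta>' t) * complex_of_real (sqrt (real (Suc m) / 2)) * herm_coeff (u t0) (Suc m)))"
        unfolding one w_def[symmetric] c_def by simp
      have "cmod w * (sqrt (real m / 2) + sqrt (real (Suc m) / 2)) \<le> 1"
        using wS' nn \<eta>(2) unfolding distrib_left by linarith
      then show "\<bar>q t / r * q t + p t / r * p t\<bar> + cmod (complex_of_real (q t / r) * \<zeta> t - complex_of_real (p t / r) * \<zeta>' t) * (sqrt (real m / 2) + sqrt (real (Suc m) / 2)) \<le> 2"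
        unfolding one w_def[symmetric] by simp
    qed (use G0 t qp(8) in auto)
  qed
  define N where "N = (L2norm (u t0))\<^sup>2"
  have N: "N > 0" using nz by (simp add: N_def)
  have Tp: "T > 0" using T t0_pos by linarith
  \<comment> \<open>Before \<open>T\<close> the ladder part is not yet under control; there the
    conserved \<open>L2\<close> norm alone dominates \<open>cl * (t^2) powr s\<close>.\<close>
  define cl where "cl = min c1 (N / (T\<^sup>2) powr s)"
  have cl: "cl > 0" using c1 N Tp by (simp add: cl_def)
  have low: "cl * (t\<^sup>2) powr s \<le> (\<Sum>n. (real n + 1/2) powr s * (cmod (herm_coeff (u t) n))\<^sup>2) + N"
    if t: "t \<ge> t0" for t
  proof (cases "t \<ge> T")
    case True
    have "cl * (t\<^sup>2) powr s \<le> c1 * (t\<^sup>2) powr s" by (intro mult_right_mono) (auto simp: cl_def)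
    then show ?thesis using late[OF True] N by linarith
  next
    case False
    have "cl * (t\<^sup>2) powr s \<le> N / (T\<^sup>2) powr s * (T\<^sup>2) powr s"
      using False t t0_pos s N by (intro mult_mono powr_mono2 power_mono) (auto simp: cl_def)
    also have "\<dots> = N" using Tp by simp
    finally have "cl * (t\<^sup>2) powr s \<le> N" .
    moreover have "0 \<le> (\<Sum>n. (real n + 1/2) powr s * (cmod (herm_coeff (u t) n))\<^sup>2)"
      using up[OF t] by (intro suminf_nonneg) (auto simp: in_Hs_def)
    ultimately show ?thesis by linarith
  qed
  show ?case
  proof (rule Hs_norm_two_sided[where \<mu> = "t0\<^sup>2" and c = cl and C = "C1 * K powr s"])
    show "0 < t0\<^sup>2" using t0_pos by simp
    show "0 < C1 * K powr s" using C1(1) K(1) by simp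
  qed (rule t2 s cl cons low[unfolded N_def] conjunct1[OF up] conjunct2[OF up]; assumption?)+
qed

end

theorem theorem1p3:
  fixes t0 :: real and f :: "real \<Rightarrow> real"
  assumes "t0 > 0" and "classM t0 f"
  shows "\<exists>\<phi> :: real \<Rightarrow> real. C2_on {t0..} \<phi> \<and>
    ((((\<lambda>t. dR t0 (dR t0 f) t / f t) \<longlongrightarrow> 0) at_top) \<longrightarrow> (\<phi> \<longlongrightarrow> 0) at_top) \<and>
    (\<forall>s>0.
      (\<forall>u. schrod_sol t0 (\<lambda>t x. (1/2) * (1 + \<phi> t) * x\<^sup>2) u \<and>
            in_Hs s (u t0) \<and> L2norm (u t0) \<noteq> 0 \<longrightarrow>
         (\<exists>c0>1. \<forall>t\<ge>t0. in_Hs s (u t) \<and>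
            f t powr (s/2) / c0 \<le> Hs_norm s (u t) \<and> Hs_norm s (u t) \<le> c0 * f t powr (s/2))) \<and>
      ((f \<in> o(\<lambda>t. t\<^sup>2) \<and>
        (\<exists>\<kappa>. 0 < \<kappa> \<and> \<kappa> < 2 \<and> (\<forall>t\<ge>t0. t * dR t0 f t / f t \<le> \<kappa>)) \<and>
        monotone_on {t0..} (\<le>) (\<ge>) (\<lambda>t. t * dR t0 f t / f t)) \<longrightarrow>
       (\<forall>a::real. a \<noteq> 0 \<longrightarrow>
         (\<forall>u. schrod_sol t0 (\<lambda>t x. (1/2) * (1 + \<phi> t) * x\<^sup>2 + a * sin t * x) u \<and>
               in_Hs s (u t0) \<and> L2norm (u t0) \<noteq> 0 \<longrightarrow>
            (\<exists>c1>1. \<forall>t\<ge>t0. in_Hs s (u t) \<and>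
               t powr s / c1 \<le> Hs_norm s (u t) \<and> Hs_norm s (u t) \<le> c1 * t powr s)))))"
proof -
  obtain f1 where f1: "\<And>t. t \<ge> t0 \<Longrightarrow> (f has_real_derivative f1 t) (at t within {t0..})"
    using assms(2) unfolding classM_def C2_on_def by auto
  have f': "(f has_real_derivative dR t0 f t) (at t within {t0..})" if "t \<ge> t0" for t
    using f1[OF that] dR_eqI[OF that f1[OF that]] by simp
  show ?thesis
  proof (rule classM_parametric_drive[OF assms], goal_cases)
    case (1 h h1 g v C)
    note drive = 1
    interpret parametric_drive t0 f h h1 g v C by (rule drive(1))
    have cont: "continuous_on {t0..} (drive h h1)"
      using drive(2) DERIV_continuous_on[of "{t0..}" "drive h h1"] unfolding C2_on_def by fastforce
    \<comment> \<open>The forced case is run with \<open>X t = t^2\<close>, the order of the squared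
      distance from the origin in phase space, so that it shares the final comparison with the case
      \<open>X = f\<close>.\<close>
    have sq: "(t\<^sup>2) powr (s / 2) = t powr s" if "t \<ge> t0" for t s :: real
    proof -
      have "(t\<^sup>2) powr (s / 2) = (t powr 2) powr (s / 2)" using that t0_pos by simp
      then show ?thesis by (simp only: powr_powr) simp
    qed
    \<comment> \<open>One potential, built from \<open>f\<close> alone, serves every
      \<open>s\<close>, every \<open>a\<close> and both equations.\<close>
    show ?case
    proof (intro exI[of _ "drive h h1"] conjI allI impI, goal_cases)
      case 1
      show ?case by (rule drive(2))
    next
      case 2
      show ?case by (rule drive(3))
    next
      case (3 s u)
      from 3(2) show ?case by (elim conjE) (rule unforced_growth[OF cont 3(1)])
    next
      case (4 s a u)
      from 4(2) obtain \<kappa> where \<kappa>: "\<kappa> < 2" "\<And>t. t \<ge> t0 \<Longrightarrow> t * dR t0 f t / f t \<le> \<kappa>" by blast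
      have "((\<lambda>t. f t / t\<^sup>2) \<longlongrightarrow> 0) at_top" using 4(2) by (elim conjE) (rule smalloD_tendsto)
      moreover have "schrod_sol t0 (\<lambda>t x. (1/2) * (1 + drive h h1 t) * x\<^sup>2 + a * sin t * x) u" "in_Hs s (u t0)" "L2norm (u t0) \<noteq> 0"
        using 4(4) by blast+
      ultimately have "\<exists>c1>1. \<forall>t\<ge>t0. in_Hs s (u t) \<and> (t\<^sup>2) powr (s/2) / c1 \<le> Hs_norm s (u t) \<and> Hs_norm s (u t) \<le> c1 * (t\<^sup>2) powr (s/2)"
        by (intro forced_growth[OF cont 4(1,3) f' \<kappa>])
      then show ?case by (simp only: sq cong: conj_cong imp_cong)
    qed
  qed
qed

end
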